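(* Let $\Psi$ be a branching mechanism satisfying Grey's condition and let $\Phi$ be an immigration mechanism. Let $Y=(Y_t,t\ge 0)$ be a $\mathrm{CBI}(\Psi,\Phi)$ process started at $0$, let $\mathcal Z=\overline{\{t\ge 0: Y_t=0\}}$, and let $(v_t)_{t>0}$ be the solution of $\frac{\mathrm d v_s}{\mathrm d s}=-\Psi(v_s)$, $v_{0+}=\infty$. Let $\theta>0$ be such that $\Psi(z)>0$ for all $z\ge\theta$. (i) $\mathcal Z=\{0\}$ almost surely if and only if $\int_0^1\exp\left[-\int_1^u\Phi(v_s)\,\mathrm ds\right]\mathrm du=\infty$. (ii) If $\int_0^1\exp\left[-\int_1^u\Phi(v_s)\,\mathrm ds\right]\mathrm du<\infty$, then: (a) The random set $\mathcal Z$ is the closure of the range of a subordinator with Laplace exponent $$L(q)=\left[\int_0^\infty e^{-qt}\exp\left(\int_t^1\Phi(v_s)\,\mathrm ds\right)\mathrm dt\right]^{-1}=\left[\int_0^\infty e^{-qt}\exp\left(\int_{v_1}^{v_t}\frac{\Phi(u)}{\Psi(u)}\,\mathrm du\right)\mathrm dt\right]^{-1}.$$ (b) The random set $\mathcal Z$ has almost surely a positive Lebesgue measure if and only if $\int_\theta^\infty\frac{\Phi(s)}{\Psi(s)}\,\mathrm ds<\infty$. (c) The random set $\mathcal Z$ is almost surely the union of closed non-degenerate intervals (i.e. intervals of positive length) if and only if $\Phi$ is the Laplace exponent of a compound Poisson process (i.e. $\beta=0$ and $\nu_0$ is a finite measure).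
   Context: Mechanisms. A branching mechanism is a function $\Psi(q)=dq+\frac12\sigma^2q^2+\int_0^\infty(e^{-qu}-1+qu\mathbf 1_{u\in(0,1)})\,\nu_1(\mathrm du)$, $q\ge0$, with $d\in\mathbb R$, $\sigma^2\ge0$ and $\nu_1$ a measure on $(0,\infty)$ with $\int_0^\infty(1\wedge u^2)\nu_1(\mathrm du)<\infty$. An immigration mechanism is a function $\Phi(q)=\beta q+\int_0^\infty(1-e^{-qu})\,\nu_0(\mathrm du)$, $q\ge 0$, with $\beta\ge0$ and $\int_0^\infty(1\wedge u)\nu_0(\mathrm du)<\infty$. CBI. For $q>0$ let $v_t(q)$ solve $v_t(q)=q-\int_0^t\Psi(v_s(q))\,\mathrm ds$. A $\mathrm{CBI}(\Psi,\Phi)$ (continuous-state branching process with immigration) started at $x\ge0$ is the càdlàg Markov process $Y$ with $Y_0=x$ and $\mathbb E_x[e^{-qY_t}]=\exp\left(-xv_t(q)-\int_0^t\Phi(v_s(q))\,\mathrm ds\right)$ for all $q>0,t\ge0$. Grey's condition: there exists $\theta>0$ such that $\Psi(z)>0$ for all $z\ge\theta$ and $\int_\theta^\infty\frac{\mathrm dq}{\Psi(q)}<\infty$. Under it, $v_t:=\lim_{\lambda\to\infty}v_t(\lambda)$ is finite for every $t>0$; this is the solution of $\frac{\mathrm d v_s}{\mathrm d s}=-\Psi(v_s)$ with $v_{0+}=\infty$ used in the claim. Subordinators may be killed; the Laplace exponent $L$ of a subordinator $\sigma$ is defined by $\mathbb E[e^{-q\sigma_t}]=e^{-tL(q)}$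 for $q>0$ (with $e^{-\infty}=0$). *)

theory Defs
  imports "HOL-Probability.Probability"
begin

section \<open>Mechanisms\<close>

text \<open>
  Mechanisms are functions on $[0,\infty)$: the predicates below constrain \<open>\<Psi> q\<close> and \<open>\<Phi> q\<close>
  only for \<open>q \<ge> 0\<close>. The Levy measures are measures on the space $(0,\infty)$.
\<close>

definition branching_mechanism ::
    "real \<Rightarrow> real \<Rightarrow> real measure \<Rightarrow> (real \<Rightarrow> real) \<Rightarrow> bool" where
  "branching_mechanism d \<sigma> \<nu> \<Psi> \<longleftrightarrow>
     sets \<nu> = sets (restrict_space borel {0<..}) \<and>
     (\<integral>\<^sup>+u. ennreal (min 1 (u\<^sup>2)) \<partial>\<nu>) < \<infinity> \<and>
     (\<forall>q\<ge>0. \<Psi> q = d * q + 1 / 2 * \<sigma>\<^sup>2 * q\<^sup>2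
        + (\<integral>u. (exp (- q * u) - 1 + q * u * indicator {0<..<1} u) \<partial>\<nu>))"

definition immigration_mechanism ::
    "real \<Rightarrow> real measure \<Rightarrow> (real \<Rightarrow> real) \<Rightarrow> bool" where
  "immigration_mechanism \<beta> \<nu> \<Phi> \<longleftrightarrow>
     0 \<le> \<beta> \<and>
     sets \<nu> = sets (restrict_space borel {0<..}) \<and>
     (\<integral>\<^sup>+u. ennreal (min 1 u) \<partial>\<nu>) < \<infinity> \<and>
     (\<forall>q\<ge>0. \<Phi> q = \<beta> * q + (\<integral>u. (1 - exp (- q * u)) \<partial>\<nu>))"

definition grey_condition :: "(real \<Rightarrow> real) \<Rightarrow> bool" where
  "grey_condition \<Psi> \<longleftrightarrow>
     (\<exists>\<theta>>0. (\<forall>z\<ge>\<theta>. 0 < \<Psi> z) \<and> (\<integral>\<^sup>+q\<in>{\<theta>..}. ennreal (1 / \<Psi> q) \<partial>lborel) < \<infinity>)"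

text \<open>
  \<open>v t q\<close> is $v_t(q)$. The integral equation is stated with \<open>has_integral\<close> so that integrability
  is part of it. The condition \<open>0 \<le> v t q\<close> keeps the solution in the domain of \<open>\<Psi>\<close>.
\<close>

definition cumulant_flow :: "(real \<Rightarrow> real) \<Rightarrow> (real \<Rightarrow> real \<Rightarrow> real) \<Rightarrow> bool" where
  "cumulant_flow \<Psi> v \<longleftrightarrow>
     (\<forall>q>0. \<forall>t\<ge>0. 0 \<le> v t q \<and> ((\<lambda>s. \<Psi> (v s q)) has_integral (q - v t q)) {0..t})"

definition flow_from_infinity :: "(real \<Rightarrow> real) \<Rightarrow> (real \<Rightarrow> real) \<Rightarrow> bool" where
  "flow_from_infinity \<Psi> v \<longleftrightarrow>
     (\<forall>t>0. 0 \<le> v t \<and> (v has_real_derivative - \<Psi> (v t)) (at t)) \<and>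
     filterlim v at_top (at_right 0)"

section \<open>Processes with values in $[0,\infty]$\<close>

text \<open>
  Processes are indexed by real times, of which only the nonnegative ones matter.
  The state \<open>\<infinity>\<close> is the cemetery of a killed subordinator, and the state
  reached by a branching process that explodes.
\<close>

text \<open>The function $e^{-qy}$ for $q > 0$, with $e^{-\infty} = 0$.\<close>

definition exp_neg :: "real \<Rightarrow> ennreal \<Rightarrow> real" where
  "exp_neg q y = (if y = \<infinity> then 0 else exp (- q * enn2real y))"

definition cadlag :: "(real \<Rightarrow> ennreal) \<Rightarrow> bool" where
  "cadlag f \<longleftrightarrow>
     (\<forall>t\<ge>0. continuous (at_right t) f) \<and> (\<forall>t>0. \<exists>l. (f \<longlongrightarrow> l) (at_left t))"

definition natural_filtration ::
    "'a measure \<Rightarrow> (real \<Rightarrow> 'a \<Rightarrow> ennreal) \<Rightarrow> real \<Rightarrow> 'a measure" where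
  "natural_filtration M Y s =
     sigma (space M) {Y r -` B \<inter> space M | r B. 0 \<le> r \<and> r \<le> s \<and> B \<in> sets borel}"

definition markov_process ::
    "'a measure \<Rightarrow> (real \<Rightarrow> ennreal \<Rightarrow> ennreal measure) \<Rightarrow> (real \<Rightarrow> 'a \<Rightarrow> ennreal) \<Rightarrow> bool" where
  "markov_process M P Y \<longleftrightarrow>
     (\<forall>t\<ge>0. P t \<in> borel \<rightarrow>\<^sub>M prob_algebra borel) \<and>
     (\<forall>t\<ge>0. Y t \<in> borel_measurable M) \<and>
     (\<forall>s\<ge>0. \<forall>t\<ge>0. \<forall>B\<in>sets borel.
        AE \<omega> in M. real_cond_exp M (natural_filtration M Y s) (\<lambda>\<omega>. indicator B (Y (s + t) \<omega>)) \<omega>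
          = measure (P t (Y s \<omega>)) B)"

text \<open>
  \<open>P t x\<close> is the law of $Y_t$ under $\mathbb{P}_x$. For \<open>x < \<infinity>\<close> it is determined by its Laplace
  transform; \<open>\<infinity>\<close> is absorbing, which is the same formula at \<open>x = \<infinity>\<close> with $e^{-\infty} = 0$.
\<close>

definition CBI_transition ::
    "(real \<Rightarrow> real) \<Rightarrow> (real \<Rightarrow> real) \<Rightarrow> (real \<Rightarrow> ennreal \<Rightarrow> ennreal measure) \<Rightarrow> bool" where
  "CBI_transition \<Psi> \<Phi> P \<longleftrightarrow>
     (\<exists>v. cumulant_flow \<Psi> v \<and>
       (\<forall>t\<ge>0. \<forall>q>0. \<forall>x\<ge>0.
          (\<integral>y. exp_neg q y \<partial>P t (ennreal x))
            = exp (- x * v t q - (LBINT s=0..ereal t. \<Phi> (v s q))))) \<and>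
     (\<forall>t\<ge>0. P t \<infinity> = return borel \<infinity>)"

definition CBI ::
    "'a measure \<Rightarrow> (real \<Rightarrow> real) \<Rightarrow> (real \<Rightarrow> real) \<Rightarrow> real \<Rightarrow> (real \<Rightarrow> 'a \<Rightarrow> ennreal) \<Rightarrow> bool" where
  "CBI M \<Psi> \<Phi> x Y \<longleftrightarrow>
     (\<exists>P. CBI_transition \<Psi> \<Phi> P \<and> markov_process M P Y) \<and>
     (\<forall>\<omega>\<in>space M. cadlag (\<lambda>t. Y t \<omega>)) \<and>
     (AE \<omega> in M. Y 0 \<omega> = ennreal x)"

text \<open>
  Possibly killed subordinators. On the event \<open>S s < \<infinity>\<close> that killing has not occurred by time
  \<open>s\<close>, the increment \<open>S (s + t) - S s\<close> (which is \<open>\<infinity>\<close> if killing occurs in between) is independent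
  of the past and distributed as \<open>S t\<close>. Monotonicity makes \<open>\<infinity>\<close> absorbing.
\<close>

definition subordinator :: "'a measure \<Rightarrow> (real \<Rightarrow> 'a \<Rightarrow> ennreal) \<Rightarrow> bool" where
  "subordinator M S \<longleftrightarrow>
     (\<forall>t\<ge>0. S t \<in> borel_measurable M) \<and>
     (\<forall>\<omega>\<in>space M. S 0 \<omega> = 0 \<and> cadlag (\<lambda>t. S t \<omega>) \<and> mono_on {0..} (\<lambda>t. S t \<omega>)) \<and>
     (\<forall>s\<ge>0. \<forall>t\<ge>0. \<forall>A\<in>sets (natural_filtration M S s). \<forall>B\<in>sets borel.
        measure M {\<omega>\<in>A. S s \<omega> < \<infinity> \<and> S (s + t) \<omega> - S s \<omega> \<in> B}
          = measure M {\<omega>\<in>A. S s \<omega> < \<infinity>} * measure M {\<omega>\<in>space M. S t \<omega> \<in> B})"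

definition has_Laplace_exponent ::
    "'a measure \<Rightarrow> (real \<Rightarrow> 'a \<Rightarrow> ennreal) \<Rightarrow> (real \<Rightarrow> real) \<Rightarrow> bool" where
  "has_Laplace_exponent M S L \<longleftrightarrow>
     (\<forall>q>0. \<forall>t\<ge>0. (\<integral>\<omega>. exp_neg q (S t \<omega>) \<partial>M) = exp (- t * L q))"

section \<open>Random sets\<close>

definition zero_set :: "(real \<Rightarrow> 'a \<Rightarrow> ennreal) \<Rightarrow> 'a \<Rightarrow> real set" where
  "zero_set Y \<omega> = closure {t. 0 \<le> t \<and> Y t \<omega> = 0}"

text \<open>The range of a killed subordinator does not include the cemetery.\<close>

definition closed_range :: "(real \<Rightarrow> 'a \<Rightarrow> ennreal) \<Rightarrow> 'a \<Rightarrow> real set" where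
  "closed_range S \<omega> = closure {enn2real (S t \<omega>) | t. 0 \<le> t \<and> S t \<omega> < \<infinity>}"

definition nondegenerate_closed_interval :: "real set \<Rightarrow> bool" where
  "nondegenerate_closed_interval I \<longleftrightarrow>
     closed I \<and> is_interval I \<and> (\<exists>a\<in>I. \<exists>b\<in>I. a < b)"

end

theory Submission
  imports Defs "HOL-Real_Asymp.Real_Asymp"
begin

text \<open>
  Put \<open>u t = exp (\<integral>\<^sub>t\<^sup>1 \<Phi> (v s) ds)\<close> and \<open>h e y = u e * exp (- v e * y)\<close>. By the flow property of \<open>v\<close>
  the semigroup of \<open>Y\<close> maps \<open>h e\<close> to \<open>h (e + t)\<close>, so \<open>u\<close> is the potential density at \<open>0\<close> and \<open>h e\<close>
  approximates the Dirac mass at \<open>0\<close> as \<open>e \<rightarrow> 0\<close>. If \<open>u\<close> is integrable at \<open>0\<close>, then \<open>\<integral>\<^sub>0\<^sup>t h e (Y s) ds\<close>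
  converges in mean square to a continuous local time at \<open>0\<close>, whose inverse is a subordinator with potential
  density \<open>u\<close> and closed range \<open>\<Z>\<close>. The local time increases after every zero: its discounted expected
  increment \<open>\<integral> exp (- q * x) * h x y dx\<close> from the starting point \<open>y\<close> is continuous at \<open>y = 0\<close>, so it
  is close to its maximal value whenever \<open>Y\<close> is small. If \<open>u\<close> is not integrable, a visit to \<open>0\<close>
  after time \<open>a > 0\<close> is followed by an expected occupation \<open>\<integral> h (e + x) 0 dx\<close> that exceeds every bound as
  \<open>e \<rightarrow> 0\<close>, while the expected occupation after \<open>a\<close> stays bounded; so there is no such visit.

  If \<open>u \<le> K\<close>, the local time is at most \<open>K\<close> times the Lebesgue measure of the zeros. Conversely
  \<open>u e * P (Y t = 0) \<le> u (e + t)\<close>, so \<open>P (Y t = 0) = 0\<close> if \<open>u\<close> is unbounded. The same comparison between the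
  times of a grid of mesh \<open>t\<close> shows that, given \<open>Y s = 0\<close>, the zeros contain the interval from \<open>s\<close> to \<open>s + x\<close>
  with probability at least \<open>exp (- c * x)\<close> if \<open>\<Phi> \<le> c\<close>, and with probability \<open>0\<close> if \<open>\<Phi>\<close> is unbounded.
\<close>

section \<open>Measurability and uniqueness of laws\<close>

text \<open>All probabilistic input is the Markov property at fixed times, tested on the functions
  \<open>h e\<close>. Random times are handled in two ways. The time \<open>S \<kappa>\<close> is
  approximated from above by dyadic times; this works because \<open>Y\<close> vanishes at the
  limit. The first visit to a neighbourhood of 0 is sought on finite grids and enters only through
  an inequality between two measures, summed over disjoint first passage events. Mean square
  convergence rests on one estimate that is uniform in the state: shifting the smoothing parameter
  by at most \<open>\<eta>\<close> changes a potential by at most \<open>U \<eta>\<close>. The law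
  of the inverse comes from an integral equation for \<open>\<phi> y\<close>, the expectation of
  \<open>exp (- q * S y)\<close>: its integral beyond \<open>y\<close> is
  \<open>\<phi> y / L q\<close>, which leaves only an exponential. Paths are used through right
  continuity, so the closure in \<open>zero_set\<close> may add points; they are countable, as each
  is followed by an interval without zeros. On the deterministic side \<open>\<Psi>\<close> may be
  negative, or infinitely steep at 0, so the flow is identified with \<open>v\<close> by convexity
  above a positive lower bound.\<close>

lemma dyadic_from_right:
  fixes t :: real
  shows "filterlim (\<lambda>n. (of_int \<lfloor>t * 2 ^ n\<rfloor> + 1) / 2 ^ n) (at_right t) sequentially"
proof -
  \<comment> \<open>The \<open>+ 1\<close> makes the approximation strictly larger than
    \<open>t\<close>, so right limits apply along it; later it places the approximating times after
    the random time.\<close>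
  have gt: "t < (of_int \<lfloor>t * 2 ^ n\<rfloor> + 1) / 2 ^ n" for n :: nat
    using floor_correct[of "t * 2 ^ n"] by (simp add: field_simps)
  have le: "(of_int \<lfloor>t * 2 ^ n\<rfloor> + 1) / 2 ^ n \<le> t + (1/2) ^ n" for n :: nat
    by (simp add: field_simps power_divide)
  have "(\<lambda>n. t + (1/2) ^ n) \<longlonglongrightarrow> t + 0"
    by (intro tendsto_intros) auto
  then have "(\<lambda>n. (of_int \<lfloor>t * 2 ^ n\<rfloor> + 1) / 2 ^ n) \<longlonglongrightarrow> t"
    using tendsto_sandwich[OF always_eventually always_eventually tendsto_const, OF allI allI, OF less_imp_le[OF gt] le]
    by simp
  then show ?thesis
    by (rule tendsto_imp_filterlim_at_right) (intro always_eventually allI gt)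
qed

text \<open>With \<open>t\<close> replaced by its upper dyadic neighbour only countably many times
  occur, so each approximation is jointly measurable; right continuity gives the pointwise
  limit.\<close>

lemma right_continuous_jointly_measurable:
  fixes X :: "real \<Rightarrow> 'a \<Rightarrow> 'b :: {complete_linorder, linorder_topology, second_countable_topology}"
  assumes meas: "\<And>t. X t \<in> borel_measurable N"
    and rc: "\<And>t \<omega>. \<omega> \<in> space N \<Longrightarrow> continuous (at_right t) (\<lambda>t. X t \<omega>)"
  shows "(\<lambda>(t, \<omega>). X t \<omega>) \<in> borel_measurable (borel \<Otimes>\<^sub>M N)"
proof -
  have "(\<lambda>p. X (fst p) (snd p)) \<in> borel_measurable (borel \<Otimes>\<^sub>M N)"
  proof (rule borel_measurable_LIMSEQ_order)
    fix n :: nat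
    have fl: "(\<lambda>p::real \<times> 'a. \<lfloor>fst p * 2 ^ n\<rfloor>) \<in> measurable (borel \<Otimes>\<^sub>M N) (count_space UNIV)"
      by measurable
    have "(\<lambda>p. X ((of_int i + 1) / (2::real) ^ n) (snd p)) \<in> borel_measurable (borel \<Otimes>\<^sub>M N)" for i :: int
      using meas by measurable
    from measurable_compose_countable[OF this fl]
    show "(\<lambda>p. X ((of_int \<lfloor>(fst p :: real) * 2 ^ n\<rfloor> + 1) / (2::real) ^ n) (snd p)) \<in> borel_measurable (borel \<Otimes>\<^sub>M N)" .
  next
    fix p :: "real \<times> 'a" assume "p \<in> space (borel \<Otimes>\<^sub>M N)"
    then have "snd p \<in> space N" by (auto simp: space_pair_measure)
    from rc[OF this, of "fst p"] have "((\<lambda>t. X t (snd p)) \<longlongrightarrow> X (fst p) (snd p)) (at_right (fst p))"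
      by (simp add: continuous_within)
    from filterlim_compose[OF this dyadic_from_right]
    show "(\<lambda>n. X ((of_int \<lfloor>(fst p :: real) * 2 ^ n\<rfloor> + 1) / (2::real) ^ n) (snd p)) \<longlonglongrightarrow> X (fst p) (snd p)" .
  qed
  then show ?thesis by (simp add: case_prod_beta')
qed

text \<open>The two densities induce the same measure on \<open>F\<close>. Nonnegative integrals
  admit unbounded weights \<open>W\<close>, such as exponentials of the inverse local time.\<close>

lemma nn_integral_eq_subalgebra:
  fixes f g W :: "'a \<Rightarrow> ennreal"
  assumes sub: "subalgebra M F"
    and [measurable]: "f \<in> borel_measurable M" "g \<in> borel_measurable M"
    and W: "W \<in> borel_measurable F"
    and eq: "\<And>A. A \<in> sets F \<Longrightarrow> (\<integral>\<^sup>+x. f x * indicator A x \<partial>M) = (\<integral>\<^sup>+x. g x * indicator A x \<partial>M)"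
  shows "(\<integral>\<^sup>+x. f x * W x \<partial>M) = (\<integral>\<^sup>+x. g x * W x \<partial>M)"
proof -
  have setsF: "A \<in> sets M" if "A \<in> sets F" for A
    using that sub by (auto simp: subalgebra_def)
  have [measurable]: "W \<in> borel_measurable M"
    using measurable_from_subalg[OF sub W] .
  have subd: "subalgebra (density M h) F" for h
    using sub by (auto simp: subalgebra_def)
  have "restr_to_subalg (density M f) F = restr_to_subalg (density M g) F"
  proof (rule measure_eqI)
    fix A assume "A \<in> sets (restr_to_subalg (density M f) F)"
    then have A: "A \<in> sets F" by (simp add: sets_restr_to_subalg[OF subd])
    then show "emeasure (restr_to_subalg (density M f) F) A = emeasure (restr_to_subalg (density M g) F) A"
      using eq[OF A] setsF[OF A] by (simp add: emeasure_restr_to_subalg[OF subd A] emeasure_density)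
  qed (simp add: sets_restr_to_subalg[OF subd])
  then have "(\<integral>\<^sup>+x. W x \<partial>density M f) = (\<integral>\<^sup>+x. W x \<partial>density M g)"
    using nn_integral_subalgebra2[OF subd W, of f] nn_integral_subalgebra2[OF subd W, of g] by simp
  then show ?thesis by (simp add: nn_integral_density)
qed

section \<open>Laplace transforms of laws on the extended half-line\<close>

lemma exp_neg_bounds: "0 \<le> exp_neg q y" "0 \<le> q \<Longrightarrow> exp_neg q y \<le> 1"
  by (auto simp: exp_neg_def)

lemma exp_neg_measurable [measurable]: "exp_neg q \<in> borel_measurable borel"
  unfolding exp_neg_def by measurable

lemma exp_neg_power: "0 < n \<Longrightarrow> exp_neg (real n) y = exp_neg 1 y ^ n"
  by (auto simp: exp_neg_def exp_of_nat_mult[symmetric])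

lemma exp_neg_zero [simp]: "exp_neg q 0 = 1"
  by (simp add: exp_neg_def)

lemma integral_continuous_approx_poly:
  fixes X :: "'a \<Rightarrow> real" and f :: "real \<Rightarrow> real"
  assumes "prob_space M"
    and [measurable]: "X \<in> borel_measurable M" "f \<in> borel_measurable borel"
    and bd: "\<And>\<omega>. X \<omega> \<in> {0..1}"
    and p: "\<And>x. x \<in> {0..1} \<Longrightarrow> \<bar>f x - (\<Sum>i\<le>n. a i * x ^ i)\<bar> < e"
  shows "\<bar>(\<integral>\<omega>. f (X \<omega>) \<partial>M) - (\<Sum>i\<le>n. a i * (\<integral>\<omega>. X \<omega> ^ i \<partial>M))\<bar> \<le> e"
proof -
  interpret prob_space M by fact
  have ip: "integrable M (\<lambda>\<omega>. X \<omega> ^ i)" for i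
    by (rule integrable_const_bound[where B=1])
      (use bd in \<open>auto intro!: AE_I2 simp: power_abs[symmetric] power_le_one\<close>)
  have i2: "integrable M (\<lambda>\<omega>. \<Sum>i\<le>n. a i * X \<omega> ^ i)"
    using ip by auto
  have i3: "integrable M (\<lambda>\<omega>. f (X \<omega>) - (\<Sum>i\<le>n. a i * X \<omega> ^ i))"
    by (rule integrable_const_bound[where B=e]) (use p bd in \<open>auto intro!: AE_I2 less_imp_le\<close>)
  have i1: "integrable M (\<lambda>\<omega>. f (X \<omega>))"
    using Bochner_Integration.integrable_add[OF i3 i2] by simp
  have "(\<integral>\<omega>. f (X \<omega>) \<partial>M) - (\<Sum>i\<le>n. a i * (\<integral>\<omega>. X \<omega> ^ i \<partial>M))
      = (\<integral>\<omega>. f (X \<omega>) - (\<Sum>i\<le>n. a i * X \<omega> ^ i) \<partial>M)"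
    using ip i1 i2 by (simp add: Bochner_Integration.integral_sum)
  also have "\<bar>\<dots>\<bar> \<le> (\<integral>\<omega>. \<bar>f (X \<omega>) - (\<Sum>i\<le>n. a i * X \<omega> ^ i)\<bar> \<partial>M)"
    by (rule integral_abs_bound)
  also have "\<dots> \<le> (\<integral>\<omega>. e \<partial>M)"
    by (rule integral_mono) (use i3 p bd in \<open>auto intro!: less_imp_le\<close>)
  finally show ?thesis by (simp add: prob_space)
qed

text \<open>Polynomials are uniformly dense on \<open>{0..1}\<close>, and their integrals are
  combinations of moments.\<close>

lemma integral_continuous_eq_of_moments_eq:
  fixes X :: "'a \<Rightarrow> real" and X' :: "'b \<Rightarrow> real" and f :: "real \<Rightarrow> real"
  assumes "prob_space M" "prob_space M'"
    and "X \<in> borel_measurable M" "X' \<in> borel_measurable M'"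
    and "\<And>\<omega>. X \<omega> \<in> {0..1}" "\<And>\<omega>. X' \<omega> \<in> {0..1}"
    and eq: "\<And>n. (\<integral>\<omega>. X \<omega> ^ n \<partial>M) = (\<integral>\<omega>. X' \<omega> ^ n \<partial>M')"
    and f: "continuous_on UNIV f"
  shows "(\<integral>\<omega>. f (X \<omega>) \<partial>M) = (\<integral>\<omega>. f (X' \<omega>) \<partial>M')"
proof -
  have fm: "f \<in> borel_measurable borel"
    using f by (rule borel_measurable_continuous_onI)
  have "\<bar>(\<integral>\<omega>. f (X \<omega>) \<partial>M) - (\<integral>\<omega>. f (X' \<omega>) \<partial>M')\<bar> \<le> 0 + e" if e: "0 < e" for e
  proof -
    have "continuous_on {0..1} f" by (rule continuous_on_subset[OF f]) auto
    then have "\<exists>g. real_polynomial_function g \<and> (\<forall>x\<in>{0..1}. \<bar>f x - g x\<bar> < e / 2)"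
      by (rule Stone_Weierstrass_real_polynomial_function[OF compact_Icc _ half_gt_zero[OF e]]) blast
    then obtain g where g: "real_polynomial_function g" "\<forall>x\<in>{0..1}. \<bar>f x - g x\<bar> < e / 2" by blast
    from g(1) obtain a n where "g = (\<lambda>x. \<Sum>i\<le>n. a i * x ^ i)"
      by (auto simp: real_polynomial_function_iff_sum)
    with g(2) have p: "\<And>x. x \<in> {0..1} \<Longrightarrow> \<bar>f x - (\<Sum>i\<le>n. a i * x ^ i)\<bar> < e / 2" by auto
    from integral_continuous_approx_poly[OF assms(1,3) fm assms(5) p]
      integral_continuous_approx_poly[OF assms(2,4) fm assms(6) p]
    show ?thesis unfolding eq by linarith
  qed
  then have "\<bar>(\<integral>\<omega>. f (X \<omega>) \<partial>M) - (\<integral>\<omega>. f (X' \<omega>) \<partial>M')\<bar> \<le> 0"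
    by (rule field_le_epsilon)
  then show ?thesis by simp
qed

text \<open>Cosine and sine are continuous, so equal moments give equal characteristic
  functions.\<close>

lemma distr_eq_of_moments_eq:
  fixes X :: "'a \<Rightarrow> real" and X' :: "'b \<Rightarrow> real"
  assumes "prob_space M" "prob_space M'"
    and [measurable]: "X \<in> borel_measurable M" "X' \<in> borel_measurable M'"
    and "\<And>\<omega>. X \<omega> \<in> {0..1}" "\<And>\<omega>. X' \<omega> \<in> {0..1}"
    and eq: "\<And>n. (\<integral>\<omega>. X \<omega> ^ n \<partial>M) = (\<integral>\<omega>. X' \<omega> ^ n \<partial>M')"
  shows "distr M borel X = distr M' borel X'"
proof (rule Levy_uniqueness)
  interpret M: prob_space M by fact
  interpret M': prob_space M' by fact
  show "real_distribution (distr M borel X)" "real_distribution (distr M' borel X')"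
    by auto
  show "char (distr M borel X) = char (distr M' borel X')"
  proof
    fix t
    have cis: "(\<integral>\<omega>. iexp (t * Z \<omega>) \<partial>N) = Complex (\<integral>\<omega>. cos (t * Z \<omega>) \<partial>N) (\<integral>\<omega>. sin (t * Z \<omega>) \<partial>N)"
      if "prob_space N" and [measurable]: "Z \<in> borel_measurable N" for N :: "'c measure" and Z :: "'c \<Rightarrow> real"
    proof -
      interpret N: prob_space N by fact
      have i: "integrable N (\<lambda>\<omega>. cis (t * Z \<omega>))"
        by (rule N.integrable_const_bound[where B=1]) (auto simp: cis_conv_exp)
      show ?thesis
        unfolding cis_conv_exp[symmetric]
        using integral_Re[OF i] integral_Im[OF i] by (intro complex_eqI) simp_all
    qed
    show "char (distr M borel X) t = char (distr M' borel X') t"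
      unfolding char_def
      using cis[OF assms(1,3)] cis[OF assms(2,4)]
        integral_continuous_eq_of_moments_eq[OF assms, of "\<lambda>x. cos (t * x)"]
        integral_continuous_eq_of_moments_eq[OF assms, of "\<lambda>x. sin (t * x)"]
      by (simp add: integral_distr continuous_intros)
  qed
qed

text \<open>The Laplace transform at a natural number \<open>n\<close> is the \<open>n\<close>-th
  moment of \<open>exp_neg 1 X\<close>, a variable in \<open>{0..1}\<close> from which
  \<open>X\<close> is recovered by a measurable inverse; the value 0 stands for \<infinity>.\<close>

lemma distr_eq_of_laplace_eq:
  fixes X :: "'a \<Rightarrow> ennreal" and X' :: "'b \<Rightarrow> ennreal"
  assumes "prob_space M" "prob_space M'"
    and [measurable]: "X \<in> borel_measurable M" "X' \<in> borel_measurable M'"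
    and eq: "\<And>q. 0 < q \<Longrightarrow> (\<integral>\<omega>. exp_neg q (X \<omega>) \<partial>M) = (\<integral>\<omega>. exp_neg q (X' \<omega>) \<partial>M')"
  shows "distr M borel X = distr M' borel X'"
proof -
  interpret M: prob_space M by fact
  interpret M': prob_space M' by fact
  define \<psi> :: "real \<Rightarrow> ennreal" where "\<psi> z = (if z \<le> 0 then \<infinity> else ennreal (- ln z))" for z
  have [measurable]: "\<psi> \<in> borel_measurable borel" unfolding \<psi>_def by measurable
  have inv: "\<psi> (exp_neg 1 y) = y" for y
    by (cases y) (auto simp: \<psi>_def exp_neg_def)
  have "distr M borel (\<lambda>\<omega>. exp_neg 1 (X \<omega>)) = distr M' borel (\<lambda>\<omega>. exp_neg 1 (X' \<omega>))"
  proof (rule distr_eq_of_moments_eq)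
    \<comment> \<open>The zeroth moment is separate, since \<open>0 ^ 0 = 1\<close> whereas
      \<open>exp_neg 0 \<infinity> = 0\<close>.\<close>
    fix n show "(\<integral>\<omega>. exp_neg 1 (X \<omega>) ^ n \<partial>M) = (\<integral>\<omega>. exp_neg 1 (X' \<omega>) ^ n \<partial>M')"
      using eq[of "real n"] by (cases "n = 0") (auto simp: exp_neg_power M.prob_space M'.prob_space)
  qed (use assms exp_neg_bounds in auto)
  then have "distr (distr M borel (\<lambda>\<omega>. exp_neg 1 (X \<omega>))) borel \<psi>
      = distr (distr M' borel (\<lambda>\<omega>. exp_neg 1 (X' \<omega>))) borel \<psi>" by simp
  then show ?thesis by (simp add: distr_distr comp_def inv)
qed

section \<open>Integrals over intervals and products of them\<close>

lemma nn_integral_shift_Icc: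
  fixes f :: "real \<Rightarrow> ennreal"
  assumes [measurable]: "f \<in> borel_measurable borel"
  shows "(\<integral>\<^sup>+x\<in>{a..b}. f (c + x) \<partial>lborel) = (\<integral>\<^sup>+x\<in>{c + a..c + b}. f x \<partial>lborel)"
  by (subst (2) nn_integral_real_affine[where c=1 and t=c])
    (auto intro!: nn_integral_cong simp: indicator_def)

text \<open>The square is cut along its diagonal, and in each triangle the later time is written as
  the earlier one plus \<open>x\<close>: the form to which the Markov property at the earlier time
  applies.\<close>

lemma nn_integral_Icc_mult:
  fixes f g :: "real \<Rightarrow> ennreal"
  assumes [measurable]: "f \<in> borel_measurable borel" "g \<in> borel_measurable borel"
  shows "(\<integral>\<^sup>+s\<in>{a..b}. f s \<partial>lborel) * (\<integral>\<^sup>+s\<in>{a..b}. g s \<partial>lborel) =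
    (\<integral>\<^sup>+s\<in>{a..b}. f s * (\<integral>\<^sup>+x\<in>{0..b - s}. g (s + x) \<partial>lborel) \<partial>lborel) +
    (\<integral>\<^sup>+s\<in>{a..b}. g s * (\<integral>\<^sup>+x\<in>{0..b - s}. f (s + x) \<partial>lborel) \<partial>lborel)"
proof -
  define p where "p s r = f s * indicator {a..b} s * (g r * indicator {s..b} r)" for s r
  \<comment> \<open>Half-open, so that the two triangles are disjoint; the diagonal is a null set
    and is put back below.\<close>
  define p' where "p' s r = g r * indicator {a..b} r * (f s * indicator {r<..b} s)" for s r
  have [measurable]: "(\<lambda>x. p (fst x) (snd x)) \<in> borel_measurable (borel \<Otimes>\<^sub>M borel)"
    "(\<lambda>x. p' (fst x) (snd x)) \<in> borel_measurable (borel \<Otimes>\<^sub>M borel)"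
    "(\<lambda>x. p' (snd x) (fst x)) \<in> borel_measurable (borel \<Otimes>\<^sub>M borel)"
    unfolding p_def p'_def indicator_def by simp_all
  have [measurable]: "p s \<in> borel_measurable borel" "p' s \<in> borel_measurable borel" "(\<lambda>s. p' s r) \<in> borel_measurable borel" for s r
    unfolding p_def[abs_def] p'_def[abs_def] indicator_def by simp_all
  have "(\<integral>\<^sup>+s\<in>{a..b}. f s \<partial>lborel) * (\<integral>\<^sup>+r\<in>{a..b}. g r \<partial>lborel)
      = (\<integral>\<^sup>+s. (\<integral>\<^sup>+r. f s * indicator {a..b} s * (g r * indicator {a..b} r) \<partial>lborel) \<partial>lborel)"
    by (simp add: nn_integral_cmult nn_integral_multc)
  also have "\<dots> = (\<integral>\<^sup>+s. (\<integral>\<^sup>+r. p s r + p' s r \<partial>lborel) \<partial>lborel)"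
    by (intro nn_integral_cong) (auto simp: indicator_def p_def p'_def mult.commute)
  also have "\<dots> = (\<integral>\<^sup>+s. (\<integral>\<^sup>+r. p s r \<partial>lborel) \<partial>lborel) + (\<integral>\<^sup>+s. (\<integral>\<^sup>+r. p' s r \<partial>lborel) \<partial>lborel)"
    by (subst nn_integral_add[symmetric]) (auto simp: nn_integral_add)
  also have "(\<integral>\<^sup>+s. (\<integral>\<^sup>+r. p' s r \<partial>lborel) \<partial>lborel) = (\<integral>\<^sup>+r. (\<integral>\<^sup>+s. p' s r \<partial>lborel) \<partial>lborel)"
    by (rule lborel_pair.Fubini') (simp add: case_prod_beta')
  also have "(\<integral>\<^sup>+s. (\<integral>\<^sup>+r. p s r \<partial>lborel) \<partial>lborel)
      = (\<integral>\<^sup>+s\<in>{a..b}. f s * (\<integral>\<^sup>+x\<in>{0..b - s}. g (s + x) \<partial>lborel) \<partial>lborel)"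
  proof (rule nn_integral_cong)
    fix s
    show "(\<integral>\<^sup>+r. p s r \<partial>lborel) = f s * (\<integral>\<^sup>+x\<in>{0..b - s}. g (s + x) \<partial>lborel) * indicator {a..b} s"
      unfolding p_def by (subst nn_integral_cmult) (simp_all add: nn_integral_shift_Icc mult.assoc mult.left_commute mult.commute[of "indicator _ _"] del: add.commute)
  qed
  also have "(\<integral>\<^sup>+r. (\<integral>\<^sup>+s. p' s r \<partial>lborel) \<partial>lborel)
      = (\<integral>\<^sup>+r\<in>{a..b}. g r * (\<integral>\<^sup>+x\<in>{0..b - r}. f (r + x) \<partial>lborel) \<partial>lborel)"
  proof (rule nn_integral_cong)
    fix r
    have "(\<integral>\<^sup>+s. p' s r \<partial>lborel) = (\<integral>\<^sup>+s. g r * indicator {a..b} r * (f s * indicator {r..b} s) \<partial>lborel)"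
      by (rule nn_integral_cong_AE)
        (use AE_lborel_singleton[of r] in \<open>eventually_elim, auto simp: p'_def indicator_def\<close>)
    then show "(\<integral>\<^sup>+s. p' s r \<partial>lborel) = g r * (\<integral>\<^sup>+x\<in>{0..b - r}. f (r + x) \<partial>lborel) * indicator {a..b} r"
      by (subst (asm) nn_integral_cmult) (simp_all add: nn_integral_shift_Icc mult.assoc mult.left_commute mult.commute[of "indicator _ _"])
  qed
  finally show ?thesis .
qed

lemma nn_set_integral_cmult:
  fixes f :: "'b \<Rightarrow> ennreal"
  assumes [measurable]: "f \<in> borel_measurable N" "A \<in> sets N"
  shows "c * (\<integral>\<^sup>+x\<in>A. f x \<partial>N) = (\<integral>\<^sup>+x. f x * c * indicator A x \<partial>N)"
  by (subst nn_integral_cmult[symmetric]) (auto intro!: nn_integral_cong simp: ac_simps)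

lemma natural_filtration_subalgebra:
  assumes "\<And>r. 0 \<le> r \<Longrightarrow> Y r \<in> borel_measurable M"
  shows "subalgebra M (natural_filtration M Y s)"
proof -
  have "sets (natural_filtration M Y s) \<subseteq> sets M"
    unfolding natural_filtration_def
    by (subst sets_measure_of) (use assms in \<open>auto intro!: sets.sigma_sets_subset measurable_sets\<close>)
  then show ?thesis by (simp add: subalgebra_def natural_filtration_def space_measure_of_conv)
qed

section \<open>Approximation of the local time at zero\<close>

text \<open>For the process of the theorem, \<open>u t\<close> is $\exp(\int_t^1 \Phi(v_s)\,\mathrm ds)$; see \<open>CBI_laplace_flow_process\<close>.\<close>

locale laplace_flow_process = prob_space M for M :: "'a measure" +
  fixes Y :: "real \<Rightarrow> 'a \<Rightarrow> ennreal" and u v :: "real \<Rightarrow> real"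
  assumes Y_measurable: "\<And>t. 0 \<le> t \<Longrightarrow> Y t \<in> borel_measurable M"
    and Y_right_continuous: "\<And>\<omega> t. \<omega> \<in> space M \<Longrightarrow> 0 \<le> t \<Longrightarrow> continuous (at_right t) (\<lambda>t. Y t \<omega>)"
    and Y_0: "AE \<omega> in M. Y 0 \<omega> = 0"
    and u_measurable [measurable]: "u \<in> borel_measurable borel"
    and v_measurable [measurable]: "v \<in> borel_measurable borel"
    and u_pos: "\<And>t. 0 < t \<Longrightarrow> 0 < u t"
    and u_antimono: "\<And>s t. 0 < s \<Longrightarrow> s \<le> t \<Longrightarrow> u t \<le> u s"
    and v_pos: "\<And>t. 0 < t \<Longrightarrow> 0 < v t"
    and v_at_top: "filterlim v at_top (at_right 0)"
    and markov: "\<And>A s t e. A \<in> sets (natural_filtration M Y s) \<Longrightarrow> 0 \<le> s \<Longrightarrow> 0 \<le> t \<Longrightarrow> 0 < e \<Longrightarrow>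
      (\<integral>\<^sup>+\<omega>\<in>A. ennreal (u e * exp_neg (v e) (Y (s + t) \<omega>)) \<partial>M) =
      (\<integral>\<^sup>+\<omega>\<in>A. ennreal (u (e + t) * exp_neg (v (e + t)) (Y s \<omega>)) \<partial>M)"
begin

definition F :: "real \<Rightarrow> 'a measure" where "F = natural_filtration M Y"

text \<open>Constant before time 0, so that the process is right-continuous on the whole real line,
  as joint measurability over \<open>borel\<close> demands.\<close>

definition Yp :: "real \<Rightarrow> 'a \<Rightarrow> ennreal" where "Yp t = Y (max 0 t)"

text \<open>The value 0 at \<open>e \<le> 0\<close> gives meaning to integrals over
  \<open>{0..t}\<close> although \<open>u\<close> may be singular at 0. The price is that
  monotonicity in \<open>e\<close> fails at 0, hence the recurring exclusion of this single
  point.\<close>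

definition h :: "real \<Rightarrow> ennreal \<Rightarrow> ennreal" where
  "h e y = (if 0 < e then ennreal (u e * exp_neg (v e) y) else 0)"

lemma h_measurable [measurable]: "(\<lambda>(e, y). h e y) \<in> borel_measurable (borel \<Otimes>\<^sub>M borel)"
  unfolding h_def exp_neg_def by measurable

lemma h_measurable' [measurable (raw)]:
  "f \<in> borel_measurable N \<Longrightarrow> g \<in> borel_measurable N \<Longrightarrow> (\<lambda>x. h (f x) (g x)) \<in> borel_measurable N"
  using measurable_compose[OF _ h_measurable, of "\<lambda>x. (f x, g x)" N] by simp

lemma h_le: "h e y \<le> h e 0"
proof -
  have "u e * exp_neg (v e) y \<le> u e" if "0 < e"
    using u_pos[OF that] v_pos[OF that] exp_neg_bounds(2)[of "v e" y]
    by (simp add: mult_left_le)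
  then show ?thesis by (auto simp: h_def intro!: ennreal_leI)
qed

lemma h_0: "0 < e \<Longrightarrow> h e 0 = ennreal (u e)"
  by (simp add: h_def)

lemma h_0_antimono: "0 < s \<Longrightarrow> s \<le> t \<Longrightarrow> h t 0 \<le> h s 0"
  by (auto simp: h_0 intro!: ennreal_leI u_antimono)

lemma h_finite: "h e y < \<infinity>"
  by (simp add: h_def)

lemma h_antimono: "y \<le> z \<Longrightarrow> h e z \<le> h e y"
proof -
  assume "y \<le> z"
  then have "exp_neg (v e) z \<le> exp_neg (v e) y" if "0 < e"
    using v_pos[OF that] by (cases y; cases z) (auto simp: exp_neg_def ennreal_le_iff top_unique)
  then have "u e * exp_neg (v e) z \<le> u e * exp_neg (v e) y" if "0 < e"
    using u_pos[OF that] that by (intro mult_left_mono) auto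
  then show "h e z \<le> h e y"
    by (simp add: h_def ennreal_leI)
qed

lemma h_tendsto_0:
  assumes y: "y \<longlonglongrightarrow> 0" shows "(\<lambda>n. h x (y n)) \<longlonglongrightarrow> h x 0"
proof -
  have ev: "eventually (\<lambda>n. y n < \<infinity>) sequentially" using order_tendstoD(2)[OF y, of \<infinity>] by simp
  have "(\<lambda>n. enn2real (y n)) \<longlonglongrightarrow> enn2real 0" using tendsto_enn2real[of y 0 sequentially] y by simp
  then have "(\<lambda>n. exp (- v x * enn2real (y n))) \<longlonglongrightarrow> exp (- v x * enn2real 0)" by (intro tendsto_exp tendsto_mult tendsto_const)
  then have "(\<lambda>n. exp_neg (v x) (y n)) \<longlonglongrightarrow> exp_neg (v x) 0"
    by (rule Lim_transform_eventually[OF tendsto_eq_rhs]) (use ev in \<open>auto simp: exp_neg_def elim: eventually_mono\<close>)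
  then have "(\<lambda>n. u x * exp_neg (v x) (y n)) \<longlonglongrightarrow> u x * exp_neg (v x) 0"
    by (intro tendsto_mult tendsto_const)
  then show ?thesis
    unfolding h_def by (cases "0 < x") (auto dest: tendsto_ennrealI)
qed

lemma space_F [simp]: "space (F t) = space M"
  by (simp add: F_def natural_filtration_def space_measure_of_conv)

lemma sets_F: "sets (F t) = sigma_sets (space M) {Y r -` B \<inter> space M | r B. 0 \<le> r \<and> r \<le> t \<and> B \<in> sets borel}"
  unfolding F_def natural_filtration_def by (rule sets_measure_of) auto

lemma F_subalgebra: "subalgebra M (F t)"
  unfolding F_def by (rule natural_filtration_subalgebra) (rule Y_measurable)

lemma F_sets: "A \<in> sets (F t) \<Longrightarrow> A \<in> sets M"
  using F_subalgebra by (auto simp: subalgebra_def)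

lemma F_mono: "s \<le> t \<Longrightarrow> sets (F s) \<subseteq> sets (F t)"
  unfolding sets_F by (rule sigma_sets_mono') force

lemma Y_F_measurable: "0 \<le> r \<Longrightarrow> r \<le> t \<Longrightarrow> Y r \<in> borel_measurable (F t)"
  by (rule measurableI) (auto simp: sets_F intro!: sigma_sets.Basic)

lemma Yp_measurable [measurable]: "Yp t \<in> borel_measurable M"
  unfolding Yp_def by (rule Y_measurable) simp

lemma Yp_right_continuous: "\<omega> \<in> space M \<Longrightarrow> continuous (at_right t) (\<lambda>t. Yp t \<omega>)"
proof (cases "0 \<le> t")
  case True
  assume "\<omega> \<in> space M"
  with Y_right_continuous[OF this True]
  have "((\<lambda>t. Y t \<omega>) \<longlongrightarrow> Y t \<omega>) (at_right t)" by (simp add: continuous_within)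
  then have "((\<lambda>t. Yp t \<omega>) \<longlongrightarrow> Y t \<omega>) (at_right t)"
    by (rule Lim_transform_eventually) (use True in \<open>auto simp: eventually_at_filter Yp_def\<close>)
  then show ?thesis using True by (simp add: continuous_within Yp_def)
next
  case False
  have "((\<lambda>t. Yp t \<omega>) \<longlongrightarrow> Y 0 \<omega>) (at_right t)"
    by (rule tendsto_eventually)
      (use False in \<open>auto simp: eventually_at_right[of t 0] Yp_def intro!: exI[of _ 0]\<close>)
  then show ?thesis using False by (simp add: continuous_within Yp_def)
qed

lemma Yp_jointly_measurable: "(\<lambda>(s, \<omega>). Yp s \<omega>) \<in> borel_measurable (borel \<Otimes>\<^sub>M M)"
  by (rule right_continuous_jointly_measurable) (auto intro: Yp_right_continuous)

lemma Yp_jointly_measurable' [measurable (raw)]: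
  "f \<in> borel_measurable N \<Longrightarrow> g \<in> measurable N M \<Longrightarrow> (\<lambda>x. Yp (f x) (g x)) \<in> borel_measurable N"
  using measurable_compose[OF _ Yp_jointly_measurable, of "\<lambda>x. (f x, g x)" N] by simp

text \<open>Progressive measurability: the process stopped at \<open>t\<close> is right-continuous,
  and all its values are measurable for \<open>F t\<close>.\<close>

lemma Yp_min_jointly_measurable: "0 \<le> t \<Longrightarrow> (\<lambda>(s, \<omega>). Yp (min s t) \<omega>) \<in> borel_measurable (borel \<Otimes>\<^sub>M F t)"
proof (rule right_continuous_jointly_measurable)
  fix s \<omega> assume t: "0 \<le> t"
  then show "Yp (min s t) \<in> borel_measurable (F t)"
    unfolding Yp_def by (intro Y_F_measurable) auto
  assume "\<omega> \<in> space (F t)"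
  then have "\<omega> \<in> space M" by simp
  note rc = Yp_right_continuous[OF this, of s]
  show "continuous (at_right s) (\<lambda>s. Yp (min s t) \<omega>)"
  proof (cases "s < t")
    case True
    have "((\<lambda>s. Yp (min s t) \<omega>) \<longlongrightarrow> Yp s \<omega>) (at_right s)"
      using rc[unfolded continuous_within]
      by (rule Lim_transform_eventually)
         (use True in \<open>auto simp: eventually_at_right[of s t] intro!: exI[of _ t]\<close>)
    with True show ?thesis by (simp add: continuous_within)
  next
    case False
    have "((\<lambda>s. Yp (min s t) \<omega>) \<longlongrightarrow> Yp t \<omega>) (at_right s)"
      by (rule tendsto_eventually) (use False in \<open>auto simp: eventually_at_filter min_def\<close>)
    with False show ?thesis by (simp add: continuous_within min_absorb2)
  qed
qed

definition N :: "real \<Rightarrow> real \<Rightarrow> 'a \<Rightarrow> ennreal" where "N e s \<omega> = h e (Yp s \<omega>)"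

lemma N_measurable [measurable (raw)]:
  "f \<in> borel_measurable K \<Longrightarrow> f' \<in> borel_measurable K \<Longrightarrow> g \<in> measurable K M \<Longrightarrow>
    (\<lambda>x. N (f x) (f' x) (g x)) \<in> borel_measurable K"
  unfolding N_def by (intro h_measurable' Yp_jointly_measurable')

lemma N_F_measurable: "0 \<le> s \<Longrightarrow> s \<le> t \<Longrightarrow> N e s \<in> borel_measurable (F t)"
  unfolding N_def Yp_def by (intro h_measurable' Y_F_measurable) auto

lemma markov_N:
  assumes "0 \<le> s" "0 \<le> t" "0 < e" and W: "W \<in> borel_measurable (F s)"
  shows "(\<integral>\<^sup>+\<omega>. N e (s + t) \<omega> * W \<omega> \<partial>M) = (\<integral>\<^sup>+\<omega>. N (e + t) s \<omega> * W \<omega> \<partial>M)"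
proof (rule nn_integral_eq_subalgebra[OF F_subalgebra _ _ W])
  fix A assume "A \<in> sets (F s)"
  then show "(\<integral>\<^sup>+\<omega>\<in>A. N e (s + t) \<omega> \<partial>M) = (\<integral>\<^sup>+\<omega>\<in>A. N (e + t) s \<omega> \<partial>M)"
    using assms markov[of A s t e] by (simp add: N_def h_def Yp_def F_def)
qed auto

lemma expectation_N:
  assumes "0 \<le> s" "0 < e"
  shows "(\<integral>\<^sup>+\<omega>. N e s \<omega> \<partial>M) = h (e + s) 0"
proof -
  have "(\<integral>\<^sup>+\<omega>. N e s \<omega> \<partial>M) = (\<integral>\<^sup>+\<omega>. N (e + s) 0 \<omega> \<partial>M)"
    using markov_N[of 0 s e "\<lambda>_. 1"] assms by simp
  also have "\<dots> = (\<integral>\<^sup>+\<omega>. h (e + s) 0 \<partial>M)"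
    by (rule nn_integral_cong_AE) (use Y_0 in \<open>auto simp: N_def Yp_def\<close>)
  finally show ?thesis by (simp add: emeasure_space_1)
qed

text \<open>Fubini and the Markov property at each \<open>s + x\<close>: in expectation, the
  occupation after \<open>s\<close> may be replaced by a function of the state at \<open>s\<close>.
  The weight is \<open>N e s\<close> for second moments and an indicator elsewhere.\<close>

lemma markov_N_integral:
  assumes "0 \<le> s" "0 < e" and W: "W \<in> borel_measurable (F s)"
  shows "(\<integral>\<^sup>+\<omega>. W \<omega> * (\<integral>\<^sup>+x\<in>{0..b}. N e (s + x) \<omega> \<partial>lborel) \<partial>M)
    = (\<integral>\<^sup>+\<omega>. W \<omega> * (\<integral>\<^sup>+x\<in>{0..b}. N (e + x) s \<omega> \<partial>lborel) \<partial>M)"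
proof -
  interpret pair_sigma_finite lborel M ..
  have [measurable]: "W \<in> borel_measurable M"
    using W by (rule measurable_from_subalg[OF F_subalgebra])
  have "(\<integral>\<^sup>+\<omega>. W \<omega> * (\<integral>\<^sup>+x\<in>{0..b}. N e (s + x) \<omega> \<partial>lborel) \<partial>M)
      = (\<integral>\<^sup>+\<omega>. (\<integral>\<^sup>+x. N e (s + x) \<omega> * W \<omega> * indicator {0..b} x \<partial>lborel) \<partial>M)"
  proof (rule nn_integral_cong)
    fix \<omega> assume "\<omega> \<in> space M"
    then have [measurable]: "(\<lambda>x. N e (s + x) \<omega>) \<in> borel_measurable borel"
      by (intro N_measurable) auto
    show "W \<omega> * (\<integral>\<^sup>+x\<in>{0..b}. N e (s + x) \<omega> \<partial>lborel) = (\<integral>\<^sup>+x. N e (s + x) \<omega> * W \<omega> * indicator {0..b} x \<partial>lborel)"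
      by (rule nn_set_integral_cmult) auto
  qed
  also have "\<dots> = (\<integral>\<^sup>+x. (\<integral>\<^sup>+\<omega>. N e (s + x) \<omega> * W \<omega> * indicator {0..b} x \<partial>M) \<partial>lborel)"
    by (rule Fubini') measurable
  also have "\<dots> = (\<integral>\<^sup>+x. (\<integral>\<^sup>+\<omega>. N (e + x) s \<omega> * W \<omega> * indicator {0..b} x \<partial>M) \<partial>lborel)"
  proof (rule nn_integral_cong)
    fix x
    show "(\<integral>\<^sup>+\<omega>. N e (s + x) \<omega> * W \<omega> * indicator {0..b} x \<partial>M) = (\<integral>\<^sup>+\<omega>. N (e + x) s \<omega> * W \<omega> * indicator {0..b} x \<partial>M)"
      using markov_N[of s x e W] assms by (cases "x \<in> {0..b}") (auto simp: indicator_def)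
  qed
  also have "\<dots> = (\<integral>\<^sup>+\<omega>. (\<integral>\<^sup>+x. N (e + x) s \<omega> * W \<omega> * indicator {0..b} x \<partial>lborel) \<partial>M)"
    by (rule Fubini'[symmetric]) measurable
  also have "\<dots> = (\<integral>\<^sup>+\<omega>. W \<omega> * (\<integral>\<^sup>+x\<in>{0..b}. N (e + x) s \<omega> \<partial>lborel) \<partial>M)"
  proof (rule nn_integral_cong)
    fix \<omega> assume "\<omega> \<in> space M"
    then have [measurable]: "(\<lambda>x. N (e + x) s \<omega>) \<in> borel_measurable borel"
      by (intro N_measurable) auto
    show "(\<integral>\<^sup>+x. N (e + x) s \<omega> * W \<omega> * indicator {0..b} x \<partial>lborel) = W \<omega> * (\<integral>\<^sup>+x\<in>{0..b}. N (e + x) s \<omega> \<partial>lborel)"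
      by (rule nn_set_integral_cmult[symmetric]) auto
  qed
  finally show ?thesis .
qed

section \<open>Occupation integrals and their second moments\<close>

definition U :: "real \<Rightarrow> ennreal" where "U t = (\<integral>\<^sup>+x\<in>{0..t}. h x 0 \<partial>lborel)"

definition A :: "real \<Rightarrow> real \<Rightarrow> real \<Rightarrow> 'a \<Rightarrow> ennreal" where
  "A e a b \<omega> = (\<integral>\<^sup>+s\<in>{a..b}. N e s \<omega> \<partial>lborel)"

lemma A_measurable [measurable]: "A e a b \<in> borel_measurable M"
proof -
  have "(\<lambda>x. N e (snd x) (fst x) * indicator {a..b} (snd x)) \<in> borel_measurable (M \<Otimes>\<^sub>M lborel)"
    by (intro borel_measurable_times_ennreal N_measurable) (auto simp: indicator_def)
  then show ?thesis
    unfolding A_def[abs_def] by (intro lborel.borel_measurable_nn_integral) (simp add: case_prod_beta')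
qed

lemma N_time_measurable:
  "\<omega> \<in> space M \<Longrightarrow> (\<lambda>s. N e s \<omega>) \<in> borel_measurable borel"
  by (intro N_measurable) auto

lemma N_le: "N e s \<omega> \<le> h e 0"
  by (simp add: N_def h_le)

lemma A_le: "a \<le> b \<Longrightarrow> A e a b \<omega> \<le> h e 0 * ennreal (b - a)"
proof -
  assume "a \<le> b"
  have "A e a b \<omega> \<le> (\<integral>\<^sup>+s\<in>{a..b}. h e 0 \<partial>lborel)"
    unfolding A_def by (intro nn_integral_mono mult_right_mono N_le) auto
  also have "\<dots> = h e 0 * ennreal (b - a)"
    using \<open>a \<le> b\<close> by (simp add: nn_integral_cmult)
  finally show ?thesis .
qed

lemma A_finite: "A e a b \<omega> < \<infinity>"
proof (cases "a \<le> b")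
  case True
  have "h e 0 * ennreal (b - a) < \<infinity>" using h_finite[of e 0] by (simp add: ennreal_mult_less_top)
  with A_le[OF True, of e \<omega>] show ?thesis by (rule le_less_trans)
qed (simp add: A_def)

lemma A_split: "\<omega> \<in> space M \<Longrightarrow> a \<le> b \<Longrightarrow> b \<le> c \<Longrightarrow> A e a c \<omega> = A e a b \<omega> + A e b c \<omega>"
proof -
  assume \<omega>: "\<omega> \<in> space M" and ab: "a \<le> b" "b \<le> c"
  note [measurable] = N_time_measurable[OF \<omega>]
  have "A e a c \<omega> = (\<integral>\<^sup>+s. N e s \<omega> * indicator {a..b} s + N e s \<omega> * indicator {b..c} s \<partial>lborel)"
    unfolding A_def
  proof (rule nn_integral_cong_AE)
    show "AE s in lborel. N e s \<omega> * indicator {a..c} s = N e s \<omega> * indicator {a..b} s + N e s \<omega> * indicator {b..c} s"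
      using AE_lborel_singleton[of b] by eventually_elim (use ab in \<open>auto simp: indicator_def\<close>)
  qed
  also have "\<dots> = A e a b \<omega> + A e b c \<omega>"
    unfolding A_def by (rule nn_integral_add) auto
  finally show ?thesis .
qed

lemma h_time_measurable [measurable]: "(\<lambda>x. h x y) \<in> borel_measurable borel"
  by (intro h_measurable') auto

lemma U_mono: "s \<le> t \<Longrightarrow> U s \<le> U t"
  unfolding U_def by (intro nn_integral_mono mult_left_mono) (auto simp: indicator_def)

lemma h_0_integral_le_U:
  assumes "0 \<le> a" shows "(\<integral>\<^sup>+x\<in>{0..t}. h (a + x) 0 \<partial>lborel) \<le> U t"
  unfolding U_def
proof (rule nn_integral_mono_AE)
  show "AE x in lborel. h (a + x) 0 * indicator {0..t} x \<le> h x 0 * indicator {0..t} x"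
    using AE_lborel_singleton[of 0]
    by eventually_elim (use assms in \<open>auto simp: indicator_def intro!: h_0_antimono\<close>)
qed

lemma h_integral_le_U:
  assumes "0 \<le> a" shows "(\<integral>\<^sup>+x\<in>{0..t}. h (a + x) y \<partial>lborel) \<le> U t"
proof -
  have "(\<integral>\<^sup>+x\<in>{0..t}. h (a + x) y \<partial>lborel) \<le> (\<integral>\<^sup>+x\<in>{0..t}. h (a + x) 0 \<partial>lborel)"
    by (intro nn_integral_mono mult_right_mono h_le) auto
  with h_0_integral_le_U[OF assms] show ?thesis by (rule order_trans[rotated])
qed

lemma nn_integral_Icc_le_add:
  fixes f :: "real \<Rightarrow> ennreal"
  assumes [measurable]: "f \<in> borel_measurable borel" and "{a..b} \<subseteq> {a1..b1} \<union> {a2..b2}"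
  shows "(\<integral>\<^sup>+x\<in>{a..b}. f x \<partial>lborel) \<le> (\<integral>\<^sup>+x\<in>{a1..b1}. f x \<partial>lborel) + (\<integral>\<^sup>+x\<in>{a2..b2}. f x \<partial>lborel)"
proof -
  have "(\<integral>\<^sup>+x\<in>{a..b}. f x \<partial>lborel) \<le> (\<integral>\<^sup>+x. f x * indicator {a1..b1} x + f x * indicator {a2..b2} x \<partial>lborel)"
  proof (rule nn_integral_mono)
    fix x show "f x * indicator {a..b} x \<le> f x * indicator {a1..b1} x + f x * indicator {a2..b2} x"
      using subsetD[OF assms(2), of x] by (auto simp: indicator_def)
  qed
  also have "\<dots> = (\<integral>\<^sup>+x\<in>{a1..b1}. f x \<partial>lborel) + (\<integral>\<^sup>+x\<in>{a2..b2}. f x \<partial>lborel)"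
    by (rule nn_integral_add) auto
  finally show ?thesis .
qed

text \<open>Uniformity in \<open>y\<close> makes the approximating local times Cauchy in mean square.\<close>

lemma h_integral_shift_le:
  assumes "0 \<le> e" "e \<le> \<eta>" "0 \<le> d" "d \<le> \<eta>" "0 \<le> \<tau>"
  shows "(\<integral>\<^sup>+x\<in>{0..\<tau>}. h (e + x) y \<partial>lborel) \<le> (\<integral>\<^sup>+x\<in>{0..\<tau>}. h (d + x) y \<partial>lborel) + U \<eta>"
proof -
  \<comment> \<open>As integrals of \<open>\<lambda>x. h x y\<close> both sides run over windows of
    length \<open>\<tau>\<close> whose positions differ by at most \<open>\<eta>\<close>. The part
    of one window outside the other has length at most \<open>\<eta>\<close>, hence mass at most
    \<open>U \<eta>\<close>.\<close>
  have shift: "(\<integral>\<^sup>+x\<in>{0..\<tau>}. h (c + x) y \<partial>lborel) = (\<integral>\<^sup>+x\<in>{c..c + \<tau>}. h x y \<partial>lborel)" for c \<tau>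
    using nn_integral_shift_Icc[OF h_time_measurable[of y], where a=0 and b=\<tau> and c=c] by (simp only: add_0_right)
  show ?thesis
  proof (cases "e \<le> d")
    case True
    have "(\<integral>\<^sup>+x\<in>{e..e + \<tau>}. h x y \<partial>lborel) \<le> (\<integral>\<^sup>+x\<in>{d..d + \<tau>}. h x y \<partial>lborel) + (\<integral>\<^sup>+x\<in>{0..0 + \<eta>}. h x y \<partial>lborel)"
      by (rule nn_integral_Icc_le_add) (use assms True in auto)
    also have "(\<integral>\<^sup>+x\<in>{0..0 + \<eta>}. h x y \<partial>lborel) \<le> U \<eta>"
      using h_integral_le_U[of 0 y \<eta>] by (simp only: shift)
    finally show ?thesis unfolding shift by (simp add: add_left_mono)
  next
    case False
    have "(\<integral>\<^sup>+x\<in>{e..e + \<tau>}. h x y \<partial>lborel) \<le> (\<integral>\<^sup>+x\<in>{d..d + \<tau>}. h x y \<partial>lborel)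
        + (\<integral>\<^sup>+x\<in>{d + \<tau>..d + \<tau> + (e - d)}. h x y \<partial>lborel)"
      by (rule nn_integral_Icc_le_add) (use assms False in auto)
    also have "(\<integral>\<^sup>+x\<in>{d + \<tau>..d + \<tau> + (e - d)}. h x y \<partial>lborel) \<le> U (e - d)"
      using h_integral_le_U[of "d + \<tau>" y "e - d"] assms by (simp only: shift)
    also have "\<dots> \<le> U \<eta>" by (rule U_mono) (use assms in auto)
    finally show ?thesis unfolding shift by (simp add: add_left_mono)
  qed
qed

text \<open>The half of the expectation of \<open>A e a b * A d a b\<close> in which the time
  smoothed by \<open>e\<close> comes first; the Markov property at that time \<open>s\<close> has
  turned \<open>N d (s + x)\<close> into \<open>h (d + x) (Yp s)\<close>.\<close>

definition Q :: "real \<Rightarrow> real \<Rightarrow> real \<Rightarrow> real \<Rightarrow> ennreal" where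
  "Q a b e d = (\<integral>\<^sup>+s\<in>{a..b}. (\<integral>\<^sup>+\<omega>. N e s \<omega> * (\<integral>\<^sup>+x\<in>{0..b - s}. h (d + x) (Yp s \<omega>) \<partial>lborel) \<partial>M) \<partial>lborel)"

lemma H_measurable [measurable (raw)]:
  assumes [measurable]: "f \<in> borel_measurable K" "g \<in> borel_measurable K" "k \<in> borel_measurable K"
  shows "(\<lambda>z. \<integral>\<^sup>+x\<in>{0..f z}. h (k z + x) (g z) \<partial>lborel) \<in> borel_measurable K"
proof -
  have "(\<lambda>z. h (k (fst z) + snd z) (g (fst z)) * indicator {0..f (fst z)} (snd z)) \<in> borel_measurable (K \<Otimes>\<^sub>M lborel)"
    unfolding indicator_def by (intro borel_measurable_times_ennreal h_measurable') simp_all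
  then show ?thesis
    by (intro lborel.borel_measurable_nn_integral) (simp add: case_prod_beta')
qed

lemma Yp_time_measurable [measurable]: "\<omega> \<in> space M \<Longrightarrow> (\<lambda>s. Yp s \<omega>) \<in> borel_measurable borel"
  by (intro Yp_jointly_measurable') auto

lemma A_inner_measurable:
  "(\<lambda>z. \<integral>\<^sup>+x\<in>{0..b - snd z}. N d (snd z + x) (fst z) \<partial>lborel) \<in> borel_measurable (M \<Otimes>\<^sub>M borel)"
proof -
  have "(\<lambda>z. N d (snd (fst z) + snd z) (fst (fst z)) * indicator {0..b - snd (fst z)} (snd z)) \<in> borel_measurable ((M \<Otimes>\<^sub>M borel) \<Otimes>\<^sub>M lborel)"
    unfolding indicator_def by (intro borel_measurable_times_ennreal N_measurable) simp_all
  then show ?thesis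
    by (intro lborel.borel_measurable_nn_integral) (simp add: case_prod_beta')
qed

text \<open>\<open>nn_integral_Icc_mult\<close> orders the two times, and each half is treated by
  the Markov property at the earlier one.\<close>

lemma expectation_A_mult:
  assumes "0 \<le> a" "0 < e" "0 < d"
  shows "(\<integral>\<^sup>+\<omega>. A e a b \<omega> * A d a b \<omega> \<partial>M) = Q a b e d + Q a b d e"
proof -
  interpret pair_sigma_finite M lborel ..
  define R where "R e d s \<omega> = N e s \<omega> * (\<integral>\<^sup>+x\<in>{0..b - s}. N d (s + x) \<omega> \<partial>lborel) * indicator {a..b} s" for e d s \<omega>
  have [measurable]: "(\<lambda>z. R e d (snd z) (fst z)) \<in> borel_measurable (M \<Otimes>\<^sub>M lborel)" for e d
    unfolding R_def using A_inner_measurable[of d b]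
    by (intro borel_measurable_times_ennreal N_measurable) (simp_all cong: measurable_cong_sets)
  have R:  "(\<integral>\<^sup>+\<omega>. (\<integral>\<^sup>+s. R e d s \<omega> \<partial>lborel) \<partial>M) = Q a b e d" if "0 < e" "0 < d" for e d
  proof -
    have "(\<integral>\<^sup>+\<omega>. (\<integral>\<^sup>+s. R e d s \<omega> \<partial>lborel) \<partial>M) = (\<integral>\<^sup>+s. (\<integral>\<^sup>+\<omega>. R e d s \<omega> \<partial>M) \<partial>lborel)"
      by (rule Fubini'[symmetric]) (simp add: case_prod_beta')
    also have "\<dots> = Q a b e d"
      unfolding Q_def
    proof (rule nn_integral_cong)
      fix s
      show "(\<integral>\<^sup>+\<omega>. R e d s \<omega> \<partial>M) = (\<integral>\<^sup>+\<omega>. N e s \<omega> * (\<integral>\<^sup>+x\<in>{0..b - s}. h (d + x) (Yp s \<omega>) \<partial>lborel) \<partial>M) * indicator {a..b} s"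
        using markov_N_integral[of s d "N e s" "b - s", OF _ that(2) N_F_measurable] assms(1)
        by (cases "s \<in> {a..b}") (auto simp: R_def N_def)
    qed
    finally show ?thesis .
  qed
  have "(\<integral>\<^sup>+\<omega>. A e a b \<omega> * A d a b \<omega> \<partial>M) = (\<integral>\<^sup>+\<omega>. (\<integral>\<^sup>+s. R e d s \<omega> \<partial>lborel) + (\<integral>\<^sup>+s. R d e s \<omega> \<partial>lborel) \<partial>M)"
    unfolding A_def R_def
    by (intro nn_integral_cong nn_integral_Icc_mult N_time_measurable) auto
  also have "\<dots> = (\<integral>\<^sup>+\<omega>. (\<integral>\<^sup>+s. R e d s \<omega> \<partial>lborel) \<partial>M) + (\<integral>\<^sup>+\<omega>. (\<integral>\<^sup>+s. R d e s \<omega> \<partial>lborel) \<partial>M)"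
    by (intro nn_integral_add lborel.borel_measurable_nn_integral) (simp_all add: case_prod_beta')
  finally show ?thesis using assms R by simp
qed

lemma Q_measurable_inner: "(\<lambda>s. (\<integral>\<^sup>+\<omega>. N e s \<omega> * (\<integral>\<^sup>+x\<in>{0..b - s}. h (d + x) (Yp s \<omega>) \<partial>lborel) \<partial>M)) \<in> borel_measurable borel"
proof -
  have "(\<lambda>z. N e (fst z) (snd z) * (\<integral>\<^sup>+x\<in>{0..b - fst z}. h (d + x) (Yp (fst z) (snd z)) \<partial>lborel)) \<in> borel_measurable (borel \<Otimes>\<^sub>M M)"
    by (intro borel_measurable_times_ennreal N_measurable H_measurable Yp_jointly_measurable') simp_all
  then show ?thesis by (intro borel_measurable_nn_integral) (simp add: case_prod_beta')
qed

lemma expectation_N_integral_le: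
  assumes "0 \<le> a" "0 < e"
  shows "(\<integral>\<^sup>+s\<in>{a..b}. (\<integral>\<^sup>+\<omega>. N e s \<omega> \<partial>M) \<partial>lborel) \<le> (\<integral>\<^sup>+s\<in>{a..b}. h s 0 \<partial>lborel)"
proof (rule nn_integral_mono_AE)
  show "AE s in lborel. (\<integral>\<^sup>+\<omega>. N e s \<omega> \<partial>M) * indicator {a..b} s \<le> h s 0 * indicator {a..b} s"
    using AE_lborel_singleton[of 0]
    by eventually_elim (use assms in \<open>auto simp: indicator_def expectation_N intro!: h_0_antimono\<close>)
qed

lemma expectation_A:
  assumes "0 \<le> a" "0 < e"
  shows "(\<integral>\<^sup>+\<omega>. A e a b \<omega> \<partial>M) = (\<integral>\<^sup>+s\<in>{a..b}. h (e + s) 0 \<partial>lborel)"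
proof -
  interpret pair_sigma_finite lborel M ..
  have "(\<lambda>x. N e (fst x) (snd x) * indicator {a..b} (fst x)) \<in> borel_measurable (lborel \<Otimes>\<^sub>M M)"
    by (intro borel_measurable_times_ennreal N_measurable) (auto simp: indicator_def)
  then have "(\<integral>\<^sup>+\<omega>. A e a b \<omega> \<partial>M) = (\<integral>\<^sup>+s. (\<integral>\<^sup>+\<omega>. N e s \<omega> * indicator {a..b} s \<partial>M) \<partial>lborel)"
    unfolding A_def by (intro Fubini') (simp add: case_prod_beta')
  also have "\<dots> = (\<integral>\<^sup>+s\<in>{a..b}. h (e + s) 0 \<partial>lborel)"
    by (intro nn_integral_cong) (use assms in \<open>auto simp: indicator_def expectation_N\<close>)
  finally show ?thesis .
qed

lemma expectation_A_le:
  assumes "0 \<le> a" "0 < e"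
  shows "(\<integral>\<^sup>+\<omega>. A e a b \<omega> \<partial>M) \<le> (\<integral>\<^sup>+s\<in>{a..b}. h s 0 \<partial>lborel)"
  unfolding expectation_A[OF assms]
proof (rule nn_integral_mono_AE)
  show "AE s in lborel. h (e + s) 0 * indicator {a..b} s \<le> h s 0 * indicator {a..b} s"
    using AE_lborel_singleton[of 0]
    by eventually_elim (use assms in \<open>auto simp: indicator_def intro!: h_0_antimono\<close>)
qed

text \<open>The inner potential is at most \<open>U (b - a)\<close> whatever the state, so the bound
  involves neither smoothing parameter and survives the limit.\<close>

lemma Q_le:
  assumes "0 \<le> a" "0 < e" "0 < d"
  shows "Q a b e d \<le> U (b - a) * (\<integral>\<^sup>+s\<in>{a..b}. h s 0 \<partial>lborel)"
proof -
  have "Q a b e d \<le> (\<integral>\<^sup>+s. U (b - a) * ((\<integral>\<^sup>+\<omega>. N e s \<omega> \<partial>M) * indicator {a..b} s) \<partial>lborel)"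
    unfolding Q_def
  proof (rule nn_integral_mono)
    fix s
    show "(\<integral>\<^sup>+\<omega>. N e s \<omega> * (\<integral>\<^sup>+x\<in>{0..b - s}. h (d + x) (Yp s \<omega>) \<partial>lborel) \<partial>M) * indicator {a..b} s
      \<le> U (b - a) * ((\<integral>\<^sup>+\<omega>. N e s \<omega> \<partial>M) * indicator {a..b} s)"
    proof (cases "s \<in> {a..b}")
      case True
      have "(\<integral>\<^sup>+x\<in>{0..b - s}. h (d + x) (Yp s \<omega>) \<partial>lborel) \<le> U (b - a)" for \<omega>
        using h_integral_le_U[of d "Yp s \<omega>" "b - s"] U_mono[of "b - s" "b - a"] True assms by auto
      then have "(\<integral>\<^sup>+\<omega>. N e s \<omega> * (\<integral>\<^sup>+x\<in>{0..b - s}. h (d + x) (Yp s \<omega>) \<partial>lborel) \<partial>M) \<le> (\<integral>\<^sup>+\<omega>. U (b - a) * N e s \<omega> \<partial>M)"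
        by (intro nn_integral_mono) (subst mult.commute, intro mult_right_mono, auto)
      also have "\<dots> = U (b - a) * (\<integral>\<^sup>+\<omega>. N e s \<omega> \<partial>M)"
        by (intro nn_integral_cmult N_measurable) auto
      finally show ?thesis using True by simp
    qed simp
  qed
  also have "\<dots> = U (b - a) * (\<integral>\<^sup>+s\<in>{a..b}. (\<integral>\<^sup>+\<omega>. N e s \<omega> \<partial>M) \<partial>lborel)"
  proof (rule nn_integral_cmult)
    have "(\<lambda>z. N e (fst z) (snd z)) \<in> borel_measurable (borel \<Otimes>\<^sub>M M)"
      by (intro N_measurable) simp_all
    then have "(\<lambda>s. \<integral>\<^sup>+\<omega>. N e s \<omega> \<partial>M) \<in> borel_measurable borel"
      by (intro borel_measurable_nn_integral) (simp add: case_prod_beta')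
    then show "(\<lambda>s. (\<integral>\<^sup>+\<omega>. N e s \<omega> \<partial>M) * indicator {a..b} s) \<in> borel_measurable lborel" by simp
  qed
  also have "\<dots> \<le> U (b - a) * (\<integral>\<^sup>+s\<in>{a..b}. h s 0 \<partial>lborel)"
    by (intro mult_left_mono expectation_N_integral_le assms) auto
  finally show ?thesis .
qed

text \<open>By \<open>h_integral_shift_le\<close> a change of \<open>d\<close> costs at most
  \<open>U \<eta>\<close> in the inner integral, uniformly in the state; the outer mass is at most
  \<open>U b\<close>.\<close>

lemma Q_shift_le:
  assumes "0 < e" "0 < d" "0 < d'" "d \<le> \<eta>" "d' \<le> \<eta>"
  shows "Q 0 b e d \<le> Q 0 b e d' + U \<eta> * U b"
proof -
  have "Q 0 b e d \<le> (\<integral>\<^sup>+s. (\<integral>\<^sup>+\<omega>. N e s \<omega> * (\<integral>\<^sup>+x\<in>{0..b - s}. h (d' + x) (Yp s \<omega>) \<partial>lborel) \<partial>M) * indicator {0..b} s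
      + U \<eta> * ((\<integral>\<^sup>+\<omega>. N e s \<omega> \<partial>M) * indicator {0..b} s) \<partial>lborel)"
    unfolding Q_def
  proof (rule nn_integral_mono)
    fix s
    show "(\<integral>\<^sup>+\<omega>. N e s \<omega> * (\<integral>\<^sup>+x\<in>{0..b - s}. h (d + x) (Yp s \<omega>) \<partial>lborel) \<partial>M) * indicator {0..b} s
      \<le> (\<integral>\<^sup>+\<omega>. N e s \<omega> * (\<integral>\<^sup>+x\<in>{0..b - s}. h (d' + x) (Yp s \<omega>) \<partial>lborel) \<partial>M) * indicator {0..b} s
        + U \<eta> * ((\<integral>\<^sup>+\<omega>. N e s \<omega> \<partial>M) * indicator {0..b} s)"
    proof (cases "s \<in> {0..b}")
      case True
      have "(\<integral>\<^sup>+\<omega>. N e s \<omega> * (\<integral>\<^sup>+x\<in>{0..b - s}. h (d + x) (Yp s \<omega>) \<partial>lborel) \<partial>M)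
          \<le> (\<integral>\<^sup>+\<omega>. N e s \<omega> * (\<integral>\<^sup>+x\<in>{0..b - s}. h (d' + x) (Yp s \<omega>) \<partial>lborel) + U \<eta> * N e s \<omega> \<partial>M)"
        using h_integral_shift_le[where e=d and \<eta>=\<eta> and d=d' and \<tau>="b - s"] assms True
        by (intro nn_integral_mono) (auto simp: mult.commute[of "U \<eta>"] distrib_left[symmetric] intro!: mult_left_mono)
      also have "\<dots> = (\<integral>\<^sup>+\<omega>. N e s \<omega> * (\<integral>\<^sup>+x\<in>{0..b - s}. h (d' + x) (Yp s \<omega>) \<partial>lborel) \<partial>M) + U \<eta> * (\<integral>\<^sup>+\<omega>. N e s \<omega> \<partial>M)"
        by (subst nn_integral_add)
          (auto intro!: N_measurable H_measurable borel_measurable_times_ennreal nn_integral_cmult)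
      finally show ?thesis using True by simp
    qed simp
  qed
  also have "\<dots> = Q 0 b e d' + U \<eta> * (\<integral>\<^sup>+s\<in>{0..b}. (\<integral>\<^sup>+\<omega>. N e s \<omega> \<partial>M) \<partial>lborel)"
  proof -
    have "(\<lambda>z. N e (fst z) (snd z)) \<in> borel_measurable (borel \<Otimes>\<^sub>M M)"
      by (intro N_measurable) simp_all
    then have "(\<lambda>s. \<integral>\<^sup>+\<omega>. N e s \<omega> \<partial>M) \<in> borel_measurable borel"
      by (intro borel_measurable_nn_integral) (simp add: case_prod_beta')
    then show ?thesis
      unfolding Q_def using Q_measurable_inner[of e b d']
      by (subst nn_integral_add) (auto intro!: nn_integral_cmult)
  qed
  also have "\<dots> \<le> Q 0 b e d' + U \<eta> * U b"
    unfolding U_def[of b] by (intro add_left_mono mult_left_mono expectation_N_integral_le assms) auto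
  finally show ?thesis .
qed

lemma expectation_A_square_le:
  assumes "0 \<le> a" "0 < e"
  shows "(\<integral>\<^sup>+\<omega>. A e a b \<omega> * A e a b \<omega> \<partial>M) \<le> 2 * U (b - a) * (\<integral>\<^sup>+s\<in>{a..b}. h s 0 \<partial>lborel)"
  using add_mono[OF Q_le[OF assms assms(2), of b] Q_le[OF assms assms(2), of b]]
  by (simp add: expectation_A_mult[OF assms assms(2)] mult_2[symmetric] mult.assoc)

text \<open>In the expanded square, \<open>Q 0 b e e\<close> and \<open>Q 0 b d d\<close> each occur
  twice and are compared with the mixed terms by \<open>Q_shift_le\<close>; the four errors make the
  factor 4.\<close>

lemma expectation_A_diff_square_le:
  assumes "0 < e" "0 < d" "e \<le> \<eta>" "d \<le> \<eta>" and fin: "U b < \<infinity>"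
  shows "(\<integral>\<^sup>+\<omega>. ennreal ((enn2real (A e 0 b \<omega>) - enn2real (A d 0 b \<omega>))\<^sup>2) \<partial>M) \<le> 4 * U \<eta> * U b"
proof -
  define D where "D \<omega> = ennreal ((enn2real (A e 0 b \<omega>) - enn2real (A d 0 b \<omega>))\<^sup>2)" for \<omega>
  define P where "P = (\<integral>\<^sup>+\<omega>. A e 0 b \<omega> * A d 0 b \<omega> \<partial>M)"
  have [measurable]: "D \<in> borel_measurable M" unfolding D_def by measurable
  have Pfin: "P < \<infinity>"
  proof -
    have "P \<le> U b * U b + U b * U b"
      unfolding P_def using add_mono[OF Q_le[of 0 e d b] Q_le[of 0 d e b]] assms
      by (simp add: expectation_A_mult U_def)
    also have "\<dots> < \<infinity>" using fin by (simp add: ennreal_mult_less_top)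
    finally show ?thesis .
  qed
  \<comment> \<open>The mixed term stays on the left, as subtraction in \<open>ennreal\<close> is
    truncated; finiteness of \<open>P\<close> allows its cancellation at the end.\<close>
  have "(\<integral>\<^sup>+\<omega>. D \<omega> \<partial>M) + 2 * P = (\<integral>\<^sup>+\<omega>. D \<omega> + 2 * (A e 0 b \<omega> * A d 0 b \<omega>) \<partial>M)"
    unfolding P_def by (simp add: nn_integral_add nn_integral_cmult)
  also have "\<dots> = (\<integral>\<^sup>+\<omega>. A e 0 b \<omega> * A e 0 b \<omega> + A d 0 b \<omega> * A d 0 b \<omega> \<partial>M)"
  proof (rule nn_integral_cong)
    fix \<omega>
    obtain x where x: "A e 0 b \<omega> = ennreal x" "0 \<le> x"
      using A_finite[of e 0 b \<omega>] by (cases "A e 0 b \<omega>") auto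
    obtain y where y: "A d 0 b \<omega> = ennreal y" "0 \<le> y"
      using A_finite[of d 0 b \<omega>] by (cases "A d 0 b \<omega>") auto
    have "D \<omega> + 2 * (A e 0 b \<omega> * A d 0 b \<omega>) = ennreal ((x - y)\<^sup>2 + 2 * (x * y))"
      using x y unfolding D_def by (simp add: ennreal_mult ennreal_plus)
    also have "(x - y)\<^sup>2 + 2 * (x * y) = x * x + y * y"
      by (simp add: power2_eq_square algebra_simps)
    also have "ennreal \<dots> = A e 0 b \<omega> * A e 0 b \<omega> + A d 0 b \<omega> * A d 0 b \<omega>"
      using x y by (simp add: ennreal_mult ennreal_plus)
    finally show "D \<omega> + 2 * (A e 0 b \<omega> * A d 0 b \<omega>) = A e 0 b \<omega> * A e 0 b \<omega> + A d 0 b \<omega> * A d 0 b \<omega>" .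
  qed
  also have "\<dots> = (Q 0 b e e + Q 0 b e e) + (Q 0 b d d + Q 0 b d d)"
    using assms by (simp add: nn_integral_add expectation_A_mult)
  also have "\<dots> \<le> ((Q 0 b e d + U \<eta> * U b) + (Q 0 b e d + U \<eta> * U b))
      + ((Q 0 b d e + U \<eta> * U b) + (Q 0 b d e + U \<eta> * U b))"
    by (intro add_mono Q_shift_le) (use assms in auto)
  also have "\<dots> = 4 * U \<eta> * U b + 2 * P"
    unfolding P_def using assms
    by (simp add: expectation_A_mult mult_2[symmetric] algebra_simps)
  finally have "(\<integral>\<^sup>+\<omega>. D \<omega> \<partial>M) + 2 * P \<le> 4 * U \<eta> * U b + 2 * P" .
  then show ?thesis
    using Pfin unfolding D_def by (simp add: ennreal_add_left_cancel_le add.commute ennreal_mult_eq_top_iff) auto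
qed

end

section \<open>Limits of monotone functions along dyadic grids\<close>

lemma dyadic_cell:
  fixes t :: real assumes "0 \<le> t" "t < real K"
  obtains k :: nat where "k < K * 2 ^ m" "real k / 2 ^ m \<le> t" "t < (real k + 1) / 2 ^ m"
proof -
  have fl: "of_int \<lfloor>t * 2 ^ m\<rfloor> \<le> t * 2 ^ m" "t * 2 ^ m < of_int \<lfloor>t * 2 ^ m\<rfloor> + 1"
    using floor_correct[of "t * 2 ^ m"] by simp_all
  define k where "k = nat \<lfloor>t * 2 ^ m\<rfloor>"
  have k: "real k = of_int \<lfloor>t * 2 ^ m\<rfloor>" using assms by (simp add: k_def)
  have "t * 2 ^ m < real K * 2 ^ m" using assms by simp
  then have "real k < real (K * 2 ^ m)"
    using fl(1) k unfolding of_nat_mult of_nat_power of_nat_numeral by linarith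
  then have "k < K * 2 ^ m" by linarith
  moreover have "real k / 2 ^ m \<le> t" using fl k by (simp add: field_simps)
  moreover have "t < (real k + 1) / 2 ^ m" using fl k by (simp add: field_simps)
  ultimately show thesis using that by blast
qed

lemma dyadic_Rats: "real k / 2 ^ m \<in> \<rat>" "(real k + 1) / 2 ^ m \<in> \<rat>"
proof -
  show "real k / 2 ^ m \<in> \<rat>" by (intro Rats_divide Rats_power) auto
  show "(real k + 1) / 2 ^ m \<in> \<rat>" by (intro Rats_divide Rats_power Rats_add) auto
qed

text \<open>Assumption \<open>cont\<close> says that \<open>f\<close> has no jumps.\<close>

lemma monotone_rational_limit:
  fixes X :: "nat \<Rightarrow> real \<Rightarrow> real" and f :: "real \<Rightarrow> real"
  assumes mono: "\<And>n s t. 0 \<le> s \<Longrightarrow> s \<le> t \<Longrightarrow> X n s \<le> X n t"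
    and conv: "\<And>q. q \<in> \<rat> \<Longrightarrow> 0 \<le> q \<Longrightarrow> (\<lambda>n. X n q) \<longlonglongrightarrow> f q"
    and cont: "\<And>K \<eta>. 0 < \<eta> \<Longrightarrow> \<exists>m::nat. \<forall>k<K * 2 ^ m. f ((real k + 1) / 2 ^ m) - f (real k / 2 ^ m) < \<eta>"
  defines "l \<equiv> \<lambda>t. lim (\<lambda>n. X n t)"
  shows "\<And>t. 0 \<le> t \<Longrightarrow> (\<lambda>n. X n t) \<longlonglongrightarrow> l t"
    and "\<And>s t. 0 \<le> s \<Longrightarrow> s \<le> t \<Longrightarrow> l s \<le> l t"
    and "continuous_on {0..} l"
proof -
  have "convergent (\<lambda>n. X n t)" if t: "0 \<le> t" for t
    unfolding Cauchy_convergent_iff[symmetric]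
  proof (rule CauchyI')
    fix e :: real assume e: "0 < e"
    obtain K where K: "t < real K" using reals_Archimedean2 by blast
    obtain m where m: "\<And>k. k < K * 2 ^ m \<Longrightarrow> f ((real k + 1) / 2 ^ m) - f (real k / 2 ^ m) < e / 3"
      using cont[of "e / 3" K] e by auto
    obtain k where k: "k < K * 2 ^ m" "real k / 2 ^ m \<le> t" "t < (real k + 1) / 2 ^ m"
      using dyadic_cell[OF t K] by blast
    let ?a = "real k / 2 ^ m" and ?b = "(real k + 1) / 2 ^ m"
    have ab: "0 \<le> ?a" "0 \<le> ?b" by simp_all
    have "eventually (\<lambda>n. dist (X n ?a) (f ?a) < e / 3) sequentially"
      using conv[OF dyadic_Rats(1) ab(1)] e by (intro tendstoD) auto
    moreover have "eventually (\<lambda>n. dist (X n ?b) (f ?b) < e / 3) sequentially"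
      using conv[OF dyadic_Rats(2) ab(2)] e by (intro tendstoD) auto
    ultimately obtain n0 where n0: "\<And>n. n0 \<le> n \<Longrightarrow> \<bar>X n ?a - f ?a\<bar> < e / 3 \<and> \<bar>X n ?b - f ?b\<bar> < e / 3"
      unfolding dist_real_def using eventually_conj[THEN eventually_sequentially[THEN iffD1]] by blast
    \<comment> \<open>Monotonicity squeezes \<open>X n t\<close> between the values at the two ends
      of the dyadic cell of \<open>t\<close>.\<close>
    have "f ?a - e / 3 < X n t \<and> X n t < f ?b + e / 3" if "n0 \<le> n" for n
    proof -
      have "X n ?a \<le> X n t" "X n t \<le> X n ?b" using k t ab by (intro mono; linarith)+
      with n0[OF that] show ?thesis unfolding abs_less_iff by linarith
    qed
    note bds = this
    have "dist (X p t) (X n t) < e" if "n0 \<le> p" "n0 \<le> n" for p n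
      using m[OF k(1)] bds[OF that(1)] bds[OF that(2)] unfolding dist_real_def abs_less_iff by linarith
    then show "\<exists>M. \<forall>p\<ge>M. \<forall>n>p. dist (X p t) (X n t) < e"
      by (intro exI[of _ n0]) auto
  qed
  then show lim: "(\<lambda>n. X n t) \<longlonglongrightarrow> l t" if "0 \<le> t" for t
    using that by (simp add: l_def convergent_LIMSEQ_iff)
  show mono_l: "l s \<le> l t" if "0 \<le> s" "s \<le> t" for s t
    using lim[of s] lim[of t] that mono by (intro LIMSEQ_le[OF lim lim]) auto
  have lf: "l q = f q" if "q \<in> \<rat>" "0 \<le> q" for q
    using LIMSEQ_unique[OF lim conv] that by auto
  show "continuous_on {0..} l"
    unfolding continuous_on_iff
  proof (intro ballI allI impI)
    fix t e :: real assume t: "t \<in> {0..}" and e: "0 < e"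
    obtain K where K: "t + 1 < real K" using reals_Archimedean2 by blast
    obtain m where m: "\<And>k. k < K * 2 ^ m \<Longrightarrow> f ((real k + 1) / 2 ^ m) - f (real k / 2 ^ m) < e / 2"
      using cont[of "e / 2" K] e by auto
    \<comment> \<open>A step shorter than the mesh meets at most two adjacent cells, each
      contributing less than \<open>e / 2\<close>.\<close>
    have step: "l y - l x < e" if xy: "0 \<le> x" "x \<le> y" "y < x + 1 / 2 ^ m" "y < real K" for x y
    proof -
      obtain k where k: "k < K * 2 ^ m" "real k / 2 ^ m \<le> x" "x < (real k + 1) / 2 ^ m"
        using dyadic_cell[of x K] xy by auto
      have y: "y < (real (Suc k) + 1) / 2 ^ m" using xy k(3) by (simp add: add_divide_distrib)
      have fk: "f ((real k + 1) / 2 ^ m) - f (real k / 2 ^ m) < e / 2" by (rule m[OF k(1)])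
      have lx: "f (real k / 2 ^ m) \<le> l x"
        using mono_l[of "real k / 2 ^ m" x] lf[OF dyadic_Rats(1)] k by simp
      show ?thesis
      proof (cases "y < (real k + 1) / 2 ^ m")
        case True
        then have "l y \<le> f ((real k + 1) / 2 ^ m)"
          using mono_l[of y "(real k + 1) / 2 ^ m"] lf[OF dyadic_Rats(2)] xy by simp
        then show ?thesis using fk lx e by linarith
      next
        case False
        have Sk: "real (Suc k) = real k + 1" by simp
        have "real (Suc k) / 2 ^ m < real K" unfolding Sk using False xy(4) by linarith
        then have "real (Suc k) < real (K * 2 ^ m)"
          unfolding pos_divide_less_eq[OF zero_less_power[OF zero_less_numeral]] by simp
        then have "Suc k < K * 2 ^ m" by linarith
        from m[OF this] have "f ((real (Suc k) + 1) / 2 ^ m) - f ((real k + 1) / 2 ^ m) < e / 2"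
          by (simp add: add.commute)
        moreover have "l y \<le> f ((real (Suc k) + 1) / 2 ^ m)"
          using mono_l[of y "(real (Suc k) + 1) / 2 ^ m"] lf[OF dyadic_Rats(2), of "Suc k"] xy y by simp
        ultimately show ?thesis using fk lx by linarith
      qed
    qed
    show "\<exists>d>0. \<forall>x\<in>{0..}. dist x t < d \<longrightarrow> dist (l x) (l t) < e"
    proof (intro exI[of _ "1 / 2 ^ m"] conjI ballI impI)
      fix x assume x: "x \<in> {0..}" "dist x t < 1 / 2 ^ m"
      have "(1::real) / 2 ^ m \<le> 1" by simp
      then have xK: "x < real K" using x(2) K unfolding dist_real_def abs_less_iff by linarith
      show "dist (l x) (l t) < e"
      proof (cases "x \<le> t")
        case True
        then show ?thesis using step[of x t] mono_l[of x t] x t K by (auto simp: dist_real_def)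
      next
        case False
        then show ?thesis using step[of t x] mono_l[of t x] x t xK by (auto simp: dist_real_def)
      qed
    qed simp
  qed
qed

section \<open>Almost sure convergence of the approximations\<close>

locale local_time_process = laplace_flow_process +
  assumes u_integrable: "(\<integral>\<^sup>+x\<in>{0<..<1}. ennreal (u x) \<partial>lborel) < \<infinity>"
    and growth: "\<And>\<kappa>. 0 < \<kappa> \<Longrightarrow> ((\<lambda>e. u e * exp (- \<kappa> * v e)) \<longlongrightarrow> 0) (at_right 0)"
begin

lemma U_finite: "U t < \<infinity>"
proof -
  have "U 1 = (\<integral>\<^sup>+x\<in>{0<..<1}. ennreal (u x) \<partial>lborel)"
    unfolding U_def
  proof (rule nn_integral_cong_AE)
    show "AE x in lborel. h x 0 * indicator {0..1} x = ennreal (u x) * indicator {0<..<1} x"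
      using AE_lborel_singleton[of 0] AE_lborel_singleton[of 1]
      by eventually_elim (auto simp: indicator_def h_0)
  qed
  then have "U 1 < \<infinity>" using u_integrable by simp
  moreover have "U t \<le> U 1 + (\<integral>\<^sup>+x\<in>{1..1 + \<bar>t\<bar>}. h x 0 \<partial>lborel)"
    unfolding U_def by (rule nn_integral_Icc_le_add) auto
  moreover have "(\<integral>\<^sup>+x\<in>{1..1 + \<bar>t\<bar>}. h x 0 \<partial>lborel) \<le> (\<integral>\<^sup>+x\<in>{1..1 + \<bar>t\<bar>}. h 1 0 \<partial>lborel)"
    by (intro nn_integral_mono) (auto simp: indicator_def intro!: h_0_antimono)
  moreover have "(\<integral>\<^sup>+x\<in>{1..1 + \<bar>t\<bar>}. h 1 0 \<partial>lborel) < \<infinity>"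
    by (simp add: nn_integral_cmult h_0 ennreal_mult_less_top)
  ultimately show ?thesis
    by (metis (no_types, lifting) add_left_mono ennreal_add_less_top infinity_ennreal_def le_less_trans)
qed

lemma U_tendsto_0: "(\<lambda>n. U (1 / real (Suc n))) \<longlonglongrightarrow> 0"
proof -
  have "(\<lambda>n. \<integral>\<^sup>+x\<in>{0..1 / real (Suc n)}. h x 0 \<partial>lborel) \<longlonglongrightarrow> (\<integral>\<^sup>+(x::real). 0 \<partial>lborel)"
  proof (rule nn_integral_dominated_convergence[where w="\<lambda>x. h x 0 * indicator {0..1} x"])
    show "(\<integral>\<^sup>+x\<in>{0..1}. h x 0 \<partial>lborel) < \<infinity>" using U_finite[of 1] by (simp add: U_def)
    show "AE x in lborel. h x 0 * indicator {0..1 / real (Suc n)} x \<le> h x 0 * indicator {0..1} x" for n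
    proof (intro AE_I2 mult_left_mono)
      have "{0..1 / real (Suc n)} \<subseteq> {0..1}" by auto
      then show "indicator {0..1 / real (Suc n)} x \<le> (indicator {0..1} x :: ennreal)" for x
        by (rule indicator_leI[OF subsetD])
    qed simp
    show "AE x in lborel. (\<lambda>n. h x 0 * indicator {0..1 / real (Suc n)} x) \<longlonglongrightarrow> 0"
    proof (rule AE_I2)
      fix x :: real
      show "(\<lambda>n. h x 0 * indicator {0..1 / real (Suc n)} x) \<longlonglongrightarrow> 0"
      proof (cases "0 < x")
        case True
        have "(\<lambda>n. 1 / real (Suc n)) \<longlonglongrightarrow> 0" using LIMSEQ_inverse_real_of_nat by (simp add: inverse_eq_divide)
        then have "eventually (\<lambda>n. 1 / real (Suc n) < x) sequentially" using True by (rule order_tendstoD)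
        then show ?thesis by (intro tendsto_eventually, elim eventually_mono) (simp add: indicator_def)
      qed (simp add: h_def)
    qed
  qed auto
  then show ?thesis by (simp add: U_def)
qed

lemma ex_small_U: "\<exists>e>0. e \<le> 1 / real (Suc n) \<and> U e \<le> ennreal ((1 / 16) ^ n)"
proof -
  have "eventually (\<lambda>k. U (1 / real (Suc k)) < ennreal ((1 / 16) ^ n)) sequentially"
    by (rule order_tendstoD[OF U_tendsto_0]) simp
  with eventually_ge_at_top[of n] have "eventually (\<lambda>k. n \<le> k \<and> U (1 / real (Suc k)) < ennreal ((1 / 16) ^ n)) sequentially"
    by (rule eventually_conj)
  then obtain k where k: "n \<le> k" "U (1 / real (Suc k)) < ennreal ((1 / 16) ^ n)"
    by (auto simp: eventually_sequentially)
  then show ?thesis by (intro exI[of _ "1 / real (Suc k)"]) (auto simp: field_simps)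
qed

text \<open>The rate \<open>(1 / 16) ^ n\<close> leaves \<open>(1 / 4) ^ n\<close> after
  multiplication by the weight \<open>4 ^ n\<close> in \<open>expectation_X_step\<close>.\<close>

definition eta :: "nat \<Rightarrow> real" where
  "eta n = (SOME e. 0 < e \<and> e \<le> 1 / real (Suc n) \<and> U e \<le> ennreal ((1 / 16) ^ n))"

text \<open>A running minimum: with a decreasing sequence, \<open>U (eps n)\<close> controls both
  members of a consecutive pair of approximations.\<close>

definition eps :: "nat \<Rightarrow> real" where "eps n = Min (eta ` {..n})"

lemma eta: "0 < eta n" "eta n \<le> 1 / real (Suc n)" "U (eta n) \<le> ennreal ((1 / 16) ^ n)"
  using someI_ex[OF ex_small_U[of n]] unfolding eta_def by auto

lemma eps_le_eta: "eps n \<le> eta n"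
  unfolding eps_def by (rule Min_le) auto

lemma eps_pos: "0 < eps n"
  unfolding eps_def using eta by (subst Min_gr_iff) auto

lemma eps_Suc_le: "eps (Suc n) \<le> eps n"
  unfolding eps_def by (rule Min_antimono) auto

lemma U_eps_le: "U (eps n) \<le> ennreal ((1 / 16) ^ n)"
  using U_mono[OF eps_le_eta] eta(3) by (rule order_trans)

lemma eps_tendsto: "eps \<longlonglongrightarrow> 0"
proof (rule tendsto_sandwich[OF always_eventually always_eventually tendsto_const])
  show "(\<lambda>n. 1 / real (Suc n)) \<longlonglongrightarrow> 0" using LIMSEQ_inverse_real_of_nat by (simp add: inverse_eq_divide)
  show "\<forall>n. 0 \<le> eps n" using eps_pos less_imp_le by blast
  show "\<forall>n. eps n \<le> 1 / real (Suc n)" using eps_le_eta eta(2) order_trans by blast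
qed

lemma U_eps_tendsto: "(\<lambda>n. U (eps n)) \<longlonglongrightarrow> 0"
proof (rule tendsto_sandwich[OF always_eventually always_eventually tendsto_const])
  have "(\<lambda>n. ennreal ((1 / 16) ^ n)) \<longlonglongrightarrow> ennreal 0"
    by (intro tendsto_ennrealI LIMSEQ_realpow_zero) auto
  then show "(\<lambda>n. ennreal ((1 / 16) ^ n)) \<longlonglongrightarrow> 0" by simp
qed (use U_eps_le in auto)

definition X :: "nat \<Rightarrow> real \<Rightarrow> 'a \<Rightarrow> real" where "X n t \<omega> = enn2real (A (eps n) 0 t \<omega>)"

lemma X_measurable [measurable]: "X n t \<in> borel_measurable M"
  unfolding X_def[abs_def] by measurable

lemma ennreal_X: "ennreal (X n t \<omega>) = A (eps n) 0 t \<omega>"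
  unfolding X_def using A_finite[of "eps n" 0 t \<omega>] by (simp add: less_top)

lemma A_eq_X_diff:
  assumes "\<omega> \<in> space M" "0 \<le> a" "a \<le> b"
  shows "A (eps n) a b \<omega> = ennreal (X n b \<omega> - X n a \<omega>)" and "X n a \<omega> \<le> X n b \<omega>"
proof -
  have eq: "A (eps n) 0 b \<omega> = A (eps n) 0 a \<omega> + A (eps n) a b \<omega>" using assms by (rule A_split)
  obtain r where r: "A (eps n) a b \<omega> = ennreal r" "0 \<le> r"
    using A_finite[of "eps n" a b \<omega>] by (cases "A (eps n) a b \<omega>") auto
  have "ennreal (X n b \<omega>) = ennreal (X n a \<omega> + r)"
    using eq r ennreal_plus[of "X n a \<omega>" r] unfolding ennreal_X[symmetric] by (simp add: X_def)
  then have "X n b \<omega> = X n a \<omega> + r"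
    using r by (subst (asm) ennreal_inj) (auto simp: X_def)
  with r show "A (eps n) a b \<omega> = ennreal (X n b \<omega> - X n a \<omega>)" "X n a \<omega> \<le> X n b \<omega>" by auto
qed

lemma expectation_X_step:
  "(\<integral>\<^sup>+\<omega>. ennreal \<bar>X (Suc n) t \<omega> - X n t \<omega>\<bar> \<partial>M) \<le> ennreal ((1 / 4) ^ n) * (4 * U t + 1)"
proof -
  \<comment> \<open>The inequality of arithmetic and geometric means turns mean square bounds into
    absolute moments; the weights keep both terms summable.\<close>
  have *: "\<bar>x\<bar> \<le> 4 ^ n * x\<^sup>2 + (1 / 4) ^ n" for x :: real
  proof -
    have "0 \<le> (2 ^ n * \<bar>x\<bar> - (1 / 2) ^ n)\<^sup>2" by simp
    also have "\<dots> = 4 ^ n * x\<^sup>2 + (1 / 4) ^ n - 2 * ((2::real) ^ n * (1 / 2) ^ n) * \<bar>x\<bar>"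
      by (simp add: power2_diff power_mult_distrib power_mult[symmetric] power_divide mult.commute[of n 2] power_mult[of _ 2 n])
    also have "(2::real) ^ n * (1 / 2) ^ n = 1" by (simp flip: power_mult_distrib)
    finally show ?thesis by linarith
  qed
  have "(\<integral>\<^sup>+\<omega>. ennreal \<bar>X (Suc n) t \<omega> - X n t \<omega>\<bar> \<partial>M)
      \<le> (\<integral>\<^sup>+\<omega>. ennreal (4 ^ n) * ennreal ((X (Suc n) t \<omega> - X n t \<omega>)\<^sup>2) + ennreal ((1 / 4) ^ n) \<partial>M)"
    using * by (intro nn_integral_mono) (auto simp flip: ennreal_mult ennreal_plus intro!: ennreal_leI)
  also have "\<dots> = ennreal (4 ^ n) * (\<integral>\<^sup>+\<omega>. ennreal ((X (Suc n) t \<omega> - X n t \<omega>)\<^sup>2) \<partial>M) + ennreal ((1 / 4) ^ n)"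
    by (simp add: nn_integral_add nn_integral_cmult emeasure_space_1)
  also have "\<dots> \<le> ennreal (4 ^ n) * (4 * U (eps n) * U t) + ennreal ((1 / 4) ^ n)"
    unfolding X_def
    by (intro add_right_mono mult_left_mono expectation_A_diff_square_le eps_pos eps_Suc_le U_finite) auto
  also have "\<dots> \<le> ennreal (4 ^ n) * (4 * ennreal ((1 / 16) ^ n) * U t) + ennreal ((1 / 4) ^ n)"
    by (intro add_right_mono mult_left_mono mult_right_mono U_eps_le) auto
  also have "\<dots> = (ennreal (4 ^ n) * ennreal ((1 / 16) ^ n)) * (4 * U t) + ennreal ((1 / 4) ^ n)"
    by (simp add: ac_simps)
  also have "ennreal (4 ^ n) * ennreal ((1 / 16) ^ n) = ennreal ((1 / 4) ^ n)"
    by (simp flip: ennreal_mult power_mult_distrib)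
  finally show ?thesis by (simp add: distrib_left)
qed

text \<open>Bounds the whole sequence \<open>X n t\<close> at once. Its finiteness yields
  convergence, and its integrability the domination in \<open>expectation_ell\<close>.\<close>

definition W :: "real \<Rightarrow> 'a \<Rightarrow> ennreal" where
  "W t \<omega> = ennreal (X 0 t \<omega>) + (\<Sum>n. ennreal \<bar>X (Suc n) t \<omega> - X n t \<omega>\<bar>)"

lemma W_measurable [measurable]: "W t \<in> borel_measurable M"
  unfolding W_def[abs_def] by measurable

lemma X_le_W: "ennreal (X n t \<omega>) \<le> W t \<omega>"
proof -
  have "ennreal (X n t \<omega>) \<le> ennreal (X 0 t \<omega>) + (\<Sum>k<n. ennreal \<bar>X (Suc k) t \<omega> - X k t \<omega>\<bar>)"
  proof (induction n)
    case (Suc n)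
    have "ennreal (X (Suc n) t \<omega>) \<le> ennreal (X n t \<omega>) + ennreal \<bar>X (Suc n) t \<omega> - X n t \<omega>\<bar>"
    proof -
      have "ennreal (X (Suc n) t \<omega>) \<le> ennreal (X n t \<omega> + \<bar>X (Suc n) t \<omega> - X n t \<omega>\<bar>)"
        by (rule ennreal_leI) linarith
      also have "\<dots> = ennreal (X n t \<omega>) + ennreal \<bar>X (Suc n) t \<omega> - X n t \<omega>\<bar>"
        by (rule ennreal_plus) (auto simp: X_def)
      finally show ?thesis .
    qed
    with Suc show ?case by (auto simp: add.assoc[symmetric] intro: order_trans add_right_mono)
  qed simp
  also have "\<dots> \<le> W t \<omega>"
    unfolding W_def by (intro add_left_mono sum_le_suminf) auto
  finally show ?thesis .
qed

lemma expectation_W_finite: "0 \<le> t \<Longrightarrow> (\<integral>\<^sup>+\<omega>. W t \<omega> \<partial>M) < \<infinity>"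
proof -
  assume t: "0 \<le> t"
  have "(\<integral>\<^sup>+\<omega>. W t \<omega> \<partial>M) = (\<integral>\<^sup>+\<omega>. A (eps 0) 0 t \<omega> \<partial>M) + (\<Sum>n. \<integral>\<^sup>+\<omega>. ennreal \<bar>X (Suc n) t \<omega> - X n t \<omega>\<bar> \<partial>M)"
    unfolding W_def ennreal_X by (subst nn_integral_add) (auto simp: nn_integral_suminf)
  also have "\<dots> \<le> U t + (\<Sum>n. ennreal ((1 / 4) ^ n) * (4 * U t + 1))"
    unfolding U_def[of t]
    by (intro add_mono expectation_A_le eps_pos suminf_le summableI expectation_X_step[unfolded U_def]) auto
  also have "(\<Sum>n. ennreal ((1 / 4) ^ n) * (4 * U t + 1)) = (\<Sum>n. ennreal ((1 / 4) ^ n)) * (4 * U t + 1)"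
    by (rule ennreal_suminf_multc)
  also have "(\<Sum>n. ennreal ((1 / 4) ^ n)) = ennreal (\<Sum>n. (1 / 4) ^ n)"
    by (intro suminf_ennreal_eq) (auto intro!: summable_sums summable_geometric)
  finally show ?thesis
    using U_finite[of t] by (auto simp: ennreal_mult_less_top elim!: le_less_trans)
qed

lemma AE_W_finite: "0 \<le> t \<Longrightarrow> AE \<omega> in M. W t \<omega> < \<infinity>"
  using nn_integral_PInf_AE[OF W_measurable] expectation_W_finite[of t] by (auto simp: less_top)

lemma X_convergent: "W t \<omega> < \<infinity> \<Longrightarrow> convergent (\<lambda>n. X n t \<omega>)"
proof -
  assume "W t \<omega> < \<infinity>"
  then have "(\<Sum>n. ennreal \<bar>X (Suc n) t \<omega> - X n t \<omega>\<bar>) \<noteq> \<top>" by (auto simp: W_def less_top)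
  then have "summable (\<lambda>n. \<bar>X (Suc n) t \<omega> - X n t \<omega>\<bar>)" by (intro summable_suminf_not_top) auto
  then have "summable (\<lambda>n. X (Suc n) t \<omega> - X n t \<omega>)" by (rule summable_rabs_cancel)
  then have "convergent (\<lambda>n. (\<Sum>k<n. X (Suc k) t \<omega> - X k t \<omega>) + X 0 t \<omega>)"
    by (intro convergent_add convergent_const) (simp add: summable_iff_convergent)
  then show ?thesis by (simp only: sum_lessThan_telescope[of "\<lambda>n. X n t \<omega>"] diff_add_cancel)
qed

end

lemma nn_integral_Icc_split:
  fixes f :: "real \<Rightarrow> ennreal"
  assumes [measurable]: "f \<in> borel_measurable borel" and "a \<le> b" "b \<le> c"
  shows "(\<integral>\<^sup>+x\<in>{a..c}. f x \<partial>lborel) = (\<integral>\<^sup>+x\<in>{a..b}. f x \<partial>lborel) + (\<integral>\<^sup>+x\<in>{b..c}. f x \<partial>lborel)"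
proof -
  have "(\<integral>\<^sup>+x\<in>{a..c}. f x \<partial>lborel) = (\<integral>\<^sup>+x. f x * indicator {a..b} x + f x * indicator {b..c} x \<partial>lborel)"
  proof (rule nn_integral_cong_AE)
    show "AE x in lborel. f x * indicator {a..c} x = f x * indicator {a..b} x + f x * indicator {b..c} x"
      using AE_lborel_singleton[of b] by eventually_elim (use assms(2,3) in \<open>auto simp: indicator_def\<close>)
  qed
  then show ?thesis by (simp add: nn_integral_add)
qed

section \<open>The augmented filtration\<close>

context laplace_flow_process
begin

text \<open>The augmentation of \<open>F\<close> by the null sets of \<open>M\<close>: the local time is only an almost sure limit.\<close>

definition Fb :: "real \<Rightarrow> 'a measure" where
  "Fb t = measure_of (space M) {C \<in> sets M. \<exists>B\<in>sets (F t). AE \<omega> in M. \<omega> \<in> C \<longleftrightarrow> \<omega> \<in> B} (\<lambda>_. 0)"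

lemma space_Fb [simp]: "space (Fb t) = space M"
  by (simp add: Fb_def space_measure_of_conv)

lemma sets_Fb: "sets (Fb t) = {C \<in> sets M. \<exists>B\<in>sets (F t). AE \<omega> in M. \<omega> \<in> C \<longleftrightarrow> \<omega> \<in> B}"
  (is "_ = ?S")
proof -
  have "sigma_algebra (space M) ?S"
    unfolding sigma_algebra_iff2
  proof (intro conjI ballI allI impI)
    show "?S \<subseteq> Pow (space M)" using sets.sets_into_space by auto
    show "{} \<in> ?S" by auto
  next
    fix C assume "C \<in> ?S"
    then obtain B where B: "C \<in> sets M" "B \<in> sets (F t)" "AE \<omega> in M. \<omega> \<in> C \<longleftrightarrow> \<omega> \<in> B" by blast
    then have "space M - B \<in> sets (F t)" using sets.compl_sets[of B "F t"] by simp
    moreover have "AE \<omega> in M. \<omega> \<in> space M - C \<longleftrightarrow> \<omega> \<in> space M - B" using B(3) by auto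
    ultimately show "space M - C \<in> ?S" using B(1) by blast
  next
    fix C :: "nat \<Rightarrow> 'a set" assume "range C \<subseteq> ?S"
    then have C: "C n \<in> sets M" "\<exists>B\<in>sets (F t). AE \<omega> in M. \<omega> \<in> C n \<longleftrightarrow> \<omega> \<in> B" for n by auto
    from C(2) obtain B where B: "B n \<in> sets (F t)" "AE \<omega> in M. \<omega> \<in> C n \<longleftrightarrow> \<omega> \<in> B n" for n by metis
    have "AE \<omega> in M. \<forall>n. \<omega> \<in> C n \<longleftrightarrow> \<omega> \<in> B n" using B(2) by (simp add: AE_all_countable)
    then have "AE \<omega> in M. \<omega> \<in> (\<Union>n. C n) \<longleftrightarrow> \<omega> \<in> (\<Union>n. B n)" by eventually_elim auto
    moreover have "(\<Union>n. B n) \<in> sets (F t)" using B(1) by blast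
    ultimately show "(\<Union>n. C n) \<in> ?S" using C(1) by blast
  qed
  then show ?thesis unfolding Fb_def by (rule sigma_algebra.sets_measure_of_eq)
qed

lemma Fb_sets: "C \<in> sets (Fb t) \<Longrightarrow> C \<in> sets M"
  by (simp add: sets_Fb)

lemma F_Fb: "sets (F t) \<subseteq> sets (Fb t)"
  using F_sets by (auto simp: sets_Fb)

lemma Fb_mono: "s \<le> t \<Longrightarrow> sets (Fb s) \<subseteq> sets (Fb t)"
  using F_mono[of s t] by (auto simp: sets_Fb)

lemma Fb_measurable_AE:
  assumes f: "f \<in> measurable M K" and g: "g \<in> measurable (F t) K" and eq: "AE \<omega> in M. f \<omega> = g \<omega>"
  shows "f \<in> measurable (Fb t) K"
proof (rule measurableI)
  fix \<omega> assume "\<omega> \<in> space (Fb t)" then show "f \<omega> \<in> space K" using f by (auto dest: measurable_space)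
next
  fix B assume B: "B \<in> sets K"
  have "g -` B \<inter> space M \<in> sets (F t)" using measurable_sets[OF g B] by simp
  moreover have "AE \<omega> in M. \<omega> \<in> f -` B \<inter> space M \<longleftrightarrow> \<omega> \<in> g -` B \<inter> space M"
    using eq by eventually_elim auto
  ultimately show "f -` B \<inter> space (Fb t) \<in> sets (Fb t)"
    using measurable_sets[OF f B] unfolding sets_Fb space_Fb by blast
qed

lemma Fb_measurable_mono: "s \<le> t \<Longrightarrow> f \<in> measurable (Fb s) K \<Longrightarrow> f \<in> measurable (Fb t) K"
  using Fb_mono[of s t] by (auto simp: measurable_def)

text \<open>On \<open>{0..t}\<close> the process agrees with the process stopped at
  \<open>t\<close>, which is jointly measurable over \<open>F t\<close>.\<close>

lemma A_F_measurable: assumes "0 \<le> t" shows "A e 0 t \<in> borel_measurable (F t)"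
proof -
  have "(\<lambda>z. h e (Yp (min (snd z) t) (fst z)) * indicator {0..t} (snd z)) \<in> borel_measurable (F t \<Otimes>\<^sub>M lborel)"
  proof (intro borel_measurable_times_ennreal h_measurable')
    show "(\<lambda>z. Yp (min (snd z) t) (fst z)) \<in> borel_measurable (F t \<Otimes>\<^sub>M lborel)"
    proof -
      have "(\<lambda>z. (snd z, fst z)) \<in> measurable (F t \<Otimes>\<^sub>M lborel) (borel \<Otimes>\<^sub>M F t)"
        by (intro measurable_Pair) (simp_all cong: measurable_cong_sets)
      from measurable_compose[OF this Yp_min_jointly_measurable[OF assms]]
      show ?thesis by simp
    qed
  qed (auto simp: indicator_def)
  then have "(\<lambda>\<omega>. \<integral>\<^sup>+s\<in>{0..t}. h e (Yp (min s t) \<omega>) \<partial>lborel) \<in> borel_measurable (F t)"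
    by (intro lborel.borel_measurable_nn_integral) (simp add: case_prod_beta')
  also have "(\<lambda>\<omega>. \<integral>\<^sup>+s\<in>{0..t}. h e (Yp (min s t) \<omega>) \<partial>lborel) = A e 0 t"
    unfolding A_def N_def fun_eq_iff
    by (intro allI nn_integral_cong) (auto simp: indicator_def min_def)
  finally show ?thesis .
qed

end

section \<open>Continuity of the local time and its conditional expectation\<close>

context local_time_process
begin

text \<open>Sums of squared increments along dyadic grids: their smallness excludes jumps of the local time.\<close>

definition V :: "nat \<Rightarrow> nat \<Rightarrow> 'a \<Rightarrow> ennreal" where
  "V K m \<omega> = (\<Sum>k<K * 2 ^ m. liminf (\<lambda>n. A (eps n) (real k / 2 ^ m) ((real k + 1) / 2 ^ m) \<omega>
     * A (eps n) (real k / 2 ^ m) ((real k + 1) / 2 ^ m) \<omega>))"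

lemma V_measurable [measurable]: "V K m \<in> borel_measurable M"
  unfolding V_def[abs_def] by measurable

lemma sum_cells: "(\<Sum>k<n. \<integral>\<^sup>+s\<in>{real k / 2 ^ m..(real k + 1) / 2 ^ m}. h s 0 \<partial>lborel) = U (real n / 2 ^ m)"
proof (induction n)
  case 0
  have "U 0 = (\<integral>\<^sup>+(x::real). 0 \<partial>lborel)" unfolding U_def
    by (rule nn_integral_cong) (auto simp: indicator_def h_def)
  then show ?case by simp
next
  case (Suc n)
  have "U (real (Suc n) / 2 ^ m) = U (real n / 2 ^ m) + (\<integral>\<^sup>+s\<in>{real n / 2 ^ m..(real n + 1) / 2 ^ m}. h s 0 \<partial>lborel)"
    unfolding U_def of_nat_Suc add.commute[of 1 "real n"]
    by (rule nn_integral_Icc_split) (auto intro: divide_right_mono)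
  with Suc show ?case by simp
qed

text \<open>A squared increment over a cell costs twice the potential of one mesh width times the
  mass of the cell, and the masses add up to \<open>U (real K)\<close>. Fatou's lemma passes from
  the smoothing \<open>eps n\<close> to the lower limit.\<close>

lemma expectation_V_le: "(\<integral>\<^sup>+\<omega>. V K m \<omega> \<partial>M) \<le> 2 * U (1 / 2 ^ m) * U (real K)"
proof -
  let ?a = "\<lambda>k::nat. real k / 2 ^ m" and ?b = "\<lambda>k::nat. (real k + 1) / 2 ^ m"
  have "(\<integral>\<^sup>+\<omega>. V K m \<omega> \<partial>M) = (\<Sum>k<K * 2 ^ m. \<integral>\<^sup>+\<omega>. liminf (\<lambda>n. A (eps n) (?a k) (?b k) \<omega> * A (eps n) (?a k) (?b k) \<omega>) \<partial>M)"
    unfolding V_def by (rule nn_integral_sum) measurable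
  also have "\<dots> \<le> (\<Sum>k<K * 2 ^ m. 2 * U (1 / 2 ^ m) * (\<integral>\<^sup>+s\<in>{?a k..?b k}. h s 0 \<partial>lborel))"
  proof (rule sum_mono)
    fix k
    have "(\<integral>\<^sup>+\<omega>. liminf (\<lambda>n. A (eps n) (?a k) (?b k) \<omega> * A (eps n) (?a k) (?b k) \<omega>) \<partial>M)
        \<le> liminf (\<lambda>n. \<integral>\<^sup>+\<omega>. A (eps n) (?a k) (?b k) \<omega> * A (eps n) (?a k) (?b k) \<omega> \<partial>M)"
      by (rule nn_integral_liminf) measurable
    also have "\<dots> \<le> limsup (\<lambda>n. \<integral>\<^sup>+\<omega>. A (eps n) (?a k) (?b k) \<omega> * A (eps n) (?a k) (?b k) \<omega> \<partial>M)"
      by (rule Liminf_le_Limsup) simp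
    also have "\<dots> \<le> 2 * U (?b k - ?a k) * (\<integral>\<^sup>+s\<in>{?a k..?b k}. h s 0 \<partial>lborel)"
      by (intro Limsup_bounded always_eventually allI expectation_A_square_le eps_pos) simp
    also have "?b k - ?a k = 1 / 2 ^ m" by (simp add: diff_divide_distrib[symmetric])
    finally show "(\<integral>\<^sup>+\<omega>. liminf (\<lambda>n. A (eps n) (?a k) (?b k) \<omega> * A (eps n) (?a k) (?b k) \<omega>) \<partial>M)
      \<le> 2 * U (1 / 2 ^ m) * (\<integral>\<^sup>+s\<in>{?a k..?b k}. h s 0 \<partial>lborel)" .
  qed
  also have "\<dots> = 2 * U (1 / 2 ^ m) * U (real K)"
    unfolding sum_distrib_left[symmetric] sum_cells by simp
  finally show ?thesis .
qed

text \<open>The expectations tend to 0 as \<open>m\<close> grows. An infimum is the right notion,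
  since for a given tolerance only one level with small increments is wanted.\<close>

lemma AE_INF_V: "AE \<omega> in M. (INF m. V K m \<omega>) = 0"
proof -
  have "(\<lambda>m. U (1 / 2 ^ m)) \<longlonglongrightarrow> 0"
  proof (rule tendsto_sandwich[OF always_eventually _ tendsto_const])
    have "filterlim (\<lambda>m::nat. (2::nat) ^ m - 1) sequentially sequentially"
      by (rule filterlim_subseq) (auto simp: strict_mono_def diff_less_mono)
    from filterlim_compose[OF U_tendsto_0 this]
    show "(\<lambda>m. U (1 / 2 ^ m)) \<longlonglongrightarrow> 0" by (simp add: of_nat_diff)
    show "eventually (\<lambda>m. U (1 / 2 ^ m) \<le> U (1 / 2 ^ m)) sequentially" by simp
  qed simp
  then have "(\<lambda>m. U (1 / 2 ^ m) * (2 * U (real K))) \<longlonglongrightarrow> 0 * (2 * U (real K))"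
    using U_finite[of "real K"] by (intro tendsto_mult_ennreal tendsto_const) (auto simp: ennreal_mult_eq_top_iff less_top)
  then have lim: "(\<lambda>m. 2 * U (1 / 2 ^ m) * U (real K)) \<longlonglongrightarrow> 0" by (simp add: ac_simps)
  have "(\<integral>\<^sup>+\<omega>. (INF m. V K m \<omega>) \<partial>M) \<le> 2 * U (1 / 2 ^ m) * U (real K)" for m
    using nn_integral_mono[of M "\<lambda>\<omega>. INF m. V K m \<omega>" "V K m"] expectation_V_le[of K m]
    by (auto intro: INF_lower order_trans)
  then have "(\<integral>\<^sup>+\<omega>. (INF m. V K m \<omega>) \<partial>M) \<le> 0"
    by (intro LIMSEQ_le_const[OF lim]) auto
  then have "(\<integral>\<^sup>+\<omega>. (INF m. V K m \<omega>) \<partial>M) = 0" by simp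
  then show ?thesis by (subst (asm) nn_integral_0_iff_AE) auto
qed

text \<open>Countably many conditions, so the set has full measure; times between the rationals are
  reached by monotonicity.\<close>

definition G :: "'a set" where
  "G = {\<omega>\<in>space M. Y 0 \<omega> = 0 \<and> (\<forall>q\<in>\<rat> \<inter> {0..}. W q \<omega> < \<infinity>) \<and> (\<forall>K. (INF m. V K m \<omega>) = 0)}"

lemma G_sets [measurable]: "G \<in> sets M"
proof -
  have [measurable]: "Y 0 \<in> borel_measurable M" by (rule Y_measurable) simp
  have "countable (\<rat> \<inter> {0::real..})" using countable_rat by auto
  then show ?thesis unfolding G_def
    by (intro sets.sets_Collect_conj sets.sets_Collect_countable_All sets.sets_Collect_countable_Ball) auto
qed

lemma AE_G: "AE \<omega> in M. \<omega> \<in> G"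
proof -
  have "AE \<omega> in M. \<forall>q\<in>\<rat> \<inter> {0..}. W q \<omega> < \<infinity>"
    using countable_rat by (subst AE_ball_countable) (auto intro!: AE_W_finite[unfolded infinity_ennreal_def])
  moreover have "AE \<omega> in M. \<forall>K. (INF m. V K m \<omega>) = 0"
    using AE_INF_V by (simp add: AE_all_countable)
  ultimately show ?thesis using Y_0 AE_space unfolding G_def by eventually_elim simp
qed

lemma G_space: "\<omega> \<in> G \<Longrightarrow> \<omega> \<in> space M" by (simp add: G_def)

lemma G_0: "\<omega> \<in> G \<Longrightarrow> Yp 0 \<omega> = 0" by (simp add: G_def Yp_def)

text \<open>The value 0 outside \<open>G\<close> makes monotonicity and continuity hold on every
  path.\<close>

definition ell :: "real \<Rightarrow> 'a \<Rightarrow> real" where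
  "ell t \<omega> = (if \<omega> \<in> G then lim (\<lambda>n. X n t \<omega>) else 0)"

lemma ell_pathwise:
  assumes \<omega>: "\<omega> \<in> G"
  shows X_tendsto_ell: "\<And>t. 0 \<le> t \<Longrightarrow> (\<lambda>n. X n t \<omega>) \<longlonglongrightarrow> ell t \<omega>"
    and ell_mono: "\<And>s t. 0 \<le> s \<Longrightarrow> s \<le> t \<Longrightarrow> ell s \<omega> \<le> ell t \<omega>"
    and ell_continuous: "continuous_on {0..} (\<lambda>t. ell t \<omega>)"
proof -
  have \<omega>': "\<omega> \<in> space M" using \<omega> by (rule G_space)
  define f where "f q = lim (\<lambda>n. X n q \<omega>)" for q
  have conv: "(\<lambda>n. X n q \<omega>) \<longlonglongrightarrow> f q" if "q \<in> \<rat>" "0 \<le> q" for q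
    using X_convergent[of q \<omega>] \<omega> that by (auto simp: f_def G_def convergent_LIMSEQ_iff)
  have mono: "X n s \<omega> \<le> X n t \<omega>" if "0 \<le> s" "s \<le> t" for n s t
    using A_eq_X_diff(2)[OF \<omega>' that] .
  have cont: "\<exists>m::nat. \<forall>k<K * 2 ^ m. f ((real k + 1) / 2 ^ m) - f (real k / 2 ^ m) < \<eta>" if \<eta>: "0 < \<eta>" for K \<eta>
  proof -
    \<comment> \<open>Each summand of \<open>V\<close> is a squared increment, so a sum below
      \<open>\<eta> * \<eta>\<close> keeps every increment over the grid below
      \<open>\<eta>\<close>.\<close>
    have "(INF m. V K m \<omega>) < ennreal (\<eta> * \<eta>)" using \<omega> \<eta> by (simp add: G_def)
    then obtain m where m: "V K m \<omega> < ennreal (\<eta> * \<eta>)" by (auto simp: INF_less_iff)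
    have "f ((real k + 1) / 2 ^ m) - f (real k / 2 ^ m) < \<eta>" if k: "k < K * 2 ^ m" for k
    proof -
      let ?a = "real k / 2 ^ m" and ?b = "(real k + 1) / 2 ^ m"
      have ab: "0 \<le> ?a" "?a \<le> ?b" by (auto intro: divide_right_mono)
      then have b0: "0 \<le> ?b" by linarith
      have eq: "A (eps n) ?a ?b \<omega> * A (eps n) ?a ?b \<omega> = ennreal ((X n ?b \<omega> - X n ?a \<omega>) * (X n ?b \<omega> - X n ?a \<omega>))" for n
        using A_eq_X_diff[OF \<omega>' ab, of n] by (simp add: ennreal_mult)
      have "(\<lambda>n. A (eps n) ?a ?b \<omega> * A (eps n) ?a ?b \<omega>) \<longlonglongrightarrow> ennreal ((f ?b - f ?a) * (f ?b - f ?a))"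
        unfolding eq by (intro tendsto_intros tendsto_ennrealI conv dyadic_Rats ab b0)
      then have "liminf (\<lambda>n. A (eps n) ?a ?b \<omega> * A (eps n) ?a ?b \<omega>) = ennreal ((f ?b - f ?a) * (f ?b - f ?a))"
        by (intro lim_imp_Liminf) auto
      moreover have "liminf (\<lambda>n. A (eps n) ?a ?b \<omega> * A (eps n) ?a ?b \<omega>) \<le> V K m \<omega>"
        unfolding V_def using k by (intro member_le_sum[where f="\<lambda>k. liminf (\<lambda>n. A (eps n) (real k / 2 ^ m) ((real k + 1) / 2 ^ m) \<omega>
     * A (eps n) (real k / 2 ^ m) ((real k + 1) / 2 ^ m) \<omega>)"]) auto
      ultimately have "ennreal ((f ?b - f ?a) * (f ?b - f ?a)) < ennreal (\<eta> * \<eta>)" using m by simp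
      then have "(f ?b - f ?a)\<^sup>2 < \<eta>\<^sup>2" by (simp add: ennreal_less_iff power2_eq_square)
      then show ?thesis using \<eta> by (auto intro: power_less_imp_less_base)
    qed
    then show ?thesis by blast
  qed
  note lims = monotone_rational_limit[of "\<lambda>n t. X n t \<omega>" f, OF mono conv cont]
  have eq: "ell t \<omega> = lim (\<lambda>n. X n t \<omega>)" for t using \<omega> by (simp add: ell_def)
  show "\<And>t. 0 \<le> t \<Longrightarrow> (\<lambda>n. X n t \<omega>) \<longlonglongrightarrow> ell t \<omega>" unfolding eq by (rule lims(1))
  show "\<And>s t. 0 \<le> s \<Longrightarrow> s \<le> t \<Longrightarrow> ell s \<omega> \<le> ell t \<omega>" unfolding eq by (rule lims(2))
  show "continuous_on {0..} (\<lambda>t. ell t \<omega>)" unfolding eq by (rule lims(3))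
qed

lemma ell_0: "ell 0 \<omega> = 0"
proof (cases "\<omega> \<in> G")
  case True
  have "A e 0 0 \<omega> = 0" for e using A_le[of 0 0 e \<omega>] by simp
  then have "X n 0 \<omega> = 0" for n by (simp add: X_def)
  then show ?thesis by (simp add: ell_def)
qed (simp add: ell_def)

lemma ell_measurable [measurable]: "ell t \<in> borel_measurable M"
  unfolding ell_def[abs_def] by measurable

text \<open>The limit of the approximations is measurable for \<open>F t\<close>, and
  \<open>ell t\<close> agrees with it on \<open>G\<close>; but \<open>G\<close> itself depends on
  the whole path, so only the augmentation contains the result.\<close>

lemma ell_Fb_measurable: assumes "0 \<le> t" shows "ell t \<in> borel_measurable (Fb t)"
proof (rule Fb_measurable_AE)
  have "X n t \<in> borel_measurable (F t)" for n
    unfolding X_def[abs_def] using A_F_measurable[OF assms] by measurable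
  then show "(\<lambda>\<omega>. lim (\<lambda>n. X n t \<omega>)) \<in> borel_measurable (F t)" by measurable
  show "AE \<omega> in M. ell t \<omega> = lim (\<lambda>n. X n t \<omega>)" using AE_G by eventually_elim (simp add: ell_def)
qed measurable

text \<open>The Markov identity for \<open>eps n\<close> passes to the limit on both sides: on the
  left with the dominating variable \<open>W r\<close>, on the right because a shift by
  \<open>eps n\<close> costs at most \<open>U (eps n)\<close>, uniformly in the state.\<close>

lemma expectation_ell:
  assumes C: "C \<in> sets (Fb t)" and t: "0 \<le> t" "t \<le> r"
  shows "(\<integral>\<^sup>+\<omega>\<in>C. ennreal (ell r \<omega> - ell t \<omega>) \<partial>M) = (\<integral>\<^sup>+\<omega>\<in>C. (\<integral>\<^sup>+x\<in>{0..r - t}. h x (Yp t \<omega>) \<partial>lborel) \<partial>M)"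
proof -
  obtain B where B: "B \<in> sets (F t)" and CB: "AE \<omega> in M. \<omega> \<in> C \<longleftrightarrow> \<omega> \<in> B"
    using C by (auto simp: sets_Fb)
  have [measurable]: "B \<in> sets M" "C \<in> sets M" using F_sets[OF B] Fb_sets[OF C] .
  define H where "H e \<omega> = (\<integral>\<^sup>+x\<in>{0..r - t}. h (e + x) (Yp t \<omega>) \<partial>lborel)" for e \<omega>
  have [measurable]: "H e \<in> borel_measurable M" for e unfolding H_def[abs_def] by measurable
  have "(\<lambda>n. \<integral>\<^sup>+\<omega>\<in>B. A (eps n) t r \<omega> \<partial>M) \<longlonglongrightarrow> (\<integral>\<^sup>+\<omega>\<in>B. ennreal (ell r \<omega> - ell t \<omega>) \<partial>M)"
  proof (rule nn_integral_dominated_convergence[where w="W r"])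
    show "AE \<omega> in M. A (eps n) t r \<omega> * indicator B \<omega> \<le> W r \<omega>" for n
    proof (rule AE_I2)
      fix \<omega> assume \<omega>: "\<omega> \<in> space M"
      have "A (eps n) t r \<omega> \<le> A (eps n) 0 r \<omega>" using A_split[OF \<omega> t] by simp
      also have "\<dots> \<le> W r \<omega>" using X_le_W[of n r \<omega>] by (simp add: ennreal_X)
      finally show "A (eps n) t r \<omega> * indicator B \<omega> \<le> W r \<omega>" by (simp add: indicator_def)
    qed
    show "(\<integral>\<^sup>+\<omega>. W r \<omega> \<partial>M) < \<infinity>" using expectation_W_finite[of r] t by simp
    show "AE \<omega> in M. (\<lambda>n. A (eps n) t r \<omega> * indicator B \<omega>) \<longlonglongrightarrow> ennreal (ell r \<omega> - ell t \<omega>) * indicator B \<omega>"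
      using AE_G
    proof eventually_elim
      case (elim \<omega>)
      have "(\<lambda>n. ennreal (X n r \<omega> - X n t \<omega>)) \<longlonglongrightarrow> ennreal (ell r \<omega> - ell t \<omega>)"
        using t by (intro tendsto_ennrealI tendsto_diff X_tendsto_ell[OF elim]) auto
      then show ?case
        using A_eq_X_diff(1)[OF G_space[OF elim] t] by (simp add: indicator_def)
    qed
  qed auto
  moreover have "(\<integral>\<^sup>+\<omega>\<in>B. A (eps n) t r \<omega> \<partial>M) = (\<integral>\<^sup>+\<omega>\<in>B. H (eps n) \<omega> \<partial>M)" for n
  proof -
    have "(\<integral>\<^sup>+\<omega>\<in>B. A (eps n) t r \<omega> \<partial>M) = (\<integral>\<^sup>+\<omega>. indicator B \<omega> * (\<integral>\<^sup>+x\<in>{0..r - t}. N (eps n) (t + x) \<omega> \<partial>lborel) \<partial>M)"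
    proof (rule nn_integral_cong)
      fix \<omega> assume "\<omega> \<in> space M"
      from nn_integral_shift_Icc[OF N_time_measurable[OF this], of "eps n" t 0 "r - t"]
      show "A (eps n) t r \<omega> * indicator B \<omega> = indicator B \<omega> * (\<integral>\<^sup>+x\<in>{0..r - t}. N (eps n) (t + x) \<omega> \<partial>lborel)"
        by (simp add: A_def mult.commute)
    qed
    also have "\<dots> = (\<integral>\<^sup>+\<omega>. indicator B \<omega> * (\<integral>\<^sup>+x\<in>{0..r - t}. N (eps n + x) t \<omega> \<partial>lborel) \<partial>M)"
      using B t by (intro markov_N_integral eps_pos) auto
    finally show ?thesis by (simp add: H_def N_def mult.commute)
  qed
  moreover have "(\<lambda>n. \<integral>\<^sup>+\<omega>\<in>B. H (eps n) \<omega> \<partial>M) \<longlonglongrightarrow> (\<integral>\<^sup>+\<omega>\<in>B. H 0 \<omega> \<partial>M)"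
  proof (rule tendsto_sandwich[where f="\<lambda>n. (\<integral>\<^sup>+\<omega>\<in>B. H 0 \<omega> \<partial>M) - U (eps n)" and h="\<lambda>n. (\<integral>\<^sup>+\<omega>\<in>B. H 0 \<omega> \<partial>M) + U (eps n)"])
    have le: "(\<integral>\<^sup>+\<omega>\<in>B. H e \<omega> \<partial>M) \<le> (\<integral>\<^sup>+\<omega>\<in>B. H d \<omega> \<partial>M) + U (eps n)"
      if "0 \<le> e" "e \<le> eps n" "0 \<le> d" "d \<le> eps n" for e d n
    proof -
      have "(\<integral>\<^sup>+\<omega>\<in>B. H e \<omega> \<partial>M) \<le> (\<integral>\<^sup>+\<omega>. H d \<omega> * indicator B \<omega> + U (eps n) \<partial>M)"
        unfolding H_def using h_integral_shift_le[OF that, of "r - t"] t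
        by (intro nn_integral_mono) (auto simp: indicator_def)
      also have "\<dots> = (\<integral>\<^sup>+\<omega>\<in>B. H d \<omega> \<partial>M) + U (eps n)"
        by (subst nn_integral_add) (auto simp: emeasure_space_1)
      finally show ?thesis .
    qed
    show "eventually (\<lambda>n. (\<integral>\<^sup>+\<omega>\<in>B. H 0 \<omega> \<partial>M) - U (eps n) \<le> (\<integral>\<^sup>+\<omega>\<in>B. H (eps n) \<omega> \<partial>M)) sequentially"
    proof (intro always_eventually allI)
      fix n
      show "(\<integral>\<^sup>+\<omega>\<in>B. H 0 \<omega> \<partial>M) - U (eps n) \<le> (\<integral>\<^sup>+\<omega>\<in>B. H (eps n) \<omega> \<partial>M)"
        using le[of 0 n "eps n"] eps_pos[of n, THEN less_imp_le] U_finite[of "eps n"]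
        by (auto simp: ennreal_minus_le_iff add.commute)
    qed
    show "eventually (\<lambda>n. (\<integral>\<^sup>+\<omega>\<in>B. H (eps n) \<omega> \<partial>M) \<le> (\<integral>\<^sup>+\<omega>\<in>B. H 0 \<omega> \<partial>M) + U (eps n)) sequentially"
      using le[of "eps _" _ 0] eps_pos[THEN less_imp_le] by (intro always_eventually allI) simp
    have "(\<integral>\<^sup>+\<omega>\<in>B. H 0 \<omega> \<partial>M) \<le> (\<integral>\<^sup>+\<omega>. U (r - t) \<partial>M)"
      unfolding H_def using h_integral_le_U[of 0 _ "r - t"] by (intro nn_integral_mono) (auto simp: indicator_def)
    then have fin: "(\<integral>\<^sup>+\<omega>\<in>B. H 0 \<omega> \<partial>M) < \<infinity>"
      using U_finite[of "r - t"] by (simp add: emeasure_space_1)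
    show "(\<lambda>n. (\<integral>\<^sup>+\<omega>\<in>B. H 0 \<omega> \<partial>M) - U (eps n)) \<longlonglongrightarrow> (\<integral>\<^sup>+\<omega>\<in>B. H 0 \<omega> \<partial>M)"
      using tendsto_diff_ennreal[OF tendsto_const U_eps_tendsto, of "\<integral>\<^sup>+\<omega>\<in>B. H 0 \<omega> \<partial>M"] fin by simp
    show "(\<lambda>n. (\<integral>\<^sup>+\<omega>\<in>B. H 0 \<omega> \<partial>M) + U (eps n)) \<longlonglongrightarrow> (\<integral>\<^sup>+\<omega>\<in>B. H 0 \<omega> \<partial>M)"
      using tendsto_add[OF tendsto_const U_eps_tendsto, of "\<integral>\<^sup>+\<omega>\<in>B. H 0 \<omega> \<partial>M"] by simp
  qed
  ultimately have "(\<integral>\<^sup>+\<omega>\<in>B. ennreal (ell r \<omega> - ell t \<omega>) \<partial>M) = (\<integral>\<^sup>+\<omega>\<in>B. H 0 \<omega> \<partial>M)"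
    using LIMSEQ_unique by auto
  moreover have "(\<integral>\<^sup>+\<omega>\<in>C. f \<omega> \<partial>M) = (\<integral>\<^sup>+\<omega>\<in>B. f \<omega> \<partial>M)" for f
    by (rule nn_integral_cong_AE) (use CB in \<open>eventually_elim, auto simp: indicator_def\<close>)
  ultimately show ?thesis by (simp add: H_def)
qed

end

text \<open>The right side is the probability that an exponential time of rate \<open>q\<close>
  exceeds \<open>s\<close>. The strict inequality matches \<open>S_less_iff\<close>.\<close>

lemma exp_neg_eq_integral:
  assumes q: "0 < q"
  shows "ennreal (exp_neg q s) = (\<integral>\<^sup>+r. ennreal (q * exp (- q * r)) * indicator {0<..} r * indicator {r. s < ennreal r} r \<partial>lborel)"
proof -
  have tail: "(\<integral>\<^sup>+r. ennreal (q * exp (- q * r)) * indicator {a..} r \<partial>lborel) = ennreal (exp (- q * a))" for a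
  proof -
    have "(\<integral>\<^sup>+r. ennreal (q * exp (- q * r)) * indicator {a..} r \<partial>lborel) = ennreal (0 - (- exp (- q * a)))"
    proof (rule nn_integral_FTC_atLeast)
      have "((\<lambda>r. exp (- q * r)) \<longlongrightarrow> 0) at_top"
        using q by real_asymp
      then show "((\<lambda>r. - exp (- q * r)) \<longlongrightarrow> 0) at_top" using tendsto_minus by fastforce
    qed (use q in \<open>auto intro!: derivative_eq_intros\<close>)
    then show ?thesis by simp
  qed
  show ?thesis
  proof (cases s)
    case (real a)
    have "(\<integral>\<^sup>+r. ennreal (q * exp (- q * r)) * indicator {0<..} r * indicator {r. s < ennreal r} r \<partial>lborel)
        = (\<integral>\<^sup>+r. ennreal (q * exp (- q * r)) * indicator {a..} r \<partial>lborel)"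
    proof (rule nn_integral_cong_AE)
      show "AE r in lborel. ennreal (q * exp (- q * r)) * indicator {0<..} r * indicator {r. s < ennreal r} r
        = ennreal (q * exp (- q * r)) * indicator {a..} r"
        using AE_lborel_singleton[of a] by eventually_elim (use real in \<open>auto simp: indicator_def ennreal_less_iff\<close>)
    qed
    then show ?thesis using real by (simp only: tail) (simp add: exp_neg_def)
  qed (simp add: exp_neg_def)
qed

section \<open>The inverse of the local time and discounted potentials\<close>

context local_time_process
begin

lemma ell_mono': "0 \<le> s \<Longrightarrow> s \<le> t \<Longrightarrow> ell s \<omega> \<le> ell t \<omega>"
  using ell_mono[of \<omega> s t] by (cases "\<omega> \<in> G") (auto simp: ell_def)

lemma ell_continuous': "continuous_on {0..} (\<lambda>t. ell t \<omega>)"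
proof (cases "\<omega> \<in> G")
  case True then show ?thesis by (rule ell_continuous)
next
  case False then show ?thesis by (simp add: ell_def)
qed

lemma ell_nonneg: "0 \<le> t \<Longrightarrow> 0 \<le> ell t \<omega>"
  using ell_mono'[of 0 t \<omega>] by (simp add: ell_0)

lemma ell_tendsto_right: "0 \<le> t \<Longrightarrow> ((\<lambda>t. ell t \<omega>) \<longlongrightarrow> ell t \<omega>) (at_right t)"
proof -
  assume t: "0 \<le> t"
  then have "((\<lambda>t. ell t \<omega>) \<longlongrightarrow> ell t \<omega>) (at t within {0..})"
    using ell_continuous'[of \<omega>] by (auto simp: continuous_on_def)
  then show ?thesis by (rule tendsto_within_subset) (use t in auto)
qed

lemma ell_jointly_measurable:
  "(\<lambda>z. ennreal (ell (max 0 (fst z)) (snd z))) \<in> borel_measurable (borel \<Otimes>\<^sub>M M)"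
proof -
  have "(\<lambda>(t, \<omega>). ennreal (ell (max 0 t) \<omega>)) \<in> borel_measurable (borel \<Otimes>\<^sub>M M)"
  proof (rule right_continuous_jointly_measurable)
    fix t \<omega>
    have "continuous_on UNIV (\<lambda>t. ell (max 0 t) \<omega>)"
      by (rule continuous_on_compose2[OF ell_continuous'[of \<omega>]]) (auto intro!: continuous_intros)
    then show "continuous (at_right t) (\<lambda>t. ennreal (ell (max 0 t) \<omega>))"
      by (intro continuous_on_imp_continuous_within[of UNIV] continuous_on_ennreal) auto
  qed auto
  then show ?thesis by (simp add: case_prod_beta')
qed

lemma ell_time_measurable [measurable]: "(\<lambda>t. ell (max 0 t) \<omega>) \<in> borel_measurable borel"
  by (intro borel_measurable_continuous_onI continuous_on_compose2[OF ell_continuous'[of \<omega>]]) (auto intro!: continuous_intros)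

text \<open>The strict inequality selects the right-continuous inverse. The infimum of the empty set
  is \<infinity>, so killing occurs when the level reaches the total local time.\<close>

definition S :: "real \<Rightarrow> 'a \<Rightarrow> ennreal" where
  "S x \<omega> = Inf {ennreal t | t. 0 \<le> t \<and> x < ell t \<omega>}"

text \<open>Left continuity of the local time allows \<open>t\<close> to be moved slightly back,
  which makes the inequality for \<open>S\<close> strict. Events of the inverse thus become events
  at fixed times.\<close>

lemma S_less_iff:
  assumes x: "0 \<le> x" and t: "0 \<le> t"
  shows "S x \<omega> < ennreal t \<longleftrightarrow> x < ell t \<omega>"
proof
  assume "S x \<omega> < ennreal t"
  then obtain s where s: "0 \<le> s" "x < ell s \<omega>" "ennreal s < ennreal t"
    unfolding S_def by (auto simp: Inf_less_iff)
  then show "x < ell t \<omega>" using ell_mono'[of s t \<omega>] t by (simp add: ennreal_less_iff)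
next
  assume l: "x < ell t \<omega>"
  then have t0: "0 < t" using x t ell_0[of \<omega>] by (cases "t = 0") auto
  obtain d where d: "0 < d" "\<And>s. 0 \<le> s \<Longrightarrow> dist s t < d \<Longrightarrow> dist (ell s \<omega>) (ell t \<omega>) < ell t \<omega> - x"
    using ell_continuous'[of \<omega>] t l unfolding continuous_on_iff
    by (metis atLeast_iff diff_gt_0_iff_gt)
  define s where "s = max 0 (t - d / 2)"
  have s: "0 \<le> s" "s < t" "dist s t < d" using d(1) t0 by (auto simp: s_def dist_real_def)
  then have "x < ell s \<omega>" using d(2)[OF s(1,3)] by (auto simp: dist_real_def abs_less_iff)
  then have "S x \<omega> \<le> ennreal s" unfolding S_def using s(1) by (intro Inf_lower) auto
  also have "\<dots> < ennreal t" using s by (simp add: ennreal_less_iff)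
  finally show "S x \<omega> < ennreal t" .
qed

lemma S_mono: "x \<le> y \<Longrightarrow> S x \<omega> \<le> S y \<omega>"
  unfolding S_def by (rule Inf_superset_mono) auto

lemma S_finite_iff: "S x \<omega> < \<infinity> \<longleftrightarrow> (\<exists>t\<ge>0. x < ell t \<omega>)"
  unfolding S_def by (auto simp: Inf_less_iff)

lemma ell_S:
  assumes "0 \<le> x" "S x \<omega> = ennreal s" "0 \<le> s"
  shows "ell s \<omega> = x"
proof (rule antisym)
  show "ell s \<omega> \<le> x" using S_less_iff[of x s \<omega>] assms by simp
  show "x \<le> ell s \<omega>"
  proof (rule tendsto_lowerbound[OF ell_tendsto_right[OF assms(3)]])
    show "eventually (\<lambda>t. x \<le> ell t \<omega>) (at_right s)"
    proof (rule eventually_mono[OF eventually_at_right_less])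
      fix t assume "s < t"
      then show "x \<le> ell t \<omega>"
        using S_less_iff[of x t \<omega>] assms by (simp add: ennreal_less_iff)
    qed
  qed simp
qed

lemma S_ell_le: "0 \<le> s \<Longrightarrow> ennreal s \<le> S (ell s \<omega>) \<omega>"
  using S_less_iff[of "ell s \<omega>" s \<omega>] ell_nonneg[of s \<omega>] by (simp add: not_less[symmetric])

text \<open>Sublevel sets of a monotone function are intervals.\<close>

lemma S_time_measurable [measurable]: "(\<lambda>y. S (max 0 y) \<omega>) \<in> borel_measurable borel"
proof (rule borel_measurableI_less)
  fix c
  have "is_interval {y. S (max 0 y) \<omega> < c}"
    unfolding is_interval_1
  proof (intro ballI allI impI)
    fix a b x assume "a \<in> {y. S (max 0 y) \<omega> < c}" "b \<in> {y. S (max 0 y) \<omega> < c}" "a \<le> x \<and> x \<le> b"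
    moreover from this have "S (max 0 x) \<omega> \<le> S (max 0 b) \<omega>" by (intro S_mono) auto
    ultimately show "x \<in> {y. S (max 0 y) \<omega> < c}" by (auto intro: le_less_trans)
  qed
  then have "{y. S (max 0 y) \<omega> < c} \<in> sets borel" by (rule real_interval_borel_measurable)
  then show "{y \<in> space borel. S (max 0 y) \<omega> < c} \<in> sets borel" by simp
qed

text \<open>The region \<open>S y < r\<close> is the region \<open>y < ell r\<close>, so Fubini exchanges the two time scales.\<close>

lemma nn_integral_exp_neg_S:
  assumes q: "0 < q" and t: "0 \<le> t"
  shows "(\<integral>\<^sup>+y\<in>{ell t \<omega>..}. ennreal (exp_neg q (S y \<omega>)) \<partial>lborel)
    = (\<integral>\<^sup>+r\<in>{t..}. ennreal (q * exp (- q * r)) * ennreal (ell r \<omega> - ell t \<omega>) \<partial>lborel)"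
proof -
  define k where "k y r = ennreal (q * exp (- q * r)) * (indicator {0<..} r * (indicator {ell t \<omega>..} y
      * (if y < ell (max 0 r) \<omega> then 1 else 0)))" for y r :: real
  have [measurable]: "(\<lambda>z. k (fst z) (snd z)) \<in> borel_measurable (borel \<Otimes>\<^sub>M borel)"
    "(\<lambda>z. k (snd z) (fst z)) \<in> borel_measurable (borel \<Otimes>\<^sub>M borel)"
    unfolding k_def by measurable
  have "(\<integral>\<^sup>+y\<in>{ell t \<omega>..}. ennreal (exp_neg q (S y \<omega>)) \<partial>lborel) = (\<integral>\<^sup>+y. (\<integral>\<^sup>+r. k y r \<partial>lborel) \<partial>lborel)"
  proof (rule nn_integral_cong)
    fix y
    show "ennreal (exp_neg q (S y \<omega>)) * indicator {ell t \<omega>..} y = (\<integral>\<^sup>+r. k y r \<partial>lborel)"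
    proof (cases "ell t \<omega> \<le> y")
      case True
      then have y: "0 \<le> y" using ell_nonneg[OF t, of \<omega>] by linarith
      have "ennreal (exp_neg q (S y \<omega>)) = (\<integral>\<^sup>+r. k y r \<partial>lborel)"
        unfolding exp_neg_eq_integral[OF q] k_def
        by (intro nn_integral_cong) (use True S_less_iff[OF y, of _ \<omega>] in \<open>auto simp: indicator_def\<close>)
      with True show ?thesis by simp
    qed (simp add: k_def)
  qed
  also have "\<dots> = (\<integral>\<^sup>+r. (\<integral>\<^sup>+y. k y r \<partial>lborel) \<partial>lborel)"
    by (rule lborel_pair.Fubini') (simp add: case_prod_beta')
  also have "\<dots> = (\<integral>\<^sup>+r\<in>{t..}. ennreal (q * exp (- q * r)) * ennreal (ell r \<omega> - ell t \<omega>) \<partial>lborel)"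
  proof (rule nn_integral_cong)
    fix r
    show "(\<integral>\<^sup>+y. k y r \<partial>lborel) = ennreal (q * exp (- q * r)) * ennreal (ell r \<omega> - ell t \<omega>) * indicator {t..} r"
    proof (cases "0 < r")
      case True
      have "(\<integral>\<^sup>+y. k y r \<partial>lborel) = (\<integral>\<^sup>+y. ennreal (q * exp (- q * r)) * indicator {ell t \<omega>..<ell r \<omega>} y \<partial>lborel)"
        unfolding k_def by (intro nn_integral_cong) (use True in \<open>auto simp: indicator_def\<close>)
      also have "\<dots> = ennreal (q * exp (- q * r)) * emeasure lborel {ell t \<omega>..<ell r \<omega>}"
        by (subst nn_integral_cmult) auto
      finally show ?thesis
        using ell_mono'[of t r \<omega>] ell_mono'[of r t \<omega>] True t
        by (cases "t \<le> r") auto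
    next
      case False
      then have "r = t" if "t \<le> r" using that t by simp
      with False show ?thesis by (auto simp: k_def indicator_def)
    qed
  qed
  finally show ?thesis .
qed

text \<open>The discounted potential of the point 0 seen from the state \<open>y\<close>; the
  Laplace exponent will be the reciprocal of \<open>g q 0\<close>.\<close>

definition g :: "real \<Rightarrow> ennreal \<Rightarrow> ennreal" where
  "g q y = (\<integral>\<^sup>+x\<in>{0..}. ennreal (exp (- q * x)) * h x y \<partial>lborel)"

lemma g_measurable [measurable]: "g q \<in> borel_measurable borel"
proof -
  have "(\<lambda>z. ennreal (exp (- q * snd z)) * h (snd z) (fst z) * indicator {0..} (snd z)) \<in> borel_measurable (borel \<Otimes>\<^sub>M lborel)"
    by (intro borel_measurable_times_ennreal h_measurable') (auto simp: indicator_def)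
  then show ?thesis unfolding g_def[abs_def]
    by (intro lborel.borel_measurable_nn_integral) (simp add: case_prod_beta')
qed

lemma g_antimono: "y \<le> z \<Longrightarrow> g q z \<le> g q y"
  unfolding g_def by (intro nn_integral_mono mult_right_mono mult_left_mono h_antimono) auto

text \<open>Up to 1 the integrability of \<open>u\<close> is used, beyond 1 its monotonicity
  together with the exponential factor.\<close>

lemma g_finite: assumes q: "0 < q" shows "g q 0 < \<infinity>"
proof -
  have "g q 0 \<le> (\<integral>\<^sup>+x. h x 0 * indicator {0..1} x + h 1 0 * (ennreal (exp (- q * x)) * indicator {0..} x) \<partial>lborel)"
    unfolding g_def
  proof (rule nn_integral_mono)
    fix x
    show "ennreal (exp (- q * x)) * h x 0 * indicator {0..} x
      \<le> h x 0 * indicator {0..1} x + h 1 0 * (ennreal (exp (- q * x)) * indicator {0..} x)"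
    proof (cases "0 \<le> x \<and> x \<le> 1")
      case True
      then have "exp (- q * x) \<le> 1" using q by simp
      then have "ennreal (exp (- q * x)) * h x 0 \<le> 1 * h x 0"
        by (intro mult_right_mono) auto
      then show ?thesis using True by (simp add: add_increasing2)
    next
      case False
      then show ?thesis using h_0_antimono[of 1 x]
        by (auto simp: indicator_def mult.commute intro!: mult_right_mono)
    qed
  qed
  also have "\<dots> = U 1 + h 1 0 * (\<integral>\<^sup>+x. ennreal (exp (- q * x)) * indicator {0..} x \<partial>lborel)"
    unfolding U_def by (simp add: nn_integral_add nn_integral_cmult)
  also have "(\<integral>\<^sup>+x. ennreal (exp (- q * x)) * indicator {0..} x \<partial>lborel) = ennreal (0 - (- exp (- q * 0) / q))"
  proof (rule nn_integral_FTC_atLeast)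
    show "((\<lambda>r. - exp (- q * r) / q) \<longlongrightarrow> 0) at_top" using q by real_asymp
  qed (use q in \<open>auto intro!: derivative_eq_intros\<close>)
  also have "U 1 + h 1 0 * ennreal (0 - (- exp (- q * 0) / q)) < \<infinity>"
    using U_finite[of 1] h_finite[of 1 0] by (auto simp: ennreal_mult_less_top)
  finally show ?thesis .
qed

lemma g_tendsto:
  assumes q: "0 < q" and y: "y \<longlonglongrightarrow> 0"
  shows "(\<lambda>n. g q (y n)) \<longlonglongrightarrow> g q 0"
  unfolding g_def
proof (rule nn_integral_dominated_convergence[where w="\<lambda>x. ennreal (exp (- q * x)) * h x 0 * indicator {0..} x"])
  show "(\<integral>\<^sup>+x\<in>{0..}. ennreal (exp (- q * x)) * h x 0 \<partial>lborel) < \<infinity>"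
    using g_finite[OF q] by (simp add: g_def)
  show "AE x in lborel. ennreal (exp (- q * x)) * h x (y n) * indicator {0..} x \<le> ennreal (exp (- q * x)) * h x 0 * indicator {0..} x" for n
    by (intro AE_I2 mult_right_mono mult_left_mono h_le) auto
  show "AE x in lborel. (\<lambda>n. ennreal (exp (- q * x)) * h x (y n) * indicator {0..} x) \<longlonglongrightarrow> ennreal (exp (- q * x)) * h x 0 * indicator {0..} x"
  proof (rule AE_I2)
    fix x :: real
    have "(\<lambda>n. (ennreal (exp (- q * x)) * indicator {0..} x) * h x (y n)) \<longlonglongrightarrow> (ennreal (exp (- q * x)) * indicator {0..} x) * h x 0"
      by (intro tendsto_mult_ennreal tendsto_const h_tendsto_0 y) (auto simp: h_def indicator_def)
    then show "(\<lambda>n. ennreal (exp (- q * x)) * h x (y n) * indicator {0..} x) \<longlonglongrightarrow> ennreal (exp (- q * x)) * h x 0 * indicator {0..} x"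
      by (simp add: ac_simps)
  qed
qed auto

text \<open>The Markov property at the fixed time \<open>t\<close>: both sides are the discounted
  local time expected after \<open>t\<close>. The discount is written as an average over an
  exponential time \<open>r\<close>, so that \<open>expectation_ell\<close> applies up to
  \<open>r\<close>.\<close>

lemma expectation_potential:
  assumes q: "0 < q" and C: "C \<in> sets (Fb t)" and t: "0 \<le> t"
  shows "(\<integral>\<^sup>+\<omega>\<in>C. (\<integral>\<^sup>+y\<in>{ell t \<omega>..}. ennreal (exp_neg q (S y \<omega>)) \<partial>lborel) \<partial>M)
    = (\<integral>\<^sup>+\<omega>\<in>C. ennreal (exp (- q * t)) * g q (Yp t \<omega>) \<partial>M)"
proof -
  interpret pair_sigma_finite lborel M ..
  have [measurable]: "C \<in> sets M" using Fb_sets[OF C] .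
  \<comment> \<open>The \<open>max 0\<close> changes nothing where the indicators are positive and
    makes the integrand jointly measurable.\<close>
  define k where "k r \<omega> = ennreal (q * exp (- q * r)) * (ennreal (ell (max 0 r) \<omega>) - ennreal (ell (max 0 t) \<omega>))
      * (indicator {t..} r * indicator C \<omega>)" for r \<omega>
  define k' where "k' r \<omega> = ennreal (q * exp (- q * r)) * (\<integral>\<^sup>+x\<in>{0..r - t}. h (0 + x) (Yp t \<omega>) \<partial>lborel)
      * (indicator {t..} r * indicator C \<omega>)" for r \<omega>
  define tl where "tl x \<omega> = ennreal (exp (- q * t)) * (ennreal (exp (- q * x)) * h x (Yp t \<omega>) * indicator {0..} x)" for x \<omega>
  have km: "(\<lambda>z. k (fst z) (snd z)) \<in> borel_measurable (lborel \<Otimes>\<^sub>M M)"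
    unfolding k_def using ell_jointly_measurable
    by (intro borel_measurable_times_ennreal borel_measurable_minus_ennreal) (auto simp: indicator_def cong: measurable_cong_sets)
  have k'm: "(\<lambda>z. k' (fst z) (snd z)) \<in> borel_measurable (lborel \<Otimes>\<^sub>M M)"
    unfolding k'_def
    by (intro borel_measurable_times_ennreal H_measurable) (auto simp: indicator_def)
  have "(\<integral>\<^sup>+\<omega>\<in>C. (\<integral>\<^sup>+y\<in>{ell t \<omega>..}. ennreal (exp_neg q (S y \<omega>)) \<partial>lborel) \<partial>M) = (\<integral>\<^sup>+\<omega>. (\<integral>\<^sup>+r. k r \<omega> \<partial>lborel) \<partial>M)"
  proof (rule nn_integral_cong)
    fix \<omega> assume "\<omega> \<in> space M"
    have "(\<integral>\<^sup>+r\<in>{t..}. ennreal (q * exp (- q * r)) * ennreal (ell r \<omega> - ell t \<omega>) \<partial>lborel) * indicator C \<omega> = (\<integral>\<^sup>+r. k r \<omega> \<partial>lborel)"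
      unfolding k_def
      by (cases "\<omega> \<in> C") (use t in \<open>auto simp: indicator_def ennreal_minus ell_nonneg intro!: nn_integral_cong\<close>)
    then show "(\<integral>\<^sup>+y\<in>{ell t \<omega>..}. ennreal (exp_neg q (S y \<omega>)) \<partial>lborel) * indicator C \<omega> = (\<integral>\<^sup>+r. k r \<omega> \<partial>lborel)"
      by (simp only: nn_integral_exp_neg_S[OF q t])
  qed
  also have "\<dots> = (\<integral>\<^sup>+r. (\<integral>\<^sup>+\<omega>. k r \<omega> \<partial>M) \<partial>lborel)"
    by (rule Fubini') (use km in \<open>simp add: case_prod_beta'\<close>)
  also have "\<dots> = (\<integral>\<^sup>+r. (\<integral>\<^sup>+\<omega>. k' r \<omega> \<partial>M) \<partial>lborel)"
  proof (rule nn_integral_cong)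
    fix r :: real
    show "(\<integral>\<^sup>+\<omega>. k r \<omega> \<partial>M) = (\<integral>\<^sup>+\<omega>. k' r \<omega> \<partial>M)"
    proof (cases "t \<le> r")
      case True
      have "(\<integral>\<^sup>+\<omega>. k r \<omega> \<partial>M) = (\<integral>\<^sup>+\<omega>. ennreal (q * exp (- q * r)) * (ennreal (ell r \<omega> - ell t \<omega>) * indicator C \<omega>) \<partial>M)"
        unfolding k_def using True t
        by (intro nn_integral_cong) (auto simp: indicator_def ennreal_minus ell_nonneg)
      also have "\<dots> = ennreal (q * exp (- q * r)) * (\<integral>\<^sup>+\<omega>\<in>C. (\<integral>\<^sup>+x\<in>{0..r - t}. h x (Yp t \<omega>) \<partial>lborel) \<partial>M)"
        by (subst nn_integral_cmult) (auto simp: expectation_ell[OF C t True])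
      also have "\<dots> = (\<integral>\<^sup>+\<omega>. k' r \<omega> \<partial>M)"
        unfolding k'_def using H_measurable[of "\<lambda>_. r - t" M "Yp t" "\<lambda>_. 0"] True
        by (subst nn_integral_cmult[symmetric]) (auto intro!: nn_integral_cong simp: indicator_def)
      finally show ?thesis .
    qed (simp add: k_def k'_def)
  qed
  also have "\<dots> = (\<integral>\<^sup>+\<omega>. (\<integral>\<^sup>+r. k' r \<omega> \<partial>lborel) \<partial>M)"
    by (rule Fubini'[symmetric]) (use k'm in \<open>simp add: case_prod_beta'\<close>)
  also have "\<dots> = (\<integral>\<^sup>+\<omega>\<in>C. ennreal (exp (- q * t)) * g q (Yp t \<omega>) \<partial>M)"
  proof (rule nn_integral_cong)
    fix \<omega> assume "\<omega> \<in> space M"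
    \<comment> \<open>Integration over \<open>r\<close> first leaves the exponential tail beyond
      \<open>t + x\<close>, which is the discount factor.\<close>
    define m where "m r x = ennreal (q * exp (- q * r)) * (h x (Yp t \<omega>) * (if 0 \<le> x \<and> t + x \<le> r then 1 else 0))" for r x :: real
    have mm: "(\<lambda>z. m (fst z) (snd z)) \<in> borel_measurable (lborel \<Otimes>\<^sub>M lborel)" "(\<lambda>z. m (snd z) (fst z)) \<in> borel_measurable (lborel \<Otimes>\<^sub>M lborel)"
      unfolding m_def by (intro borel_measurable_times_ennreal h_measurable'; simp)+
    have "(\<integral>\<^sup>+r\<in>{t..}. ennreal (q * exp (- q * r)) * (\<integral>\<^sup>+x\<in>{0..r - t}. h x (Yp t \<omega>) \<partial>lborel) \<partial>lborel) = (\<integral>\<^sup>+r. (\<integral>\<^sup>+x. m r x \<partial>lborel) \<partial>lborel)"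
    proof (rule nn_integral_cong)
      fix r :: real
      show "ennreal (q * exp (- q * r)) * (\<integral>\<^sup>+x\<in>{0..r - t}. h x (Yp t \<omega>) \<partial>lborel) * indicator {t..} r = (\<integral>\<^sup>+x. m r x \<partial>lborel)"
      proof (cases "t \<le> r")
        case True
        then show ?thesis unfolding m_def
          by (subst nn_integral_cmult[symmetric]) (auto intro!: nn_integral_cong simp: indicator_def)
      next
        case False
        then have "m r x = 0" for x by (auto simp: m_def)
        with False show ?thesis by simp
      qed
    qed
    also have "\<dots> = (\<integral>\<^sup>+x. (\<integral>\<^sup>+r. m r x \<partial>lborel) \<partial>lborel)"
      by (rule lborel_pair.Fubini') (use mm in \<open>simp add: case_prod_beta'\<close>)
    also have "\<dots> = (\<integral>\<^sup>+x. tl x \<omega> \<partial>lborel)"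
    proof (rule nn_integral_cong)
      fix x :: real
      show "(\<integral>\<^sup>+r. m r x \<partial>lborel) = tl x \<omega>"
      proof (cases "0 \<le> x")
        case True
        have "(\<integral>\<^sup>+r. m r x \<partial>lborel) = (\<integral>\<^sup>+r. h x (Yp t \<omega>) * (ennreal (q * exp (- q * r)) * indicator {t + x..} r) \<partial>lborel)"
          unfolding m_def using True by (intro nn_integral_cong) (auto simp: indicator_def mult.commute)
        also have "\<dots> = h x (Yp t \<omega>) * (\<integral>\<^sup>+r. ennreal (q * exp (- q * r)) * indicator {t + x..} r \<partial>lborel)"
          by (rule nn_integral_cmult) auto
        also have "(\<integral>\<^sup>+r. ennreal (q * exp (- q * r)) * indicator {t + x..} r \<partial>lborel)
            = (\<integral>\<^sup>+r. ennreal (q * exp (- q * r)) * indicator {0<..} r * indicator {r. ennreal (t + x) < ennreal r} r \<partial>lborel)"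
        proof (rule nn_integral_cong_AE)
          show "AE r in lborel. ennreal (q * exp (- q * r)) * indicator {t + x..} r
            = ennreal (q * exp (- q * r)) * indicator {0<..} r * indicator {r. ennreal (t + x) < ennreal r} r"
            using AE_lborel_singleton[of "t + x"]
            by eventually_elim (use t True in \<open>auto simp: indicator_def ennreal_less_iff simp del: ennreal_plus\<close>)
        qed
        also have "\<dots> = ennreal (exp_neg q (ennreal (t + x)))" by (rule exp_neg_eq_integral[OF q, symmetric])
        also have "exp_neg q (ennreal (t + x)) = exp (- q * t) * exp (- q * x)"
          using t True by (simp add: exp_neg_def exp_add[symmetric] algebra_simps del: ennreal_plus)
        finally show ?thesis using True by (simp add: tl_def ennreal_mult ac_simps)
      qed (simp add: m_def tl_def)
    qed
    also have "\<dots> = ennreal (exp (- q * t)) * g q (Yp t \<omega>)"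
      unfolding tl_def g_def by (rule nn_integral_cmult) auto
    finally show "(\<integral>\<^sup>+r. k' r \<omega> \<partial>lborel) = ennreal (exp (- q * t)) * g q (Yp t \<omega>) * indicator C \<omega>"
      unfolding k'_def by (cases "\<omega> \<in> C") simp_all
  qed
  finally show ?thesis .
qed

end

lemma exp_neg_antimono: "0 \<le> q \<Longrightarrow> y \<le> z \<Longrightarrow> exp_neg q z \<le> exp_neg q y"
  by (cases y; cases z) (auto simp: exp_neg_def ennreal_le_iff top_unique intro!: mult_left_mono)

text \<open>The hypotheses are the equation \<open>c * f' = - f\<close> in the form of increments.
  Iterated over \<open>n\<close> equal steps they give an Euler product on each side, and both
  products converge to exponentials.\<close>

lemma exp_decay_of_increments:
  fixes f :: "real \<Rightarrow> real"
  assumes c: "0 < c" and nonneg: "\<And>a. 0 \<le> a \<Longrightarrow> 0 \<le> f a"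
    and low: "\<And>a b. 0 \<le> a \<Longrightarrow> a \<le> b \<Longrightarrow> (b - a) * f b \<le> c * (f a - f b)"
    and up: "\<And>a b. 0 \<le> a \<Longrightarrow> a \<le> b \<Longrightarrow> c * (f a - f b) \<le> (b - a) * f a"
    and a: "0 \<le> a"
  shows "f a = f 0 * exp (- a / c)"
proof (rule antisym)
  \<comment> \<open>From \<open>n \<ge> a / c\<close> on the factor is nonnegative, as
    multiplication of inequalities by it requires.\<close>
  have lower: "f 0 * (1 + (- a / c) / real n) ^ n \<le> f a" if n: "a / c \<le> real n" "0 < n" for n :: nat
  proof -
    have "f 0 * (1 + (- a / c) / real n) ^ k \<le> f (real k * (a / n))" if "k \<le> n" for k
      using that
    proof (induction k)
      case (Suc k)
      have "c * (f (real k * (a / n)) - f (real (Suc k) * (a / n))) \<le> (real (Suc k) * (a / n) - real k * (a / n)) * f (real k * (a / n))"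
        using a by (intro up mult_nonneg_nonneg mult_right_mono divide_nonneg_nonneg) auto
      then have "f (real k * (a / n)) * (1 + (- a / c) / real n) \<le> f (real (Suc k) * (a / n))"
        using c n by (simp add: field_simps)
      moreover have "0 \<le> 1 + (- a / c) / real n" using n c a by (simp add: field_simps)
      moreover have "f 0 * (1 + (- a / c) / real n) ^ k \<le> f (real k * (a / n))" using Suc by simp
      ultimately have "f 0 * (1 + (- a / c) / real n) ^ k * (1 + (- a / c) / real n) \<le> f (real (Suc k) * (a / n))"
        by (meson mult_right_mono order_trans)
      then show ?case by (simp only: power_Suc2 mult.assoc)
    qed simp
    from this[of n] n show ?thesis by simp
  qed
  have upper: "f a * (1 + (a / c) / real n) ^ n \<le> f 0" if n: "0 < n" for n :: nat
  proof -
    have "f (real k * (a / n)) * (1 + (a / c) / real n) ^ k \<le> f 0" for k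
    proof (induction k)
      case (Suc k)
      have "(real (Suc k) * (a / n) - real k * (a / n)) * f (real (Suc k) * (a / n)) \<le> c * (f (real k * (a / n)) - f (real (Suc k) * (a / n)))"
        using a by (intro low mult_nonneg_nonneg mult_right_mono divide_nonneg_nonneg) auto
      then have "f (real (Suc k) * (a / n)) * (1 + (a / c) / real n) \<le> f (real k * (a / n))"
        using c n by (simp add: field_simps)
      moreover have "0 \<le> (1 + (a / c) / real n) ^ k" using a c by simp
      ultimately have "f (real (Suc k) * (a / n)) * (1 + (a / c) / real n) * (1 + (a / c) / real n) ^ k
          \<le> f (real k * (a / n)) * (1 + (a / c) / real n) ^ k" by (rule mult_right_mono)
      then show ?case using Suc by (simp add: mult.assoc)
    qed simp
    from this[of n] n show ?thesis by simp
  qed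
  show "f 0 * exp (- a / c) \<le> f a"
  proof (rule LIMSEQ_le_const2)
    show "(\<lambda>n. f 0 * (1 + (- a / c) / real n) ^ n) \<longlonglongrightarrow> f 0 * exp (- a / c)"
      by (intro tendsto_mult tendsto_const tendsto_exp_limit_sequentially)
    obtain n0 where "a / c \<le> real n0" using real_arch_simple by blast
    then show "\<exists>n0. \<forall>n\<ge>n0. f 0 * (1 + (- a / c) / real n) ^ n \<le> f a"
      by (intro exI[of _ "Suc n0"] allI impI lower) auto
  qed
  have "f a * exp (a / c) \<le> f 0"
  proof (rule LIMSEQ_le_const2)
    show "(\<lambda>n. f a * (1 + (a / c) / real n) ^ n) \<longlonglongrightarrow> f a * exp (a / c)"
      by (intro tendsto_mult tendsto_const tendsto_exp_limit_sequentially)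
    show "\<exists>n0. \<forall>n\<ge>n0. f a * (1 + (a / c) / real n) ^ n \<le> f 0"
      by (intro exI[of _ 1] allI impI upper) auto
  qed
  then show "f a \<le> f 0 * exp (- a / c)"
    by (simp add: exp_minus field_simps)
qed

section \<open>The strong Markov property at inverse local times\<close>

context local_time_process
begin

text \<open>Here \<open>growth\<close> enters: off 0 the smoothing kernel vanishes in the limit
  although \<open>u\<close> may explode.\<close>

lemma h_eps_tendsto:
  assumes y: "0 < y" shows "(\<lambda>n. h (eps n) y) \<longlonglongrightarrow> 0"
proof (cases y)
  case (real c)
  with y have c: "0 < c" by simp
  have "filterlim eps (at_right 0) sequentially"
    by (rule tendsto_imp_filterlim_at_right[OF eps_tendsto]) (simp add: eps_pos)
  from filterlim_compose[OF growth[OF c] this]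
  have "(\<lambda>n. ennreal (u (eps n) * exp (- c * v (eps n)))) \<longlonglongrightarrow> ennreal 0" by (intro tendsto_ennrealI)
  moreover have "h (eps n) y = ennreal (u (eps n) * exp (- c * v (eps n)))" for n
    using real eps_pos[of n] by (simp add: h_def exp_neg_def mult.commute)
  ultimately show ?thesis by simp
qed (simp add: h_def exp_neg_def eps_pos)

text \<open>If \<open>Y\<close> were nonzero at \<open>s\<close>, right continuity would keep it
  above some \<open>c\<close> for a while, where the kernel tends to 0 uniformly. The local time
  would then be flat after \<open>s\<close>, but it exceeds \<open>x\<close> at once.\<close>

lemma Y_S_eq_0:
  assumes \<omega>: "\<omega> \<in> G" and x: "0 \<le> x" and s: "S x \<omega> = ennreal s" "0 \<le> s"
  shows "Yp s \<omega> = 0"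
proof (rule ccontr)
  assume "Yp s \<omega> \<noteq> 0"
  then have "0 < Yp s \<omega>" by (simp add: zero_less_iff_neq_zero)
  then obtain c where c: "0 < c" "c < Yp s \<omega>" using dense by blast
  have "((\<lambda>t. Yp t \<omega>) \<longlongrightarrow> Yp s \<omega>) (at_right s)"
    using Yp_right_continuous[OF G_space[OF \<omega>], of s] by (simp add: continuous_within)
  from order_tendstoD(1)[OF this c(2)] obtain b where b: "s < b" "\<And>t. s < t \<Longrightarrow> t < b \<Longrightarrow> c < Yp t \<omega>"
    by (auto simp: eventually_at_right[of s "s + 1"])
  define r where "r = (s + b) / 2"
  have r: "s < r" "r < b" using b by (auto simp: r_def)
  have A_bd: "A (eps n) s r \<omega> \<le> h (eps n) c * ennreal (r - s)" for n
  proof -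
    have "A (eps n) s r \<omega> \<le> (\<integral>\<^sup>+t\<in>{s..r}. h (eps n) c \<partial>lborel)"
      unfolding A_def N_def
    proof (intro nn_integral_mono)
      fix t
      have "c \<le> Yp t \<omega>" if "t \<in> {s..r}"
        using b(2)[of t] c(2) that r by (cases "t = s") auto
      then show "h (eps n) (Yp t \<omega>) * indicator {s..r} t \<le> h (eps n) c * indicator {s..r} t"
        by (auto simp: indicator_def intro: h_antimono)
    qed
    then show ?thesis using r by (simp add: nn_integral_cmult)
  qed
  have "(\<lambda>n. h (eps n) c * ennreal (r - s)) \<longlonglongrightarrow> 0 * ennreal (r - s)"
    by (intro tendsto_mult_ennreal tendsto_const h_eps_tendsto c) auto
  then have "(\<lambda>n. A (eps n) s r \<omega>) \<longlonglongrightarrow> 0"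
    using tendsto_sandwich[OF always_eventually[OF allI[OF zero_le]] always_eventually[OF allI[OF A_bd]] tendsto_const] by simp
  moreover have "(\<lambda>n. A (eps n) s r \<omega>) \<longlonglongrightarrow> ennreal (ell r \<omega> - ell s \<omega>)"
    using r s(2) unfolding A_eq_X_diff(1)[OF G_space[OF \<omega>] s(2) less_imp_le[OF r(1)]]
    by (intro tendsto_ennrealI tendsto_diff X_tendsto_ell[OF \<omega>]) auto
  ultimately have "ennreal (ell r \<omega> - ell s \<omega>) = 0" by (rule LIMSEQ_unique[rotated])
  then have "ell r \<omega> \<le> x" using ell_S[OF x s] by (simp add: ennreal_eq_0_iff)
  moreover have "x < ell r \<omega>" using S_less_iff[OF x, of r \<omega>] s r by (simp add: ennreal_less_iff)
  ultimately show False by simp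
qed

text \<open>\<open>S_less_iff\<close> reduces the sublevel sets to comparisons at fixed times; the
  level \<infinity> is exhausted along the natural numbers.\<close>

lemma S_measurable_random:
  assumes [measurable]: "\<kappa> \<in> borel_measurable M" and \<kappa>: "\<And>\<omega>. 0 \<le> \<kappa> \<omega>"
  shows "(\<lambda>\<omega>. S (\<kappa> \<omega>) \<omega>) \<in> borel_measurable M"
proof (rule borel_measurableI_less)
  fix c
  show "{\<omega> \<in> space M. S (\<kappa> \<omega>) \<omega> < c} \<in> sets M"
  proof (cases c)
    case (real t)
    have "{\<omega> \<in> space M. S (\<kappa> \<omega>) \<omega> < c} = {\<omega> \<in> space M. \<kappa> \<omega> < ell t \<omega>}"
      using S_less_iff[OF \<kappa> real(1)] real by auto
    then show ?thesis by simp
  next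
    case top
    have "{\<omega> \<in> space M. S (\<kappa> \<omega>) \<omega> < c} = {\<omega> \<in> space M. \<exists>n::nat. \<kappa> \<omega> < ell (real n) \<omega>}"
    proof (intro Collect_cong conj_cong refl)
      fix \<omega>
      show "S (\<kappa> \<omega>) \<omega> < c \<longleftrightarrow> (\<exists>n::nat. \<kappa> \<omega> < ell (real n) \<omega>)"
        using S_finite_iff[of "\<kappa> \<omega>" \<omega>] ell_mono'[of _ "real _" \<omega>] top
        by (auto, meson less_le_trans real_arch_simple) 
    qed
    then show ?thesis by simp
  qed
qed

lemma S_measurable: "0 \<le> x \<Longrightarrow> S x \<in> borel_measurable M"
  by (rule S_measurable_random) auto

lemma S_jointly_measurable: "(\<lambda>z. S (max 0 (snd z)) (fst z)) \<in> borel_measurable (M \<Otimes>\<^sub>M borel)"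
proof (rule borel_measurableI_less)
  fix c
  have meas: "{z \<in> space (M \<Otimes>\<^sub>M borel). max 0 (snd z) < ell t (fst z)} \<in> sets (M \<Otimes>\<^sub>M borel)" for t
    by measurable
  show "{z \<in> space (M \<Otimes>\<^sub>M borel). S (max 0 (snd z)) (fst z) < c} \<in> sets (M \<Otimes>\<^sub>M borel)"
  proof (cases c)
    case (real t)
    have "{z \<in> space (M \<Otimes>\<^sub>M borel). S (max 0 (snd z)) (fst z) < c} = {z \<in> space (M \<Otimes>\<^sub>M borel). max 0 (snd z) < ell t (fst z)}"
      using S_less_iff[OF max.cobounded1 real(1)] real by auto
    then show ?thesis using meas by simp
  next
    case top
    have "{z \<in> space (M \<Otimes>\<^sub>M borel). S (max 0 (snd z)) (fst z) < c}
       = (\<Union>n::nat. {z \<in> space (M \<Otimes>\<^sub>M borel). max 0 (snd z) < ell (real n) (fst z)})"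
    proof (intro set_eqI iffI)
      fix z assume z: "z \<in> {z \<in> space (M \<Otimes>\<^sub>M borel). S (max 0 (snd z)) (fst z) < c}"
      then obtain t where t: "0 \<le> t" "max 0 (snd z) < ell t (fst z)" using top S_finite_iff[of "max 0 (snd z)" "fst z"] by auto
      obtain n :: nat where "t \<le> real n" using real_arch_simple by blast
      then have "ell t (fst z) \<le> ell (real n) (fst z)" using t by (intro ell_mono')
      then show "z \<in> (\<Union>n::nat. {z \<in> space (M \<Otimes>\<^sub>M borel). max 0 (snd z) < ell (real n) (fst z)})"
        using t z by (auto intro: less_le_trans)
    next
      fix z assume "z \<in> (\<Union>n::nat. {z \<in> space (M \<Otimes>\<^sub>M borel). max 0 (snd z) < ell (real n) (fst z)})"
      then show "z \<in> {z \<in> space (M \<Otimes>\<^sub>M borel). S (max 0 (snd z)) (fst z) < c}"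
        using top S_finite_iff[of "max 0 (snd z)" "fst z"] by (auto intro: of_nat_0_le_iff)
    qed
    then show ?thesis using meas by (simp add: sets.countable_UN)
  qed
qed

text \<open>The discounted local time after a level. The level is random so as to cover both fixed
  levels and the level \<open>ell t\<close> reached at time \<open>t\<close>.\<close>

definition J :: "real \<Rightarrow> ('a \<Rightarrow> real) \<Rightarrow> 'a \<Rightarrow> ennreal" where
  "J q \<kappa> \<omega> = (\<integral>\<^sup>+y\<in>{\<kappa> \<omega>..}. ennreal (exp_neg q (S y \<omega>)) \<partial>lborel)"

lemma J_measurable:
  assumes [measurable]: "\<kappa> \<in> borel_measurable M" and \<kappa>: "\<And>\<omega>. 0 \<le> \<kappa> \<omega>"
  shows "J q \<kappa> \<in> borel_measurable M"
proof -
  have "(\<lambda>z. ennreal (exp_neg q (S (max 0 (snd z)) (fst z))) * (if \<kappa> (fst z) \<le> snd z then 1 else 0)) \<in> borel_measurable (M \<Otimes>\<^sub>M lborel)"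
    using S_jointly_measurable
    by (intro borel_measurable_times_ennreal measurable_compose[OF _ measurable_ennreal] measurable_compose[OF _ exp_neg_measurable])
       (simp_all cong: measurable_cong_sets)
  then have "(\<lambda>\<omega>. \<integral>\<^sup>+y. ennreal (exp_neg q (S (max 0 y) \<omega>)) * (if \<kappa> \<omega> \<le> y then 1 else 0) \<partial>lborel) \<in> borel_measurable M"
    by (intro lborel.borel_measurable_nn_integral) (simp add: case_prod_beta')
  also have "(\<lambda>\<omega>. \<integral>\<^sup>+y. ennreal (exp_neg q (S (max 0 y) \<omega>)) * (if \<kappa> \<omega> \<le> y then 1 else 0) \<partial>lborel) = J q \<kappa>"
    unfolding J_def fun_eq_iff
    using \<kappa> by (intro allI nn_integral_cong) (auto simp: indicator_def max_def dest: order_trans)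
  finally show ?thesis .
qed

lemma expectation_J_0: assumes q: "0 < q" shows "(\<integral>\<^sup>+\<omega>. J q (\<lambda>_. 0) \<omega> \<partial>M) = g q 0"
proof -
  have "(\<integral>\<^sup>+\<omega>. J q (\<lambda>_. 0) \<omega> \<partial>M) = (\<integral>\<^sup>+\<omega>\<in>space M. (\<integral>\<^sup>+y\<in>{ell 0 \<omega>..}. ennreal (exp_neg q (S y \<omega>)) \<partial>lborel) \<partial>M)"
    unfolding J_def ell_0 by (intro nn_integral_cong) (auto simp: indicator_def)
  also have "\<dots> = (\<integral>\<^sup>+\<omega>\<in>space M. ennreal (exp (- q * 0)) * g q (Yp 0 \<omega>) \<partial>M)"
    using q sets.top[of "Fb 0"] by (intro expectation_potential) auto
  also have "\<dots> = (\<integral>\<^sup>+\<omega>. g q 0 \<partial>M)"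
    by (rule nn_integral_cong_AE) (use AE_G in \<open>eventually_elim, auto simp: G_0 G_space\<close>)
  finally show ?thesis by (simp add: emeasure_space_1)
qed

text \<open>The strong Markov property at \<open>S \<kappa>\<close>. The time is approximated by the
  next dyadic time, where \<open>expectation_potential\<close> applies; in the limit the state is 0
  by \<open>Y_S_eq_0\<close>, and continuity of \<open>g q\<close> at 0 makes \<open>g q 0\<close> a
  constant factor.\<close>

lemma expectation_potential_at_S:
  assumes q: "0 < q" and [measurable]: "\<kappa> \<in> borel_measurable M" and \<kappa>: "\<And>\<omega>. 0 \<le> \<kappa> \<omega>"
    and C: "C \<in> sets M" and opt: "\<And>t. 0 \<le> t \<Longrightarrow> C \<inter> {\<omega>\<in>space M. \<kappa> \<omega> < ell t \<omega>} \<in> sets (Fb t)"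
  shows "(\<integral>\<^sup>+\<omega>\<in>C. J q \<kappa> \<omega> \<partial>M) = (\<integral>\<^sup>+\<omega>\<in>C. ennreal (exp_neg q (S (\<kappa> \<omega>) \<omega>)) \<partial>M) * g q 0"
proof -
  note [measurable] = C S_measurable_random[OF \<open>\<kappa> \<in> borel_measurable M\<close> \<kappa>] J_measurable
  \<comment> \<open>The part of \<open>C\<close> where \<open>S \<kappa>\<close> falls into
    \<open>[k / 2 ^ n, (k + 1) / 2 ^ n)\<close>, expressed by the local time so that
    \<open>opt\<close> makes it known at the right end of the cell.\<close>
  define D where "D n k = C \<inter> {\<omega>\<in>space M. \<kappa> \<omega> < ell ((real k + 1) / 2 ^ n) \<omega>} - C \<inter> {\<omega>\<in>space M. \<kappa> \<omega> < ell (real k / 2 ^ n) \<omega>}" for n k :: nat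
  have DF: "D n k \<in> sets (Fb ((real k + 1) / 2 ^ n))" for n k
  proof -
    have "real k / 2 ^ n \<le> (real k + 1) / 2 ^ n" by (intro divide_right_mono) auto
    from Fb_mono[OF this] show ?thesis
      unfolding D_def using opt[of "real k / 2 ^ n"] opt[of "(real k + 1) / 2 ^ n"] by auto
  qed
  have [measurable]: "D n k \<in> sets M" for n k using Fb_sets[OF DF] .
  \<comment> \<open>For each path at most one summand is nonzero, the one for the cell of
    \<open>S \<kappa>\<close>.\<close>
  define P where "P n \<omega> = (\<Sum>k. J q (ell ((real k + 1) / 2 ^ n)) \<omega> * indicator (D n k) \<omega>)" for n \<omega>
  define R where "R n \<omega> = (\<Sum>k. ennreal (exp (- q * ((real k + 1) / 2 ^ n))) * g q (Yp ((real k + 1) / 2 ^ n) \<omega>) * indicator (D n k) \<omega>)" for n \<omega>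
  have [measurable]: "J q (ell ((real k + 1) / 2 ^ n)) \<in> borel_measurable M" for k n
    by (intro J_measurable) (auto intro: ell_nonneg)
  have [measurable]: "J q \<kappa> \<in> borel_measurable M" "J q (\<lambda>_. 0) \<in> borel_measurable M"
    by (intro J_measurable \<kappa>; simp)+
  have PR: "(\<integral>\<^sup>+\<omega>. P n \<omega> \<partial>M) = (\<integral>\<^sup>+\<omega>. R n \<omega> \<partial>M)" for n
  proof -
    have "(\<integral>\<^sup>+\<omega>. P n \<omega> \<partial>M) = (\<Sum>k. \<integral>\<^sup>+\<omega>\<in>D n k. J q (ell ((real k + 1) / 2 ^ n)) \<omega> \<partial>M)"
      unfolding P_def by (rule nn_integral_suminf) measurable
    also have "\<dots> = (\<Sum>k. \<integral>\<^sup>+\<omega>\<in>D n k. ennreal (exp (- q * ((real k + 1) / 2 ^ n))) * g q (Yp ((real k + 1) / 2 ^ n) \<omega>) \<partial>M)"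
      unfolding J_def by (intro suminf_cong expectation_potential[OF q DF]) simp
    also have "\<dots> = (\<integral>\<^sup>+\<omega>. R n \<omega> \<partial>M)"
      unfolding R_def by (rule nn_integral_suminf[symmetric]) measurable
    finally show ?thesis .
  qed
  have pick: "(\<Sum>k. f k * indicator (D n k) \<omega>) = f (nat \<lfloor>s * 2 ^ n\<rfloor>)"
    if "\<omega> \<in> C" "S (\<kappa> \<omega>) \<omega> = ennreal s" "0 \<le> s" for f :: "nat \<Rightarrow> ennreal" and n \<omega> s
  proof -
    have mem: "\<omega> \<in> D n k \<longleftrightarrow> k = nat \<lfloor>s * 2 ^ n\<rfloor>" for k
    proof -
      have "\<omega> \<in> D n k \<longleftrightarrow> real k / 2 ^ n \<le> s \<and> s < (real k + 1) / 2 ^ n"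
        using that sets.sets_into_space[OF C] S_less_iff[OF \<kappa>, of "real k / 2 ^ n" \<omega> \<omega>] S_less_iff[OF \<kappa>, of "(real k + 1) / 2 ^ n" \<omega> \<omega>]
        by (auto simp: D_def ennreal_less_iff)
      also have "\<dots> \<longleftrightarrow> real_of_int (int k) \<le> s * 2 ^ n \<and> s * 2 ^ n < real_of_int (int k) + 1"
        by (simp add: field_simps)
      also have "\<dots> \<longleftrightarrow> \<lfloor>s * 2 ^ n\<rfloor> = int k" by (simp only: floor_eq_iff)
      also have "\<dots> \<longleftrightarrow> k = nat \<lfloor>s * 2 ^ n\<rfloor>" using that by (auto simp: nat_eq_iff)
      finally show ?thesis .
    qed
    have "(\<Sum>k. f k * indicator (D n k) \<omega>) = (\<Sum>k\<in>{nat \<lfloor>s * 2 ^ n\<rfloor>}. f k * indicator (D n k) \<omega>)"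
      by (rule suminf_finite) (auto simp: mem)
    then show ?thesis by (simp add: mem)
  qed
  have zero: "(\<Sum>k. f k * indicator (D n k) \<omega>) = 0"
    if "\<omega> \<notin> C \<or> S (\<kappa> \<omega>) \<omega> = \<infinity>" for f :: "nat \<Rightarrow> ennreal" and n \<omega>
  proof -
    have "\<omega> \<notin> D n k" for k
      using that S_less_iff[OF \<kappa>, of "(real k + 1) / 2 ^ n" \<omega> \<omega>] by (auto simp: D_def)
    then show ?thesis by simp
  qed
  have fl: "real (nat \<lfloor>s * 2 ^ n\<rfloor>) = of_int \<lfloor>s * 2 ^ n\<rfloor>" if "0 \<le> s" for s :: real and n :: nat
    using that by simp
  have "(\<lambda>n. \<integral>\<^sup>+\<omega>. P n \<omega> \<partial>M) \<longlonglongrightarrow> (\<integral>\<^sup>+\<omega>\<in>C. J q \<kappa> \<omega> \<partial>M)"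
  proof (rule nn_integral_dominated_convergence[where w="J q (\<lambda>_. 0)"])
    show "(\<integral>\<^sup>+\<omega>. J q (\<lambda>_. 0) \<omega> \<partial>M) < \<infinity>" using g_finite[OF q] by (simp add: expectation_J_0[OF q])
    have J_mono: "J q \<kappa>1 \<omega> \<le> J q \<kappa>2 \<omega>" if "\<kappa>2 \<omega> \<le> \<kappa>1 \<omega>" for \<kappa>1 \<kappa>2 \<omega>
      unfolding J_def by (intro nn_integral_mono mult_left_mono) (use that in \<open>auto simp: indicator_def\<close>)
    show "AE \<omega> in M. P n \<omega> \<le> J q (\<lambda>_. 0) \<omega>" for n
    proof (rule AE_I2)
      fix \<omega>
      show "P n \<omega> \<le> J q (\<lambda>_. 0) \<omega>"
      proof (cases "\<omega> \<in> C \<and> S (\<kappa> \<omega>) \<omega> < \<infinity>")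
        case True
        then obtain s where s: "S (\<kappa> \<omega>) \<omega> = ennreal s" "0 \<le> s" by (cases "S (\<kappa> \<omega>) \<omega>") auto
        then show ?thesis unfolding P_def using True
          by (subst pick[of \<omega> s]) (auto intro!: J_mono ell_nonneg)
      next
        case False
        then show ?thesis unfolding P_def by (subst zero) (auto simp: not_less top_unique)
      qed
    qed
    show "AE \<omega> in M. (\<lambda>n. P n \<omega>) \<longlonglongrightarrow> J q \<kappa> \<omega> * indicator C \<omega>"
    proof (rule AE_I2)
      fix \<omega>
      show "(\<lambda>n. P n \<omega>) \<longlonglongrightarrow> J q \<kappa> \<omega> * indicator C \<omega>"
      proof (cases "\<omega> \<in> C \<and> S (\<kappa> \<omega>) \<omega> < \<infinity>")
        case True
        then obtain s where s: "S (\<kappa> \<omega>) \<omega> = ennreal s" "0 \<le> s" by (cases "S (\<kappa> \<omega>) \<omega>") auto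
        define T where "T n = (of_int \<lfloor>s * 2 ^ n\<rfloor> + 1) / (2::real) ^ n" for n
        have T: "P n \<omega> = J q (ell (T n)) \<omega>" for n
          unfolding P_def T_def using True s by (subst pick[of \<omega> s]) (auto simp: fl)
        have Tlim: "filterlim T (at_right s) sequentially" unfolding T_def by (rule dyadic_from_right)
        have Ts: "s < T n" for n unfolding T_def using floor_correct[of "s * 2 ^ n"] by (simp add: field_simps)
        have els: "ell s \<omega> = \<kappa> \<omega>" by (rule ell_S[OF \<kappa> s])
        have lim: "(\<lambda>n. ell (T n) \<omega>) \<longlonglongrightarrow> \<kappa> \<omega>"
          using filterlim_compose[OF ell_tendsto_right[OF s(2), of \<omega>] Tlim] els by simp
        have le: "\<kappa> \<omega> \<le> ell (T n) \<omega>" for n using ell_mono'[of s "T n" \<omega>] s Ts[of n] els by simp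
        have up: "J q (ell (T n)) \<omega> \<le> J q \<kappa> \<omega>" for n by (rule J_mono) (rule le)
        \<comment> \<open>The discount factor is at most 1, so raising the level costs at most the
          difference of the levels.\<close>
        have low: "J q \<kappa> \<omega> - ennreal (ell (T n) \<omega> - \<kappa> \<omega>) \<le> J q (ell (T n)) \<omega>" for n
        proof -
          have Sm: "(\<lambda>y. exp_neg q (S (max 0 y) \<omega>)) \<in> borel_measurable borel" by measurable
          define k where "k y = ennreal (exp_neg q (S (max 0 y) \<omega>)) * indicator {ell (T n) \<omega>..} y" for y
          have [measurable]: "k \<in> borel_measurable borel" unfolding k_def by measurable
          have "J q \<kappa> \<omega> \<le> (\<integral>\<^sup>+y. k y + indicator {\<kappa> \<omega>..ell (T n) \<omega>} y \<partial>lborel)"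
            unfolding J_def
          proof (rule nn_integral_mono)
            fix y
            show "ennreal (exp_neg q (S y \<omega>)) * indicator {\<kappa> \<omega>..} y \<le> k y + indicator {\<kappa> \<omega>..ell (T n) \<omega>} y"
              using exp_neg_bounds(2)[of q "S y \<omega>"] q le[of n] \<kappa>[of \<omega>]
              by (auto simp: indicator_def k_def max_def)
          qed
          also have "\<dots> = (\<integral>\<^sup>+y. k y \<partial>lborel) + ennreal (ell (T n) \<omega> - \<kappa> \<omega>)"
            using le[of n] by (subst nn_integral_add) auto
          also have "(\<integral>\<^sup>+y. k y \<partial>lborel) = J q (ell (T n)) \<omega>"
            unfolding k_def J_def using le[of n] \<kappa>[of \<omega>] by (intro nn_integral_cong) (auto simp: indicator_def max_def)
          finally show ?thesis by (simp add: ennreal_minus_le_iff add.commute)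
        qed
        have "(\<lambda>n. J q (ell (T n)) \<omega>) \<longlonglongrightarrow> J q \<kappa> \<omega>"
        proof (cases "J q \<kappa> \<omega> = \<top>")
          case True
          then have "J q (ell (T n)) \<omega> = \<top>" for n using low[of n] by (simp add: top_unique)
          with True show ?thesis by simp
        next
          case False
          have "(\<lambda>n. J q \<kappa> \<omega> - ennreal (ell (T n) \<omega> - \<kappa> \<omega>)) \<longlonglongrightarrow> J q \<kappa> \<omega> - ennreal (\<kappa> \<omega> - \<kappa> \<omega>)"
            by (intro tendsto_diff_ennreal tendsto_const tendsto_ennrealI tendsto_diff lim) (use False in auto)
          then have "(\<lambda>n. J q \<kappa> \<omega> - ennreal (ell (T n) \<omega> - \<kappa> \<omega>)) \<longlonglongrightarrow> J q \<kappa> \<omega>" by simp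
          from tendsto_sandwich[OF always_eventually[OF allI[OF low]] always_eventually[OF allI[OF up]] this tendsto_const]
          show ?thesis .
        qed
        with True T show ?thesis by simp
      next
        case False
        moreover have "J q \<kappa> \<omega> = 0" if top: "S (\<kappa> \<omega>) \<omega> = \<infinity>"
        proof -
          have "S y \<omega> = \<infinity>" if "\<kappa> \<omega> \<le> y" for y using S_mono[OF that, of \<omega>] top by (simp add: top_unique)
          then have "J q \<kappa> \<omega> = (\<integral>\<^sup>+(y::real). 0 \<partial>lborel)" unfolding J_def
            by (intro nn_integral_cong) (auto simp: indicator_def exp_neg_def)
          then show ?thesis by simp
        qed
        ultimately show ?thesis unfolding P_def by (subst zero) (auto simp: not_less top_unique)
      qed
    qed
  qed (simp_all add: P_def)
  moreover have "(\<lambda>n. \<integral>\<^sup>+\<omega>. R n \<omega> \<partial>M) \<longlonglongrightarrow> (\<integral>\<^sup>+\<omega>. ennreal (exp_neg q (S (\<kappa> \<omega>) \<omega>)) * indicator C \<omega> * g q 0 \<partial>M)"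
  proof (rule nn_integral_dominated_convergence[where w="\<lambda>_. g q 0"])
    show "(\<integral>\<^sup>+\<omega>. g q 0 \<partial>M) < \<infinity>" using g_finite[OF q] by (simp add: emeasure_space_1)
    show "AE \<omega> in M. R n \<omega> \<le> g q 0" for n
    proof (rule AE_I2)
      fix \<omega>
      show "R n \<omega> \<le> g q 0"
      proof (cases "\<omega> \<in> C \<and> S (\<kappa> \<omega>) \<omega> < \<infinity>")
        case True
        then obtain s where s: "S (\<kappa> \<omega>) \<omega> = ennreal s" "0 \<le> s" by (cases "S (\<kappa> \<omega>) \<omega>") auto
        have "ennreal (exp (- q * ((real k + 1) / 2 ^ n))) * g q (Yp ((real k + 1) / 2 ^ n) \<omega>) \<le> 1 * g q 0" for k
          using q by (intro mult_mono g_antimono) auto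
        from this[of "nat \<lfloor>s * 2 ^ n\<rfloor>"] show ?thesis
          unfolding R_def pick[OF conjunct1[OF True] s] by simp
      next
        case False
        then show ?thesis unfolding R_def by (subst zero) (auto simp: not_less top_unique)
      qed
    qed
    show "AE \<omega> in M. (\<lambda>n. R n \<omega>) \<longlonglongrightarrow> ennreal (exp_neg q (S (\<kappa> \<omega>) \<omega>)) * indicator C \<omega> * g q 0"
      using AE_G
    proof eventually_elim
      case (elim \<omega>)
      show ?case
      proof (cases "\<omega> \<in> C \<and> S (\<kappa> \<omega>) \<omega> < \<infinity>")
        case True
        then obtain s where s: "S (\<kappa> \<omega>) \<omega> = ennreal s" "0 \<le> s" by (cases "S (\<kappa> \<omega>) \<omega>") auto
        define T where "T n = (of_int \<lfloor>s * 2 ^ n\<rfloor> + 1) / (2::real) ^ n" for n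
        have T: "R n \<omega> = ennreal (exp (- q * T n)) * g q (Yp (T n) \<omega>)" for n
          unfolding R_def T_def using True s by (subst pick[of \<omega> s]) (auto simp: fl)
        have Tlim: "filterlim T (at_right s) sequentially" unfolding T_def by (rule dyadic_from_right)
        have "((\<lambda>t. Yp t \<omega>) \<longlongrightarrow> Yp s \<omega>) (at_right s)"
          using Yp_right_continuous[OF G_space[OF elim], of s] by (simp add: continuous_within)
        from filterlim_compose[OF this Tlim] have "(\<lambda>n. Yp (T n) \<omega>) \<longlonglongrightarrow> 0"
          using Y_S_eq_0[OF elim \<kappa> s] by simp
        then have gl: "(\<lambda>n. g q (Yp (T n) \<omega>)) \<longlonglongrightarrow> g q 0" by (rule g_tendsto[OF q])
        have "T \<longlonglongrightarrow> s" using Tlim by (simp add: filterlim_at)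
        then have "(\<lambda>n. ennreal (exp (- q * T n)) * g q (Yp (T n) \<omega>)) \<longlonglongrightarrow> ennreal (exp (- q * s)) * g q 0"
          using g_finite[OF q]
          by (intro tendsto_mult_ennreal gl tendsto_ennrealI tendsto_exp tendsto_mult tendsto_const) auto
        then show ?thesis using True s T by (simp add: exp_neg_def)
      next
        case False
        then show ?thesis unfolding R_def
          by (subst zero) (auto simp: not_less top_unique exp_neg_def indicator_def)
      qed
    qed
  qed (simp_all add: R_def)
  ultimately have "(\<integral>\<^sup>+\<omega>\<in>C. J q \<kappa> \<omega> \<partial>M) = (\<integral>\<^sup>+\<omega>. ennreal (exp_neg q (S (\<kappa> \<omega>) \<omega>)) * indicator C \<omega> * g q 0 \<partial>M)"
    unfolding PR by (rule LIMSEQ_unique)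
  also have "\<dots> = (\<integral>\<^sup>+\<omega>\<in>C. ennreal (exp_neg q (S (\<kappa> \<omega>) \<omega>)) \<partial>M) * g q 0"
    by (rule nn_integral_multc) measurable
  finally show ?thesis .
qed

end

text \<open>The dyadic approximations of \<open>z\<close> from the right, rescaled to
  \<open>[s, r)\<close>, eventually enter any right neighbourhood of \<open>z\<close> and stay
  before \<open>r\<close>.\<close>

lemma grid_right_dense:
  fixes s r z :: real
  assumes "s \<le> z" "z < r" and P: "eventually P (at_right z)"
  obtains n k :: nat where "k < 2 ^ n" "P (s + (r - s) * (real k / 2 ^ n))"
proof -
  define x where "x = (z - s) / (r - s)"
  have x: "0 \<le> x" "x < 1" using assms by (auto simp: x_def field_simps)
  define T where "T n = (of_int \<lfloor>x * 2 ^ n\<rfloor> + 1) / (2::real) ^ n" for n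
  have Tlim: "filterlim T (at_right x) sequentially" unfolding T_def by (rule dyadic_from_right)
  have xT: "x < T n" for n unfolding T_def using floor_correct[of "x * 2 ^ n"] by (simp add: field_simps)
  have "(\<lambda>n. s + (r - s) * T n) \<longlonglongrightarrow> s + (r - s) * x"
    using Tlim by (intro tendsto_intros) (simp add: filterlim_at)
  also have "s + (r - s) * x = z" using assms by (simp add: x_def)
  finally have "filterlim (\<lambda>n. s + (r - s) * T n) (at_right z) sequentially"
  proof (rule tendsto_imp_filterlim_at_right)
    have "z < s + (r - s) * T n" for n
    proof -
      have "(r - s) * x < (r - s) * T n" using assms xT[of n] by (intro mult_strict_left_mono) auto
      then show ?thesis using \<open>s + (r - s) * x = z\<close> by linarith
    qed
    then show "eventually (\<lambda>n. z < s + (r - s) * T n) sequentially" by simp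
  qed
  with P have "eventually (\<lambda>n. P (s + (r - s) * T n)) sequentially" by (rule eventually_compose_filterlim)
  moreover have "eventually (\<lambda>n. T n < 1) sequentially"
    using Tlim x by (auto simp: filterlim_at intro: order_tendstoD)
  ultimately obtain n where n: "P (s + (r - s) * T n)" "T n < 1"
    using eventually_happens'[OF sequentially_bot eventually_conj] by blast
  define k where "k = nat (\<lfloor>x * 2 ^ n\<rfloor> + 1)"
  have "real k = of_int \<lfloor>x * 2 ^ n\<rfloor> + 1" using x by (simp add: k_def)
  then have k: "real k / 2 ^ n = T n" by (simp add: T_def)
  then have "real k < 2 ^ n" using n(2) by (simp add: field_simps)
  then have "k < 2 ^ n" by (metis of_nat_less_iff of_nat_numeral of_nat_power)
  then show thesis using that[of k n] n(1) k by simp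
qed

section \<open>First passage on grids\<close>

context laplace_flow_process
begin

text \<open>The union is cut according to the first index whose event occurs; each piece is known at
  its own time \<open>t k\<close>, where the two measures are compared.\<close>

lemma first_passage:
  fixes B :: "nat \<Rightarrow> 'a set"
  assumes sets: "sets \<mu>1 = sets M" "sets \<mu>2 = sets M"
    and B: "\<And>k. k < n \<Longrightarrow> B k \<in> sets (Fb (t k))" and t: "\<And>j k. j \<le> k \<Longrightarrow> t j \<le> t k"
    and le: "\<And>k C. k < n \<Longrightarrow> C \<in> sets (Fb (t k)) \<Longrightarrow> C \<subseteq> B k \<Longrightarrow> emeasure \<mu>1 C \<le> emeasure \<mu>2 C"
  shows "emeasure \<mu>1 (\<Union>k<n. B k) \<le> emeasure \<mu>2 (\<Union>k<n. B k)"
proof -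
  define C where "C k = disjointed B k" for k
  have CF: "C k \<in> sets (Fb (t k))" if "k < n" for k
  proof -
    have inB: "B j \<in> sets (Fb (t k))" if "j \<le> k" for j
      using B[of j] Fb_mono[OF t[OF that]] that \<open>k < n\<close> by auto
    show ?thesis unfolding C_def disjointed_def by (intro sets.Diff sets.finite_UN) (auto intro: inB)
  qed
  have CM: "C k \<in> sets M" if "k < n" for k using Fb_sets[OF CF[OF that]] .
  have disj: "disjoint_family_on C {..<n}"
    unfolding C_def using disjoint_family_disjointed[of B] by (auto simp: disjoint_family_on_def)
  have un: "(\<Union>k<n. B k) = (\<Union>k<n. C k)"
    using finite_UN_disjointed_eq[of B n] unfolding C_def atLeast0LessThan by simp
  have "emeasure \<mu>1 (\<Union>k<n. C k) = (\<Sum>k<n. emeasure \<mu>1 (C k))"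
    by (rule sum_emeasure[symmetric]) (use CM sets disj in auto)
  also have "\<dots> \<le> (\<Sum>k<n. emeasure \<mu>2 (C k))"
  proof (rule sum_mono)
    fix k assume "k \<in> {..<n}"
    then show "emeasure \<mu>1 (C k) \<le> emeasure \<mu>2 (C k)"
      by (intro le[of k] CF) (auto simp: C_def disjointed_def)
  qed
  also have "\<dots> = emeasure \<mu>2 (\<Union>k<n. C k)"
    by (rule sum_emeasure) (use CM sets disj in auto)
  finally show ?thesis unfolding un .
qed

text \<open>The right end \<open>r\<close> is left out, and the grids are nested, so the events
  increase with \<open>n\<close>.\<close>

definition hit :: "real \<Rightarrow> real \<Rightarrow> real \<Rightarrow> nat \<Rightarrow> 'a set" where
  "hit s r a n = (\<Union>k<2 ^ n. {\<omega>\<in>space M. Yp (s + (r - s) * (real k / 2 ^ n)) \<omega> < ennreal a})"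

lemma Yp_Fb_measurable: "0 \<le> t \<Longrightarrow> Yp t \<in> borel_measurable (Fb t)"
  using Y_F_measurable[of t t] F_Fb[of t] by (auto simp: measurable_def Yp_def)

lemma hit_mono: "hit s r a n \<subseteq> hit s r a (Suc n)"
proof
  fix \<omega> assume "\<omega> \<in> hit s r a n"
  then obtain k where "k < 2 ^ n" "\<omega> \<in> space M" "Yp (s + (r - s) * (real k / 2 ^ n)) \<omega> < ennreal a"
    unfolding hit_def by auto
  then show "\<omega> \<in> hit s r a (Suc n)"
    unfolding hit_def by (intro UN_I[of "2 * k"]) auto
qed

lemma hit_sets [measurable]: "hit s r a n \<in> sets M"
  unfolding hit_def by measurable

lemma zero_imp_hit:
  assumes \<omega>: "\<omega> \<in> space M" and z: "s \<le> z" "z < r" "Yp z \<omega> = 0" and a: "0 < a"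
  shows "\<omega> \<in> (\<Union>n. hit s r a n)"
proof -
  have "((\<lambda>t. Yp t \<omega>) \<longlongrightarrow> Yp z \<omega>) (at_right z)"
    using Yp_right_continuous[OF \<omega>, of z] by (simp add: continuous_within)
  then have "eventually (\<lambda>t. Yp t \<omega> < ennreal a) (at_right z)"
    by (rule order_tendstoD) (use a z in simp)
  from grid_right_dense[OF z(1,2) this] obtain n k :: nat where "k < 2 ^ n" "Yp (s + (r - s) * (real k / 2 ^ n)) \<omega> < ennreal a" .
  then show ?thesis using \<omega> unfolding hit_def by blast
qed

text \<open>Plays the part of a stopping time argument: \<open>\<mu>1\<close> and
  \<open>\<mu>2\<close> will be densities of \<open>M\<close> whose comparison at a fixed time with
  a small state follows from the Markov property.\<close>

lemma hit_bound:
  assumes sets: "sets \<mu>1 = sets M" "sets \<mu>2 = sets M" and s: "0 \<le> s" "s < r"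
    and le: "\<And>t C. s \<le> t \<Longrightarrow> t < r \<Longrightarrow> C \<in> sets (Fb t) \<Longrightarrow> (\<And>\<omega>. \<omega> \<in> C \<Longrightarrow> Yp t \<omega> < ennreal a) \<Longrightarrow> emeasure \<mu>1 C \<le> emeasure \<mu>2 C"
  shows "emeasure \<mu>1 (\<Union>n. hit s r a n) \<le> emeasure \<mu>2 (space \<mu>2)"
proof -
  have "emeasure \<mu>1 (hit s r a n) \<le> emeasure \<mu>2 (space \<mu>2)" for n
  proof -
    define t where "t k = s + (r - s) * (real k / 2 ^ n)" for k :: nat
    have t_mono: "t j \<le> t k" if "j \<le> k" for j k
      using that s unfolding t_def by (intro add_left_mono mult_left_mono divide_right_mono) auto
    have t_s: "s \<le> t k" for k using s unfolding t_def by simp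
    have t_r: "t k < r" if "k < 2 ^ n" for k
    proof -
      have "real k < real (2 ^ n)" using that by (simp only: of_nat_less_iff)
      then have "real k / 2 ^ n < 1" by simp
      then have "(r - s) * (real k / 2 ^ n) < (r - s) * 1" using s by (intro mult_strict_left_mono) auto
      then show ?thesis by (simp add: t_def)
    qed
    have "emeasure \<mu>1 (\<Union>k<2 ^ n. {\<omega>\<in>space M. Yp (t k) \<omega> < ennreal a})
        \<le> emeasure \<mu>2 (\<Union>k<2 ^ n. {\<omega>\<in>space M. Yp (t k) \<omega> < ennreal a})"
    proof (rule first_passage[OF sets _ t_mono])
      fix k :: nat assume k: "k < 2 ^ n"
      have "Yp (t k) \<in> borel_measurable (Fb (t k))" using t_s[of k] s by (intro Yp_Fb_measurable) auto
      then have "{\<omega>\<in>space (Fb (t k)). Yp (t k) \<omega> < ennreal a} \<in> sets (Fb (t k))" by measurable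
      then show "{\<omega>\<in>space M. Yp (t k) \<omega> < ennreal a} \<in> sets (Fb (t k))" by simp
      fix C assume "C \<in> sets (Fb (t k))" "C \<subseteq> {\<omega>\<in>space M. Yp (t k) \<omega> < ennreal a}"
      then show "emeasure \<mu>1 C \<le> emeasure \<mu>2 C" using t_s t_r[OF k] by (intro le[of "t k"]) auto
    qed
    also have "\<dots> \<le> emeasure \<mu>2 (space \<mu>2)" by (rule emeasure_space)
    finally show ?thesis unfolding hit_def t_def .
  qed
  moreover have "incseq (hit s r a)" by (rule incseq_SucI) (rule hit_mono)
  then have "(SUP n. emeasure \<mu>1 (hit s r a n)) = emeasure \<mu>1 (\<Union>n. hit s r a n)"
    by (intro SUP_emeasure_incseq) (use sets in auto)
  ultimately show ?thesis by (metis SUP_least)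
qed

end

context local_time_process
begin

section \<open>The inverse local time is a subordinator\<close>

text \<open>The sigma-algebra of the past of the stopping time \<open>S x\<close>.\<close>

definition Gf :: "real \<Rightarrow> 'a measure" where
  "Gf x = measure_of (space M) {C \<in> sets M. \<forall>t\<ge>0. C \<inter> {\<omega>\<in>space M. x < ell t \<omega>} \<in> sets (Fb t)} (\<lambda>_. 0)"

lemma space_Gf [simp]: "space (Gf x) = space M"
  by (simp add: Gf_def space_measure_of_conv)

lemma ell_greater_Fb: "0 \<le> t \<Longrightarrow> {\<omega>\<in>space M. x < ell t \<omega>} \<in> sets (Fb t)"
proof -
  assume "0 \<le> t"
  then have [measurable]: "ell t \<in> borel_measurable (Fb t)" by (rule ell_Fb_measurable)
  have "{\<omega>\<in>space (Fb t). x < ell t \<omega>} \<in> sets (Fb t)" by measurable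
  then show ?thesis by simp
qed

lemma sets_Gf: "sets (Gf x) = {C \<in> sets M. \<forall>t\<ge>0. C \<inter> {\<omega>\<in>space M. x < ell t \<omega>} \<in> sets (Fb t)}"
  (is "_ = ?S")
proof -
  have "sigma_algebra (space M) ?S"
    unfolding sigma_algebra_iff2
  proof (intro conjI ballI allI impI)
    show "?S \<subseteq> Pow (space M)" using sets.sets_into_space by auto
    show "{} \<in> ?S" by auto
  next
    fix C assume C: "C \<in> ?S"
    have "(space M - C) \<inter> {\<omega>\<in>space M. x < ell t \<omega>} = {\<omega>\<in>space M. x < ell t \<omega>} - C \<inter> {\<omega>\<in>space M. x < ell t \<omega>}" for t by auto
    with C show "space M - C \<in> ?S" by (auto intro!: sets.Diff ell_greater_Fb)
  next
    fix C :: "nat \<Rightarrow> 'a set" assume C: "range C \<subseteq> ?S"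
    have "(\<Union>n. C n) \<inter> {\<omega>\<in>space M. x < ell t \<omega>} = (\<Union>n. C n \<inter> {\<omega>\<in>space M. x < ell t \<omega>})" for t by auto
    moreover have "C n \<in> sets M" "0 \<le> t \<Longrightarrow> C n \<inter> {\<omega>\<in>space M. x < ell t \<omega>} \<in> sets (Fb t)" for n t
      using C by auto
    ultimately have "(\<Union>n. C n) \<inter> {\<omega>\<in>space M. x < ell t \<omega>} \<in> sets (Fb t)" if "0 \<le> t" for t
      using that by (simp only:) blast
    then show "(\<Union>n. C n) \<in> ?S" using C by auto
  qed
  then show ?thesis unfolding Gf_def by (rule sigma_algebra.sets_measure_of_eq)
qed

lemma Gf_sets: "C \<in> sets (Gf x) \<Longrightarrow> C \<in> sets M"
  by (simp add: sets_Gf)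

lemma Gf_subalgebra: "subalgebra M (Gf x)"
  by (auto simp: subalgebra_def sets_Gf)

lemma Gf_mono: "x \<le> y \<Longrightarrow> sets (Gf x) \<subseteq> sets (Gf y)"
proof
  fix C assume xy: "x \<le> y" and C: "C \<in> sets (Gf x)"
  have "C \<inter> {\<omega>\<in>space M. y < ell t \<omega>} \<in> sets (Fb t)" if "0 \<le> t" for t
  proof -
    have "C \<inter> {\<omega>\<in>space M. y < ell t \<omega>} = C \<inter> {\<omega>\<in>space M. x < ell t \<omega>} \<inter> {\<omega>\<in>space M. y < ell t \<omega>}"
      using xy by auto
    then show ?thesis using C that ell_greater_Fb[OF that] by (simp add: sets_Gf sets.Int)
  qed
  then show "C \<in> sets (Gf y)" using C by (simp add: sets_Gf)
qed

text \<open>Null sets belong to \<open>Gf x\<close> because \<open>Fb\<close> is augmented; this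
  keeps the modified process \<open>S'\<close> adapted.\<close>

lemma Gf_null: assumes C: "C \<in> sets M" "AE \<omega> in M. \<omega> \<notin> C" shows "C \<in> sets (Gf x)"
proof -
  have "C \<inter> {\<omega>\<in>space M. x < ell t \<omega>} \<in> sets (Fb t)" for t
    unfolding sets_Fb using C by (auto intro!: bexI[of _ "{}"] elim: eventually_mono)
  then show ?thesis using C by (simp add: sets_Gf)
qed

lemma S_Gf_measurable: assumes "0 \<le> y" "y \<le> x" shows "S y \<in> borel_measurable (Gf x)"
proof (rule borel_measurableI_less)
  fix c
  have Sm [measurable]: "S y \<in> borel_measurable M" using assms(1) by (rule S_measurable)
  have "{\<omega>\<in>space M. S y \<omega> < c} \<inter> {\<omega>\<in>space M. x < ell t \<omega>} \<in> sets (Fb t)" if t: "0 \<le> t" for t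
  proof (cases "ennreal t \<le> c")
    case True
    \<comment> \<open>As \<open>y \<le> x\<close>, the event \<open>x < ell t \<omega>\<close>
      already forces \<open>S y \<omega> < ennreal t\<close>.\<close>
    have "S y \<omega> < c" if "x < ell t \<omega>" for \<omega>
      using S_less_iff[OF assms(1) t, of \<omega>] True that assms(2) by (auto intro: less_le_trans)
    then have "{\<omega>\<in>space M. S y \<omega> < c} \<inter> {\<omega>\<in>space M. x < ell t \<omega>} = {\<omega>\<in>space M. x < ell t \<omega>}" by auto
    then show ?thesis using ell_greater_Fb[OF t] by simp
  next
    case False
    then obtain r where r: "c = ennreal r" "0 \<le> r" "r \<le> t" by (cases c) (auto simp: not_le ennreal_less_iff)
    then have "{\<omega>\<in>space M. S y \<omega> < c} = {\<omega>\<in>space M. y < ell r \<omega>}" using S_less_iff[OF assms(1) r(2)] by auto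
    then have "{\<omega>\<in>space M. S y \<omega> < c} \<in> sets (Fb t)" using ell_greater_Fb[OF r(2), of y] Fb_mono[OF r(3)] by auto
    then show ?thesis using ell_greater_Fb[OF t] by (intro sets.Int)
  qed
  then show "{\<omega> \<in> space (Gf x). S y \<omega> < c} \<in> sets (Gf x)" by (simp add: sets_Gf)
qed

lemma g_pos: "0 < g q 0"
proof -
  have "0 < ennreal (exp (- \<bar>q\<bar> * 2)) * h 2 0 * emeasure lborel {1..2::real}"
    using u_pos[of 2] by (simp add: h_0 ennreal_zero_less_mult_iff)
  also have "\<dots> = (\<integral>\<^sup>+x\<in>{1..2::real}. ennreal (exp (- \<bar>q\<bar> * 2)) * h 2 0 \<partial>lborel)"
    by (subst nn_integral_cmult_indicator) auto
  also have "\<dots> \<le> g q 0"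
    unfolding g_def
  proof (rule nn_integral_mono)
    fix x :: real
    have "q * x \<le> \<bar>q\<bar> * 2" if "1 \<le> x" "x \<le> 2"
      using that by (intro mult_mono) auto
    then show "ennreal (exp (- \<bar>q\<bar> * 2)) * h 2 0 * indicator {1..2} x \<le> ennreal (exp (- q * x)) * h x 0 * indicator {0..} x"
      by (auto simp: indicator_def intro!: mult_mono h_0_antimono ennreal_leI)
  qed
  finally show ?thesis .
qed

definition L :: "real \<Rightarrow> real" where "L q = inverse (enn2real (g q 0))"

lemma g_eq: "0 < q \<Longrightarrow> g q 0 = ennreal (enn2real (g q 0))" "0 < q \<Longrightarrow> 0 < enn2real (g q 0)"
  using g_finite[of q] g_pos[of q] by (auto simp: less_top enn2real_positive_iff)

text \<open>With \<open>\<phi> y\<close> the expectation of \<open>exp (- q * S y)\<close> on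
  \<open>C\<close>, the strong Markov property at the level \<open>y\<close> says that the integral
  of \<open>\<phi>\<close> beyond \<open>y\<close> is \<open>c * \<phi> y\<close>. This forces
  exponential decay at the rate \<open>1 / c = L q\<close>.\<close>

lemma laplace_step:
  assumes q: "0 < q" and x: "0 \<le> x" "0 \<le> a" and C: "C \<in> sets (Gf x)"
  shows "(\<integral>\<^sup>+\<omega>\<in>C. ennreal (exp_neg q (S (x + a) \<omega>)) \<partial>M)
    = ennreal (exp (- a * L q)) * (\<integral>\<^sup>+\<omega>\<in>C. ennreal (exp_neg q (S x \<omega>)) \<partial>M)"
proof -
  define c where "c = enn2real (g q 0)"
  have c: "g q 0 = ennreal c" "0 < c" using g_eq[OF q] by (auto simp: c_def)
  have [measurable]: "C \<in> sets M" using Gf_sets[OF C] .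
  have [measurable]: "S y \<in> borel_measurable M" if "0 \<le> y" for y using that by (rule S_measurable)
  define \<phi> where "\<phi> y = (\<integral>\<^sup>+\<omega>\<in>C. ennreal (exp_neg q (S y \<omega>)) \<partial>M)" for y
  have \<phi>_le: "\<phi> y \<le> 1" for y
  proof -
    have "\<phi> y \<le> (\<integral>\<^sup>+\<omega>. 1 \<partial>M)"
      unfolding \<phi>_def using exp_neg_bounds(2)[of q] q by (intro nn_integral_mono) (auto simp: indicator_def)
    then show ?thesis by (simp add: emeasure_space_1)
  qed
  define f where "f b = enn2real (\<phi> (x + b))" for b
  have f: "\<phi> (x + b) = ennreal (f b)" "0 \<le> f b" for b
    using \<phi>_le[of "x + b"] by (auto simp: f_def less_top intro!: ennreal_enn2real[symmetric] intro: le_less_trans)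
  have Jphi: "(\<integral>\<^sup>+\<omega>\<in>C. J q (\<lambda>_. y) \<omega> \<partial>M) = \<phi> y * ennreal c" if "x \<le> y" for y
  proof -
    have "C \<in> sets (Gf y)" using C Gf_mono[OF that] by auto
    then show ?thesis unfolding \<phi>_def c(1)[symmetric]
      using that x by (intro expectation_potential_at_S q) (auto simp: sets_Gf)
  qed
  \<comment> \<open>Monotonicity of \<open>S\<close> bounds the part between two levels by the
    values at its ends. Sums instead of differences avoid truncated subtraction.\<close>
  have inc: "ennreal (b - a) * \<phi> (x + b) + \<phi> (x + b) * ennreal c \<le> \<phi> (x + a) * ennreal c \<and>
      \<phi> (x + a) * ennreal c \<le> ennreal (b - a) * \<phi> (x + a) + \<phi> (x + b) * ennreal c"
    if ab: "0 \<le> a" "a \<le> b" for a b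
  proof -
    have Jm: "J q (\<lambda>_. x + b) \<in> borel_measurable M" using x ab by (intro J_measurable) auto
    have split: "J q (\<lambda>_. x + a) \<omega> = (\<integral>\<^sup>+y\<in>{x + a..<x + b}. ennreal (exp_neg q (S y \<omega>)) \<partial>lborel) + J q (\<lambda>_. x + b) \<omega>" for \<omega>
    proof -
      have m: "(\<lambda>y. ennreal (exp_neg q (S y \<omega>)) * indicator A y) \<in> borel_measurable borel" if "A \<in> sets borel" "A \<subseteq> {0..}" for A
      proof -
        have "(\<lambda>y. ennreal (exp_neg q (S (max 0 y) \<omega>)) * indicator A y) \<in> borel_measurable borel"
          using that(1) by measurable
        also have "(\<lambda>y. ennreal (exp_neg q (S (max 0 y) \<omega>)) * indicator A y) = (\<lambda>y. ennreal (exp_neg q (S y \<omega>)) * indicator A y)"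
          using that(2) by (auto simp: fun_eq_iff indicator_def max_def)
        finally show ?thesis .
      qed
      show ?thesis unfolding J_def
        by (subst nn_integral_add[symmetric]) (use ab x in \<open>auto intro!: m nn_integral_cong split: split_indicator\<close>)
    qed
    have "(\<integral>\<^sup>+y\<in>{x + a..<x + b}. ennreal (exp_neg q (S y \<omega>)) \<partial>lborel) \<le> (\<integral>\<^sup>+y\<in>{x + a..<x + b}. ennreal (exp_neg q (S (x + a) \<omega>)) \<partial>lborel)" for \<omega>
      using q by (intro nn_integral_mono) (auto simp: indicator_def intro!: ennreal_leI exp_neg_antimono S_mono)
    then have up: "J q (\<lambda>_. x + a) \<omega> \<le> ennreal (exp_neg q (S (x + a) \<omega>)) * ennreal (b - a) + J q (\<lambda>_. x + b) \<omega>" for \<omega>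
      unfolding split using ab by (intro add_right_mono) (simp add: nn_integral_cmult_indicator)
    have "(\<integral>\<^sup>+y\<in>{x + a..<x + b}. ennreal (exp_neg q (S (x + b) \<omega>)) \<partial>lborel) \<le> (\<integral>\<^sup>+y\<in>{x + a..<x + b}. ennreal (exp_neg q (S y \<omega>)) \<partial>lborel)" for \<omega>
      using q by (intro nn_integral_mono) (auto simp: indicator_def intro!: ennreal_leI exp_neg_antimono S_mono)
    then have low: "ennreal (exp_neg q (S (x + b) \<omega>)) * ennreal (b - a) + J q (\<lambda>_. x + b) \<omega> \<le> J q (\<lambda>_. x + a) \<omega>" for \<omega>
      unfolding split using ab by (intro add_right_mono) (simp add: nn_integral_cmult_indicator)
    have intg: "(\<integral>\<^sup>+\<omega>. (ennreal (exp_neg q (S y \<omega>)) * ennreal (b - a) + J q (\<lambda>_. x + b) \<omega>) * indicator C \<omega> \<partial>M)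
        = ennreal (b - a) * \<phi> y + \<phi> (x + b) * ennreal c" if "0 \<le> y" for y
    proof -
      have "(\<integral>\<^sup>+\<omega>. (ennreal (exp_neg q (S y \<omega>)) * ennreal (b - a) + J q (\<lambda>_. x + b) \<omega>) * indicator C \<omega> \<partial>M)
         = (\<integral>\<^sup>+\<omega>. ennreal (b - a) * (ennreal (exp_neg q (S y \<omega>)) * indicator C \<omega>) + J q (\<lambda>_. x + b) \<omega> * indicator C \<omega> \<partial>M)"
        by (intro nn_integral_cong) (auto simp: indicator_def mult.commute)
      also have "\<dots> = ennreal (b - a) * \<phi> y + (\<integral>\<^sup>+\<omega>\<in>C. J q (\<lambda>_. x + b) \<omega> \<partial>M)"
        unfolding \<phi>_def using Jm that by (simp add: nn_integral_add nn_integral_cmult)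
      finally show ?thesis using Jphi[of "x + b"] ab by simp
    qed
    have "ennreal (b - a) * \<phi> (x + b) + \<phi> (x + b) * ennreal c \<le> (\<integral>\<^sup>+\<omega>\<in>C. J q (\<lambda>_. x + a) \<omega> \<partial>M)"
      using x ab by (subst intg[symmetric]) (auto intro!: nn_integral_mono mult_right_mono low)
    moreover have "(\<integral>\<^sup>+\<omega>\<in>C. J q (\<lambda>_. x + a) \<omega> \<partial>M) \<le> ennreal (b - a) * \<phi> (x + a) + \<phi> (x + b) * ennreal c"
      using x ab by (subst intg[symmetric]) (auto intro!: nn_integral_mono mult_right_mono up)
    ultimately show ?thesis using Jphi[of "x + a"] ab by simp
  qed
  have "f a = f 0 * exp (- a / c)"
  proof (rule exp_decay_of_increments[OF c(2) f(2) _ _ x(2)])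
    fix a b :: real assume ab: "0 \<le> a" "a \<le> b"
    have eq: "ennreal (b - a) * ennreal y + ennreal (f b) * ennreal c = ennreal ((b - a) * y + f b * c)"
      if "0 \<le> y" for y using that ab f(2)[of b] c(2) by (simp add: ennreal_mult)
    have eq2: "ennreal y * ennreal c = ennreal (y * c)" if "0 \<le> y" for y
      using that c(2) by (simp add: ennreal_mult)
    note i = inc[OF ab, unfolded f(1) eq[OF f(2)]]
    have "(b - a) * f b + f b * c \<le> f a * c"
      using i f(2)[of a] c(2) by (simp add: eq2 del: ennreal_plus)
    then show "(b - a) * f b \<le> c * (f a - f b)" by (simp add: algebra_simps)
    have "f a * c \<le> (b - a) * f a + f b * c"
      using i f(2)[of a] f(2)[of b] c(2) ab by (simp add: eq2 del: ennreal_plus)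
    then show "c * (f a - f b) \<le> (b - a) * f a" by (simp add: algebra_simps)
  qed
  then have "\<phi> (x + a) = ennreal (exp (- a * L q)) * \<phi> x"
    using f(1)[of a] f(1)[of 0] f(2)[of 0] by (simp add: L_def c_def[symmetric] divide_inverse ennreal_mult mult.commute)
  then show ?thesis by (simp add: \<phi>_def)
qed

text \<open>The local time expected after \<open>t\<close> is evaluated twice: at \<open>t\<close>
  itself and at \<open>S (ell t)\<close>, when the local time next increases and the state is 0. So
  \<open>g q (Yp t) / g q 0\<close> is the Laplace transform of the waiting time in between, given
  the past.\<close>

lemma hitting_identity:
  assumes q: "0 < q" and t: "0 \<le> t" and C: "C \<in> sets (Fb t)"
  shows "(\<integral>\<^sup>+\<omega>\<in>C. ennreal (exp_neg q (S (ell t \<omega>) \<omega>)) \<partial>M) * g q 0 = (\<integral>\<^sup>+\<omega>\<in>C. ennreal (exp (- q * t)) * g q (Yp t \<omega>) \<partial>M)"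
proof -
  have "(\<integral>\<^sup>+\<omega>\<in>C. J q (ell t) \<omega> \<partial>M) = (\<integral>\<^sup>+\<omega>\<in>C. ennreal (exp_neg q (S (ell t \<omega>) \<omega>)) \<partial>M) * g q 0"
  proof (rule expectation_potential_at_S[OF q _ ell_nonneg[OF t] Fb_sets[OF C]])
    fix r :: real assume r: "0 \<le> r"
    \<comment> \<open>Whether the local time grew between \<open>t\<close> and \<open>r\<close> is
      known at \<open>r\<close>; for \<open>r < t\<close> the event is empty.\<close>
    show "C \<inter> {\<omega> \<in> space M. ell t \<omega> < ell r \<omega>} \<in> sets (Fb r)"
    proof (cases "t \<le> r")
      case True
      have [measurable]: "ell t \<in> borel_measurable (Fb r)" "ell r \<in> borel_measurable (Fb r)"
        using ell_Fb_measurable[OF t] ell_Fb_measurable[OF r] Fb_measurable_mono[OF True] by auto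
      have "{\<omega> \<in> space (Fb r). ell t \<omega> < ell r \<omega>} \<in> sets (Fb r)" by measurable
      then show ?thesis using C Fb_mono[OF True] by auto
    next
      case False
      then have "{\<omega> \<in> space M. ell t \<omega> < ell r \<omega>} = {}" using ell_mono'[OF r, of t] by (auto simp: not_less)
      then have "C \<inter> {\<omega> \<in> space M. ell t \<omega> < ell r \<omega>} = {}" by blast
      then show ?thesis by (simp only: sets.empty_sets)
    qed
  qed simp
  then show ?thesis unfolding J_def using expectation_potential[OF q C t] by simp
qed

section \<open>The local time increases at every zero\<close>

definition Hit :: "real \<Rightarrow> real \<Rightarrow> 'a set" where
  "Hit s r = (\<Inter>m. \<Union>n. hit s r (1 / real (Suc m)) n)"

lemma Hit_sets [measurable]: "Hit s r \<in> sets M"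
  unfolding Hit_def by measurable

text \<open>On \<open>D\<close> the wait after any \<open>t < r'\<close> lasts at least until
  \<open>r\<close>, which lowers the discount factor by at least \<open>\<delta>\<close>. By
  \<open>hitting_identity\<close> its mean is nearly maximal when \<open>Yp t\<close> is small, so
  \<open>D\<close> is unlikely on every first passage below \<open>1 / real (Suc m)\<close>; then
  \<open>m\<close> tends to infinity. \<open>Hit\<close> is a measurable substitute for a zero
  between \<open>s\<close> and \<open>r'\<close>.\<close>

lemma AE_hit:
  assumes s: "0 \<le> s" "s < r'" "r' < r"
  shows "AE \<omega> in M. \<omega> \<in> Hit s r' \<longrightarrow> ell s \<omega> < ell r \<omega>"
proof -
  define D where "D = {\<omega>\<in>space M. ell r \<omega> \<le> ell s \<omega>}"
  have [measurable]: "D \<in> sets M" unfolding D_def by measurable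
  define c where "c = enn2real (g 1 0)"
  have c: "g 1 0 = ennreal c" "0 < c" using g_eq[of 1] by (auto simp: c_def)
  define ga where "ga m = enn2real (g 1 (ennreal (1 / real (Suc m))))" for m
  have gfin: "g 1 y < \<infinity>" for y using g_antimono[of 0 y 1] g_finite[of 1] by (simp add: le_less_trans)
  have ga: "g 1 (ennreal (1 / real (Suc m))) = ennreal (ga m)" "0 \<le> ga m" for m
    using gfin by (auto simp: ga_def less_top)
  have ga_le: "ga m \<le> c" for m
    using g_antimono[of 0 "ennreal (1 / real (Suc m))" 1] unfolding c(1) ga(1) using c(2) by (simp add: ennreal_le_iff)
  \<comment> \<open>Positive because \<open>r' < r\<close>: this gap keeps the loss of discount away
    from 0 for all \<open>t < r'\<close>.\<close>
  define \<delta> where "\<delta> = exp (- r') - exp (- r)"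
  have \<delta>: "0 < \<delta>" using s by (simp add: \<delta>_def)
  have step: "ennreal (\<delta> * c) * emeasure M (C \<inter> D) \<le> ennreal (c - ga m) * emeasure M C"
    if t: "s \<le> t" "t < r'" and C: "C \<in> sets (Fb t)" and small: "\<And>\<omega>. \<omega> \<in> C \<Longrightarrow> Yp t \<omega> < ennreal (1 / real (Suc m))" for t C m
  proof -
    have t0: "0 \<le> t" using t s by simp
    have [measurable]: "C \<in> sets M" using Fb_sets[OF C] .
    have [measurable]: "(\<lambda>\<omega>. S (ell t \<omega>) \<omega>) \<in> borel_measurable M" using t0 by (intro S_measurable_random ell_nonneg) auto
    have pt: "ennreal \<delta> * indicator (C \<inter> D) \<omega> + ennreal (exp_neg 1 (S (ell t \<omega>) \<omega>)) * indicator C \<omega> \<le> ennreal (exp (- t)) * indicator C \<omega>" for \<omega>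
    proof -
      have 1: "exp_neg 1 (S (ell t \<omega>) \<omega>) \<le> exp (- t)"
        using exp_neg_antimono[OF _ S_ell_le[OF t0, of \<omega>], of 1] t0 by (simp add: exp_neg_def)
      \<comment> \<open>On \<open>D\<close> the local time is flat from \<open>t\<close> to
        \<open>r\<close>, so the inverse at the level \<open>ell t\<close> is at least
        \<open>r\<close>.\<close>
      have 2: "\<delta> + exp_neg 1 (S (ell t \<omega>) \<omega>) \<le> exp (- t)" if "\<omega> \<in> D"
      proof -
        have "ell r \<omega> \<le> ell t \<omega>" using that ell_mono'[OF s(1) t(1), of \<omega>] by (simp add: D_def)
        then have "ennreal r \<le> S (ell t \<omega>) \<omega>"
          using S_less_iff[OF ell_nonneg[OF t0], of r \<omega> \<omega>] s by (simp add: not_less[symmetric])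
        then have "exp_neg 1 (S (ell t \<omega>) \<omega>) \<le> exp (- r)"
          using exp_neg_antimono[of 1 "ennreal r"] s by (simp add: exp_neg_def)
        moreover have "exp (- r') \<le> exp (- t)" using t by simp
        ultimately show ?thesis unfolding \<delta>_def by linarith
      qed
      show ?thesis using 1 2 \<delta> exp_neg_bounds(1)[of 1 "S (ell t \<omega>) \<omega>"]
        by (auto simp: indicator_def ennreal_leI simp flip: ennreal_plus)
    qed
    have "ennreal (\<delta> * c) * emeasure M (C \<inter> D) + ennreal (exp (- t)) * ennreal (ga m) * emeasure M C
        \<le> (\<integral>\<^sup>+\<omega>. ennreal \<delta> * indicator (C \<inter> D) \<omega> \<partial>M) * g 1 0 + (\<integral>\<^sup>+\<omega>\<in>C. ennreal (exp (- 1 * t)) * g 1 (Yp t \<omega>) \<partial>M)"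
    proof (rule add_mono)
      show "ennreal (\<delta> * c) * emeasure M (C \<inter> D) \<le> (\<integral>\<^sup>+\<omega>. ennreal \<delta> * indicator (C \<inter> D) \<omega> \<partial>M) * g 1 0"
        using \<delta> c by (subst nn_integral_cmult_indicator) (auto simp: ennreal_mult ac_simps)
      have "ennreal (exp (- t)) * ennreal (ga m) * emeasure M C = (\<integral>\<^sup>+\<omega>\<in>C. ennreal (exp (- t)) * ennreal (ga m) \<partial>M)"
        by (subst nn_integral_cmult_indicator) auto
      also have "\<dots> \<le> (\<integral>\<^sup>+\<omega>\<in>C. ennreal (exp (- 1 * t)) * g 1 (Yp t \<omega>) \<partial>M)"
        unfolding ga(1)[symmetric] using small[THEN less_imp_le] by (intro nn_integral_mono) (auto simp: indicator_def intro!: mult_left_mono g_antimono)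
      finally show "ennreal (exp (- t)) * ennreal (ga m) * emeasure M C \<le> (\<integral>\<^sup>+\<omega>\<in>C. ennreal (exp (- 1 * t)) * g 1 (Yp t \<omega>) \<partial>M)" .
    qed
    also have "\<dots> = (\<integral>\<^sup>+\<omega>. ennreal \<delta> * indicator (C \<inter> D) \<omega> + ennreal (exp_neg 1 (S (ell t \<omega>) \<omega>)) * indicator C \<omega> \<partial>M) * g 1 0"
      using hitting_identity[OF zero_less_one t0 C]
      by (subst nn_integral_add) (auto simp: distrib_right)
    also have "\<dots> \<le> (\<integral>\<^sup>+\<omega>. ennreal (exp (- t)) * indicator C \<omega> \<partial>M) * g 1 0"
      by (intro mult_right_mono nn_integral_mono pt) auto
    also have "\<dots> = ennreal (exp (- t)) * emeasure M C * ennreal c"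
      unfolding c(1) by (subst nn_integral_cmult_indicator) auto
    finally have "ennreal (\<delta> * c * measure M (C \<inter> D) + exp (- t) * ga m * measure M C) \<le> ennreal (exp (- t) * measure M C * c)"
      using \<delta> c(2) ga(2)[of m] by (simp add: emeasure_eq_measure ennreal_mult ennreal_plus)
    then have "\<delta> * c * measure M (C \<inter> D) + exp (- t) * ga m * measure M C \<le> exp (- t) * measure M C * c"
      using c(2) by (subst (asm) ennreal_le_iff) auto
    then have "\<delta> * c * measure M (C \<inter> D) \<le> exp (- t) * ((c - ga m) * measure M C)"
      by (simp add: algebra_simps)
    also have "\<dots> \<le> 1 * ((c - ga m) * measure M C)"
      using t0 ga_le[of m] by (intro mult_right_mono mult_nonneg_nonneg) auto
    finally have "ennreal (\<delta> * c * measure M (C \<inter> D)) \<le> ennreal ((c - ga m) * measure M C)" by (simp add: ennreal_leI)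
    then show ?thesis using \<delta> c(2) ga_le[of m] by (simp add: emeasure_eq_measure ennreal_mult)
  qed
  define H where "H = Hit s r'"
  have [measurable]: "H \<in> sets M" unfolding H_def by measurable
  have "ennreal (\<delta> * c) * emeasure M (H \<inter> D) \<le> ennreal (c - ga m)" for m
  proof -
    \<comment> \<open>The bound of \<open>step\<close> is recast as a comparison of two densities,
      the form that \<open>hit_bound\<close> takes.\<close>
    define \<mu>1 where "\<mu>1 = density M (\<lambda>\<omega>. ennreal (\<delta> * c) * indicator D \<omega>)"
    define \<mu>2 where "\<mu>2 = density M (\<lambda>\<omega>. ennreal (c - ga m))"
    have e1: "emeasure \<mu>1 C = ennreal (\<delta> * c) * emeasure M (C \<inter> D)" if "C \<in> sets M" for C
    proof -
      have "emeasure \<mu>1 C = (\<integral>\<^sup>+\<omega>. ennreal (\<delta> * c) * indicator (C \<inter> D) \<omega> \<partial>M)"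
        unfolding \<mu>1_def using that by (subst emeasure_density) (auto intro!: nn_integral_cong simp: indicator_def)
      then show ?thesis using that by (simp add: nn_integral_cmult_indicator)
    qed
    have e2: "emeasure \<mu>2 C = ennreal (c - ga m) * emeasure M C" if "C \<in> sets M" for C
      unfolding \<mu>2_def using that by (simp add: emeasure_density nn_integral_cmult_indicator)
    have "emeasure \<mu>1 (\<Union>n. hit s r' (1 / real (Suc m)) n) \<le> emeasure \<mu>2 (space \<mu>2)"
    proof (rule hit_bound[OF _ _ s(1,2)])
      fix t C assume "s \<le> t" "t < r'" "C \<in> sets (Fb t)" "\<And>\<omega>. \<omega> \<in> C \<Longrightarrow> Yp t \<omega> < ennreal (1 / real (Suc m))"
      from step[OF this] show "emeasure \<mu>1 C \<le> emeasure \<mu>2 C"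
        using Fb_sets[OF \<open>C \<in> sets (Fb t)\<close>] by (simp add: e1 e2)
    qed (auto simp: \<mu>1_def \<mu>2_def)
    also have "emeasure \<mu>2 (space \<mu>2) = ennreal (c - ga m)"
      using e2[OF sets.top] by (simp add: \<mu>2_def emeasure_space_1)
    finally have "ennreal (\<delta> * c) * emeasure M ((\<Union>n. hit s r' (1 / real (Suc m)) n) \<inter> D) \<le> ennreal (c - ga m)"
      by (simp add: e1 sets.countable_UN)
    moreover have "emeasure M (H \<inter> D) \<le> emeasure M ((\<Union>n. hit s r' (1 / real (Suc m)) n) \<inter> D)"
      by (intro emeasure_mono) (auto simp: H_def Hit_def)
    ultimately show ?thesis by (meson mult_left_mono order_trans zero_le)
  qed
  moreover have "(\<lambda>m. ennreal (c - ga m)) \<longlonglongrightarrow> ennreal (c - c)"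
  proof (intro tendsto_ennrealI tendsto_diff tendsto_const)
    have "(\<lambda>m. ennreal (1 / real (Suc m))) \<longlonglongrightarrow> ennreal 0"
      using LIMSEQ_inverse_real_of_nat by (intro tendsto_ennrealI) (simp add: inverse_eq_divide)
    then have "(\<lambda>m. g 1 (ennreal (1 / real (Suc m)))) \<longlonglongrightarrow> g 1 0" by (intro g_tendsto) auto
    then have "(\<lambda>m. ennreal (ga m)) \<longlonglongrightarrow> ennreal c" unfolding ga(1) c(1) .
    then show "ga \<longlonglongrightarrow> c" using c(2) ga(2) by (subst (asm) tendsto_ennreal_iff) auto
  qed
  ultimately have "ennreal (\<delta> * c) * emeasure M (H \<inter> D) \<le> ennreal (c - c)"
    by (intro LIMSEQ_le_const) auto
  then have "emeasure M (H \<inter> D) = 0" using \<delta> c(2) by simp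
  then have "H \<inter> D \<in> null_sets M" by (intro null_setsI) auto
  then have "AE \<omega> in M. \<omega> \<notin> H \<inter> D" by (rule AE_not_in)
  then show ?thesis using AE_space by eventually_elim (auto simp: H_def D_def not_less[symmetric])
qed

text \<open>Restricted to rational times, so that only countably many exceptional sets are
  removed.\<close>

definition G2 :: "'a set" where
  "G2 = {\<omega>\<in>G. \<forall>s r' r :: rat. 0 \<le> s \<and> s < r' \<and> r' < r \<longrightarrow>
     \<omega> \<in> Hit (real_of_rat s) (real_of_rat r') \<longrightarrow> ell (real_of_rat s) \<omega> < ell (real_of_rat r) \<omega>}"

lemma G2_sets [measurable]: "G2 \<in> sets M"
proof -
  have "G2 = {\<omega>\<in>space M. \<omega> \<in> G \<and> (\<forall>s r' r :: rat. 0 \<le> s \<and> s < r' \<and> r' < r \<longrightarrow>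
     \<omega> \<in> Hit (real_of_rat s) (real_of_rat r') \<longrightarrow> ell (real_of_rat s) \<omega> < ell (real_of_rat r) \<omega>)}"
    using G_space unfolding G2_def by blast
  also have "\<dots> \<in> sets M" by measurable
  finally show ?thesis .
qed

lemma AE_G2: "AE \<omega> in M. \<omega> \<in> G2"
proof -
  have "AE \<omega> in M. \<forall>s r' r :: rat. 0 \<le> s \<and> s < r' \<and> r' < r \<longrightarrow>
     \<omega> \<in> Hit (real_of_rat s) (real_of_rat r') \<longrightarrow> ell (real_of_rat s) \<omega> < ell (real_of_rat r) \<omega>"
    unfolding AE_all_countable
  proof (intro allI)
    fix s r' r :: rat
    show "AE \<omega> in M. 0 \<le> s \<and> s < r' \<and> r' < r \<longrightarrow>
     \<omega> \<in> Hit (real_of_rat s) (real_of_rat r') \<longrightarrow> ell (real_of_rat s) \<omega> < ell (real_of_rat r) \<omega>"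
      using AE_hit[of "real_of_rat s" "real_of_rat r'" "real_of_rat r"]
      by (cases "0 \<le> s \<and> s < r' \<and> r' < r") (auto simp: of_rat_less)
  qed
  then show ?thesis using AE_G by eventually_elim (simp add: G2_def)
qed

lemma G2_G: "\<omega> \<in> G2 \<Longrightarrow> \<omega> \<in> G" by (simp add: G2_def)

text \<open>Two rationals squeezed between \<open>z\<close> and \<open>t\<close> lead back to the
  countably many events of \<open>G2\<close>.\<close>

lemma ell_increases_at_zero:
  assumes \<omega>: "\<omega> \<in> G2" and s: "s \<in> \<rat>" "0 \<le> s" "s \<le> z" and z: "Yp z \<omega> = 0" and t: "z < t"
  shows "ell s \<omega> < ell t \<omega>"
proof -
  obtain r' where r': "r' \<in> \<rat>" "z < r'" "r' < t" using Rats_dense_in_real[OF t] by blast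
  obtain r where r: "r \<in> \<rat>" "r' < r" "r < t" using Rats_dense_in_real[OF r'(3)] by blast
  have "\<omega> \<in> Hit s r'"
    using zero_imp_hit[OF G_space[OF G2_G[OF \<omega>]] s(3) r'(2) z] by (auto simp: Hit_def)
  moreover have "s < r'" using s(3) r'(2) by linarith
  moreover obtain a a' a'' where "s = real_of_rat a" "r' = real_of_rat a'" "r = real_of_rat a''"
    using s(1) r'(1) r(1) by (auto elim!: Rats_cases)
  ultimately have "ell s \<omega> < ell r \<omega>" using \<omega> s(2) r(2) unfolding G2_def by (auto simp: of_rat_less)
  also have "\<dots> \<le> ell t \<omega>" using s r r' by (intro ell_mono') auto
  finally show ?thesis .
qed

lemma S_0: assumes \<omega>: "\<omega> \<in> G2" shows "S 0 \<omega> = 0"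
proof (rule ccontr)
  assume "S 0 \<omega> \<noteq> 0"
  then have "0 < S 0 \<omega>" by (simp add: zero_less_iff_neq_zero)
  then obtain t where t: "0 < t" "t < S 0 \<omega>" using dense by blast
  then obtain r where r: "t = ennreal r" "0 < r" by (cases t) auto
  have "ell 0 \<omega> < ell r \<omega>" by (rule ell_increases_at_zero[OF \<omega>, of 0 0]) (use G_0[OF G2_G[OF \<omega>]] r in auto)
  then have "S 0 \<omega> < ennreal r" using S_less_iff[of 0 r \<omega>] r by (simp add: ell_0)
  then show False using t r by simp
qed

lemma S_right_continuous: assumes x: "0 \<le> x" shows "continuous (at_right x) (\<lambda>x. S x \<omega>)"
  unfolding continuous_within
proof (rule order_tendstoI)
  fix a assume "a < S x \<omega>"
  then have "a < S y \<omega>" if "x < y" for y using S_mono[of x y \<omega>] that by (auto intro: less_le_trans)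
  then show "eventually (\<lambda>y. a < S y \<omega>) (at_right x)" by (rule eventually_mono[OF eventually_at_right_less])
next
  fix a assume "S x \<omega> < a"
  then obtain t where t: "0 \<le> t" "x < ell t \<omega>" "ennreal t < a" unfolding S_def by (auto simp: Inf_less_iff)
  have "eventually (\<lambda>y. y < ell t \<omega>) (at_right x)" using t(2) by (auto simp: eventually_at_right[OF t(2)])
  moreover have "S y \<omega> < a" if "y < ell t \<omega>" for y
  proof -
    have "S y \<omega> \<le> ennreal t" unfolding S_def using t(1) that by (intro Inf_lower) auto
    then show ?thesis using t(3) by (rule le_less_trans)
  qed
  ultimately show "eventually (\<lambda>y. S y \<omega> < a) (at_right x)" by (auto elim: eventually_mono)
qed

lemma mono_left_limit:
  fixes f :: "real \<Rightarrow> ennreal"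
  assumes "mono_on {0..} f" "0 < t" shows "\<exists>l. (f \<longlongrightarrow> l) (at_left t)"
proof (intro exI order_tendstoI)
  let ?l = "SUP y\<in>{0..<t}. f y"
  have ev: "eventually (\<lambda>y. max s 0 < y \<and> y < t) (at_left t)" if "s < t" for s
    unfolding eventually_at_left_field using that assms(2) by (intro exI[of _ "max s 0"]) auto
  fix a assume "a < ?l"
  then obtain y where y: "0 \<le> y" "y < t" "a < f y" by (auto simp: less_SUP_iff)
  show "eventually (\<lambda>x. a < f x) (at_left t)"
    using ev[OF y(2)]
  proof eventually_elim
    case (elim x)
    then have "f y \<le> f x" using y by (intro mono_onD[OF assms(1)]) auto
    then show ?case using y(3) by (rule less_le_trans[rotated])
  qed
next
  let ?l = "SUP y\<in>{0..<t}. f y"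
  fix a assume a: "?l < a"
  have "eventually (\<lambda>y. max 0 0 < y \<and> y < t) (at_left t)"
    unfolding eventually_at_left_field using assms(2) by (intro exI[of _ 0]) auto
  then show "eventually (\<lambda>x. f x < a) (at_left t)"
  proof eventually_elim
    case (elim x)
    then have "f x \<le> ?l" by (intro SUP_upper) auto
    then show ?case using a by (rule le_less_trans)
  qed
qed

text \<open>Every path of a subordinator has to be cadlag and start at \<open>0\<close>, not only almost every one.\<close>

definition S' :: "real \<Rightarrow> 'a \<Rightarrow> ennreal" where
  "S' x \<omega> = (if \<omega> \<in> G2 then S x \<omega> else ennreal x)"

lemma S'_measurable: "0 \<le> x \<Longrightarrow> S' x \<in> borel_measurable M"
  unfolding S'_def[abs_def] using S_measurable[of x] by measurable

lemma S'_path: "S' 0 \<omega> = 0" "cadlag (\<lambda>t. S' t \<omega>)" "mono_on {0..} (\<lambda>t. S' t \<omega>)"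
proof -
  show "S' 0 \<omega> = 0" by (simp add: S'_def S_0)
  show mono: "mono_on {0..} (\<lambda>t. S' t \<omega>)" by (auto simp: mono_on_def S'_def S_mono ennreal_leI)
  have "continuous (at_right t) (\<lambda>t. S' t \<omega>)" if "0 \<le> t" for t
  proof (cases "\<omega> \<in> G2")
    case True
    then show ?thesis using S_right_continuous[OF that, of \<omega>] by (simp add: S'_def)
  next
    case False
    have "continuous (at_right t) ennreal" by (simp add: continuous_within tendsto_ennrealI)
    with False show ?thesis by (simp add: S'_def)
  qed
  then show "cadlag (\<lambda>t. S' t \<omega>)" unfolding cadlag_def using mono_left_limit[OF mono] by simp
qed

lemma S'_Gf_measurable: assumes "0 \<le> y" "y \<le> x" shows "S' y \<in> borel_measurable (Gf x)"
proof -
  have "space M - G2 \<in> sets (Gf x)" by (rule Gf_null) (use AE_G2 in auto)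
  then have [measurable]: "G2 \<in> sets (Gf x)"
    using sets.compl_sets[of "space M - G2" "Gf x"] sets.sets_into_space[OF G2_sets] by (simp add: double_diff)
  have [measurable]: "S y \<in> borel_measurable (Gf x)" using assms by (rule S_Gf_measurable)
  show ?thesis unfolding S'_def[abs_def] by measurable
qed

lemma natural_filtration_S': "sets (natural_filtration M S' x) \<subseteq> sets (Gf x)"
proof -
  have "sets (natural_filtration M S' x) = sigma_sets (space (Gf x)) {S' r -` B \<inter> space M | r B. 0 \<le> r \<and> r \<le> x \<and> B \<in> sets borel}"
    unfolding natural_filtration_def space_Gf by (rule sets_measure_of) auto
  also have "\<dots> \<subseteq> sets (Gf x)"
  proof (rule sets.sigma_sets_subset, safe)
    fix r :: real and B :: "ennreal set" assume "0 \<le> r" "r \<le> x" "B \<in> sets borel"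
    then show "S' r -` B \<inter> space M \<in> sets (Gf x)"
      using measurable_sets[OF S'_Gf_measurable, of r x B] by simp
  qed
  finally show ?thesis .
qed

lemma AE_S': "AE \<omega> in M. \<forall>x. S' x \<omega> = S x \<omega>"
  using AE_G2 by eventually_elim (simp add: S'_def)

text \<open>The identity of \<open>laplace_step\<close> is weighted with
  \<open>exp (q * S x)\<close>, which belongs to the past of \<open>S x\<close> and is finite on
  \<open>C\<close>; the weight cancels the factor at the level \<open>x\<close>.\<close>

lemma laplace_increment:
  assumes q: "0 < q" and x: "0 \<le> x" "0 \<le> t" and C: "C \<in> sets (Gf x)" and fin: "\<And>\<omega>. \<omega> \<in> C \<Longrightarrow> S' x \<omega> < \<infinity>"
  shows "(\<integral>\<^sup>+\<omega>\<in>C. ennreal (exp_neg q (S' (x + t) \<omega> - S' x \<omega>)) \<partial>M) = ennreal (exp (- t * L q)) * emeasure M C"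
proof -
  have [measurable]: "C \<in> sets M" "C \<in> sets (Gf x)" using Gf_sets[OF C] C .
  have [measurable]: "S y \<in> borel_measurable M" if "0 \<le> y" for y using S_measurable[OF that] .
  have [measurable]: "S x \<in> borel_measurable (Gf x)" using x by (intro S_Gf_measurable) auto
  define W where "W \<omega> = indicator C \<omega> * ennreal (exp (q * enn2real (S x \<omega>)))" for \<omega>
  have W: "W \<in> borel_measurable (Gf x)" unfolding W_def by measurable
  have "(\<integral>\<^sup>+\<omega>\<in>C. ennreal (exp_neg q (S' (x + t) \<omega> - S' x \<omega>)) \<partial>M) = (\<integral>\<^sup>+\<omega>. ennreal (exp_neg q (S (x + t) \<omega>)) * W \<omega> \<partial>M)"
  proof (rule nn_integral_cong_AE)
    show "AE \<omega> in M. ennreal (exp_neg q (S' (x + t) \<omega> - S' x \<omega>)) * indicator C \<omega> = ennreal (exp_neg q (S (x + t) \<omega>)) * W \<omega>"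
      using AE_S'
    proof eventually_elim
      case (elim \<omega>)
      show ?case
      proof (cases "\<omega> \<in> C")
        case True
        then have "S x \<omega> < \<infinity>" using fin[OF True] elim by simp
        then obtain a where a: "S x \<omega> = ennreal a" "0 \<le> a" by (cases "S x \<omega>") auto
        show ?thesis
        proof (cases "S (x + t) \<omega>")
          case (real b)
          then have "a \<le> b" using S_mono[of x "x + t" \<omega>] a x by (simp add: ennreal_le_iff)
          then have "exp_neg q (S (x + t) \<omega> - S x \<omega>) = exp_neg q (S (x + t) \<omega>) * exp (q * enn2real (S x \<omega>))"
            using a real by (simp add: exp_neg_def ennreal_minus exp_add[symmetric] algebra_simps)
          then show ?thesis using True elim by (simp add: W_def ennreal_mult exp_neg_bounds)
        next
          case top
          then show ?thesis using True elim a by (simp add: W_def exp_neg_def)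
        qed
      qed (simp add: W_def)
    qed
  qed
  also have "\<dots> = (\<integral>\<^sup>+\<omega>. (ennreal (exp (- t * L q)) * ennreal (exp_neg q (S x \<omega>))) * W \<omega> \<partial>M)"
  proof (rule nn_integral_eq_subalgebra[OF Gf_subalgebra _ _ W])
    fix A assume A: "A \<in> sets (Gf x)"
    then have [measurable]: "A \<in> sets M" by (rule Gf_sets)
    show "(\<integral>\<^sup>+\<omega>\<in>A. ennreal (exp_neg q (S (x + t) \<omega>)) \<partial>M) = (\<integral>\<^sup>+\<omega>\<in>A. ennreal (exp (- t * L q)) * ennreal (exp_neg q (S x \<omega>)) \<partial>M)"
      unfolding laplace_step[OF q x A] using x by (simp add: nn_integral_cmult mult.assoc)
  qed (use x in \<open>measurable, auto\<close>)
  also have "\<dots> = (\<integral>\<^sup>+\<omega>. ennreal (exp (- t * L q)) * indicator C \<omega> \<partial>M)"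
  proof (rule nn_integral_cong_AE)
    show "AE \<omega> in M. (ennreal (exp (- t * L q)) * ennreal (exp_neg q (S x \<omega>))) * W \<omega> = ennreal (exp (- t * L q)) * indicator C \<omega>"
      using AE_S'
    proof eventually_elim
      case (elim \<omega>)
      show ?case
      proof (cases "\<omega> \<in> C")
        case True
        then have "S x \<omega> < \<infinity>" using fin[OF True] elim by simp
        then obtain a where a: "S x \<omega> = ennreal a" "0 \<le> a" by (cases "S x \<omega>") auto
        have "ennreal (exp (- q * a)) * ennreal (exp (q * a)) = 1"
          by (simp flip: ennreal_mult exp_add)
        then show ?thesis using True a by (simp add: W_def exp_neg_def mult.assoc)
      qed (simp add: W_def)
    qed
  qed
  also have "\<dots> = ennreal (exp (- t * L q)) * emeasure M C"
    by (rule nn_integral_cmult_indicator) simp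
  finally show ?thesis .
qed

lemma nn_laplace_S':
  assumes q: "0 < q" and t: "0 \<le> t"
  shows "(\<integral>\<^sup>+\<omega>. ennreal (exp_neg q (S' t \<omega>)) \<partial>M) = ennreal (exp (- t * L q))"
proof -
  have "(\<integral>\<^sup>+\<omega>\<in>space M. ennreal (exp_neg q (S' (0 + t) \<omega> - S' 0 \<omega>)) \<partial>M) = ennreal (exp (- t * L q)) * emeasure M (space M)"
    using sets.top[of "Gf 0"] t by (intro laplace_increment q) (auto simp: S'_path)
  moreover have "(\<integral>\<^sup>+\<omega>\<in>space M. ennreal (exp_neg q (S' (0 + t) \<omega> - S' 0 \<omega>)) \<partial>M) = (\<integral>\<^sup>+\<omega>. ennreal (exp_neg q (S' t \<omega>)) \<partial>M)"
    by (intro nn_integral_cong) (auto simp: S'_path)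
  ultimately show ?thesis by (simp add: emeasure_space_1)
qed

lemma has_Laplace_exponent_S': "has_Laplace_exponent M S' L"
  unfolding has_Laplace_exponent_def
proof (intro allI impI)
  fix q t :: real assume qt: "0 < q" "0 \<le> t"
  have [measurable]: "S' t \<in> borel_measurable M" using S'_measurable[OF qt(2)] .
  have "(\<integral>\<omega>. exp_neg q (S' t \<omega>) \<partial>M) = enn2real (\<integral>\<^sup>+\<omega>. ennreal (exp_neg q (S' t \<omega>)) \<partial>M)"
    by (rule integral_eq_nn_integral) (auto simp: exp_neg_bounds)
  then show "(\<integral>\<omega>. exp_neg q (S' t \<omega>) \<partial>M) = exp (- t * L q)"
    by (simp only: nn_laplace_S'[OF qt] enn2real_ennreal exp_ge_zero)
qed

text \<open>Under the measure conditioned on \<open>C\<close> the increment has the Laplace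
  transform of \<open>S' t\<close>, hence its law; this is the product formula.\<close>

lemma subordinator_S': "subordinator M S'"
  unfolding subordinator_def
proof (intro conjI allI impI ballI)
  fix s t :: real and A and B :: "ennreal set" assume s: "0 \<le> s" and t: "0 \<le> t" and A: "A \<in> sets (natural_filtration M S' s)" and B: "B \<in> sets borel"
  have [measurable]: "S' y \<in> borel_measurable M" if "0 \<le> y" for y using S'_measurable[OF that] .
  have [measurable]: "S' s \<in> borel_measurable (Gf s)" using s by (intro S'_Gf_measurable) auto
  have AG: "A \<in> sets (Gf s)" using A natural_filtration_S'[of s] by auto
  define C where "C = {\<omega>\<in>A. S' s \<omega> < \<infinity>}"
  have "C = A \<inter> {\<omega>\<in>space (Gf s). S' s \<omega> < \<infinity>}" unfolding C_def using sets.sets_into_space[OF AG] by auto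
  moreover have "{\<omega>\<in>space (Gf s). S' s \<omega> < \<infinity>} \<in> sets (Gf s)" by measurable
  ultimately have CG: "C \<in> sets (Gf s)" using AG by (simp add: sets.Int del: space_Gf)
  then have C [measurable]: "C \<in> sets M" by (rule Gf_sets)
  define X where "X \<omega> = S' (s + t) \<omega> - S' s \<omega>" for \<omega>
  have [measurable]: "S' (s + t) \<in> borel_measurable M" "S' s \<in> borel_measurable M"
    using s t by (auto intro: S'_measurable)
  have [measurable]: "X \<in> borel_measurable M" unfolding X_def by measurable
  have eq: "{\<omega> \<in> A. S' s \<omega> < \<infinity> \<and> S' (s + t) \<omega> - S' s \<omega> \<in> B} = C \<inter> X -` B \<inter> space M"
    unfolding C_def X_def using sets.sets_into_space[OF AG] by auto
  have XB: "X -` B \<inter> space M \<in> sets M" using B by measurable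
  show "measure M {\<omega> \<in> A. S' s \<omega> < \<infinity> \<and> S' (s + t) \<omega> - S' s \<omega> \<in> B}
    = measure M {\<omega> \<in> A. S' s \<omega> < \<infinity>} * measure M {\<omega> \<in> space M. S' t \<omega> \<in> B}"
  \<comment> \<open>Conditioning requires positive probability; otherwise both sides are 0.\<close>
  proof (cases "measure M C = 0")
    case True
    have "measure M (C \<inter> X -` B \<inter> space M) \<le> measure M C"
      using C by (intro finite_measure_mono) auto
    then show ?thesis unfolding eq C_def[symmetric] using True by (simp add: measure_le_0_iff)
  next
    case False
    then have emC: "emeasure M C \<noteq> 0" "emeasure M C \<noteq> \<infinity>" by (auto simp: emeasure_eq_measure)
    interpret U: prob_space "uniform_measure M C" by (rule prob_space_uniform_measure[OF emC])
    have "distr (uniform_measure M C) borel X = distr M borel (S' t)"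
    proof (rule distr_eq_of_laplace_eq)
      fix q :: real assume q: "0 < q"
      have "(\<integral>\<omega>. exp_neg q (X \<omega>) \<partial>uniform_measure M C) = enn2real (\<integral>\<^sup>+\<omega>. ennreal (exp_neg q (X \<omega>)) \<partial>uniform_measure M C)"
        by (rule integral_eq_nn_integral) (auto simp: exp_neg_bounds)
      also have "(\<integral>\<^sup>+\<omega>. ennreal (exp_neg q (X \<omega>)) \<partial>uniform_measure M C) = (\<integral>\<^sup>+\<omega>\<in>C. ennreal (exp_neg q (X \<omega>)) \<partial>M) / emeasure M C"
        by (rule nn_integral_uniform_measure) measurable
      also have "(\<integral>\<^sup>+\<omega>\<in>C. ennreal (exp_neg q (X \<omega>)) \<partial>M) = ennreal (exp (- t * L q)) * emeasure M C"
        unfolding X_def by (rule laplace_increment[OF q s t CG]) (simp add: C_def)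
      also have "ennreal (exp (- t * L q)) * emeasure M C / emeasure M C = ennreal (exp (- t * L q))"
        using emC by (simp add: ennreal_mult_divide_eq)
      also have "enn2real \<dots> = (\<integral>\<omega>. exp_neg q (S' t \<omega>) \<partial>M)"
        using has_Laplace_exponent_S' q t unfolding has_Laplace_exponent_def by simp
      finally show "(\<integral>\<omega>. exp_neg q (X \<omega>) \<partial>uniform_measure M C) = (\<integral>\<omega>. exp_neg q (S' t \<omega>) \<partial>M)" .
    qed (use t in \<open>auto intro: U.prob_space_axioms prob_space_axioms\<close>)
    then have "emeasure (distr (uniform_measure M C) borel X) B = emeasure (distr M borel (S' t)) B" by simp
    then have "emeasure M (C \<inter> (X -` B \<inter> space M)) / emeasure M C = emeasure M (S' t -` B \<inter> space M)"
      using B C XB t by (simp add: emeasure_distr)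
    then have "measure M (C \<inter> (X -` B \<inter> space M)) / measure M C = measure M (S' t -` B \<inter> space M)"
      using False by (simp add: emeasure_eq_measure divide_ennreal zero_less_measure_iff)
    moreover have "{\<omega> \<in> space M. S' t \<omega> \<in> B} = S' t -` B \<inter> space M" by auto
    ultimately show ?thesis unfolding eq C_def[symmetric] using False by (simp add: field_simps Int_assoc)
  qed
qed (auto simp: S'_measurable S'_path)

text \<open>Values of the inverse are zeros. Conversely, for a rational \<open>s\<close> just below
  a zero \<open>z\<close>, the inverse at the level \<open>ell s\<close> lies between
  \<open>s\<close> and \<open>z\<close>, since the local time grows right after
  \<open>z\<close>.\<close>

lemma zero_set_eq_closed_range:
  assumes \<omega>: "\<omega> \<in> G2" shows "zero_set Y \<omega> = closed_range S' \<omega>"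
proof
  have S': "S' x \<omega> = S x \<omega>" for x using \<omega> by (simp add: S'_def)
  show "closed_range S' \<omega> \<subseteq> zero_set Y \<omega>"
    unfolding closed_range_def zero_set_def
  proof (rule closure_mono, safe)
    fix x assume x: "0 \<le> x" "S' x \<omega> < \<infinity>"
    then obtain s where s: "S x \<omega> = ennreal s" "0 \<le> s" unfolding S' by (cases "S x \<omega>") auto
    have "Yp s \<omega> = 0" by (rule Y_S_eq_0[OF G2_G[OF \<omega>] x(1) s])
    then show "Y (enn2real (S' x \<omega>)) \<omega> = 0" using s by (simp add: S' Yp_def)
  qed simp
  show "zero_set Y \<omega> \<subseteq> closed_range S' \<omega>"
    unfolding zero_set_def
  proof (rule closure_minimal)
    show "closed (closed_range S' \<omega>)" by (simp add: closed_range_def)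
    show "{t. 0 \<le> t \<and> Y t \<omega> = 0} \<subseteq> closed_range S' \<omega>"
    proof
      fix z assume "z \<in> {t. 0 \<le> t \<and> Y t \<omega> = 0}"
      then have z: "0 \<le> z" "Yp z \<omega> = 0" by (auto simp: Yp_def)
      show "z \<in> closed_range S' \<omega>"
        unfolding closed_range_def closure_approachable
      proof (intro allI impI)
        fix e :: real assume e: "0 < e"
        \<comment> \<open>At \<open>z = 0\<close> there is no smaller nonnegative rational, so
          \<open>s = 0\<close> is taken there.\<close>
        obtain s where s: "s \<in> \<rat>" "0 \<le> s" "s \<le> z" "z - e < s"
        proof (cases "z = 0")
          case True then show thesis using that[of 0] e by auto
        next
          case False
          then have "max 0 (z - e) < z" using z e by auto
          then obtain s where "s \<in> \<rat>" "max 0 (z - e) < s" "s < z" using Rats_dense_in_real by blast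
          then show thesis using that[of s] by auto
        qed
        define x where "x = ell s \<omega>"
        have x: "0 \<le> x" using ell_nonneg[OF s(2)] by (simp add: x_def)
        have lt: "S x \<omega> < ennreal t" if "z < t" for t
          using ell_increases_at_zero[OF \<omega> s(1,2,3) z(2) that] S_less_iff[OF x, of t \<omega>] that z by (simp add: x_def)
        have "S x \<omega> < \<infinity>" using lt[of "z + 1"] by (auto elim: less_trans)
        then obtain r where r: "S x \<omega> = ennreal r" "0 \<le> r" by (cases "S x \<omega>") auto
        have "r \<le> t" if "z < t" for t using lt[OF that] r that z by (simp add: ennreal_less_iff)
        then have "r \<le> z" by (rule dense_ge)
        moreover have "s \<le> r" using S_ell_le[OF s(2), of \<omega>] r by (simp add: x_def[symmetric] ennreal_le_iff)
        ultimately have "dist r z < e" using s by (simp add: dist_real_def)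
        then show "\<exists>y\<in>{enn2real (S' t \<omega>) |t. 0 \<le> t \<and> S' t \<omega> < \<infinity>}. dist y z < e"
          using x r unfolding S' by (intro bexI[of _ r]) (auto intro!: exI[of _ x])
      qed
    qed
  qed
qed

lemma L_eq:
  assumes q: "0 < q"
  shows "L q = inverse (LINT t:{0<..}|lborel. exp (- q * t) * u t)"
proof -
  have "(LINT t:{0<..}|lborel. exp (- q * t) * u t) = (\<integral>t. indicator {0<..} t * (exp (- q * t) * u t) \<partial>lborel)"
    by (simp add: set_lebesgue_integral_def)
  also have "\<dots> = enn2real (\<integral>\<^sup>+t. ennreal (indicator {0<..} t * (exp (- q * t) * u t)) \<partial>lborel)"
    by (rule integral_eq_nn_integral) (auto simp: indicator_def intro!: mult_nonneg_nonneg less_imp_le[OF u_pos])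
  also have "(\<integral>\<^sup>+t. ennreal (indicator {0<..} t * (exp (- q * t) * u t)) \<partial>lborel) = g q 0"
    unfolding g_def
    by (intro nn_integral_cong) (auto simp: indicator_def h_def ennreal_mult u_pos[THEN less_imp_le])
  finally show ?thesis by (simp add: L_def)
qed

end

section \<open>Triviality and Lebesgue measure of the zero set\<close>

text \<open>Each added point is followed by an open interval that misses \<open>Z\<close>, hence
  also its closure. A rational chosen in it separates the point from all later ones, so the choice
  is injective.\<close>

lemma countable_closure_diff:
  fixes Z :: "real set"
  assumes gap: "\<And>t. t \<in> closure Z - Z \<Longrightarrow> \<exists>d>t. \<forall>x. t < x \<and> x < d \<longrightarrow> x \<notin> Z"
  shows "countable (closure Z - Z)"
proof -
  have "\<exists>q. q \<in> \<rat> \<and> t < q \<and> (\<forall>x. t < x \<and> x \<le> q \<longrightarrow> x \<notin> closure Z)" if t: "t \<in> closure Z - Z" for t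
  proof -
    from gap[OF t] obtain d where d: "t < d" "\<And>x. t < x \<Longrightarrow> x < d \<Longrightarrow> x \<notin> Z" by blast
    have "{t<..<d} \<inter> Z = {}" using d(2) by auto
    then have cl: "{t<..<d} \<inter> closure Z = {}" by (simp add: open_Int_closure_eq_empty)
    obtain q where "q \<in> \<rat>" "t < q" "q < d" using Rats_dense_in_real[OF d(1)] by blast
    then show ?thesis using cl by (intro exI[of _ q]) (auto simp: disjoint_iff)
  qed
  then obtain q where q: "\<And>t. t \<in> closure Z - Z \<Longrightarrow> q t \<in> \<rat> \<and> t < q t \<and> (\<forall>x. t < x \<and> x \<le> q t \<longrightarrow> x \<notin> closure Z)"
    by metis
  have lt: "q s < q t" if "s \<in> closure Z - Z" "t \<in> closure Z - Z" "s < t" for s t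
  proof -
    have "\<not> t \<le> q s" using q[OF that(1)] that by auto
    then show ?thesis using q[OF that(2)] by linarith
  qed
  have "inj_on q (closure Z - Z)"
    by (rule inj_onI) (metis lt less_irrefl linorder_less_linear)
  moreover have "countable (q ` (closure Z - Z))"
    by (rule countable_subset[OF _ countable_rat]) (use q in auto)
  ultimately show ?thesis by (rule countable_image_inj_on[rotated])
qed

context laplace_flow_process
begin

lemma positive_right_of:
  assumes \<omega>: "\<omega> \<in> space M" and t: "Yp t \<omega> \<noteq> 0"
  shows "\<exists>d>t. \<forall>x. t < x \<and> x < d \<longrightarrow> Yp x \<omega> \<noteq> 0"
proof -
  have "((\<lambda>t. Yp t \<omega>) \<longlongrightarrow> Yp t \<omega>) (at_right t)"
    using Yp_right_continuous[OF \<omega>, of t] by (simp add: continuous_within)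
  from order_tendstoD(1)[OF this, of 0] t
  show ?thesis by (auto simp: eventually_at_right_field zero_less_iff_neq_zero)
qed

definition zeros :: "'a \<Rightarrow> real set" where "zeros \<omega> = {t. 0 \<le> t \<and> Yp t \<omega> = 0}"

lemma zero_set_eq: "zero_set Y \<omega> = closure (zeros \<omega>)"
  unfolding zero_set_def zeros_def Yp_def by (intro arg_cong[where f=closure]) auto

lemma zero_set_nonneg: "zero_set Y \<omega> \<subseteq> {0..}"
  unfolding zero_set_eq by (rule closure_minimal) (auto simp: zeros_def)

lemma countable_zero_set_diff:
  assumes \<omega>: "\<omega> \<in> space M" shows "countable (zero_set Y \<omega> - zeros \<omega>)"
  unfolding zero_set_eq
proof (rule countable_closure_diff)
  fix t assume t: "t \<in> closure (zeros \<omega>) - zeros \<omega>"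
  then have "0 \<le> t" using zero_set_nonneg[of \<omega>] by (auto simp: zero_set_eq)
  with t have "Yp t \<omega> \<noteq> 0" by (auto simp: zeros_def)
  from positive_right_of[OF \<omega> this] show "\<exists>d>t. \<forall>x. t < x \<and> x < d \<longrightarrow> x \<notin> zeros \<omega>"
    by (auto simp: zeros_def)
qed

lemma zeros_measurable: "\<omega> \<in> space M \<Longrightarrow> zeros \<omega> \<in> sets borel"
proof -
  assume "\<omega> \<in> space M"
  then have [measurable]: "(\<lambda>t. Yp t \<omega>) \<in> borel_measurable borel" by (rule Yp_time_measurable)
  have "{t \<in> space borel. 0 \<le> t \<and> Yp t \<omega> = 0} \<in> sets borel" by measurable
  then show ?thesis by (simp add: zeros_def)
qed

lemma emeasure_zero_set:
  assumes \<omega>: "\<omega> \<in> space M" shows "emeasure lborel (zero_set Y \<omega>) = emeasure lborel (zeros \<omega>)"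
proof -
  have "zero_set Y \<omega> = zeros \<omega> \<union> (zero_set Y \<omega> - zeros \<omega>)"
    using closure_subset[of "zeros \<omega>"] by (auto simp: zero_set_eq)
  also have "emeasure lborel \<dots> = emeasure lborel (zeros \<omega>)"
    using countable_imp_null_set_lborel[OF countable_zero_set_diff[OF \<omega>]] zeros_measurable[OF \<omega>]
    by (intro emeasure_Un_null_set) auto
  finally show ?thesis .
qed

lemma markov_integral_Fb:
  assumes C: "C \<in> sets (Fb t)" and t: "0 \<le> t" and e: "0 < e"
  shows "(\<integral>\<^sup>+\<omega>\<in>C. (\<integral>\<^sup>+x\<in>{0..b}. N e (t + x) \<omega> \<partial>lborel) \<partial>M) = (\<integral>\<^sup>+\<omega>\<in>C. (\<integral>\<^sup>+x\<in>{0..b}. h (e + x) (Yp t \<omega>) \<partial>lborel) \<partial>M)"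
proof -
  obtain B where B: "B \<in> sets (F t)" and CB: "AE \<omega> in M. \<omega> \<in> C \<longleftrightarrow> \<omega> \<in> B"
    using C by (auto simp: sets_Fb)
  have eq: "(\<integral>\<^sup>+\<omega>\<in>C. f \<omega> \<partial>M) = (\<integral>\<^sup>+\<omega>. indicator B \<omega> * f \<omega> \<partial>M)" for f
    by (rule nn_integral_cong_AE) (use CB in \<open>eventually_elim, auto simp: indicator_def\<close>)
  show ?thesis
    unfolding eq using markov_N_integral[OF t e, of "indicator B" b] B by (simp add: N_def)
qed

text \<open>Two limits in this order: \<open>m\<close> to infinity at fixed \<open>e\<close>, so
  that the potential from a small state becomes the one from 0, then \<open>e\<close> to 0. The
  start \<open>a > 0\<close> keeps the expected occupation below \<open>c\<close> for every
  \<open>e\<close>, because \<open>u\<close> is at most \<open>u a\<close> there.\<close>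

lemma no_hit:
  assumes a: "0 < a" "a < T" and inf: "(\<integral>\<^sup>+x\<in>{0<..<1}. ennreal (u x) \<partial>lborel) = \<infinity>"
  shows "AE \<omega> in M. \<omega> \<notin> (\<Inter>m. \<Union>n. hit a T (1 / real (Suc m)) n)"
proof -
  define H where "H = (\<Inter>m. \<Union>n. hit a T (1 / real (Suc m)) n)"
  have [measurable]: "H \<in> sets M" unfolding H_def by measurable
  \<comment> \<open>The window runs to \<open>T + 1\<close> so as to contain a unit interval after
    every time before \<open>T\<close>.\<close>
  define c where "c = h a 0 * ennreal (T + 1 - a)"
  have cfin: "c < \<infinity>" unfolding c_def using h_finite[of a 0] by (simp add: ennreal_mult_less_top)
  have key: "(\<integral>\<^sup>+x\<in>{0..1}. h (e + x) (ennreal (1 / real (Suc m))) \<partial>lborel) * emeasure M H \<le> c" if e: "0 < e" for e m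
  proof -
    define k where "k = (\<integral>\<^sup>+x\<in>{0..1}. h (e + x) (ennreal (1 / real (Suc m))) \<partial>lborel)"
    define \<mu>1 where "\<mu>1 = density M (\<lambda>\<omega>. k)"
    define \<mu>2 where "\<mu>2 = density M (A e a (T + 1))"
    have e1: "emeasure \<mu>1 C = k * emeasure M C" if "C \<in> sets M" for C
      unfolding \<mu>1_def using that by (simp add: emeasure_density nn_integral_cmult_indicator)
    have "emeasure \<mu>1 (\<Union>n. hit a T (1 / real (Suc m)) n) \<le> emeasure \<mu>2 (space \<mu>2)"
    proof (rule hit_bound[OF _ _ less_imp_le[OF a(1)] a(2)])
      fix t C assume t: "a \<le> t" "t < T" and C: "C \<in> sets (Fb t)" and small: "\<And>\<omega>. \<omega> \<in> C \<Longrightarrow> Yp t \<omega> < ennreal (1 / real (Suc m))"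
      have CM [measurable]: "C \<in> sets M" using Fb_sets[OF C] .
      have "emeasure \<mu>1 C = (\<integral>\<^sup>+\<omega>\<in>C. k \<partial>M)" using CM by (simp add: e1 nn_integral_cmult_indicator)
      also have "\<dots> \<le> (\<integral>\<^sup>+\<omega>\<in>C. (\<integral>\<^sup>+x\<in>{0..1}. h (e + x) (Yp t \<omega>) \<partial>lborel) \<partial>M)"
        unfolding k_def using small[THEN less_imp_le]
        by (intro nn_integral_mono) (auto simp: indicator_def intro!: nn_integral_mono h_antimono)
      also have "\<dots> = (\<integral>\<^sup>+\<omega>\<in>C. (\<integral>\<^sup>+x\<in>{0..1}. N e (t + x) \<omega> \<partial>lborel) \<partial>M)"
        using t a e by (intro markov_integral_Fb[symmetric] C) auto
      also have "\<dots> \<le> (\<integral>\<^sup>+\<omega>. A e a (T + 1) \<omega> * indicator C \<omega> \<partial>M)"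
      proof (rule nn_integral_mono)
        fix \<omega> assume \<omega>: "\<omega> \<in> space M"
        have "(\<integral>\<^sup>+x\<in>{0..1}. N e (t + x) \<omega> \<partial>lborel) = (\<integral>\<^sup>+x\<in>{t + 0..t + 1}. N e x \<omega> \<partial>lborel)"
          by (rule nn_integral_shift_Icc[OF N_time_measurable[OF \<omega>]])
        also have "\<dots> \<le> A e a (T + 1) \<omega>"
          unfolding A_def using t by (intro nn_integral_mono) (auto simp: indicator_def)
        finally show "(\<integral>\<^sup>+x\<in>{0..1}. N e (t + x) \<omega> \<partial>lborel) * indicator C \<omega> \<le> A e a (T + 1) \<omega> * indicator C \<omega>"
          by (rule mult_right_mono) simp
      qed
      also have "\<dots> = emeasure \<mu>2 C" unfolding \<mu>2_def by (subst emeasure_density) auto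
      finally show "emeasure \<mu>1 C \<le> emeasure \<mu>2 C" .
    qed (auto simp: \<mu>1_def \<mu>2_def)
    also have "emeasure \<mu>2 (space \<mu>2) = (\<integral>\<^sup>+\<omega>. A e a (T + 1) \<omega> \<partial>M)"
      unfolding \<mu>2_def by (simp add: emeasure_density)
    also have "\<dots> = (\<integral>\<^sup>+s\<in>{a..T + 1}. h (e + s) 0 \<partial>lborel)" using a e by (intro expectation_A) auto
    also have "\<dots> \<le> (\<integral>\<^sup>+s\<in>{a..T + 1}. h a 0 \<partial>lborel)"
      using a e by (intro nn_integral_mono) (auto simp: indicator_def intro!: h_0_antimono)
    also have "\<dots> = c" using a by (simp add: c_def nn_integral_cmult)
    finally have "k * emeasure M (\<Union>n. hit a T (1 / real (Suc m)) n) \<le> c" by (simp add: e1 sets.countable_UN)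
    moreover have "emeasure M H \<le> emeasure M (\<Union>n. hit a T (1 / real (Suc m)) n)"
      by (intro emeasure_mono) (auto simp: H_def)
    ultimately show ?thesis unfolding k_def[symmetric] by (meson mult_left_mono order_trans zero_le)
  qed
  have key2: "(\<integral>\<^sup>+x\<in>{e..1}. h x 0 \<partial>lborel) * emeasure M H \<le> c" if e: "0 < e" for e
  proof -
    have yl: "(\<lambda>m. ennreal (1 / real (Suc m))) \<longlonglongrightarrow> 0"
      using tendsto_ennrealI[OF LIMSEQ_inverse_real_of_nat] by (simp add: inverse_eq_divide)
    define p where "p m = (\<integral>\<^sup>+x\<in>{0..1}. h (e + x) (ennreal (1 / real (Suc m))) \<partial>lborel)" for m
    have "p \<longlonglongrightarrow> (\<integral>\<^sup>+x\<in>{0..1}. h (e + x) 0 \<partial>lborel)"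
      unfolding p_def[abs_def]
    proof (rule nn_integral_dominated_convergence[where w="\<lambda>x. h e 0 * indicator {0..1} x"])
      show "AE x in lborel. h (e + x) (ennreal (1 / real (Suc m))) * indicator {0..1} x \<le> h e 0 * indicator {0..1} x" for m
        using e by (intro AE_I2) (auto simp: indicator_def intro!: order_trans[OF h_le h_0_antimono])
      show "(\<integral>\<^sup>+x\<in>{0..1::real}. h e 0 \<partial>lborel) < \<infinity>" using h_finite[of e 0] by (simp add: nn_integral_cmult)
      show "AE x in lborel. (\<lambda>m. h (e + x) (ennreal (1 / real (Suc m))) * indicator {0..1} x) \<longlonglongrightarrow> h (e + x) 0 * indicator {0..1} x"
        using h_tendsto_0[OF yl] by (intro AE_I2) (auto simp: indicator_def)
    qed measurable
    moreover have "(\<integral>\<^sup>+x\<in>{0..1}. h (e + x) 0 \<partial>lborel) < \<infinity>"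
    proof -
      have "(\<integral>\<^sup>+x\<in>{0..1}. h (e + x) 0 \<partial>lborel) \<le> (\<integral>\<^sup>+x\<in>{0..1::real}. h e 0 \<partial>lborel)"
        using e by (intro nn_integral_mono) (auto simp: indicator_def intro!: h_0_antimono)
      also have "\<dots> < \<infinity>" using h_finite[of e 0] by (simp add: nn_integral_cmult)
      finally show ?thesis .
    qed
    ultimately have "(\<lambda>m. p m * emeasure M H) \<longlonglongrightarrow> (\<integral>\<^sup>+x\<in>{0..1}. h (e + x) 0 \<partial>lborel) * emeasure M H"
      by (intro tendsto_mult_ennreal tendsto_const) (auto simp: emeasure_eq_measure)
    then have "(\<integral>\<^sup>+x\<in>{0..1}. h (e + x) 0 \<partial>lborel) * emeasure M H \<le> c"
      by (rule LIMSEQ_le_const2) (use key[OF e] in \<open>auto simp: p_def\<close>)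
    moreover have "(\<integral>\<^sup>+x\<in>{e..1}. h x 0 \<partial>lborel) \<le> (\<integral>\<^sup>+x\<in>{0..1}. h (e + x) 0 \<partial>lborel)"
      unfolding nn_integral_shift_Icc[OF h_time_measurable] using e by (intro nn_integral_mono) (auto simp: indicator_def)
    ultimately show ?thesis by (meson mult_right_mono order_trans zero_le)
  qed
  have "(\<lambda>n. \<integral>\<^sup>+x\<in>{1 / real (Suc n)..1}. h x 0 \<partial>lborel) \<longlonglongrightarrow> (\<integral>\<^sup>+x. h x 0 * indicator {0<..1} x \<partial>lborel)"
  proof (rule nn_integral_LIMSEQ)
    show "incseq (\<lambda>n x. h x 0 * indicator {1 / real (Suc n)..1} x)"
    proof (rule incseq_SucI, rule le_funI, rule mult_left_mono)
      fix n x
      have "1 / real (Suc (Suc n)) \<le> 1 / real (Suc n)" by (simp add: field_simps)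
      then show "indicator {1 / real (Suc n)..1} x \<le> (indicator {1 / real (Suc (Suc n))..1} x :: ennreal)"
        by (auto simp: indicator_def)
    qed simp
    fix x :: real
    show "(\<lambda>n. h x 0 * indicator {1 / real (Suc n)..1} x) \<longlonglongrightarrow> h x 0 * indicator {0<..1} x"
    proof (cases "0 < x")
      case True
      have "(\<lambda>n. 1 / real (Suc n)) \<longlonglongrightarrow> 0" using LIMSEQ_inverse_real_of_nat by (simp add: inverse_eq_divide)
      then have "eventually (\<lambda>n. 1 / real (Suc n) < x) sequentially" using True by (rule order_tendstoD)
      then show ?thesis by (intro tendsto_eventually, elim eventually_mono) (simp add: indicator_def True)
    next
      case False
      then show ?thesis by (simp add: h_def)
    qed
  qed measurable
  also have "(\<integral>\<^sup>+x. h x 0 * indicator {0<..1} x \<partial>lborel) = (\<integral>\<^sup>+x\<in>{0<..<1}. ennreal (u x) \<partial>lborel)"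
  proof (rule nn_integral_cong_AE)
    show "AE x in lborel. h x 0 * indicator {0<..1} x = ennreal (u x) * indicator {0<..<1} x"
      using AE_lborel_singleton[of 1] by eventually_elim (auto simp: indicator_def h_0)
  qed
  finally have lim: "(\<lambda>n. \<integral>\<^sup>+x\<in>{1 / real (Suc n)..1}. h x 0 \<partial>lborel) \<longlonglongrightarrow> \<infinity>" using inf by simp
  have "emeasure M H = 0"
  proof (rule ccontr)
    assume H0: "emeasure M H \<noteq> 0"
    have "(\<lambda>n. (\<integral>\<^sup>+x\<in>{1 / real (Suc n)..1}. h x 0 \<partial>lborel) * emeasure M H) \<longlonglongrightarrow> \<infinity> * emeasure M H"
      using H0 by (intro tendsto_mult_ennreal lim tendsto_const) auto
    then have "\<infinity> * emeasure M H \<le> c" by (rule LIMSEQ_le_const2) (use key2 in auto)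
    then show False using H0 cfin by (simp add: ennreal_top_mult top_unique)
  qed
  then have "H \<in> null_sets M" by (intro null_setsI) auto
  then show ?thesis unfolding H_def[symmetric] by (rule AE_not_in)
qed

lemma zero_set_trivial:
  assumes inf: "(\<integral>\<^sup>+x\<in>{0<..<1}. ennreal (u x) \<partial>lborel) = \<infinity>"
  shows "AE \<omega> in M. zero_set Y \<omega> = {0}"
proof -
  \<comment> \<open>Countably many windows exhaust the positive times.\<close>
  have "AE \<omega> in M. \<forall>k j :: nat. \<omega> \<notin> (\<Inter>m. \<Union>n. hit (1 / real (Suc k)) (1 / real (Suc k) + real (Suc j)) (1 / real (Suc m)) n)"
    unfolding AE_all_countable by (intro allI no_hit inf) auto
  then show ?thesis using AE_space Y_0
  proof eventually_elim
    case (elim \<omega>)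
    have "Yp z \<omega> \<noteq> 0" if z: "0 < z" for z
    proof
      assume z0: "Yp z \<omega> = 0"
      obtain k where k: "1 / real (Suc k) < z" using nat_approx_posE[OF z] by auto
      obtain j :: nat where j: "z < real j" using reals_Archimedean2 by blast
      have "z < 1 / real (Suc k) + real (Suc j)" using j by (simp add: add_pos_nonneg add_strict_increasing2)
      then have "\<omega> \<in> (\<Inter>m. \<Union>n. hit (1 / real (Suc k)) (1 / real (Suc k) + real (Suc j)) (1 / real (Suc m)) n)"
        by (intro INT_I zero_imp_hit[OF elim(2) less_imp_le[OF k] _ z0] divide_pos_pos) simp_all
      then show False using elim(1) by blast
    qed
    then have "zeros \<omega> = {0}" using elim by (auto simp: zeros_def Yp_def le_less)
    then show ?case by (simp add: zero_set_eq)
  qed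
qed

end

section \<open>Non-triviality and positive Lebesgue measure\<close>

context local_time_process
begin

text \<open>The inverse at half of the local time collected up to 1 is a zero, and it is positive
  since the local time starts at 0.\<close>

lemma zero_set_nontrivial: "\<not> (AE \<omega> in M. zero_set Y \<omega> = {0})"
proof
  assume "AE \<omega> in M. zero_set Y \<omega> = {0}"
  then have "AE \<omega> in M. False" using AE_G2
  proof eventually_elim
    case (elim \<omega>)
    have "ell 0 \<omega> < ell 1 \<omega>"
      by (rule ell_increases_at_zero[OF elim(2), of 0 0]) (use G_0[OF G2_G[OF elim(2)]] in auto)
    then have x: "0 < ell 1 \<omega> / 2" "ell 1 \<omega> / 2 < ell 1 \<omega>" by (auto simp: ell_0)
    define x where "x = ell 1 \<omega> / 2"
    have "S x \<omega> < ennreal 1" using S_less_iff[of x 1 \<omega>] x by (simp add: x_def)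
    then obtain s where s: "S x \<omega> = ennreal s" "0 \<le> s" by (cases "S x \<omega>") auto
    have "ell s \<omega> = x" using ell_S[OF _ s] x by (simp add: x_def)
    then have "s \<noteq> 0" using x by (auto simp: x_def ell_0)
    moreover have "Yp s \<omega> = 0" using Y_S_eq_0[OF G2_G[OF elim(2)] _ s] x by (simp add: x_def)
    then have "s \<in> zero_set Y \<omega>" using s closure_subset[of "zeros \<omega>"] by (auto simp: zero_set_eq zeros_def)
    ultimately show False using elim(1) by simp
  qed
  then show False by (simp add: AE_False)
qed

text \<open>The kernel is at most \<open>K\<close> on the zeros and converges boundedly to 0 off
  them.\<close>

lemma ell_le_Lebesgue:
  assumes \<omega>: "\<omega> \<in> G" and K: "\<And>e. 0 < e \<Longrightarrow> u e \<le> K" and ab: "0 \<le> a" "a \<le> b"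
  shows "ennreal (ell b \<omega> - ell a \<omega>) \<le> ennreal K * emeasure lborel (zeros \<omega> \<inter> {a..b})"
proof -
  have [measurable]: "zeros \<omega> \<in> sets borel" "(\<lambda>s. Yp s \<omega>) \<in> borel_measurable borel"
    using G_space[OF \<omega>] zeros_measurable Yp_time_measurable by auto
  have hK: "h e y \<le> ennreal K" for e y
    using order_trans[OF h_le[of e y]] K[of e] by (cases "0 < e") (auto simp: h_0 ennreal_leI, simp add: h_def)
  have A_le: "A (eps n) a b \<omega> \<le> ennreal K * emeasure lborel (zeros \<omega> \<inter> {a..b})
      + (\<integral>\<^sup>+s. h (eps n) (Yp s \<omega>) * indicator ({a..b} - zeros \<omega>) s \<partial>lborel)" for n
  proof -
    have "A (eps n) a b \<omega> \<le> (\<integral>\<^sup>+s. ennreal K * indicator (zeros \<omega> \<inter> {a..b}) s + h (eps n) (Yp s \<omega>) * indicator ({a..b} - zeros \<omega>) s \<partial>lborel)"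
      unfolding A_def N_def by (intro nn_integral_mono) (auto simp: indicator_def hK)
    then show ?thesis by (subst (asm) nn_integral_add) (auto simp: nn_integral_cmult_indicator)
  qed
  have "(\<lambda>n. \<integral>\<^sup>+s. h (eps n) (Yp s \<omega>) * indicator ({a..b} - zeros \<omega>) s \<partial>lborel) \<longlonglongrightarrow> (\<integral>\<^sup>+(s::real). 0 \<partial>lborel)"
  proof (rule nn_integral_dominated_convergence[where w="\<lambda>s. ennreal K * indicator {a..b} s"])
    show "(\<integral>\<^sup>+s. ennreal K * indicator {a..b} s \<partial>lborel) < \<infinity>" using ab by (simp add: nn_integral_cmult_indicator ennreal_mult_less_top)
    show "AE s in lborel. h (eps n) (Yp s \<omega>) * indicator ({a..b} - zeros \<omega>) s \<le> ennreal K * indicator {a..b} s" for n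
      by (intro AE_I2) (auto simp: indicator_def hK)
    show "AE s in lborel. (\<lambda>n. h (eps n) (Yp s \<omega>) * indicator ({a..b} - zeros \<omega>) s) \<longlonglongrightarrow> 0"
    proof (rule AE_I2)
      fix s
      show "(\<lambda>n. h (eps n) (Yp s \<omega>) * indicator ({a..b} - zeros \<omega>) s) \<longlonglongrightarrow> 0"
        using h_eps_tendsto[of "Yp s \<omega>"] ab
        by (cases "s \<in> {a..b} - zeros \<omega>") (auto simp: zeros_def zero_less_iff_neq_zero)
    qed
  qed auto
  then have "(\<lambda>n. ennreal K * emeasure lborel (zeros \<omega> \<inter> {a..b})
      + (\<integral>\<^sup>+s. h (eps n) (Yp s \<omega>) * indicator ({a..b} - zeros \<omega>) s \<partial>lborel)) \<longlonglongrightarrow> ennreal K * emeasure lborel (zeros \<omega> \<inter> {a..b}) + 0"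
    by (intro tendsto_add tendsto_const) simp
  moreover have "(\<lambda>n. A (eps n) a b \<omega>) \<longlonglongrightarrow> ennreal (ell b \<omega> - ell a \<omega>)"
    unfolding A_eq_X_diff(1)[OF G_space[OF \<omega>] ab]
    using ab by (intro tendsto_ennrealI tendsto_diff X_tendsto_ell[OF \<omega>]) auto
  ultimately show ?thesis using A_le by (intro LIMSEQ_le[of "\<lambda>n. A (eps n) a b \<omega>"]) auto
qed

lemma positive_Lebesgue_at_zero:
  assumes \<omega>: "\<omega> \<in> G2" and K: "\<And>e. 0 < e \<Longrightarrow> u e \<le> K"
    and s: "s \<in> \<rat>" "0 \<le> s" "s \<le> z" and z: "Yp z \<omega> = 0" and t: "z < t"
  shows "0 < emeasure lborel (zeros \<omega> \<inter> {s..t})"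
proof (rule ccontr)
  assume "\<not> 0 < emeasure lborel (zeros \<omega> \<inter> {s..t})"
  then have "emeasure lborel (zeros \<omega> \<inter> {s..t}) = 0" by (simp add: zero_less_iff_neq_zero)
  with ell_le_Lebesgue[OF G2_G[OF \<omega>] K s(2), of t] s t have "ennreal (ell t \<omega> - ell s \<omega>) \<le> 0" by simp
  then show False using ell_increases_at_zero[OF \<omega> s z t] by (simp add: ennreal_eq_0_iff)
qed

lemma positive_Lebesgue:
  assumes K: "\<And>e. 0 < e \<Longrightarrow> u e \<le> K" shows "AE \<omega> in M. 0 < emeasure lborel (zero_set Y \<omega>)"
  using AE_G2
proof eventually_elim
  case (elim \<omega>)
  have "0 < emeasure lborel (zeros \<omega> \<inter> {0..1})"
    by (rule positive_Lebesgue_at_zero[OF elim K, of 0 0]) (use G_0[OF G2_G[OF elim]] in auto)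
  also have "\<dots> \<le> emeasure lborel (zeros \<omega>)"
    using zeros_measurable[OF G_space[OF G2_G[OF elim]]] by (intro emeasure_mono) auto
  finally show ?case using emeasure_zero_set[OF G_space[OF G2_G[OF elim]]] by simp
qed

end

section \<open>Zero Lebesgue measure under an unbounded potential density\<close>

context laplace_flow_process
begin

lemma null_Lebesgue:
  assumes unb: "\<And>K. \<exists>e>0. K \<le> u e"
  shows "AE \<omega> in M. emeasure lborel (zero_set Y \<omega>) = 0"
proof -
  interpret P: pair_sigma_finite lborel M ..
  have P0: "emeasure M {\<omega>\<in>space M. Yp t \<omega> = 0} = 0" if t: "0 < t" for t
  proof -
    have le: "ennreal (u e) * emeasure M {\<omega>\<in>space M. Yp t \<omega> = 0} \<le> ennreal (u t)" if e: "0 < e" for e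
    proof -
      have "ennreal (u e) * emeasure M {\<omega>\<in>space M. Yp t \<omega> = 0} = (\<integral>\<^sup>+\<omega>. ennreal (u e) * indicator {\<omega>\<in>space M. Yp t \<omega> = 0} \<omega> \<partial>M)"
        by (rule nn_integral_cmult_indicator[symmetric]) measurable
      also have "\<dots> \<le> (\<integral>\<^sup>+\<omega>. N e t \<omega> \<partial>M)"
        by (intro nn_integral_mono) (auto simp: indicator_def N_def h_0 e)
      also have "\<dots> = h (e + t) 0" using t e by (intro expectation_N) auto
      also have "\<dots> \<le> ennreal (u t)" using h_0_antimono[of t "e + t"] t e by (simp add: h_0)
      finally show ?thesis .
    qed
    have "measure M {\<omega>\<in>space M. Yp t \<omega> = 0} \<le> 0 + d" if d: "0 < d" for d
    proof -
      \<comment> \<open>By \<open>le\<close> the probability is at most \<open>u t / u e\<close>;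
        unboundedness of \<open>u\<close> brings this below \<open>d\<close>.\<close>
      obtain e where e: "0 < e" "u t / d \<le> u e" using unb by blast
      have "u e * measure M {\<omega>\<in>space M. Yp t \<omega> = 0} \<le> u t"
        using le[OF e(1)] u_pos[OF e(1)] u_pos[OF t] by (simp add: emeasure_eq_measure flip: ennreal_mult)
      then have "measure M {\<omega>\<in>space M. Yp t \<omega> = 0} \<le> u t / u e" using u_pos[OF e(1)] by (simp add: field_simps)
      also have "\<dots> \<le> d" using e d u_pos[OF e(1)] by (simp add: field_simps)
      finally show ?thesis by simp
    qed
    then have "measure M {\<omega>\<in>space M. Yp t \<omega> = 0} \<le> 0" by (rule field_le_epsilon)
    then show ?thesis by (simp add: emeasure_eq_measure measure_le_0_iff)
  qed
  have m: "(\<lambda>z. if 0 \<le> fst z \<and> Yp (fst z) (snd z) = 0 then 1 else 0 :: ennreal) \<in> borel_measurable (lborel \<Otimes>\<^sub>M M)"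
    by measurable
  have "(\<integral>\<^sup>+\<omega>. emeasure lborel (zeros \<omega>) \<partial>M) = (\<integral>\<^sup>+\<omega>. (\<integral>\<^sup>+t. (if 0 \<le> t \<and> Yp t \<omega> = 0 then 1 else 0) \<partial>lborel) \<partial>M)"
  proof (rule nn_integral_cong)
    fix \<omega> assume "\<omega> \<in> space M"
    then have "zeros \<omega> \<in> sets lborel" using zeros_measurable by simp
    from nn_integral_indicator[OF this, symmetric]
    show "emeasure lborel (zeros \<omega>) = (\<integral>\<^sup>+t. (if 0 \<le> t \<and> Yp t \<omega> = 0 then 1 else 0) \<partial>lborel)"
      by (simp add: zeros_def indicator_def of_bool_def)
  qed
  also have "\<dots> = (\<integral>\<^sup>+t. (\<integral>\<^sup>+\<omega>. (if 0 \<le> t \<and> Yp t \<omega> = 0 then 1 else 0) \<partial>M) \<partial>lborel)"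
    by (rule P.Fubini') (use m in \<open>simp add: case_prod_beta'\<close>)
  also have "\<dots> = (\<integral>\<^sup>+(t::real). 0 \<partial>lborel)"
  proof (rule nn_integral_cong_AE)
    show "AE t in lborel. (\<integral>\<^sup>+\<omega>. (if 0 \<le> t \<and> Yp t \<omega> = 0 then 1 else 0) \<partial>M) = 0"
      using AE_lborel_singleton[of 0]
    proof eventually_elim
      case (elim t)
      show ?case
      proof (cases "0 \<le> t")
        case True
        have "(\<integral>\<^sup>+\<omega>. (if 0 \<le> t \<and> Yp t \<omega> = 0 then 1 else 0) \<partial>M) = (\<integral>\<^sup>+\<omega>. indicator {\<omega>\<in>space M. Yp t \<omega> = 0} \<omega> \<partial>M)"
          using True by (intro nn_integral_cong) (auto simp: indicator_def)
        also have "\<dots> = emeasure M {\<omega>\<in>space M. Yp t \<omega> = 0}" by (rule nn_integral_indicator) measurable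
        also have "\<dots> = 0" using True elim by (intro P0) auto
        finally show ?thesis .
      qed simp
    qed
  qed
  finally have "(\<integral>\<^sup>+\<omega>. emeasure lborel (zeros \<omega>) \<partial>M) = 0" by simp
  moreover have "(\<lambda>\<omega>. emeasure lborel (zeros \<omega>)) \<in> borel_measurable M"
  proof -
    have "(\<lambda>z. if 0 \<le> snd z \<and> Yp (snd z) (fst z) = 0 then 1 else 0 :: ennreal) \<in> borel_measurable (M \<Otimes>\<^sub>M lborel)" by measurable
    then have "(\<lambda>\<omega>. \<integral>\<^sup>+t. (if 0 \<le> t \<and> Yp t \<omega> = 0 then 1 else 0) \<partial>lborel) \<in> borel_measurable M"
      by (intro lborel.borel_measurable_nn_integral) (simp add: case_prod_beta')
    then show ?thesis
    proof (rule measurable_cong[THEN iffD1, rotated])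
      fix \<omega> assume "\<omega> \<in> space M"
      then have "zeros \<omega> \<in> sets lborel" using zeros_measurable by simp
      from nn_integral_indicator[OF this]
      show "(\<integral>\<^sup>+t. (if 0 \<le> t \<and> Yp t \<omega> = 0 then 1 else 0) \<partial>lborel) = emeasure lborel (zeros \<omega>)"
        by (simp add: zeros_def indicator_def of_bool_def)
    qed
  qed
  ultimately have "AE \<omega> in M. emeasure lborel (zeros \<omega>) = 0" by (subst (asm) nn_integral_0_iff_AE) auto
  then show ?thesis using AE_space by eventually_elim (simp add: emeasure_zero_set)
qed

end

section \<open>Intervals of zeros\<close>

lemma dyadic_between:
  fixes a b :: real assumes "0 \<le> a" "a < b"
  obtains n k :: nat where "a < real k / 2 ^ n" "real k / 2 ^ n < b"
proof -
  have "eventually (\<lambda>n. (of_int \<lfloor>a * 2 ^ n\<rfloor> + 1) / (2::real) ^ n \<in> {a<..<b}) sequentially"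
  proof (rule eventually_compose_filterlim[OF _ dyadic_from_right])
    show "eventually (\<lambda>x. x \<in> {a<..<b}) (at_right a)" using assms(2) by (rule eventually_at_right_real)
  qed
  then obtain n where n: "(of_int \<lfloor>a * 2 ^ n\<rfloor> + 1) / (2::real) ^ n \<in> {a<..<b}"
    using eventually_happens'[OF sequentially_bot] by blast
  have "real (nat (\<lfloor>a * 2 ^ n\<rfloor> + 1)) = of_int \<lfloor>a * 2 ^ n\<rfloor> + 1" using assms(1) by simp
  then show thesis using n that[of "nat (\<lfloor>a * 2 ^ n\<rfloor> + 1)" n] by simp
qed

text \<open>With \<open>p\<close> the predicate of being a zero, this counts the ends of zero
  intervals seen by the grid of level \<open>n\<close>; a bound over all levels will mean finitely
  many such ends.\<close>

definition exits :: "(real \<Rightarrow> bool) \<Rightarrow> nat \<Rightarrow> nat \<Rightarrow> nat" where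
  "exits p n i = (\<Sum>k<i. if p (real k / 2 ^ n) \<and> \<not> p ((real k + 1) / 2 ^ n) then 1 else 0)"

lemma exits_mono: "i \<le> j \<Longrightarrow> exits p n i \<le> exits p n j"
  unfolding exits_def by (rule sum_mono2) auto

text \<open>Whatever \<open>p\<close> is at the midpoint, an exit over a cell is also an exit over
  one of its halves.\<close>

lemma exits_refine: "exits p n i \<le> exits p (Suc n) (2 * i)"
proof (induction i)
  case (Suc i)
  have 1: "real (2 * i) / 2 ^ Suc n = real i / 2 ^ n" "(real (2 * i + 1) + 1) / 2 ^ Suc n = (real i + 1) / 2 ^ n"
    "(real (2 * i) + 1) / 2 ^ Suc n = real (2 * i + 1) / 2 ^ Suc n" by (simp_all add: field_simps)
  have "exits p (Suc n) (2 * Suc i) = exits p (Suc n) (2 * i)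
    + (if p (real (2 * i) / 2 ^ Suc n) \<and> \<not> p ((real (2 * i) + 1) / 2 ^ Suc n) then 1 else 0)
    + (if p (real (2 * i + 1) / 2 ^ Suc n) \<and> \<not> p ((real (2 * i + 1) + 1) / 2 ^ Suc n) then 1 else 0)"
    unfolding exits_def by simp
  moreover have "exits p n (Suc i) = exits p n i + (if p (real i / 2 ^ n) \<and> \<not> p ((real i + 1) / 2 ^ n) then 1 else 0)"
    unfolding exits_def by simp
  ultimately show ?case using Suc unfolding 1 by auto
qed (simp add: exits_def)

lemma exits_refine': "exits p n i \<le> exits p (n + d) (i * 2 ^ d)"
proof (induction d)
  case (Suc d)
  then show ?case using exits_refine[of p "n + d" "i * 2 ^ d"] by (simp add: ac_simps)
qed simp

lemma exits_step:
  assumes "i < j" "p (real i / 2 ^ n)" "\<not> p (real j / 2 ^ n)"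
  shows "exits p n i + 1 \<le> exits p n j"
proof -
  obtain k where k: "i \<le> k" "k < j" "p (real k / 2 ^ n)" "\<not> p ((real k + 1) / 2 ^ n)"
  proof -
    have "\<exists>k\<ge>i. k < j \<and> p (real k / 2 ^ n) \<and> \<not> p (real (Suc k) / 2 ^ n)"
    proof (rule ccontr)
      assume no: "\<not> ?thesis"
      have "p (real k / 2 ^ n)" if "i \<le> k" "k \<le> j" for k
        using that
      proof (induction k rule: dec_induct)
        case base then show ?case using assms by simp
      next
        case (step m) then show ?case using no by auto
      qed
      then show False using assms by auto
    qed
    then show thesis using that by (auto simp: add.commute)
  qed
  have "exits p n i + 1 \<le> exits p n k + 1" using exits_mono[OF k(1)] by simp
  also have "\<dots> = exits p n (Suc k)" using k by (simp add: exits_def)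
  also have "\<dots> \<le> exits p n j" using k by (intro exits_mono) auto
  finally show ?thesis .
qed

text \<open>The level is quantified, so that exits found on different grids can be collected on a
  common refinement.\<close>

definition exits_at :: "(real \<Rightarrow> bool) \<Rightarrow> nat \<Rightarrow> real \<Rightarrow> bool" where
  "exits_at p N t \<longleftrightarrow> (\<exists>n i. t = real i / 2 ^ n \<and> N \<le> exits p n i)"

lemma exits_at_step:
  assumes t0: "exits_at p N t0" and "t0 \<le> s" "s < t" and s: "s = real k / 2 ^ n" "p s" and t: "t = real l / 2 ^ m" "\<not> p t"
  shows "exits_at p (Suc N) t"
proof -
  obtain n0 i0 where t0: "t0 = real i0 / 2 ^ n0" "N \<le> exits p n0 i0" using t0 by (auto simp: exits_at_def)
  \<comment> \<open>The sum of the levels is a common refinement of the three grids.\<close>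
  define r where "r = n0 + n + m"
  have lvl: "t0 = real (i0 * 2 ^ (n + m)) / 2 ^ r" "s = real (k * 2 ^ (n0 + m)) / 2 ^ r" "t = real (l * 2 ^ (n0 + n)) / 2 ^ r"
    unfolding r_def t0(1) s(1) t(1) by (simp_all add: power_add)
  have lt: "k * 2 ^ (n0 + m) < l * 2 ^ (n0 + n)" and le: "i0 * 2 ^ (n + m) \<le> k * 2 ^ (n0 + m)"
  proof -
    have "real (k * 2 ^ (n0 + m)) < real (l * 2 ^ (n0 + n))"
      using assms(3) unfolding lvl(2,3) by (simp only: divide_less_cancel) auto
    then show "k * 2 ^ (n0 + m) < l * 2 ^ (n0 + n)" by (simp only: of_nat_less_iff)
    have "real (i0 * 2 ^ (n + m)) \<le> real (k * 2 ^ (n0 + m))"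
      using assms(2) unfolding lvl(1,2) by (simp only: divide_le_cancel) auto
    then show "i0 * 2 ^ (n + m) \<le> k * 2 ^ (n0 + m)" by (simp only: of_nat_le_iff)
  qed
  have "Suc N \<le> exits p n0 i0 + 1" using t0 by simp
  also have "\<dots> \<le> exits p r (i0 * 2 ^ (n + m)) + 1"
    using exits_refine'[of p n0 i0 "n + m"] by (simp add: r_def add.assoc)
  also have "\<dots> \<le> exits p r (k * 2 ^ (n0 + m)) + 1" using exits_mono[OF le] by simp
  also have "\<dots> \<le> exits p r (l * 2 ^ (n0 + n))"
    using s(2) t(2) unfolding lvl(2,3) by (intro exits_step lt)
  finally show ?thesis unfolding exits_at_def using lvl(3) by blast
qed

lemma exits_at_bound:
  assumes "exits_at p N t" "t \<le> real K" and B: "\<And>n. exits p n (K * 2 ^ n) \<le> B"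
  shows "N \<le> B"
proof -
  obtain n i where i: "t = real i / 2 ^ n" "N \<le> exits p n i" using assms(1) by (auto simp: exits_at_def)
  have "real i \<le> real (K * 2 ^ n)" using assms(2) i(1) by (simp add: field_simps)
  then have "i \<le> K * 2 ^ n" by (simp only: of_nat_le_iff)
  then show ?thesis using i(2) B[of n] exits_mono[of i "K * 2 ^ n" p n] by linarith
qed

text \<open>Otherwise exits accumulate at \<open>z\<close> from the left: each new one is sought
  after the last, and the count exceeds \<open>B\<close>.\<close>

lemma no_exits_left:
  assumes z: "0 < z" "z \<le> real K" and B: "\<And>n. exits p n (K * 2 ^ n) \<le> B"
  shows "\<exists>\<delta>>0. \<forall>k n l m. z - \<delta> < real k / 2 ^ n \<and> real k / 2 ^ n < real l / 2 ^ m \<and> real l / 2 ^ m < z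
      \<and> p (real k / 2 ^ n) \<longrightarrow> p (real l / 2 ^ m)"
proof (rule ccontr)
  assume no: "\<not> ?thesis"
  have "\<exists>t<z. exits_at p N t" for N
  proof (induction N)
    case 0
    show ?case using z by (intro exI[of _ 0]) (auto simp: exits_at_def exits_def intro!: exI[of _ 0])
  next
    case (Suc N)
    then obtain t0 where t0: "t0 < z" "exits_at p N t0" by blast
    then have "0 < z - t0" by simp
    with no obtain k n l m where st: "z - (z - t0) < real k / 2 ^ n" "real k / 2 ^ n < real l / 2 ^ m" "real l / 2 ^ m < z"
      "p (real k / 2 ^ n)" "\<not> p (real l / 2 ^ m)" by blast
    have "exits_at p (Suc N) (real l / 2 ^ m)"
      by (rule exits_at_step[OF t0(2) _ st(2) refl st(4) refl st(5)]) (use st in simp)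
    then show ?case using st(3) by blast
  qed
  then obtain t where t: "t < z" "exits_at p (Suc B) t" by blast
  have "Suc B \<le> B" by (rule exits_at_bound[OF t(2) _ B]) (use t z in linarith)
  then show False by simp
qed

text \<open>Exits accumulating at \<open>z\<close> from the right have to be collected backwards:
  the new exit is chosen first, then the others between \<open>z\<close> and it. Hence the induction
  over all \<open>\<delta>\<close> at once.\<close>

lemma no_exits_right:
  assumes z: "0 \<le> z" "z + 1 \<le> real K" and B: "\<And>n. exits p n (K * 2 ^ n) \<le> B"
  shows "\<exists>\<delta>>0. \<forall>k n l m. z < real k / 2 ^ n \<and> real k / 2 ^ n < real l / 2 ^ m \<and> real l / 2 ^ m < z + \<delta>
      \<and> p (real k / 2 ^ n) \<longrightarrow> p (real l / 2 ^ m)"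
proof (rule ccontr)
  assume no: "\<not> ?thesis"
  have "\<forall>\<delta>>0. \<exists>t. z < t \<and> t < z + \<delta> \<and> exits_at p N t" for N
  proof (induction N)
    case 0
    show ?case
    proof (intro allI impI)
      fix \<delta> :: real assume "0 < \<delta>"
      then obtain n k where "z < real k / 2 ^ n" "real k / 2 ^ n < z + \<delta>"
        by (metis dyadic_between less_add_same_cancel1 z(1))
      then show "\<exists>t. z < t \<and> t < z + \<delta> \<and> exits_at p 0 t" by (auto simp: exits_at_def)
    qed
  next
    case (Suc N)
    show ?case
    proof (intro allI impI)
      fix \<delta> :: real assume "0 < \<delta>"
      with no obtain k n l m where st: "z < real k / 2 ^ n" "real k / 2 ^ n < real l / 2 ^ m" "real l / 2 ^ m < z + \<delta>"
        "p (real k / 2 ^ n)" "\<not> p (real l / 2 ^ m)" by blast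
      from st(1) Suc obtain t0 where t0: "z < t0" "t0 < z + (real k / 2 ^ n - z)" "exits_at p N t0"
        by (metis diff_gt_0_iff_gt)
      have "exits_at p (Suc N) (real l / 2 ^ m)"
        by (rule exits_at_step[OF t0(3) _ st(2) refl st(4) refl st(5)]) (use t0 in simp)
      then show "\<exists>t. z < t \<and> t < z + \<delta> \<and> exits_at p (Suc N) t" using st by (intro exI[of _ "real l / 2 ^ m"]) auto
    qed
  qed
  then obtain t where t: "t < z + 1" "exits_at p (Suc B) t" using zero_less_one by blast
  have "Suc B \<le> B" by (rule exits_at_bound[OF t(2) _ B]) (use t z in linarith)
  then show False by simp
qed

section \<open>Persistence of zeros along grids\<close>

context laplace_flow_process
begin

lemma markov_N_Fb:
  assumes C: "C \<in> sets (Fb s)" and s: "0 \<le> s" "0 \<le> t" "0 < e"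
  shows "(\<integral>\<^sup>+\<omega>\<in>C. N e (s + t) \<omega> \<partial>M) = (\<integral>\<^sup>+\<omega>\<in>C. N (e + t) s \<omega> \<partial>M)"
proof -
  obtain B where B: "B \<in> sets (F s)" and CB: "AE \<omega> in M. \<omega> \<in> C \<longleftrightarrow> \<omega> \<in> B"
    using C by (auto simp: sets_Fb)
  have eq: "(\<integral>\<^sup>+\<omega>\<in>C. f \<omega> \<partial>M) = (\<integral>\<^sup>+\<omega>. f \<omega> * indicator B \<omega> \<partial>M)" for f
    by (rule nn_integral_cong_AE) (use CB in \<open>eventually_elim, auto simp: indicator_def\<close>)
  show ?thesis unfolding eq using B s by (intro markov_N) auto
qed

lemma zero_N_integral:
  assumes C: "C \<in> sets (Fb s)" and s: "0 \<le> s" "0 \<le> t" "0 < e" and zero: "\<And>\<omega>. \<omega> \<in> C \<Longrightarrow> Yp s \<omega> = 0"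
  shows "(\<integral>\<^sup>+\<omega>\<in>C. N e (s + t) \<omega> \<partial>M) = ennreal (u (e + t) * measure M C)"
proof -
  have [measurable]: "C \<in> sets M" using Fb_sets[OF C] .
  have "(\<integral>\<^sup>+\<omega>\<in>C. N e (s + t) \<omega> \<partial>M) = (\<integral>\<^sup>+\<omega>. ennreal (u (e + t)) * indicator C \<omega> \<partial>M)"
    unfolding markov_N_Fb[OF C s] using zero s
    by (intro nn_integral_cong) (auto simp: indicator_def N_def h_0)
  then show ?thesis using u_pos[of "e + t"] s
    by (simp add: nn_integral_cmult_indicator emeasure_eq_measure ennreal_mult)
qed

text \<open>On zeros \<open>N e\<close> equals \<open>u e\<close>, so a single \<open>e\<close>
  bounds the probability from above by the ratio \<open>u (e + t) / u e\<close>.\<close>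

lemma zero_stays_le:
  assumes C: "C \<in> sets (Fb s)" and s: "0 \<le> s" "0 \<le> t" and zero: "\<And>\<omega>. \<omega> \<in> C \<Longrightarrow> Yp s \<omega> = 0"
    and e: "0 < e" "u (e + t) \<le> q * u e"
  shows "measure M {\<omega>\<in>C. Yp (s + t) \<omega> = 0} \<le> q * measure M C"
proof -
  have [measurable]: "C \<in> sets M" using Fb_sets[OF C] .
  have eq: "{\<omega>\<in>C. Yp (s + t) \<omega> = 0} = C \<inter> {\<omega>\<in>space M. Yp (s + t) \<omega> = 0}"
    using sets.sets_into_space[of C M] by auto
  have [measurable]: "{\<omega>\<in>C. Yp (s + t) \<omega> = 0} \<in> sets M" unfolding eq by measurable
  have "ennreal (u e * measure M {\<omega>\<in>C. Yp (s + t) \<omega> = 0}) = (\<integral>\<^sup>+\<omega>. ennreal (u e) * indicator {\<omega>\<in>C. Yp (s + t) \<omega> = 0} \<omega> \<partial>M)"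
    using u_pos[OF e(1)] by (simp add: nn_integral_cmult_indicator emeasure_eq_measure ennreal_mult)
  also have "\<dots> \<le> (\<integral>\<^sup>+\<omega>\<in>C. N e (s + t) \<omega> \<partial>M)"
    by (intro nn_integral_mono) (auto simp: indicator_def N_def h_0 e)
  also have "\<dots> = ennreal (u (e + t) * measure M C)" by (rule zero_N_integral[OF C s e(1) zero])
  finally have "u e * measure M {\<omega>\<in>C. Yp (s + t) \<omega> = 0} \<le> u (e + t) * measure M C"
    using u_pos[of "e + t"] e s by (subst (asm) ennreal_le_iff) auto
  also have "\<dots> \<le> q * u e * measure M C" using e by (intro mult_right_mono) auto
  finally have "u e * measure M {\<omega>\<in>C. Yp (s + t) \<omega> = 0} \<le> u e * (q * measure M C)" by (simp add: ac_simps)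
  then show ?thesis using u_pos[OF e(1)] by simp
qed

text \<open>As \<open>e\<close> tends to 0, \<open>N e / u e\<close> converges to the indicator of a
  zero, because \<open>v e\<close> tends to infinity. So a lower bound on the ratio for all
  \<open>e\<close> becomes one on the probability.\<close>

lemma zero_stays_ge:
  assumes C: "C \<in> sets (Fb s)" and s: "0 \<le> s" "0 \<le> t" and zero: "\<And>\<omega>. \<omega> \<in> C \<Longrightarrow> Yp s \<omega> = 0"
    and q: "0 \<le> q" "\<And>e. 0 < e \<Longrightarrow> q * u e \<le> u (e + t)"
  shows "q * measure M C \<le> measure M {\<omega>\<in>C. Yp (s + t) \<omega> = 0}"
proof -
  have [measurable]: "C \<in> sets M" using Fb_sets[OF C] .
  have eq: "{\<omega>\<in>C. Yp (s + t) \<omega> = 0} = C \<inter> {\<omega>\<in>space M. Yp (s + t) \<omega> = 0}"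
    using sets.sets_into_space[of C M] by auto
  have [measurable]: "{\<omega>\<in>C. Yp (s + t) \<omega> = 0} \<in> sets M" unfolding eq by measurable
  define e where "e n = 1 / real (Suc n)" for n
  have e: "0 < e n" for n by (simp add: e_def)
  have "e \<longlonglongrightarrow> 0" unfolding e_def using LIMSEQ_inverse_real_of_nat by (simp add: inverse_eq_divide)
  then have "filterlim e (at_right 0) sequentially"
    by (rule tendsto_imp_filterlim_at_right) (simp add: e)
  from filterlim_compose[OF v_at_top this] have ve: "filterlim (\<lambda>n. v (e n)) at_top sequentially" .
  have "(\<lambda>n. \<integral>\<^sup>+\<omega>\<in>C. ennreal (exp_neg (v (e n)) (Yp (s + t) \<omega>)) \<partial>M) \<longlonglongrightarrow> (\<integral>\<^sup>+\<omega>. indicator {\<omega>\<in>C. Yp (s + t) \<omega> = 0} \<omega> \<partial>M)"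
  proof (rule nn_integral_dominated_convergence[where w="\<lambda>_. 1"])
    show "AE \<omega> in M. ennreal (exp_neg (v (e n)) (Yp (s + t) \<omega>)) * indicator C \<omega> \<le> 1" for n
      using exp_neg_bounds(2)[OF less_imp_le[OF v_pos[OF e[of n]]]] by (intro AE_I2) (auto simp: indicator_def)
    show "AE \<omega> in M. (\<lambda>n. ennreal (exp_neg (v (e n)) (Yp (s + t) \<omega>)) * indicator C \<omega>) \<longlonglongrightarrow> indicator {\<omega>\<in>C. Yp (s + t) \<omega> = 0} \<omega>"
    proof (rule AE_I2)
      fix \<omega>
      have "(\<lambda>n. ennreal (exp_neg (v (e n)) (Yp (s + t) \<omega>))) \<longlonglongrightarrow> 0" if nz: "Yp (s + t) \<omega> \<noteq> 0"
      proof (cases "Yp (s + t) \<omega>")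
        case (real y)
        with nz have y: "0 < y" by (cases "y = 0") auto
        have "filterlim (\<lambda>n. v (e n) * y) at_top sequentially"
          by (rule filterlim_tendsto_pos_mult_at_top[OF tendsto_const y ve, simplified mult.commute[of y]])
        then have "filterlim (\<lambda>n. - (v (e n) * y)) at_bot sequentially" by (simp add: filterlim_uminus_at_bot)
        from filterlim_compose[OF exp_at_bot this]
        have "(\<lambda>n. ennreal (exp (- (v (e n) * y)))) \<longlonglongrightarrow> ennreal 0" by (intro tendsto_ennrealI)
        then show ?thesis using real by (simp add: exp_neg_def)
      qed (simp add: exp_neg_def)
      then show "(\<lambda>n. ennreal (exp_neg (v (e n)) (Yp (s + t) \<omega>)) * indicator C \<omega>) \<longlonglongrightarrow> indicator {\<omega>\<in>C. Yp (s + t) \<omega> = 0} \<omega>"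
        by (cases "\<omega> \<in> C"; cases "Yp (s + t) \<omega> = 0") auto
    qed
  qed (auto simp: emeasure_space_1)
  then have lim: "(\<lambda>n. \<integral>\<^sup>+\<omega>\<in>C. ennreal (exp_neg (v (e n)) (Yp (s + t) \<omega>)) \<partial>M) \<longlonglongrightarrow> ennreal (measure M {\<omega>\<in>C. Yp (s + t) \<omega> = 0})"
    by (simp add: emeasure_eq_measure)
  have "ennreal (q * measure M C) \<le> (\<integral>\<^sup>+\<omega>\<in>C. ennreal (exp_neg (v (e n)) (Yp (s + t) \<omega>)) \<partial>M)" for n
  proof -
    have ue: "0 < u (e n)" using u_pos[OF e] .
    have "ennreal (u (e n)) * (\<integral>\<^sup>+\<omega>\<in>C. ennreal (exp_neg (v (e n)) (Yp (s + t) \<omega>)) \<partial>M) = (\<integral>\<^sup>+\<omega>\<in>C. N (e n) (s + t) \<omega> \<partial>M)"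
      using ue e[of n] by (subst nn_integral_cmult[symmetric]) (auto simp: N_def h_def ennreal_mult exp_neg_bounds mult.assoc intro!: nn_integral_cong)
    also have "\<dots> = ennreal (u (e n + t) * measure M C)" by (rule zero_N_integral[OF C s e zero])
    also have "\<dots> \<ge> ennreal (q * u (e n) * measure M C)" using q(2)[OF e] by (intro ennreal_leI mult_right_mono) auto
    also have "ennreal (q * u (e n) * measure M C) = ennreal (u (e n)) * ennreal (q * measure M C)"
      using q ue by (simp add: ennreal_mult[symmetric] ac_simps)
    finally show ?thesis using ue by (simp add: ennreal_mult_le_mult_iff)
  qed
  then have "ennreal (q * measure M C) \<le> ennreal (measure M {\<omega>\<in>C. Yp (s + t) \<omega> = 0})"
    by (intro LIMSEQ_le_const[OF lim]) auto
  then show ?thesis by (subst (asm) ennreal_le_iff) auto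
qed

definition grid_zero :: "real \<Rightarrow> real \<Rightarrow> nat \<Rightarrow> 'a set" where
  "grid_zero s t m = {\<omega>\<in>space M. \<forall>k\<le>m. Yp (s + t * real k) \<omega> = 0}"

lemma grid_zero_Fb: assumes "0 \<le> s" "0 \<le> t" shows "grid_zero s t m \<in> sets (Fb (s + t * real m))"
proof -
  have "Yp (s + t * real k) \<in> borel_measurable (Fb (s + t * real m))" if "k \<le> m" for k
    using assms that by (intro Fb_measurable_mono[OF _ Yp_Fb_measurable]) (auto intro: mult_left_mono)
  then have "{\<omega>\<in>space (Fb (s + t * real m)). Yp (s + t * real k) \<omega> = 0} \<in> sets (Fb (s + t * real m))" if "k \<le> m" for k
    using that by (intro borel_measurable_eq) auto
  then have "(\<Inter>k\<in>{..m}. {\<omega>\<in>space M. Yp (s + t * real k) \<omega> = 0}) \<in> sets (Fb (s + t * real m))"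
    by (intro sets.finite_INT) auto
  also have "(\<Inter>k\<in>{..m}. {\<omega>\<in>space M. Yp (s + t * real k) \<omega> = 0}) = grid_zero s t m"
    by (auto simp: grid_zero_def)
  finally show ?thesis .
qed

lemma grid_zero_Suc: "grid_zero s t (Suc m) = {\<omega>\<in>grid_zero s t m. Yp (s + t * real m + t) \<omega> = 0}"
  by (auto simp: grid_zero_def le_Suc_eq algebra_simps)

lemma grid_zero_ge:
  assumes s: "0 \<le> s" "0 \<le> t" and q: "0 \<le> q" "\<And>e. 0 < e \<Longrightarrow> q * u e \<le> u (e + t)"
  shows "q ^ m * measure M {\<omega>\<in>space M. Yp s \<omega> = 0} \<le> measure M (grid_zero s t m)"
proof (induction m)
  case (Suc m)
  have "q ^ Suc m * measure M {\<omega>\<in>space M. Yp s \<omega> = 0} \<le> q * measure M (grid_zero s t m)"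
    using mult_left_mono[OF Suc q(1)] by (simp add: ac_simps)
  also have "\<dots> \<le> measure M (grid_zero s t (Suc m))"
    unfolding grid_zero_Suc using s q
    by (intro zero_stays_ge grid_zero_Fb) (auto simp: grid_zero_def)
  finally show ?case .
qed (simp add: grid_zero_def)

lemma grid_zero_le:
  assumes s: "0 \<le> s" "0 \<le> t" and e: "0 < e" "0 \<le> q" "u (e + t) \<le> q * u e"
  shows "measure M (grid_zero s t m) \<le> q ^ m"
proof (induction m)
  case 0 show ?case by simp
next
  case (Suc m)
  have "measure M (grid_zero s t (Suc m)) \<le> q * measure M (grid_zero s t m)"
    unfolding grid_zero_Suc using s e
    by (intro zero_stays_le[where e=e] grid_zero_Fb) (auto simp: grid_zero_def)
  also have "\<dots> \<le> q ^ Suc m" using mult_left_mono[OF Suc e(2)] by simp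
  finally show ?case .
qed

text \<open>Only countably many times occur, so the event is measurable; right continuity extends
  the zeros to the whole interval before its right end.\<close>

definition stay :: "real \<Rightarrow> real \<Rightarrow> 'a set" where
  "stay s x = {\<omega>\<in>space M. \<forall>n::nat. \<forall>k\<le>2 ^ n. Yp (s + x * (real k / 2 ^ n)) \<omega> = 0}"

lemma stay_eq: "stay s x = (\<Inter>n. grid_zero s (x / 2 ^ n) (2 ^ n))"
  by (auto simp: stay_def grid_zero_def)

lemma stay_sets [measurable]: "stay s x \<in> sets M"
  unfolding stay_def by measurable

lemma stay_zero:
  assumes \<omega>: "\<omega> \<in> stay s x" and t: "s \<le> t" "t < s + x"
  shows "Yp t \<omega> = 0"
proof (rule ccontr)
  assume "Yp t \<omega> \<noteq> 0"
  have "\<omega> \<in> space M" using \<omega> by (simp add: stay_def)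
  from positive_right_of[OF this \<open>Yp t \<omega> \<noteq> 0\<close>]
  have "eventually (\<lambda>r. Yp r \<omega> \<noteq> 0) (at_right t)" by (auto simp: eventually_at_right_field)
  from grid_right_dense[OF t this] obtain n k :: nat where "k < 2 ^ n" "Yp (s + (s + x - s) * (real k / 2 ^ n)) \<omega> \<noteq> 0" .
  then show False using \<omega> by (auto simp: stay_def dest: less_imp_le)
qed

lemma zero_imp_stay:
  assumes \<omega>: "\<omega> \<in> space M" and z: "\<And>t. s \<le> t \<Longrightarrow> t \<le> s + x \<Longrightarrow> Yp t \<omega> = 0" and x: "0 \<le> x"
  shows "\<omega> \<in> stay s x"
  unfolding stay_def
proof (intro CollectI conjI \<omega> allI impI z)
  fix n k :: nat assume "k \<le> 2 ^ n"
  then have "real k \<le> real (2 ^ n)" by (simp only: of_nat_le_iff)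
  then have "real k / 2 ^ n \<le> 1" by simp
  then have "x * (real k / 2 ^ n) \<le> x * 1" using x by (rule mult_left_mono)
  then show "s + x * (real k / 2 ^ n) \<le> s + x" by simp
qed (use x in simp)

text \<open>The \<open>2 ^ n\<close> factors \<open>exp (- c * (x / 2 ^ n))\<close> multiply to
  \<open>exp (- c * x)\<close> at every level, and the grid events decrease to
  \<open>stay s x\<close>.\<close>

lemma stay_ge:
  assumes s: "0 \<le> s" "0 \<le> x" and c: "\<And>e t. 0 < e \<Longrightarrow> 0 \<le> t \<Longrightarrow> u e \<le> u (e + t) * exp (c * t)"
  shows "exp (- c * x) * measure M {\<omega>\<in>space M. Yp s \<omega> = 0} \<le> measure M (stay s x)"
proof -
  have dec: "decseq (\<lambda>n. grid_zero s (x / 2 ^ n) (2 ^ n))"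
  proof (rule decseq_SucI, rule subsetI)
    fix n \<omega> assume \<omega>: "\<omega> \<in> grid_zero s (x / 2 ^ Suc n) (2 ^ Suc n)"
    have "Yp (s + x / 2 ^ n * real k) \<omega> = 0" if "k \<le> 2 ^ n" for k
    proof -
      have "2 * k \<le> 2 ^ Suc n" using that by simp
      moreover have "\<forall>k\<le>2 ^ Suc n. Yp (s + x / 2 ^ Suc n * real k) \<omega> = 0" using \<omega> unfolding grid_zero_def by blast
      ultimately have "Yp (s + x / 2 ^ Suc n * real (2 * k)) \<omega> = 0" by blast
      then show ?thesis by simp
    qed
    then show "\<omega> \<in> grid_zero s (x / 2 ^ n) (2 ^ n)" using \<omega> by (simp add: grid_zero_def)
  qed
  have "grid_zero s (x / 2 ^ n) (2 ^ n) \<in> sets M" for n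
    using s by (intro Fb_sets[OF grid_zero_Fb]) auto
  then have lim: "(\<lambda>n. measure M (grid_zero s (x / 2 ^ n) (2 ^ n))) \<longlonglongrightarrow> measure M (stay s x)"
    unfolding stay_eq using dec by (intro finite_Lim_measure_decseq) auto
  show ?thesis
  proof (rule LIMSEQ_le_const[OF lim], intro exI allI impI)
    fix n
    have "exp (- c * (x / 2 ^ n)) ^ 2 ^ n * measure M {\<omega>\<in>space M. Yp s \<omega> = 0} \<le> measure M (grid_zero s (x / 2 ^ n) (2 ^ n))"
    proof (rule grid_zero_ge)
      fix e :: real assume "0 < e"
      from c[OF this, of "x / 2 ^ n"] s show "exp (- c * (x / 2 ^ n)) * u e \<le> u (e + x / 2 ^ n)"
        by (simp add: exp_minus field_simps)
    qed (use s in auto)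
    also have "exp (- c * (x / 2 ^ n)) ^ 2 ^ n = exp (- c * x)"
      by (simp flip: exp_of_nat_mult)
    finally show "exp (- c * x) * measure M {\<omega>\<in>space M. Yp s \<omega> = 0} \<le> measure M (grid_zero s (x / 2 ^ n) (2 ^ n))" .
  qed
qed

text \<open>The bound \<open>exp (- C * x)\<close> holds for every \<open>C\<close>: a fine grid
  compares \<open>u\<close> only at small arguments, where it falls faster than at the rate
  \<open>C\<close>.\<close>

lemma stay_null:
  assumes x: "0 < x" and c: "\<And>C. \<exists>e0>0. \<forall>e t. 0 < e \<longrightarrow> 0 \<le> t \<longrightarrow> e + t \<le> e0 \<longrightarrow> u (e + t) \<le> exp (- C * t) * u e"
  shows "measure M (stay 0 x) = 0"
proof -
  have "measure M (stay 0 x) \<le> exp (- C * x)" for C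
  proof -
    obtain e0 where e0: "0 < e0" "\<And>e t. 0 < e \<Longrightarrow> 0 \<le> t \<Longrightarrow> e + t \<le> e0 \<Longrightarrow> u (e + t) \<le> exp (- C * t) * u e" using c by blast
    obtain n where "x / e0 < 2 ^ n" using real_arch_pow[of 2 "x / e0"] by auto
    then have n: "x / 2 ^ n < e0" using e0 by (simp add: field_simps)
    have "measure M (stay 0 x) \<le> measure M (grid_zero 0 (x / 2 ^ n) (2 ^ n))"
      unfolding stay_eq using x by (intro finite_measure_mono Fb_sets[OF grid_zero_Fb]) auto
    \<comment> \<open>With \<open>e = e0 - x / 2 ^ n\<close>, one mesh width beyond \<open>e\<close>
      is exactly \<open>e0\<close>.\<close>
    also have "\<dots> \<le> exp (- C * (x / 2 ^ n)) ^ 2 ^ n"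
      using n x by (intro grid_zero_le[where e="e0 - x / 2 ^ n"] e0(2)) auto
    also have "\<dots> = exp (- C * x)" by (simp flip: exp_of_nat_mult)
    finally show ?thesis .
  qed
  moreover have "((\<lambda>C. exp (- C * x)) \<longlongrightarrow> 0) at_top" using x by real_asymp
  ultimately have "measure M (stay 0 x) \<le> 0" by (intro tendsto_lowerbound) auto
  then show ?thesis by (simp add: measure_le_0_iff)
qed

text \<open>The point 0 belongs to the set and nothing of the set lies to its left, so an interval
  of the union through 0 contains some \<open>{0..b}\<close> with \<open>b > 0\<close>. All times
  before \<open>b\<close> are then zeros, which \<open>stay_null\<close> forbids.\<close>

lemma not_union_of_intervals:
  assumes c: "\<And>C. \<exists>e0>0. \<forall>e t. 0 < e \<longrightarrow> 0 \<le> t \<longrightarrow> e + t \<le> e0 \<longrightarrow> u (e + t) \<le> exp (- C * t) * u e"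
  shows "\<not> (AE \<omega> in M. \<exists>\<I>. (\<forall>I\<in>\<I>. nondegenerate_closed_interval I) \<and> zero_set Y \<omega> = \<Union>\<I>)"
proof
  assume "AE \<omega> in M. \<exists>\<I>. (\<forall>I\<in>\<I>. nondegenerate_closed_interval I) \<and> zero_set Y \<omega> = \<Union>\<I>"
  moreover have "AE \<omega> in M. \<forall>j::nat. \<omega> \<notin> stay 0 (1 / real (Suc j))"
    unfolding AE_all_countable
  proof (intro allI AE_not_in null_setsI)
    fix j :: nat
    show "emeasure M (stay 0 (1 / real (Suc j))) = 0" using stay_null[OF _ c, of "1 / real (Suc j)"] by (simp add: emeasure_eq_measure)
  qed measurable
  ultimately have "AE \<omega> in M. False" using AE_space Y_0
  proof eventually_elim
    case (elim \<omega>)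
    then obtain \<I> where \<I>: "\<And>I. I \<in> \<I> \<Longrightarrow> nondegenerate_closed_interval I" "zero_set Y \<omega> = \<Union>\<I>" by blast
    have "0 \<in> zeros \<omega>" using elim by (simp add: zeros_def Yp_def)
    then have "0 \<in> zero_set Y \<omega>" using closure_subset[of "zeros \<omega>"] by (auto simp: zero_set_eq)
    then obtain I where I: "I \<in> \<I>" "0 \<in> I" using \<I>(2) by auto
    have Isub: "I \<subseteq> zero_set Y \<omega>" using I \<I>(2) by auto
    obtain b where b: "b \<in> I" "0 < b"
    proof -
      obtain a b where "a \<in> I" "b \<in> I" "a < b" using \<I>(1)[OF I(1)] unfolding nondegenerate_closed_interval_def by blast
      moreover have "0 \<le> a" using \<open>a \<in> I\<close> Isub zero_set_nonneg[of \<omega>] by auto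
      ultimately show thesis using that[of b] by auto
    qed
    have "is_interval I" using \<I>(1)[OF I(1)] by (simp add: nondegenerate_closed_interval_def)
    then have sub: "{0..b} \<subseteq> zero_set Y \<omega>" using I(2) b(1) Isub unfolding is_interval_1 by (meson atLeastAtMost_iff subsetD subsetI)
    \<comment> \<open>A nonzero of \<open>Y\<close> would be followed by an interval of nonzeros
      inside the closure, but the closure adds only countably many points.\<close>
    have Y0: "Yp t \<omega> = 0" if t: "0 \<le> t" "t < b" for t
    proof (rule ccontr)
      assume "Yp t \<omega> \<noteq> 0"
      from positive_right_of[OF elim(3) this] obtain d where d: "t < d" "\<And>x. t < x \<Longrightarrow> x < d \<Longrightarrow> Yp x \<omega> \<noteq> 0" by blast
      have "{t<..<min d b} \<subseteq> zero_set Y \<omega> - zeros \<omega>" using sub d(2) t by (auto simp: zeros_def)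
      then have "countable {t<..<min d b}" using countable_zero_set_diff[OF elim(3)] by (rule countable_subset)
      moreover have "t < min d b" using d t by simp
      ultimately show False using uncountable_open_interval[of t "min d b"] by simp
    qed
    obtain j where j: "1 / real (Suc j) < b" using nat_approx_posE[OF b(2)] by auto
    have "\<omega> \<in> stay 0 (1 / real (Suc j))" by (rule zero_imp_stay[OF elim(3)]) (use j in \<open>auto intro!: Y0\<close>)
    then show False using elim(2) by blast
  qed
  then show False by (simp add: AE_False)
qed

end

lemma nondegenerate_Icc:
  assumes "a < b" shows "nondegenerate_closed_interval {a..b}"
  unfolding nondegenerate_closed_interval_def
proof (intro conjI)
  show "\<exists>x\<in>{a..b}. \<exists>y\<in>{a..b}. x < y"
    using assms by (intro bexI[of _ a] bexI[of _ b]) auto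
qed (auto simp: is_interval_cc)

section \<open>Zero sets that are unions of intervals\<close>

context laplace_flow_process
begin

text \<open>Given a zero at \<open>t\<close>, staying for \<open>1 / real (Suc j)\<close> fails with
  probability at most \<open>1 - exp (- c * (1 / real (Suc j)))\<close>, which tends to 0.\<close>

lemma AE_zero_imp_stay:
  assumes c: "\<And>e t. 0 < e \<Longrightarrow> 0 \<le> t \<Longrightarrow> u e \<le> u (e + t) * exp (c * t)" and t: "0 \<le> t"
  shows "AE \<omega> in M. Yp t \<omega> = 0 \<longrightarrow> (\<exists>j. \<omega> \<in> stay t (1 / real (Suc j)))"
proof -
  define Z where "Z = {\<omega>\<in>space M. Yp t \<omega> = 0}"
  have [measurable]: "Z \<in> sets M" unfolding Z_def by measurable
  define B where "B = Z - (\<Union>j. stay t (1 / real (Suc j)))"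
  have [measurable]: "B \<in> sets M" unfolding B_def by measurable
  have stayZ: "stay t x \<subseteq> Z" for x
  proof
    fix \<omega> assume "\<omega> \<in> stay t x"
    then have "\<omega> \<in> space M" "\<forall>k\<le>2 ^ 0. Yp (t + x * (real k / 2 ^ 0)) \<omega> = 0" unfolding stay_def by blast+
    then have "Yp (t + x * (real 0 / 2 ^ 0)) \<omega> = 0" by blast
    then show "\<omega> \<in> Z" using \<open>\<omega> \<in> space M\<close> by (simp add: Z_def)
  qed
  have "measure M B \<le> 1 - exp (- c * (1 / real (Suc j)))" for j
  proof -
    have "exp (- c * (1 / real (Suc j))) * measure M Z \<le> measure M (stay t (1 / real (Suc j)))"
      unfolding Z_def by (rule stay_ge[OF t _ c]) auto
    moreover have "measure M B \<le> measure M (Z - stay t (1 / real (Suc j)))"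
      by (intro finite_measure_mono) (auto simp: B_def)
    moreover have "measure M (Z - stay t (1 / real (Suc j))) = measure M Z - measure M (stay t (1 / real (Suc j)))"
      by (intro finite_measure_Diff stayZ) auto
    ultimately have "measure M B \<le> (1 - exp (- c * (1 / real (Suc j)))) * measure M Z"
      by (simp add: algebra_simps)
    also have "\<dots> \<le> (1 - exp (- c * (1 / real (Suc j)))) * 1"
    proof (rule mult_left_mono)
      \<comment> \<open>The hypothesis itself forces \<open>0 \<le> c\<close>, as \<open>u\<close>
        is antitone.\<close>
      have "u 1 \<le> u (1 + 1) * exp (c * 1)" by (rule c) auto
      also have "\<dots> \<le> u 1 * exp c" using u_antimono[of 1 2] by simp
      finally have "0 \<le> c" using u_pos[of 1] by simp
      then show "0 \<le> 1 - exp (- c * (1 / real (Suc j)))" by simp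
    qed simp
    finally show ?thesis by simp
  qed
  moreover have "(\<lambda>j. 1 - exp (- c * (1 / real (Suc j)))) \<longlonglongrightarrow> 1 - exp (- c * 0)"
    using LIMSEQ_inverse_real_of_nat by (intro tendsto_intros) (simp add: inverse_eq_divide)
  ultimately have "measure M B \<le> 1 - exp (- c * 0)" by (intro LIMSEQ_le_const) auto
  then have "B \<in> null_sets M" by (intro null_setsI) (auto simp: emeasure_eq_measure measure_le_0_iff)
  then have "AE \<omega> in M. \<omega> \<notin> B" by (rule AE_not_in)
  then show ?thesis using AE_space by eventually_elim (auto simp: B_def Z_def)
qed

text \<open>Fubini turns the null events at fixed times into a null set of times on almost every
  path. \<open>R\<close> spells out \<open>stay\<close> to expose its joint measurability.\<close>

lemma AE_AE_zero_imp_stay: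
  assumes c: "\<And>e t. 0 < e \<Longrightarrow> 0 \<le> t \<Longrightarrow> u e \<le> u (e + t) * exp (c * t)"
  shows "AE \<omega> in M. AE t in lborel. 0 \<le> t \<longrightarrow> Yp t \<omega> = 0 \<longrightarrow> (\<exists>j. \<omega> \<in> stay t (1 / real (Suc j)))"
proof -
  interpret P: pair_sigma_finite lborel M ..
  define R where "R t \<omega> \<longleftrightarrow> (0 \<le> t \<longrightarrow> Yp t \<omega> = 0 \<longrightarrow> (\<exists>j. \<forall>n::nat. \<forall>k\<le>2 ^ n. Yp (t + 1 / real (Suc j) * (real k / 2 ^ n)) \<omega> = 0))"
    for t \<omega>
  have "Measurable.pred (lborel \<Otimes>\<^sub>M M) (\<lambda>z. R (fst z) (snd z))"
    unfolding R_def by measurable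
  then have m: "{z \<in> space (lborel \<Otimes>\<^sub>M M). R (fst z) (snd z)} \<in> sets (lborel \<Otimes>\<^sub>M M)" by (rule predE)
  have "AE t in lborel. AE \<omega> in M. R t \<omega>"
  proof (rule AE_I2)
    fix t :: real
    show "AE \<omega> in M. R t \<omega>"
    proof (cases "0 \<le> t")
      case True
      have "AE \<omega> in M. Yp t \<omega> = 0 \<longrightarrow> (\<exists>j. \<omega> \<in> stay t (1 / real (Suc j)))"
        by (rule AE_zero_imp_stay[OF _ True]) (rule c)
      then show ?thesis by eventually_elim (auto simp: R_def stay_def)
    qed (simp add: R_def)
  qed
  then have "AE \<omega> in M. AE t in lborel. R t \<omega>" using P.AE_commute[OF m] by simp
  then show ?thesis using AE_space
  proof eventually_elim
    case (elim \<omega>)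
    from elim(1) show ?case by eventually_elim (use elim(2) in \<open>auto simp: R_def stay_def\<close>)
  qed
qed

text \<open>Each of the \<open>K * 2 ^ n\<close> cells is an exit with probability at most
  \<open>c / 2 ^ n\<close>, so the expected count is at most \<open>K * c\<close> at every level.
  The count increases with the level, and monotone convergence bounds all levels at once.\<close>

lemma AE_exits_bounded:
  assumes c: "\<And>e t. 0 < e \<Longrightarrow> 0 \<le> t \<Longrightarrow> u e \<le> u (e + t) * exp (c * t)"
  shows "AE \<omega> in M. \<exists>B. \<forall>n. exits (\<lambda>t. Yp t \<omega> = 0) n (K * 2 ^ n) \<le> B"
proof -
  define f where "f n \<omega> = ennreal (real (exits (\<lambda>t. Yp t \<omega> = 0) n (K * 2 ^ n)))" for n \<omega>
  define T where "T n k = {\<omega>\<in>space M. Yp (real k / 2 ^ n) \<omega> = 0 \<and> Yp ((real k + 1) / 2 ^ n) \<omega> \<noteq> 0}" for n k :: nat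
  have [measurable]: "T n k \<in> sets M" for n k unfolding T_def by measurable
  have f_eq: "f n \<omega> = (\<Sum>k<K * 2 ^ n. indicator (T n k) \<omega>)" if "\<omega> \<in> space M" for n \<omega>
  proof -
    have "f n \<omega> = (\<Sum>k<K * 2 ^ n. ennreal (real (if Yp (real k / 2 ^ n) \<omega> = 0 \<and> \<not> Yp ((real k + 1) / 2 ^ n) \<omega> = 0 then 1 else 0)))"
      unfolding f_def exits_def of_nat_sum by (rule sum_ennreal[symmetric]) simp
    also have "\<dots> = (\<Sum>k<K * 2 ^ n. indicator (T n k) \<omega>)"
      using that by (intro sum.cong) (auto simp: T_def indicator_def)
    finally show ?thesis .
  qed
  have [measurable]: "f n \<in> borel_measurable M" for n
    by (rule measurable_cong[THEN iffD2, of M "f n" "\<lambda>\<omega>. \<Sum>k<K * 2 ^ n. indicator (T n k) \<omega>"]) (auto simp: f_eq)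
  have PT: "measure M (T n k) \<le> c / 2 ^ n" for n k
  proof -
    define s where "s = real k / 2 ^ n"
    define t where "t = (1::real) / 2 ^ n"
    have st: "0 \<le> s" "0 \<le> t" "(real k + 1) / 2 ^ n = s + t" by (auto simp: s_def t_def add_divide_distrib)
    define Z where "Z = {\<omega>\<in>space M. Yp s \<omega> = 0}"
    have Ym: "Yp s \<in> borel_measurable (Fb s)" using st(1) by (rule Yp_Fb_measurable)
    have "{\<omega>\<in>space (Fb s). Yp s \<omega> = 0} \<in> sets (Fb s)" using Ym by (intro borel_measurable_eq) auto
    then have Z: "Z \<in> sets (Fb s)" by (simp add: Z_def)
    have [measurable]: "Z \<in> sets M" using Fb_sets[OF Z] .
    have "exp (- c * t) * measure M Z \<le> measure M {\<omega>\<in>Z. Yp (s + t) \<omega> = 0}"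
    proof (rule zero_stays_ge[OF Z st(1,2)])
      fix e :: real assume "0 < e"
      from c[OF this st(2)] show "exp (- c * t) * u e \<le> u (e + t)" by (simp add: exp_minus field_simps)
    qed (auto simp: Z_def)
    moreover have "T n k = Z - {\<omega>\<in>Z. Yp (s + t) \<omega> = 0}" unfolding T_def st(3) s_def[symmetric] by (auto simp: Z_def)
    moreover have "{\<omega>\<in>Z. Yp (s + t) \<omega> = 0} = {\<omega>\<in>space M. Yp s \<omega> = 0 \<and> Yp (s + t) \<omega> = 0}" by (auto simp: Z_def)
    then have "{\<omega>\<in>Z. Yp (s + t) \<omega> = 0} \<in> sets M" by simp
    then have "measure M (Z - {\<omega>\<in>Z. Yp (s + t) \<omega> = 0}) = measure M Z - measure M {\<omega>\<in>Z. Yp (s + t) \<omega> = 0}"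
      by (intro finite_measure_Diff) auto
    ultimately have "measure M (T n k) \<le> (1 - exp (- c * t)) * measure M Z" by (simp add: algebra_simps)
    also have "\<dots> \<le> (c * t) * measure M Z"
      using exp_ge_add_one_self[of "- c * t"] by (intro mult_right_mono) auto
    also have "\<dots> \<le> (c * t) * 1"
    proof (rule mult_left_mono)
      have "u 1 \<le> u (1 + 1) * exp (c * 1)" by (rule c) auto
      also have "\<dots> \<le> u 1 * exp c" using u_antimono[of 1 2] by simp
      finally have "0 \<le> c" using u_pos[of 1] by simp
      then show "0 \<le> c * t" using st by simp
    qed simp
    finally show ?thesis by (simp add: t_def)
  qed
  have "(\<integral>\<^sup>+\<omega>. f n \<omega> \<partial>M) \<le> ennreal (real K * c)" for n
  proof -
    have "(\<integral>\<^sup>+\<omega>. f n \<omega> \<partial>M) = (\<integral>\<^sup>+\<omega>. (\<Sum>k<K * 2 ^ n. indicator (T n k) \<omega>) \<partial>M)"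
      by (intro nn_integral_cong f_eq)
    also have "\<dots> = (\<Sum>k<K * 2 ^ n. ennreal (measure M (T n k)))"
      by (subst nn_integral_sum) (auto simp: emeasure_eq_measure)
    also have "\<dots> \<le> (\<Sum>k<K * 2 ^ n. ennreal (c / 2 ^ n))" by (intro sum_mono ennreal_leI PT)
    also have "\<dots> = ennreal (real K * c)"
      by (simp add: ennreal_of_nat_eq_real_of_nat ennreal_mult'[symmetric])
    finally show ?thesis .
  qed
  moreover have "incseq f"
  proof (rule incseq_SucI, rule le_funI)
    fix n \<omega>
    show "f n \<omega> \<le> f (Suc n) \<omega>"
      unfolding f_def using exits_refine[of "\<lambda>t. Yp t \<omega> = 0" n "K * 2 ^ n"]
      by (intro ennreal_leI) (simp add: ac_simps)
  qed
  ultimately have "(\<integral>\<^sup>+\<omega>. (SUP n. f n \<omega>) \<partial>M) \<le> ennreal (real K * c)"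
    by (subst nn_integral_monotone_convergence_SUP) (auto intro: SUP_least)
  then have "(\<integral>\<^sup>+\<omega>. (SUP n. f n \<omega>) \<partial>M) \<noteq> \<infinity>" by (auto simp: top_unique)
  then have "AE \<omega> in M. (SUP n. f n \<omega>) \<noteq> \<infinity>" by (intro nn_integral_PInf_AE) measurable
  then show ?thesis
  proof eventually_elim
    case (elim \<omega>)
    then obtain r where r: "(SUP n. f n \<omega>) = ennreal r" "0 \<le> r" by (cases "SUP n. f n \<omega>") auto
    obtain B :: nat where B: "r \<le> real B" using real_arch_simple by blast
    have "exits (\<lambda>t. Yp t \<omega> = 0) n (K * 2 ^ n) \<le> B" for n
    proof -
      have "f n \<omega> \<le> ennreal r" unfolding r(1)[symmetric] by (rule SUP_upper) simp
      then have "real (exits (\<lambda>t. Yp t \<omega> = 0) n (K * 2 ^ n)) \<le> r" using r(2) by (simp add: f_def)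
      then show ?thesis using B by linarith
    qed
    then show ?case by blast
  qed
qed

text \<open>By right continuity a nonzero persists on an interval, which contains dyadic
  times.\<close>

lemma zero_on_dyadics:
  assumes \<omega>: "\<omega> \<in> space M" and a: "0 \<le> a" and z: "\<And>n k. a < real k / 2 ^ n \<Longrightarrow> real k / 2 ^ n < b \<Longrightarrow> Yp (real k / 2 ^ n) \<omega> = 0"
    and t: "a \<le> t" "t < b"
  shows "Yp t \<omega> = 0"
proof (rule ccontr)
  assume "Yp t \<omega> \<noteq> 0"
  from positive_right_of[OF \<omega> this] obtain d where d: "t < d" "\<And>x. t < x \<Longrightarrow> x < d \<Longrightarrow> Yp x \<omega> \<noteq> 0" by blast
  have "0 \<le> t" "t < min d b" using a t d by auto
  then obtain n k where "t < real k / 2 ^ n" "real k / 2 ^ n < min d b" by (rule dyadic_between)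
  then show False using d(2) z t by fastforce
qed

end

context local_time_process
begin

text \<open>Bounded exit counts give the structure seen by dyadic times. The obstacle is a zero
  without dyadic zeros nearby: it is excluded because the zeros around it have positive Lebesgue
  measure, and almost all of them are followed by an interval of zeros.\<close>

lemma union_of_intervals:
  assumes c: "\<And>e t. 0 < e \<Longrightarrow> 0 \<le> t \<Longrightarrow> u e \<le> u (e + t) * exp (c * t)"
  shows "AE \<omega> in M. \<exists>\<I>. (\<forall>I\<in>\<I>. nondegenerate_closed_interval I) \<and> zero_set Y \<omega> = \<Union>\<I>"
proof -
  have bd: "u e \<le> u 1 * exp c" if "0 < e" for e
  proof -
    have "u e \<le> u (e + 1) * exp (c * 1)" using that by (intro c) auto
    also have "\<dots> \<le> u 1 * exp c" using u_antimono[of 1 "e + 1"] that by simp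
    finally show ?thesis .
  qed
  have "AE \<omega> in M. \<forall>K::nat. \<exists>B. \<forall>n. exits (\<lambda>t. Yp t \<omega> = 0) n (K * 2 ^ n) \<le> B"
    unfolding AE_all_countable by (intro allI AE_exits_bounded[where c=c] c)
  moreover have "AE \<omega> in M. AE t in lborel. 0 \<le> t \<longrightarrow> Yp t \<omega> = 0 \<longrightarrow> (\<exists>j. \<omega> \<in> stay t (1 / real (Suc j)))"
    by (intro AE_AE_zero_imp_stay[where c=c] c)
  ultimately show ?thesis using AE_G2
  proof eventually_elim
    case (elim \<omega>)
    have \<omega>: "\<omega> \<in> space M" using G_space[OF G2_G[OF elim(3)]] .
    define p where "p t \<longleftrightarrow> Yp t \<omega> = 0" for t
    have cl: "zeros \<omega> \<subseteq> zero_set Y \<omega>" unfolding zero_set_eq by (rule closure_subset)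
    have closed: "closed (zero_set Y \<omega>)" by (simp add: zero_set_eq)
    have near: "\<exists>k n. a < real k / 2 ^ n \<and> real k / 2 ^ n < b \<and> real k / 2 ^ n \<noteq> z \<and> p (real k / 2 ^ n)"
      if w: "w \<in> zeros \<omega>" "a < w" "w < b" for w a b z
    proof -
      obtain s where s: "s \<in> \<rat>" "0 \<le> s" "s \<le> w" "a < s"
      proof (cases "w = 0")
        case True then show thesis using that[of 0] w by auto
      next
        case False
        then have "max 0 a < w" using w by (auto simp: zeros_def)
        then obtain s where "s \<in> \<rat>" "max 0 a < s" "s < w" using Rats_dense_in_real by blast
        then show thesis using that[of s] by auto
      qed
      define t where "t = (w + b) / 2"
      have t: "w < t" "t < b" using w by (auto simp: t_def)
      have pos: "0 < emeasure lborel (zeros \<omega> \<inter> {s..t})"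
        by (rule positive_Lebesgue_at_zero[OF elim(3) bd s(1,2,3) _ t(1)]) (use w in \<open>auto simp: zeros_def\<close>)
      have "\<exists>x\<in>zeros \<omega> \<inter> {s..t}. \<exists>j. \<omega> \<in> stay x (1 / real (Suc j))"
      proof (rule ccontr)
        assume no: "\<not> ?thesis"
        have "AE x in lborel. x \<notin> zeros \<omega> \<inter> {s..t}"
          using elim(2) by eventually_elim (use no in \<open>auto simp: zeros_def\<close>)
        then have "zeros \<omega> \<inter> {s..t} \<in> null_sets lborel"
          using zeros_measurable[OF \<omega>] by (subst AE_iff_null_sets) auto
        then show False using pos by auto
      qed
      then obtain x j where x: "x \<in> zeros \<omega>" "s \<le> x" "x \<le> t" "\<omega> \<in> stay x (1 / real (Suc j))" by auto
      define y where "y = min b (x + 1 / real (Suc j))"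
      have xy: "x < y" using x t by (simp add: y_def)
      have x0: "0 \<le> x" using x by (simp add: zeros_def)
      \<comment> \<open>A subinterval on one side of \<open>z\<close>, so that the dyadic zero found
        in it differs from \<open>z\<close>.\<close>
      obtain c' d' where cd: "x \<le> c'" "c' < d'" "d' \<le> y" "z \<le> c' \<or> d' \<le> z"
      proof (cases "z \<le> x")
        case True then show thesis using that[of x y] xy by auto
      next
        case False then show thesis using that[of x "min y z"] xy by auto
      qed
      have "0 \<le> c'" using x0 cd by simp
      then obtain n k where nk: "c' < real k / 2 ^ n" "real k / 2 ^ n < d'" using cd(2) by (rule dyadic_between)
      have "Yp (real k / 2 ^ n) \<omega> = 0" by (rule stay_zero[OF x(4)]) (use nk cd in \<open>auto simp: y_def\<close>)
      then show ?thesis using nk cd s x by (intro exI[of _ k] exI[of _ n]) (auto simp: p_def y_def)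
    qed
    have cover: "\<exists>I. nondegenerate_closed_interval I \<and> I \<subseteq> zero_set Y \<omega> \<and> z \<in> I" if z: "z \<in> zero_set Y \<omega>" for z
    proof -
      have z0: "0 \<le> z" using z zero_set_nonneg[of \<omega>] by auto
      obtain K :: nat where K: "z + 1 \<le> real K" using real_arch_simple by blast
      obtain B where B: "\<And>n. exits p n (K * 2 ^ n) \<le> B" using elim(1) unfolding p_def by blast
      obtain \<delta> where \<delta>: "0 < \<delta>" "\<And>k n l m. z < real k / 2 ^ n \<Longrightarrow> real k / 2 ^ n < real l / 2 ^ m \<Longrightarrow> real l / 2 ^ m < z + \<delta>
          \<Longrightarrow> p (real k / 2 ^ n) \<Longrightarrow> p (real l / 2 ^ m)"
        using no_exits_right[OF z0 K B] by blast
      obtain \<delta>' where \<delta>': "0 < \<delta>'" "\<And>k n l m. z - \<delta>' < real k / 2 ^ n \<Longrightarrow> real k / 2 ^ n < real l / 2 ^ m \<Longrightarrow> real l / 2 ^ m < z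
          \<Longrightarrow> p (real k / 2 ^ n) \<Longrightarrow> p (real l / 2 ^ m)"
      \<comment> \<open>No dyadic time lies to the left of 0, so any \<open>\<delta>'\<close> serves
        there.\<close>
      proof (cases "z = 0")
        case True
        have "z \<le> real l / 2 ^ m" for l m :: nat using True by simp
        then have "\<not> real l / 2 ^ m < z" for l m :: nat by (simp only: not_less)
        then show thesis using that[of 1] by simp
      next
        case False
        then have "0 < z" "z \<le> real K" using z0 K by auto
        from no_exits_left[OF this B] show thesis using that by blast
      qed
      \<comment> \<open>Either dyadic zeros accumulate at \<open>z\<close> from the right, or one
        occurs shortly before \<open>z\<close>, or there are none nearby. In the first two cases no
        exit intervenes; the third contradicts \<open>near\<close>.\<close>
      consider (right) "\<forall>d>0. \<exists>k n. z < real k / 2 ^ n \<and> real k / 2 ^ n < z + d \<and> p (real k / 2 ^ n)"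
        | (left) "\<exists>k n. z - \<delta>' < real k / 2 ^ n \<and> real k / 2 ^ n < z \<and> p (real k / 2 ^ n)"
        | (none) d where "0 < d" "\<And>k n. z < real k / 2 ^ n \<Longrightarrow> real k / 2 ^ n < z + d \<Longrightarrow> \<not> p (real k / 2 ^ n)"
          "\<And>k n. z - \<delta>' < real k / 2 ^ n \<Longrightarrow> real k / 2 ^ n < z \<Longrightarrow> \<not> p (real k / 2 ^ n)"
        by blast
      then show ?thesis
      proof cases
        case right
        have dy: "Yp (real l / 2 ^ m) \<omega> = 0" if "z < real l / 2 ^ m" "real l / 2 ^ m < z + \<delta>" for l m :: nat
        proof -
          from that have "0 < real l / 2 ^ m - z" by simp
          with right obtain k n where kn: "z < real k / 2 ^ n" "real k / 2 ^ n < z + (real l / 2 ^ m - z)" "p (real k / 2 ^ n)" by blast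
          show ?thesis using \<delta>(2)[OF kn(1) _ that(2) kn(3)] kn(2) by (simp add: p_def)
        qed
        have "Yp t \<omega> = 0" if "z \<le> t" "t < z + \<delta>" for t by (rule zero_on_dyadics[OF \<omega> z0 dy that])
        then have "{z..z + \<delta> / 2} \<subseteq> zero_set Y \<omega>" using z0 \<delta>(1) cl by (auto simp: zeros_def)
        then show ?thesis using \<delta>(1)
          by (intro exI[of _ "{z..z + \<delta> / 2}"] conjI nondegenerate_Icc) auto
      next
        case left
        then obtain k n where kn: "z - \<delta>' < real k / 2 ^ n" "real k / 2 ^ n < z" "p (real k / 2 ^ n)" by blast
        have "Yp t \<omega> = 0" if "real k / 2 ^ n \<le> t" "t < z" for t
        proof (rule zero_on_dyadics[OF \<omega> _ _ that])
          fix m l :: nat assume "real k / 2 ^ n < real l / 2 ^ m" "real l / 2 ^ m < z"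
          then show "Yp (real l / 2 ^ m) \<omega> = 0" using \<delta>'(2)[OF kn(1) _ _ kn(3)] by (simp add: p_def)
        qed simp
        moreover have "0 \<le> t" if "real k / 2 ^ n \<le> t" for t
          by (rule order_trans[OF _ that]) simp
        ultimately have "{real k / 2 ^ n..<z} \<subseteq> zeros \<omega>" by (auto simp: zeros_def)
        then have "closure {real k / 2 ^ n..<z} \<subseteq> zero_set Y \<omega>" unfolding zero_set_eq by (rule closure_mono)
        then have "{real k / 2 ^ n..z} \<subseteq> zero_set Y \<omega>" using kn(2) by (simp add: closure_atLeastLessThan)
        then show ?thesis using kn(2)
          by (intro exI[of _ "{real k / 2 ^ n..z}"] conjI nondegenerate_Icc) auto
      next
        case (none d)
        have "0 < min d \<delta>'" using none(1) \<delta>'(1) by simp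
        with z obtain w where w: "w \<in> zeros \<omega>" "dist w z < min d \<delta>'"
          unfolding zero_set_eq closure_approachable by blast
        then have "z - \<delta>' < w" "w < z + d" by (auto simp: dist_real_def)
        from near[OF w(1) this, of z] obtain k n where
          "z - \<delta>' < real k / 2 ^ n" "real k / 2 ^ n < z + d" "real k / 2 ^ n \<noteq> z" "p (real k / 2 ^ n)" by blast
        then show ?thesis using none(2)[of k n] none(3)[of k n] by fastforce
      qed
    qed
    show ?case
      by (intro exI[of _ "{I. nondegenerate_closed_interval I \<and> I \<subseteq> zero_set Y \<omega>}"]) (use cover in blast)
  qed
qed

end

section \<open>Mechanisms and flows\<close>

locale convex_flow =
  fixes \<Psi> v :: "real \<Rightarrow> real"
  assumes convex: "convex_on {0..} \<Psi>" and cont: "continuous_on {0..} \<Psi>" and zero: "\<Psi> 0 = 0"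
    and v_nonneg: "\<And>t. 0 < t \<Longrightarrow> 0 \<le> v t"
    and v_deriv: "\<And>t. 0 < t \<Longrightarrow> (v has_real_derivative - \<Psi> (v t)) (at t)"
    and v_top: "filterlim v at_top (at_right 0)"
    and positive: "\<exists>\<theta>. \<forall>z\<ge>\<theta>. 0 < \<Psi> z"
begin

lemma chord_bound:
  assumes "0 \<le> c" "c < b" "\<Psi> c = 0" "c \<le> x" "x \<le> b"
  shows "\<Psi> x \<le> max 0 (\<Psi> b / (b - c)) * (x - c)"
proof -
  define t where "t = (x - c) / (b - c)"
  have "t * (b - c) = x - c" using assms by (simp add: t_def)
  then have "x = (1 - t) *\<^sub>R c + t *\<^sub>R b" by (simp add: algebra_simps)
  moreover have "0 \<le> t" "t \<le> 1" using assms by (auto simp: t_def)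
  ultimately have t: "0 \<le> t" "t \<le> 1" "x = (1 - t) *\<^sub>R c + t *\<^sub>R b" by blast+
  have "\<Psi> x \<le> (1 - t) * \<Psi> c + t * \<Psi> b"
    unfolding t(3) using t(1,2) assms by (intro convex_onD[OF convex]) auto
  also have "\<dots> = \<Psi> b / (b - c) * (x - c)" using assms by (simp add: t_def)
  also have "\<dots> \<le> max 0 (\<Psi> b / (b - c)) * (x - c)" using assms by (intro mult_right_mono) auto
  finally show ?thesis .
qed

text \<open>Slopes of a convex function increase and \<open>\<Psi> 0 = 0\<close>, so to the right of
  \<open>a\<close> no chord has a smaller slope than the one from 0 to \<open>a\<close>. This
  one-sided bound plays the part of a Lipschitz condition in \<open>flow_eq\<close>.\<close>

lemma slope_bound:
  assumes "0 < a" "a \<le> y" "y \<le> x"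
  shows "\<Psi> a / a * (x - y) \<le> \<Psi> x - \<Psi> y"
proof (cases "y = x")
  case False
  then have yx: "y < x" using assms by simp
  have 1: "\<Psi> a / a \<le> \<Psi> y / y"
  proof (cases "a = y")
    case False
    then show ?thesis using convex_on_slope_le(1)[OF convex, of 0 y a] assms zero by (simp add: divide_simps split: if_splits)
  qed simp
  have "\<Psi> y / y \<le> (\<Psi> y - \<Psi> x) / (y - x)"
    using order_trans[OF convex_on_slope_le(1,2)[OF convex, of 0 x y]] assms yx zero by simp
  also have "\<dots> = (\<Psi> x - \<Psi> y) / (x - y)" using minus_divide_divide[of "\<Psi> x - \<Psi> y" "x - y"] by simp
  finally have "\<Psi> a / a \<le> (\<Psi> x - \<Psi> y) / (x - y)" using 1 by simp
  then show ?thesis using yx by (simp add: pos_le_divide_eq)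
qed simp

lemma ratio_mono: "0 < a \<Longrightarrow> a \<le> b \<Longrightarrow> \<Psi> a / a \<le> \<Psi> b / b"
  using convex_on_slope_le(1)[OF convex, of 0 b a] zero by (cases "a = b") (auto simp: divide_simps split: if_splits)

text \<open>Between the zero \<open>c\<close> and \<open>b\<close>, \<open>\<Psi>\<close> lies below
  its chord, hence below a multiple of \<open>x - c\<close>. By Gronwall's argument the distance to
  \<open>c\<close> decays at most exponentially, so \<open>c\<close> is not reached in finite
  time.\<close>

lemma solution_lower_bound:
  assumes T: "0 \<le> T" and c: "0 \<le> c" "\<Psi> c = 0" and b: "c < b"
    and x: "continuous_on {0..T} x" "\<And>t. 0 < t \<Longrightarrow> t < T \<Longrightarrow> (x has_real_derivative - \<Psi> (x t)) (at t)"
    and bd: "\<And>t. 0 \<le> t \<Longrightarrow> t \<le> T \<Longrightarrow> c \<le> x t \<and> x t \<le> b"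
  shows "(x 0 - c) * exp (- max 0 (\<Psi> b / (b - c)) * T) \<le> x T - c"
proof -
  define K where "K = max 0 (\<Psi> b / (b - c))"
  have "(x 0 - c) * exp (K * 0) \<le> (x T - c) * exp (K * T)"
  proof (rule DERIV_nonneg_imp_increasing_open[OF T])
    fix t assume t: "0 < t" "t < T"
    show "\<exists>y. ((\<lambda>t. (x t - c) * exp (K * t)) has_real_derivative y) (at t) \<and> 0 \<le> y"
    proof (intro exI conjI)
      show "((\<lambda>t. (x t - c) * exp (K * t)) has_real_derivative (exp (K * t) * (K * (x t - c) - \<Psi> (x t)))) (at t)"
        using x(2)[OF t] by (auto intro!: derivative_eq_intros simp: algebra_simps)
      have "\<Psi> (x t) \<le> K * (x t - c)"
        unfolding K_def using bd[of t] t c b by (intro chord_bound) auto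
      then show "0 \<le> exp (K * t) * (K * (x t - c) - \<Psi> (x t))" by simp
    qed
  qed (intro continuous_intros x)
  then show ?thesis unfolding K_def[symmetric] by (simp add: exp_minus field_simps)
qed

lemma v_continuous: "continuous_on {0<..} v"
  by (rule DERIV_continuous_on) (use v_deriv in \<open>auto intro: has_field_derivative_at_within\<close>)

lemma \<Psi>_v_continuous: "continuous_on {0<..} (\<lambda>t. \<Psi> (v t))"
  by (rule continuous_on_compose2[OF cont v_continuous]) (auto simp: v_nonneg)

text \<open>Zeros of \<open>\<Psi>\<close> are rest points, and the solution starts above all of
  them. At the first time \<open>t1\<close> with \<open>\<Psi> (v t1) = 0\<close> it would have come
  down to a rest point in finite time, against \<open>solution_lower_bound\<close>.\<close>

lemma \<Psi>_v_pos: assumes t: "0 < t" shows "0 < \<Psi> (v t)"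
proof (rule ccontr)
  assume neg: "\<not> 0 < \<Psi> (v t)"
  obtain \<theta> where \<theta>: "\<And>z. \<theta> \<le> z \<Longrightarrow> 0 < \<Psi> z" using positive by blast
  have "eventually (\<lambda>s. \<theta> \<le> v s) (at_right 0)" using v_top by (simp add: filterlim_at_top)
  moreover have "eventually (\<lambda>s. s \<in> {0<..<t}) (at_right 0)" using t by (rule eventually_at_right_real)
  ultimately have "eventually (\<lambda>s. \<theta> \<le> v s \<and> s \<in> {0<..<t}) (at_right 0)" by (rule eventually_conj)
  then obtain \<delta> where \<delta>: "\<theta> \<le> v \<delta>" "0 < \<delta>" "\<delta> < t"
    using eventually_happens'[OF trivial_limit_at_right_real] by fastforce
  have g\<delta>: "0 < \<Psi> (v \<delta>)" using \<theta>[OF \<delta>(1)] .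
  have contg: "continuous_on {\<delta>..t} (\<lambda>t. \<Psi> (v t))"
    by (rule continuous_on_subset[OF \<Psi>_v_continuous]) (use \<delta> in auto)
  \<comment> \<open>Its minimum is the first time after \<open>\<delta>\<close> at a rest point;
    until then \<open>\<Psi> (v s)\<close> keeps its sign.\<close>
  define Z where "Z = {s\<in>{\<delta>..t}. \<Psi> (v s) = 0}"
  have "\<exists>s. \<delta> \<le> s \<and> s \<le> t \<and> \<Psi> (v s) = 0"
    using g\<delta> neg \<delta> contg by (intro IVT2') auto
  then have "Z \<noteq> {}" by (auto simp: Z_def)
  moreover have "compact Z"
  proof -
    have "closed Z" unfolding Z_def by (rule continuous_closed_preimage_constant[OF contg]) simp
    moreover have "bounded Z" unfolding Z_def by (rule bounded_subset[OF bounded_closed_interval, of _ \<delta> t]) auto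
    ultimately show ?thesis by (simp add: compact_eq_bounded_closed)
  qed
  ultimately obtain t1 where t1: "t1 \<in> Z" "\<And>s. s \<in> Z \<Longrightarrow> t1 \<le> s" using compact_attains_inf[of Z] by auto
  have t1': "\<delta> \<le> t1" "t1 \<le> t" "\<Psi> (v t1) = 0" using t1(1) by (auto simp: Z_def)
  have pos: "0 \<le> \<Psi> (v s)" if s: "\<delta> \<le> s" "s \<le> t1" for s
  proof (rule ccontr)
    assume "\<not> 0 \<le> \<Psi> (v s)"
    then have "\<exists>r. \<delta> \<le> r \<and> r \<le> s \<and> \<Psi> (v r) = 0"
      using g\<delta> s t1' by (intro IVT2' continuous_on_subset[OF contg]) auto
    then obtain r where r: "\<delta> \<le> r" "r \<le> s" "\<Psi> (v r) = 0" by blast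
    then have "r \<in> Z" using s t1' by (auto simp: Z_def)
    then have "s = t1" using t1(2)[of r] r s by simp
    then show False using \<open>\<not> 0 \<le> \<Psi> (v s)\<close> t1' by simp
  qed
  have mono: "v s \<ge> v r" if "\<delta> \<le> s" "s \<le> r" "r \<le> t1" for s r
  proof (rule DERIV_nonpos_imp_decreasing_open[OF that(2)])
    fix x assume "s < x" "x < r"
    then show "\<exists>y. (v has_real_derivative y) (at x) \<and> y \<le> 0"
      using v_deriv[of x] pos[of x] that \<delta> by (intro exI[of _ "- \<Psi> (v x)"]) auto
  qed (rule continuous_on_subset[OF v_continuous], use that \<delta> in auto)
  define c where "c = v t1"
  have c0: "0 \<le> c" using v_nonneg[of t1] t1' \<delta> by (simp add: c_def)
  have "v \<delta> \<noteq> c" using g\<delta> t1' by (auto simp: c_def)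
  then have c\<delta>: "c < v \<delta>" using mono[of \<delta> t1] t1' by (simp add: c_def)
  have "(v (\<delta> + 0) - c) * exp (- max 0 (\<Psi> (v \<delta>) / (v \<delta> - c)) * (t1 - \<delta>)) \<le> v (\<delta> + (t1 - \<delta>)) - c"
  proof (rule solution_lower_bound[of "t1 - \<delta>" c "v \<delta>" "\<lambda>s. v (\<delta> + s)"])
    show "continuous_on {0..t1 - \<delta>} (\<lambda>s. v (\<delta> + s))"
      by (rule continuous_on_compose2[OF v_continuous]) (use \<delta> in \<open>auto intro!: continuous_intros\<close>)
    fix s assume s: "0 < s" "s < t1 - \<delta>"
    then show "((\<lambda>s. v (\<delta> + s)) has_real_derivative - \<Psi> (v (\<delta> + s))) (at s)"
      using v_deriv[of "\<delta> + s"] \<delta> DERIV_shift[of v "- \<Psi> (v (\<delta> + s))" s \<delta>] by (simp add: add.commute)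
  next
    fix s assume "0 \<le> s" "s \<le> t1 - \<delta>"
    then show "c \<le> v (\<delta> + s) \<and> v (\<delta> + s) \<le> v \<delta>" using mono[of "\<delta> + s" t1] mono[of \<delta> "\<delta> + s"] by (auto simp: c_def)
  qed (use t1' c0 c\<delta> in \<open>auto simp: c_def\<close>)
  then have "(v \<delta> - c) * exp (- max 0 (\<Psi> (v \<delta>) / (v \<delta> - c)) * (t1 - \<delta>)) \<le> 0" by (simp add: c_def)
  moreover have "0 < (v \<delta> - c) * exp (- max 0 (\<Psi> (v \<delta>) / (v \<delta> - c)) * (t1 - \<delta>))" using c\<delta> by simp
  ultimately show False by simp
qed

lemma v_decreasing:
  assumes "0 < s" "s < t" shows "v t < v s"
proof (rule DERIV_neg_imp_decreasing[OF assms(2)])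
  fix x assume "s \<le> x"
  then show "\<exists>y. (v has_real_derivative y) (at x) \<and> y < 0"
    using v_deriv[of x] \<Psi>_v_pos[of x] assms by (intro exI[of _ "- \<Psi> (v x)"]) auto
qed

lemma v_antimono: "0 < s \<Longrightarrow> s \<le> t \<Longrightarrow> v t \<le> v s"
  using v_decreasing[of s t] by (cases "s = t") auto

lemma v_positive: "0 < t \<Longrightarrow> 0 < v t"
  using v_nonneg[of "t + 1"] v_decreasing[of t "t + 1"] by simp

text \<open>If \<open>\<Psi>\<close> were at most linear, \<open>v\<close> would grow at most
  exponentially backwards in time and stay bounded near 0. Since \<open>\<Psi> q / q\<close>
  increases, the only alternative is that every slope is eventually exceeded.\<close>

lemma superlinear: "eventually (\<lambda>q. C * q \<le> \<Psi> q) at_top"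
proof (rule ccontr)
  assume no: "\<not> ?thesis"
  have "\<Psi> q / q \<le> C" if q: "0 < q" for q
  proof (rule ccontr)
    assume C: "\<not> \<Psi> q / q \<le> C"
    have "C * r \<le> \<Psi> r" if "q \<le> r" for r
    proof -
      have "C \<le> \<Psi> r / r" using C ratio_mono[OF q that] by simp
      then show ?thesis using q that by (simp add: pos_le_divide_eq)
    qed
    then show False using no by (auto simp: eventually_at_top_linorder)
  qed
  then have le: "\<Psi> q \<le> C * q" if "0 < q" for q using that by (simp add: pos_divide_le_eq)
  have "v s \<le> v 1 * exp (\<bar>C\<bar>)" if s: "0 < s" "s < 1" for s
  proof -
    have "v s * exp (C * s) \<le> v 1 * exp (C * 1)"
    proof (rule DERIV_nonneg_imp_increasing_open[OF less_imp_le[OF s(2)]])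
      fix t assume t: "s < t" "t < 1"
      show "\<exists>y. ((\<lambda>t. v t * exp (C * t)) has_real_derivative y) (at t) \<and> 0 \<le> y"
      proof (intro exI conjI)
        show "((\<lambda>t. v t * exp (C * t)) has_real_derivative (exp (C * t) * (C * v t - \<Psi> (v t)))) (at t)"
          using v_deriv[of t] t s by (auto intro!: derivative_eq_intros simp: algebra_simps)
        show "0 \<le> exp (C * t) * (C * v t - \<Psi> (v t))" using le[OF v_positive[of t]] t s by simp
      qed
    qed (intro continuous_intros continuous_on_subset[OF v_continuous], use s in auto)
    then have "v s \<le> v 1 * exp (C * (1 - s))" by (simp add: exp_diff right_diff_distrib field_simps)
    also have "\<dots> \<le> v 1 * exp (\<bar>C\<bar>)"
    proof -
      have "C * (1 - s) \<le> \<bar>C\<bar> * 1" using s by (intro mult_mono) auto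
      then show ?thesis using v_nonneg[of 1] by (intro mult_left_mono) auto
    qed
    finally show ?thesis .
  qed
  moreover have "eventually (\<lambda>s. v 1 * exp (\<bar>C\<bar>) + 1 \<le> v s) (at_right 0)" using v_top by (simp add: filterlim_at_top)
  then have "eventually (\<lambda>s. v 1 * exp (\<bar>C\<bar>) + 1 \<le> v s \<and> s \<in> {0<..<1}) (at_right 0)"
    by (rule eventually_conj) (rule eventually_at_right_real, simp)
  then obtain s where "v 1 * exp (\<bar>C\<bar>) + 1 \<le> v s" "0 < s" "s < 1"
    using eventually_happens'[OF trivial_limit_at_right_real] by fastforce
  ultimately show False by fastforce
qed

text \<open>Uniqueness for the flow: the squared distance to \<open>\<lambda>s. v (e + s)\<close>,
  times an exponential, decreases from 0. As \<open>\<Psi>\<close> may be infinitely steep at 0,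
  slopes are bounded above a positive number \<open>a\<close> that lies below both
  solutions.\<close>

lemma flow_eq:
  assumes w: "cumulant_flow \<Psi> w" and e: "0 < e" and t: "0 \<le> t"
  shows "w t (v e) = v (e + t)"
proof -
  define q where "q = v e"
  have q: "0 < q" using v_positive[OF e] by (simp add: q_def)
  define x where "x s = w s q" for s
  have x_nonneg: "0 \<le> x s" if "0 \<le> s" for s using w q that by (simp add: cumulant_flow_def x_def)
  have x_int: "((\<lambda>s. \<Psi> (x s)) has_integral (q - x s)) {0..s}" if "0 \<le> s" for s
    using w q that by (simp add: cumulant_flow_def x_def)
  have x_eq: "x s = q - integral {0..s} (\<lambda>s. \<Psi> (x s))" if "0 \<le> s" for s
    using integral_unique[OF x_int[OF that]] by simp
  have x_cont: "continuous_on {0..T} x" for T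
  proof (cases "0 \<le> T")
    case True
    have "(\<lambda>s. \<Psi> (x s)) integrable_on {0..T}" using x_int[OF True] by (rule has_integral_integrable)
    then have "continuous_on {0..T} (\<lambda>s. q - integral {0..s} (\<lambda>s. \<Psi> (x s)))"
      by (intro continuous_intros indefinite_integral_continuous_1)
    then show ?thesis by (rule continuous_on_eq) (simp add: x_eq)
  qed simp
  have x_deriv: "(x has_real_derivative - \<Psi> (x s)) (at s)" if s: "0 < s" for s
  proof -
    have "continuous_on {0..s + 1} (\<lambda>s. \<Psi> (x s))"
      by (rule continuous_on_compose2[OF cont x_cont]) (auto simp: x_nonneg)
    from integral_has_real_derivative[OF this, of s] s
    have "((\<lambda>s. integral {0..s} (\<lambda>s. \<Psi> (x s))) has_real_derivative \<Psi> (x s)) (at s within {0..s + 1})" by simp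
    then have "((\<lambda>s. integral {0..s} (\<lambda>s. \<Psi> (x s))) has_real_derivative \<Psi> (x s)) (at s)"
      using s by (simp add: at_within_Icc_at)
    then have "((\<lambda>s. q - integral {0..s} (\<lambda>s. \<Psi> (x s))) has_real_derivative - \<Psi> (x s)) (at s)"
      by (auto intro!: derivative_eq_intros)
    then show ?thesis
    proof (rule has_field_derivative_transform_within_open)
      show "open {0::real<..}" by simp
    qed (use s x_eq in auto)
  qed
  have x_0: "x 0 = q" using x_eq[of 0] by simp
  obtain B where B: "\<And>s. s \<in> {0..t} \<Longrightarrow> x s \<le> B"
  proof -
    have "bounded (x ` {0..t})" by (intro compact_imp_bounded compact_continuous_image x_cont) simp
    then obtain B where "\<forall>y\<in>x ` {0..t}. norm y \<le> B" unfolding bounded_iff by blast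
    then show thesis by (intro that[of B]) force
  qed
  define b where "b = max B 1"
  \<comment> \<open>The second entry bounds the given solution from below, by
    \<open>solution_lower_bound\<close> at the rest point 0.\<close>
  define a where "a = min (v (e + t)) (q * exp (- max 0 (\<Psi> b / b) * t))"
  have a: "0 < a" using v_positive[of "e + t"] e t q by (simp add: a_def)
  have xa: "a \<le> x s" if s: "0 \<le> s" "s \<le> t" for s
  proof -
    have "(x 0 - 0) * exp (- max 0 (\<Psi> b / (b - 0)) * s) \<le> x s - 0"
    proof (rule solution_lower_bound)
      show "continuous_on {0..s} x" by (rule x_cont)
      fix r assume "0 \<le> r" "r \<le> s"
      then show "0 \<le> x r \<and> x r \<le> b" using x_nonneg B[of r] s by (auto simp: b_def)
    qed (use s zero x_deriv in \<open>auto simp: b_def\<close>)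
    moreover have "q * exp (- max 0 (\<Psi> b / b) * t) \<le> q * exp (- max 0 (\<Psi> b / b) * s)"
      using s q by (intro mult_left_mono) (auto intro: mult_left_mono)
    ultimately show ?thesis by (simp add: a_def x_0)
  qed
  have va: "a \<le> v (e + s)" if s: "0 \<le> s" "s \<le> t" for s
    using v_antimono[of "e + s" "e + t"] s e by (simp add: a_def)
  \<comment> \<open>Possibly negative; it enters only as a lower bound on slopes.\<close>
  define K where "K = \<Psi> a / a"
  have "(x 0 - v (e + 0))\<^sup>2 * exp (2 * K * 0) \<ge> (x t - v (e + t))\<^sup>2 * exp (2 * K * t)"
  proof (rule DERIV_nonpos_imp_decreasing_open[OF t])
    fix s assume s: "0 < s" "s < t"
    have vd: "((\<lambda>s. v (e + s)) has_real_derivative - \<Psi> (v (e + s))) (at s)"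
      using v_deriv[of "e + s"] e s DERIV_shift[of v "- \<Psi> (v (e + s))" s e] by (simp add: add.commute)
    show "\<exists>y. ((\<lambda>s. (x s - v (e + s))\<^sup>2 * exp (2 * K * s)) has_real_derivative y) (at s) \<and> y \<le> 0"
    proof (intro exI conjI)
      show "((\<lambda>s. (x s - v (e + s))\<^sup>2 * exp (2 * K * s)) has_real_derivative
        (2 * exp (2 * K * s) * (K * (x s - v (e + s))\<^sup>2 - (x s - v (e + s)) * (\<Psi> (x s) - \<Psi> (v (e + s)))))) (at s)"
        using x_deriv[OF s(1)] vd by (auto intro!: derivative_eq_intros simp: algebra_simps power2_eq_square)
      have "K * (x s - v (e + s))\<^sup>2 \<le> (x s - v (e + s)) * (\<Psi> (x s) - \<Psi> (v (e + s)))"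
      proof (cases "v (e + s) \<le> x s")
        case True
        from slope_bound[OF a va True] s have "K * (x s - v (e + s)) \<le> \<Psi> (x s) - \<Psi> (v (e + s))" by (simp add: K_def)
        from mult_left_mono[OF this, of "x s - v (e + s)"] True show ?thesis by (simp add: power2_eq_square ac_simps)
      next
        case False
        then have "x s \<le> v (e + s)" by simp
        from slope_bound[OF a xa this] s have "K * (v (e + s) - x s) \<le> \<Psi> (v (e + s)) - \<Psi> (x s)" by (simp add: K_def)
        from mult_left_mono[OF this, of "v (e + s) - x s"] False show ?thesis by (simp add: power2_eq_square algebra_simps)
      qed
      then show "2 * exp (2 * K * s) * (K * (x s - v (e + s))\<^sup>2 - (x s - v (e + s)) * (\<Psi> (x s) - \<Psi> (v (e + s)))) \<le> 0"
        by (simp add: mult_nonneg_nonpos)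
    qed
  next
    show "continuous_on {0..t} (\<lambda>s. (x s - v (e + s))\<^sup>2 * exp (2 * K * s))"
      by (intro continuous_intros x_cont continuous_on_compose2[OF v_continuous]) (use e in auto)
  qed
  then have "(x t - v (e + t))\<^sup>2 * exp (2 * K * t) \<le> 0" by (simp add: x_0 q_def)
  then have "(x t - v (e + t))\<^sup>2 \<le> 0" by (simp add: mult_le_0_iff)
  then show ?thesis by (simp add: x_def q_def)
qed

end

text \<open>For the upper bound, \<open>exp (- x) * (1 + x) \<le> 1\<close> whereas
  \<open>(1 - x + x\<^sup>2) * (1 + x) = 1 + x ^ 3\<close>.\<close>

lemma exp_minus_taylor_bound:
  fixes x :: real assumes "0 \<le> x"
  shows "0 \<le> exp (- x) - 1 + x" "exp (- x) - 1 + x \<le> x\<^sup>2"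
proof -
  show "0 \<le> exp (- x) - 1 + x" using exp_ge_add_one_self[of "- x"] by linarith
  have "exp (- x) * (1 + x) \<le> exp (- x) * exp x" by (intro mult_left_mono exp_ge_add_one_self) auto
  then have "exp (- x) * (1 + x) \<le> 1" by (simp flip: exp_add)
  also have "1 \<le> (1 - x + x\<^sup>2) * (1 + x)"
  proof -
    have "(1 - x + x\<^sup>2) * (1 + x) = 1 + x ^ 3" by (simp add: power2_eq_square power3_eq_cube algebra_simps)
    then show ?thesis using assms by simp
  qed
  finally have "exp (- x) \<le> 1 - x + x\<^sup>2" using assms by (simp add: mult_le_cancel_right)
  then show "exp (- x) - 1 + x \<le> x\<^sup>2" by linarith
qed

lemma
  assumes "sets \<nu> = sets (restrict_space borel {0::real<..})"
  shows space_positive_measure: "space \<nu> = {0<..}"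
    and measurable_positive_measure: "f \<in> borel_measurable borel \<Longrightarrow> f \<in> borel_measurable \<nu>"
proof -
  show "space \<nu> = {0<..}" using sets_eq_imp_space_eq[OF assms] by (simp add: space_restrict_space)
  assume "f \<in> borel_measurable borel"
  then have "f \<in> borel_measurable (restrict_space borel {0<..})" by (rule measurable_restrict_space1)
  then show "f \<in> borel_measurable \<nu>" using measurable_cong_sets[OF assms refl] by blast
qed

section \<open>Branching mechanisms\<close>

locale branching =
  fixes d \<sigma> :: real and \<nu> :: "real measure" and \<Psi> :: "real \<Rightarrow> real"
  assumes bm: "branching_mechanism d \<sigma> \<nu> \<Psi>"
begin

definition k :: "real \<Rightarrow> real \<Rightarrow> real" where
  "k q u = exp (- q * u) - 1 + q * u * indicator {0<..<1} u"

lemma sets_\<nu>: "sets \<nu> = sets (restrict_space borel {0<..})"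
  and \<nu>_finite: "(\<integral>\<^sup>+u. ennreal (min 1 (u\<^sup>2)) \<partial>\<nu>) < \<infinity>"
  and \<Psi>_eq: "0 \<le> q \<Longrightarrow> \<Psi> q = d * q + 1 / 2 * \<sigma>\<^sup>2 * q\<^sup>2 + (\<integral>u. k q u \<partial>\<nu>)"
  using bm by (auto simp: branching_mechanism_def k_def)

lemma k_measurable: "k q \<in> borel_measurable \<nu>"
  by (rule measurable_positive_measure[OF sets_\<nu>]) (simp add: k_def[abs_def])

text \<open>Uniform over \<open>q \<le> Q\<close>, so that one integrable majorant serves for the
  continuity of \<open>\<Psi>\<close>.\<close>

lemma k_bound:
  assumes "0 \<le> q" "q \<le> Q" "0 < u" shows "\<bar>k q u\<bar> \<le> (1 + Q\<^sup>2) * min 1 (u\<^sup>2)"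
proof (cases "u < 1")
  case True
  have qu: "0 \<le> q * u" using assms by simp
  have "\<bar>k q u\<bar> \<le> (q * u)\<^sup>2" using exp_minus_taylor_bound[OF qu] True assms by (simp add: k_def)
  also have "\<dots> \<le> (1 + Q\<^sup>2) * u\<^sup>2" using assms by (auto simp: power_mult_distrib intro!: mult_right_mono power_mono add_increasing)
  also have "u\<^sup>2 = min 1 (u\<^sup>2)" using True assms by (simp add: min_absorb2 power_le_one)
  finally show ?thesis .
next
  case False
  then have "exp (- q * u) \<le> 1" "min 1 (u\<^sup>2) = 1" using assms by (auto simp: one_le_power)
  moreover from this have "\<bar>k q u\<bar> = 1 - exp (- q * u)" using False by (simp add: k_def)
  moreover have "1 - exp (- q * u) \<le> 1 + Q\<^sup>2" using exp_gt_zero[of "- q * u"] zero_le_power2[of Q] by linarith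
  ultimately show ?thesis by simp
qed

lemma integrable_dominating: "integrable \<nu> (\<lambda>u. c * min 1 (u\<^sup>2))"
proof -
  have "integrable \<nu> (\<lambda>u. min 1 (u\<^sup>2))"
    using \<nu>_finite measurable_positive_measure[OF sets_\<nu>, of "\<lambda>u. min 1 (u\<^sup>2)"]
    by (intro integrableI_nonneg) auto
  then show ?thesis by simp
qed

lemma integrable_k: "0 \<le> q \<Longrightarrow> integrable \<nu> (k q)"
  by (rule Bochner_Integration.integrable_bound[OF integrable_dominating[of "1 + q\<^sup>2"] k_measurable])
    (auto intro!: AE_I2 k_bound simp: space_positive_measure[OF sets_\<nu>])

lemma \<Psi>_0: "\<Psi> 0 = 0"
  by (simp add: \<Psi>_eq k_def)

lemma \<Psi>_continuous: "continuous_on {0..} \<Psi>"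
proof -
  have "continuous_on {0..} (\<lambda>q. \<integral>u. k q u \<partial>\<nu>)"
    unfolding continuous_on_sequentially
  proof (intro allI ballI impI)
    fix q :: "nat \<Rightarrow> real" and a assume a: "a \<in> {0..}" "(\<forall>n. q n \<in> {0..}) \<and> q \<longlonglongrightarrow> a"
    have "bounded (range q)" using a(2) convergent_imp_bounded by blast
    then obtain Q where "\<forall>y\<in>range q. norm y \<le> Q" unfolding bounded_iff by blast
    then have Q: "\<bar>q n\<bar> \<le> Q" for n by simp
    have "(\<lambda>n. \<integral>u. k (q n) u \<partial>\<nu>) \<longlonglongrightarrow> (\<integral>u. k a u \<partial>\<nu>)"
    proof (rule integral_dominated_convergence[OF k_measurable k_measurable integrable_dominating[of "1 + Q\<^sup>2"]])
      show "AE u in \<nu>. (\<lambda>n. k (q n) u) \<longlonglongrightarrow> k a u"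
        unfolding k_def using a(2) by (intro AE_I2 tendsto_intros) auto
      show "AE u in \<nu>. norm (k (q n) u) \<le> (1 + Q\<^sup>2) * min 1 (u\<^sup>2)" for n
        using a(2) Q[of n] by (intro AE_I2) (auto intro!: k_bound simp: space_positive_measure[OF sets_\<nu>])
    qed
    then show "((\<lambda>q. \<integral>u. k q u \<partial>\<nu>) \<circ> q) \<longlonglongrightarrow> (\<integral>u. k a u \<partial>\<nu>)" by (simp add: comp_def)
  qed
  then have "continuous_on {0..} (\<lambda>q. d * q + 1 / 2 * \<sigma>\<^sup>2 * q\<^sup>2 + (\<integral>u. k q u \<partial>\<nu>))"
    by (intro continuous_intros)
  then show ?thesis by (rule continuous_on_eq) (simp add: \<Psi>_eq)
qed

lemma \<Psi>_convex: "convex_on {0..} \<Psi>"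
proof (rule convex_onI)
  fix t x y :: real assume t: "0 < t" "t < 1" and xy: "x \<in> {0..}" "y \<in> {0..}"
  let ?z = "(1 - t) *\<^sub>R x + t *\<^sub>R y"
  have z: "0 \<le> ?z" using t xy by simp
  have kz: "k ?z u \<le> (1 - t) * k x u + t * k y u" for u
  proof -
    have "exp ((1 - t) *\<^sub>R (- x * u) + t *\<^sub>R (- y * u)) \<le> (1 - t) * exp (- x * u) + t * exp (- y * u)"
      using t by (intro convex_onD[OF exp_convex]) auto
    also have "(1 - t) *\<^sub>R (- x * u) + t *\<^sub>R (- y * u) = - ?z * u" by (simp add: algebra_simps)
    finally show ?thesis unfolding k_def by (simp add: algebra_simps)
  qed
  have "(\<integral>u. k ?z u \<partial>\<nu>) \<le> (\<integral>u. (1 - t) * k x u + t * k y u \<partial>\<nu>)"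
    using xy z by (intro integral_mono kz Bochner_Integration.integrable_add integrable_mult_right integrable_k) auto
  also have "\<dots> = (1 - t) * (\<integral>u. k x u \<partial>\<nu>) + t * (\<integral>u. k y u \<partial>\<nu>)"
    using xy integrable_k by simp
  finally have 1: "(\<integral>u. k ?z u \<partial>\<nu>) \<le> (1 - t) * (\<integral>u. k x u \<partial>\<nu>) + t * (\<integral>u. k y u \<partial>\<nu>)" .
  have "(1 - t) * x\<^sup>2 + t * y\<^sup>2 - ?z\<^sup>2 = (1 - t) * t * (x - y)\<^sup>2" by (simp add: power2_eq_square algebra_simps)
  moreover have "0 \<le> (1 - t) * t * (x - y)\<^sup>2" using t by simp
  ultimately have 2: "?z\<^sup>2 \<le> (1 - t) * x\<^sup>2 + t * y\<^sup>2" by linarith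
  have "1 / 2 * \<sigma>\<^sup>2 * ?z\<^sup>2 \<le> 1 / 2 * \<sigma>\<^sup>2 * ((1 - t) * x\<^sup>2 + t * y\<^sup>2)"
    using 2 by (rule mult_left_mono) simp
  with 1 have "d * ?z + 1 / 2 * \<sigma>\<^sup>2 * ?z\<^sup>2 + (\<integral>u. k ?z u \<partial>\<nu>)
    \<le> d * ?z + 1 / 2 * \<sigma>\<^sup>2 * ((1 - t) * x\<^sup>2 + t * y\<^sup>2) + ((1 - t) * (\<integral>u. k x u \<partial>\<nu>) + t * (\<integral>u. k y u \<partial>\<nu>))" by linarith
  also have "\<dots> = (1 - t) * (d * x + 1 / 2 * \<sigma>\<^sup>2 * x\<^sup>2 + (\<integral>u. k x u \<partial>\<nu>)) + t * (d * y + 1 / 2 * \<sigma>\<^sup>2 * y\<^sup>2 + (\<integral>u. k y u \<partial>\<nu>))"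
    by (simp add: field_simps)
  finally show "\<Psi> ?z \<le> (1 - t) * \<Psi> x + t * \<Psi> y" using z xy by (simp only: \<Psi>_eq atLeast_iff)
qed simp

end

section \<open>Immigration mechanisms\<close>

locale immigration =
  fixes \<beta> :: real and \<nu> :: "real measure" and \<Phi> :: "real \<Rightarrow> real"
  assumes im: "immigration_mechanism \<beta> \<nu> \<Phi>"
begin

lemma \<beta>_nonneg: "0 \<le> \<beta>"
  and sets_\<nu>: "sets \<nu> = sets (restrict_space borel {0<..})"
  and \<nu>_finite: "(\<integral>\<^sup>+u. ennreal (min 1 u) \<partial>\<nu>) < \<infinity>"
  and \<Phi>_eq: "0 \<le> q \<Longrightarrow> \<Phi> q = \<beta> * q + (\<integral>u. (1 - exp (- q * u)) \<partial>\<nu>)"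
  using im by (auto simp: immigration_mechanism_def)

lemma j_measurable: "(\<lambda>u. 1 - exp (- q * u)) \<in> borel_measurable \<nu>"
  by (rule measurable_positive_measure[OF sets_\<nu>]) simp

lemma j_bounds:
  fixes q u :: real
  assumes "0 \<le> q" "q \<le> Q" "0 < u" shows "0 \<le> 1 - exp (- q * u)" "1 - exp (- q * u) \<le> max 1 Q * min 1 u"
proof -
  have "0 \<le> q * u" using assms by (intro mult_nonneg_nonneg) auto
  then show "0 \<le> 1 - exp (- q * u)" by simp
  have "1 - exp (- q * u) \<le> q * u" using exp_ge_add_one_self[of "- q * u"] by linarith
  also have "\<dots> \<le> max 1 Q * u" using assms by (intro mult_right_mono) auto
  finally have "1 - exp (- q * u) \<le> max 1 Q * u" .
  moreover have "1 - exp (- q * u) \<le> max 1 Q * 1" using exp_gt_zero[of "- q * u"] by linarith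
  ultimately show "1 - exp (- q * u) \<le> max 1 Q * min 1 u" by (simp add: min_def)
qed

lemma integrable_dominating: "integrable \<nu> (\<lambda>u. c * min 1 u)"
proof -
  have "integrable \<nu> (\<lambda>u. min 1 u)"
    using \<nu>_finite measurable_positive_measure[OF sets_\<nu>, of "\<lambda>u. min 1 u"]
    by (intro integrableI_nonneg) (auto intro!: AE_I2 simp: space_positive_measure[OF sets_\<nu>])
  then show ?thesis by simp
qed

lemma integrable_j: "0 \<le> q \<Longrightarrow> integrable \<nu> (\<lambda>u. 1 - exp (- q * u))"
  by (rule Bochner_Integration.integrable_bound[OF integrable_dominating[of "max 1 q"] j_measurable])
    (use j_bounds[of q q] in \<open>auto intro!: AE_I2 simp: space_positive_measure[OF sets_\<nu>]\<close>)

lemma \<Phi>_nonneg: "0 \<le> q \<Longrightarrow> 0 \<le> \<Phi> q"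
  using \<beta>_nonneg j_bounds(1)[of q q]
  by (auto simp: \<Phi>_eq space_positive_measure[OF sets_\<nu>] intro!: add_nonneg_nonneg integral_nonneg_AE AE_I2)

lemma \<Phi>_mono: "0 \<le> p \<Longrightarrow> p \<le> q \<Longrightarrow> \<Phi> p \<le> \<Phi> q"
  using \<beta>_nonneg
  by (auto simp: \<Phi>_eq space_positive_measure[OF sets_\<nu>] intro!: add_mono mult_left_mono integral_mono integrable_j[simplified])

lemma \<Phi>_linear_bound: "\<exists>m. \<forall>q\<ge>1. \<Phi> q \<le> m * q"
proof (intro exI allI impI)
  fix q :: real assume q: "1 \<le> q"
  have "(\<integral>u. (1 - exp (- q * u)) \<partial>\<nu>) \<le> (\<integral>u. q * min 1 u \<partial>\<nu>)"
    using j_bounds(2)[of q q] q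
    by (intro integral_mono integrable_j integrable_dominating) (auto simp: space_positive_measure[OF sets_\<nu>])
  then show "\<Phi> q \<le> (\<beta> + (\<integral>u. min 1 u \<partial>\<nu>)) * q" using q by (simp add: \<Phi>_eq algebra_simps)
qed

lemma \<Phi>_continuous: "continuous_on {0..} \<Phi>"
proof -
  have "continuous_on {0..} (\<lambda>q. \<integral>u. (1 - exp (- q * u)) \<partial>\<nu>)"
    unfolding continuous_on_sequentially
  proof (intro allI ballI impI)
    fix q :: "nat \<Rightarrow> real" and a assume a: "a \<in> {0..}" "(\<forall>n. q n \<in> {0..}) \<and> q \<longlonglongrightarrow> a"
    have "bounded (range q)" using a(2) convergent_imp_bounded by blast
    then obtain Q where "\<forall>y\<in>range q. norm y \<le> Q" unfolding bounded_iff by blast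
    then have Q: "\<bar>q n\<bar> \<le> Q" for n by simp
    have "(\<lambda>n. \<integral>u. (1 - exp (- q n * u)) \<partial>\<nu>) \<longlonglongrightarrow> (\<integral>u. (1 - exp (- a * u)) \<partial>\<nu>)"
    proof (rule integral_dominated_convergence[OF j_measurable j_measurable integrable_dominating[of "max 1 Q"]])
      show "AE u in \<nu>. (\<lambda>n. 1 - exp (- q n * u)) \<longlonglongrightarrow> 1 - exp (- a * u)"
        using a(2) by (intro AE_I2 tendsto_intros) auto
      show "AE u in \<nu>. norm (1 - exp (- q n * u)) \<le> max 1 Q * min 1 u" for n
        using a(2) Q[of n] j_bounds[of "q n" Q] by (intro AE_I2) (auto simp: space_positive_measure[OF sets_\<nu>])
    qed
    then show "((\<lambda>q. \<integral>u. (1 - exp (- q * u)) \<partial>\<nu>) \<circ> q) \<longlonglongrightarrow> (\<integral>u. (1 - exp (- a * u)) \<partial>\<nu>)" by (simp add: comp_def)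
  qed
  then have "continuous_on {0..} (\<lambda>q. \<beta> * q + (\<integral>u. (1 - exp (- q * u)) \<partial>\<nu>))"
    by (intro continuous_intros)
  then show ?thesis by (rule continuous_on_eq) (simp add: \<Phi>_eq)
qed

text \<open>Boundedness of \<open>\<Phi>\<close> is the form in which the condition meets the
  process. For the converse, a positive \<open>\<beta>\<close> would make \<open>\<Phi>\<close>
  unbounded, and Fatou's lemma, with \<open>1 - exp (- real n * u)\<close> tending to 1, bounds the
  total mass.\<close>

lemma compound_Poisson_iff: "\<beta> = 0 \<and> finite_measure \<nu> \<longleftrightarrow> (\<exists>c. \<forall>q\<ge>0. \<Phi> q \<le> c)"
proof
  assume \<beta>\<nu>: "\<beta> = 0 \<and> finite_measure \<nu>"
  then interpret finite_measure \<nu> by simp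
  have "\<Phi> q \<le> measure \<nu> (space \<nu>)" if q: "0 \<le> q" for q
  proof -
    have "(\<integral>u. (1 - exp (- q * u)) \<partial>\<nu>) \<le> (\<integral>u. 1 \<partial>\<nu>)"
      using integrable_j[OF q] by (intro integral_mono) auto
    then show ?thesis using \<beta>\<nu> q by (simp add: \<Phi>_eq)
  qed
  then show "\<exists>c. \<forall>q\<ge>0. \<Phi> q \<le> c" by blast
next
  assume "\<exists>c. \<forall>q\<ge>0. \<Phi> q \<le> c"
  then obtain c where c: "\<And>q. 0 \<le> q \<Longrightarrow> \<Phi> q \<le> c" by blast
  have nonneg: "0 \<le> (\<integral>u. (1 - exp (- q * u)) \<partial>\<nu>)" if "0 \<le> q" for q
    using j_bounds(1)[of q q] that by (intro integral_nonneg_AE AE_I2) (auto simp: space_positive_measure[OF sets_\<nu>])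
  have "\<beta> = 0"
  proof (rule ccontr)
    assume "\<beta> \<noteq> 0"
    then have b: "0 < \<beta>" using \<beta>_nonneg by simp
    have "0 \<le> c" using c[of 0] \<Phi>_nonneg[of 0] by simp
    then have q: "0 \<le> (c + 1) / \<beta>" using b by simp
    have "c + 1 \<le> \<Phi> ((c + 1) / \<beta>)" using nonneg[OF q] q b by (simp add: \<Phi>_eq)
    then show False using c[OF q] by simp
  qed
  have le: "(\<integral>\<^sup>+u. ennreal (1 - exp (- real n * u)) \<partial>\<nu>) \<le> ennreal c" for n :: nat
  proof -
    have "(\<integral>\<^sup>+u. ennreal (1 - exp (- real n * u)) \<partial>\<nu>) = ennreal (\<integral>u. (1 - exp (- real n * u)) \<partial>\<nu>)"
      using j_bounds(1)[of "real n" "real n"]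
      by (intro nn_integral_eq_integral integrable_j AE_I2) (auto simp: space_positive_measure[OF sets_\<nu>])
    also have "\<dots> \<le> ennreal c" using c[of "real n"] \<open>\<beta> = 0\<close> by (intro ennreal_leI) (simp add: \<Phi>_eq)
    finally show ?thesis .
  qed
  have "(\<integral>\<^sup>+u. 1 \<partial>\<nu>) = (\<integral>\<^sup>+u. liminf (\<lambda>n. ennreal (1 - exp (- real n * u))) \<partial>\<nu>)"
  proof (rule nn_integral_cong)
    fix u assume "u \<in> space \<nu>"
    then have u: "0 < u" by (simp add: space_positive_measure[OF sets_\<nu>])
    have "(\<lambda>n. ennreal (1 - exp (- real n * u))) \<longlonglongrightarrow> ennreal (1 - 0)"
      by (intro tendsto_ennrealI tendsto_diff tendsto_const) (use u in real_asymp)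
    then show "1 = liminf (\<lambda>n. ennreal (1 - exp (- real n * u)))"
      by (intro lim_imp_Liminf[symmetric]) auto
  qed
  also have "\<dots> \<le> liminf (\<lambda>n. \<integral>\<^sup>+u. ennreal (1 - exp (- real n * u)) \<partial>\<nu>)"
    by (rule nn_integral_liminf) (rule measurable_compose[OF j_measurable measurable_ennreal])
  also have "\<dots> \<le> limsup (\<lambda>n. \<integral>\<^sup>+u. ennreal (1 - exp (- real n * u)) \<partial>\<nu>)"
    by (rule Liminf_le_Limsup) simp
  also have "\<dots> \<le> ennreal c" by (intro Limsup_bounded always_eventually allI le)
  finally have "emeasure \<nu> (space \<nu>) \<le> ennreal c" by simp
  then have "finite_measure \<nu>" by (intro finite_measureI) (auto simp: top_unique)
  with \<open>\<beta> = 0\<close> show "\<beta> = 0 \<and> finite_measure \<nu>" by simp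
qed

end

section \<open>The exponent of the potential density\<close>

locale immigration_flow = convex_flow \<Psi> v + immigration \<beta> \<nu> \<Phi>
  for \<Psi> v :: "real \<Rightarrow> real" and \<beta> :: real and \<nu> :: "real measure" and \<Phi> :: "real \<Rightarrow> real"
begin

definition I :: "real \<Rightarrow> real" where "I t = (LBINT s=ereal t..1. \<Phi> (v s))"

lemma \<Phi>_v_continuous: "continuous_on {0<..} (\<lambda>t. \<Phi> (v t))"
  by (rule continuous_on_compose2[OF \<Phi>_continuous v_continuous]) (auto simp: v_nonneg)

lemma I_deriv:
  assumes t: "0 < t" shows "(I has_real_derivative - \<Phi> (v t)) (at t)"
proof -
  define a b where "a = min t 1 / 2" and "b = max t 1 + 1"
  have ab: "0 < a" "a < t" "t < b" "a \<le> 1" "1 \<le> b" using t by (auto simp: a_def b_def)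
  have "continuous_on {a..b} (\<lambda>s. \<Phi> (v s))"
    by (rule continuous_on_subset[OF \<Phi>_v_continuous]) (use ab in auto)
  then have "((\<lambda>u. LBINT s=ereal 1..ereal u. \<Phi> (v s)) has_vector_derivative \<Phi> (v t)) (at t within {a..b})"
    using ab by (intro interval_integral_FTC2) auto
  then have "((\<lambda>u. LBINT s=ereal 1..ereal u. \<Phi> (v s)) has_real_derivative \<Phi> (v t)) (at t)"
    using ab by (simp add: at_within_Icc_at has_real_derivative_iff_has_vector_derivative)
  then have "((\<lambda>u. - (LBINT s=ereal 1..ereal u. \<Phi> (v s))) has_real_derivative - \<Phi> (v t)) (at t)"
    by (rule DERIV_minus)
  moreover have "(\<lambda>u. - (LBINT s=ereal 1..ereal u. \<Phi> (v s))) = I"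
    unfolding I_def one_ereal_def by (subst interval_integral_endpoints_reverse) simp
  ultimately show ?thesis by simp
qed

lemma I_1: "I 1 = 0"
  by (simp add: I_def one_ereal_def)

lemma I_continuous: "continuous_on {0<..} I"
  by (rule DERIV_continuous_on) (use I_deriv in \<open>auto intro: has_field_derivative_at_within\<close>)

lemma I_diff:
  assumes e: "0 < e" and t: "0 \<le> t"
  shows "(LBINT s=0..ereal t. \<Phi> (v (e + s))) = I e - I (e + t)"
proof -
  have "(LBINT s=ereal 0..ereal t. \<Phi> (v (e + s))) = (\<lambda>s. - I (e + s)) t - (\<lambda>s. - I (e + s)) 0"
  proof (rule interval_integral_FTC_finite)
    show "continuous_on {min 0 t..max 0 t} (\<lambda>s. \<Phi> (v (e + s)))"
      by (rule continuous_on_compose2[OF \<Phi>_v_continuous]) (use e t in \<open>auto intro!: continuous_intros\<close>)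
    fix s assume s: "min 0 t \<le> s" "s \<le> max 0 t"
    have "((\<lambda>s. I (e + s)) has_real_derivative - \<Phi> (v (e + s))) (at s)"
      using I_deriv[of "e + s"] DERIV_shift[of I "- \<Phi> (v (e + s))" s e] s e t by (simp add: add.commute)
    then have "((\<lambda>s. - I (e + s)) has_real_derivative \<Phi> (v (e + s))) (at s)"
      by (auto intro!: derivative_eq_intros)
    then show "((\<lambda>s. - I (e + s)) has_vector_derivative \<Phi> (v (e + s))) (at s within {min 0 t..max 0 t})"
      by (simp add: has_real_derivative_iff_has_vector_derivative has_vector_derivative_at_within)
  qed
  then show ?thesis by (simp add: zero_ereal_def)
qed

lemma I_antimono: assumes "0 < s" "s \<le> t" shows "I t \<le> I s"
proof (rule DERIV_nonpos_imp_decreasing_open[OF assms(2)])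
  fix x assume "s < x"
  then show "\<exists>y. (I has_real_derivative y) (at x) \<and> y \<le> 0"
    using I_deriv[of x] \<Phi>_nonneg[OF v_nonneg, of x] assms by (intro exI[of _ "- \<Phi> (v x)"]) auto
qed (rule continuous_on_subset[OF I_continuous], use assms in auto)

lemma I_decrease_le:
  assumes "0 < s" "s \<le> t" and c: "\<And>r. s < r \<Longrightarrow> r < t \<Longrightarrow> \<Phi> (v r) \<le> c"
  shows "I s \<le> I t + c * (t - s)"
proof -
  have "I s + c * s \<le> I t + c * t"
  proof (rule DERIV_nonneg_imp_increasing_open[OF assms(2)])
    fix r assume r: "s < r" "r < t"
    show "\<exists>y. ((\<lambda>r. I r + c * r) has_real_derivative y) (at r) \<and> 0 \<le> y"
      using I_deriv[of r] c[OF r] r assms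
      by (intro exI[of _ "- \<Phi> (v r) + c"]) (auto intro!: derivative_eq_intros)
  qed (intro continuous_intros continuous_on_subset[OF I_continuous], use assms in auto)
  then show ?thesis by (simp add: algebra_simps)
qed

lemma I_decrease_ge:
  assumes "0 < s" "s \<le> t" and c: "\<And>r. s < r \<Longrightarrow> r < t \<Longrightarrow> c \<le> \<Phi> (v r)"
  shows "I t \<le> I s - c * (t - s)"
proof -
  have "I s + c * s \<ge> I t + c * t"
  proof (rule DERIV_nonpos_imp_decreasing_open[OF assms(2)])
    fix r assume r: "s < r" "r < t"
    show "\<exists>y. ((\<lambda>r. I r + c * r) has_real_derivative y) (at r) \<and> y \<le> 0"
      using I_deriv[of r] c[OF r] r assms
      by (intro exI[of _ "- \<Phi> (v r) + c"]) (auto intro!: derivative_eq_intros)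
  qed (intro continuous_intros continuous_on_subset[OF I_continuous], use assms in auto)
  then show ?thesis by (simp add: algebra_simps)
qed

text \<open>Since \<open>\<Phi>\<close> grows at most linearly and \<open>\<Psi>\<close> superlinearly, \<open>I - \<kappa> v\<close> is monotone near \<open>0\<close>.\<close>

lemma exp_I_growth:
  assumes \<kappa>: "0 < \<kappa>"
  shows "((\<lambda>e. exp (I e) * exp (- \<kappa> * v e)) \<longlongrightarrow> 0) (at_right 0)"
proof -
  obtain m where m: "\<And>q. 1 \<le> q \<Longrightarrow> \<Phi> q \<le> m * q" using \<Phi>_linear_bound by blast
  obtain q0 where q0: "\<And>q. q0 \<le> q \<Longrightarrow> (2 * m / \<kappa>) * q \<le> \<Psi> q"
    using superlinear[of "2 * m / \<kappa>"] unfolding eventually_at_top_linorder by blast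
  have "eventually (\<lambda>s. max 1 q0 \<le> v s) (at_right 0)" using v_top unfolding filterlim_at_top by blast
  then obtain d where d: "0 < d" "\<And>s. 0 < s \<Longrightarrow> s < d \<Longrightarrow> max 1 q0 \<le> v s"
    by (auto simp: eventually_at_right_field)
  define e0 where "e0 = d / 2"
  have e0: "0 < e0" "e0 < d" using d by (auto simp: e0_def)
  have le: "\<Phi> (v s) \<le> \<kappa> / 2 * \<Psi> (v s)" if "0 < s" "s < d" for s
  proof -
    have "m * v s = \<kappa> / 2 * ((2 * m / \<kappa>) * v s)" using \<kappa> by simp
    also have "\<dots> \<le> \<kappa> / 2 * \<Psi> (v s)" using q0[of "v s"] d(2)[OF that] \<kappa> by (intro mult_left_mono) auto
    finally show ?thesis using m[of "v s"] d(2)[OF that] by simp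
  qed
  have *: "I e - \<kappa> / 2 * v e \<le> I e0 - \<kappa> / 2 * v e0" if e: "0 < e" "e \<le> e0" for e
  proof (rule DERIV_nonneg_imp_increasing_open[OF e(2)])
    fix r assume r: "e < r" "r < e0"
    show "\<exists>y. ((\<lambda>r. I r - \<kappa> / 2 * v r) has_real_derivative y) (at r) \<and> 0 \<le> y"
      using I_deriv[of r] v_deriv[of r] le[of r] r e e0
      by (intro exI[of _ "- \<Phi> (v r) + \<kappa> / 2 * \<Psi> (v r)"]) (auto intro!: derivative_eq_intros)
  qed (intro continuous_intros continuous_on_subset[OF I_continuous] continuous_on_subset[OF v_continuous], use e in auto)
  define C where "C = exp (I e0 - \<kappa> / 2 * v e0)"
  have "filterlim (\<lambda>e. - (\<kappa> / 2) * v e) at_bot (at_right 0)"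
    using v_top \<kappa> by (intro filterlim_tendsto_neg_mult_at_bot[OF tendsto_const]) auto
  then have "((\<lambda>e. C * exp (- (\<kappa> / 2) * v e)) \<longlongrightarrow> C * 0) (at_right 0)"
    by (intro tendsto_mult tendsto_const filterlim_compose[OF exp_at_bot])
  then have lim: "((\<lambda>e. C * exp (- (\<kappa> / 2) * v e)) \<longlongrightarrow> 0) (at_right 0)" by simp
  show ?thesis
  proof (rule tendsto_sandwich[OF _ _ tendsto_const lim])
    have "eventually (\<lambda>e. e \<in> {0<..<e0}) (at_right 0)" using e0 by (intro eventually_at_right_real) simp
    then show "eventually (\<lambda>e. exp (I e) * exp (- \<kappa> * v e) \<le> C * exp (- (\<kappa> / 2) * v e)) (at_right 0)"
    proof eventually_elim
      case (elim e)
      then have "I e + (- \<kappa> * v e) \<le> (I e0 - \<kappa> / 2 * v e0) + (- (\<kappa> / 2) * v e)" using *[of e] by (simp add: field_simps)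
      then show ?case unfolding C_def exp_add[symmetric] by simp
    qed
  qed simp
qed

text \<open>The exponent loses at most \<open>c\<close> per unit of time, as
  \<open>union_of_intervals\<close> requires.\<close>

lemma exp_I_bounded_decrease:
  assumes c: "\<And>q. 0 \<le> q \<Longrightarrow> \<Phi> q \<le> c" and "0 < e" "0 \<le> t"
  shows "exp (I e) \<le> exp (I (e + t)) * exp (c * t)"
  using I_decrease_le[of e "e + t" c] assms v_nonneg by (simp add: exp_add[symmetric])

text \<open>Close to 0, \<open>v\<close> exceeds a level beyond which \<open>\<Phi>\<close> is
  larger than \<open>C\<close>; this is what \<open>not_union_of_intervals\<close> asks for.\<close>

lemma exp_I_fast_decrease:
  assumes unb: "\<not> (\<exists>c. \<forall>q\<ge>0. \<Phi> q \<le> c)"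
  shows "\<exists>e0>0. \<forall>e t. 0 < e \<longrightarrow> 0 \<le> t \<longrightarrow> e + t \<le> e0 \<longrightarrow> exp (I (e + t)) \<le> exp (- C * t) * exp (I e)"
proof -
  obtain q where q: "0 \<le> q" "C < \<Phi> q" using unb by (meson not_le)
  have "eventually (\<lambda>s. q \<le> v s) (at_right 0)" using v_top by (simp add: filterlim_at_top)
  then obtain d where d: "0 < d" "\<And>s. 0 < s \<Longrightarrow> s < d \<Longrightarrow> q \<le> v s"
    by (auto simp: eventually_at_right_field)
  show ?thesis
  proof (intro exI[of _ d] conjI allI impI d(1))
    fix e t assume et: "0 < e" "0 \<le> t" "e + t \<le> d"
    have "I (e + t) \<le> I e - C * ((e + t) - e)"
    proof (rule I_decrease_ge)
      fix r assume "e < r" "r < e + t"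
      then show "C \<le> \<Phi> (v r)" using \<Phi>_mono[OF q(1) d(2)[of r]] q et by simp
    qed (use et in auto)
    then show "exp (I (e + t)) \<le> exp (- C * t) * exp (I e)" by (simp add: exp_add[symmetric])
  qed
qed

lemma v_image: assumes "0 < a" "a \<le> b" shows "v ` {a..b} = {v b..v a}"
proof
  show "v ` {a..b} \<subseteq> {v b..v a}" using assms v_antimono by auto
  show "{v b..v a} \<subseteq> v ` {a..b}"
  proof
    fix y assume "y \<in> {v b..v a}"
    then have "\<exists>x\<ge>a. x \<le> b \<and> v x = y"
      using assms by (intro IVT2') (auto intro: continuous_on_subset[OF v_continuous])
    then show "y \<in> v ` {a..b}" by auto
  qed
qed

lemma ratio_continuous:
  assumes "0 < a" "a \<le> b" shows "continuous_on {v b..v a} (\<lambda>u. \<Phi> u / \<Psi> u)"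
proof -
  have "\<Psi> y \<noteq> 0" if "y \<in> {v b..v a}" for y
  proof -
    have "y \<in> v ` {a..b}" using that by (simp add: v_image[OF assms])
    then obtain x where "a \<le> x" "y = v x" by auto
    then show ?thesis using \<Psi>_v_pos[of x] assms by simp
  qed
  moreover have "{v b..v a} \<subseteq> {0..}" using v_nonneg[of b] assms by auto
  ultimately show ?thesis
    by (intro continuous_on_divide continuous_on_subset[OF \<Phi>_continuous] continuous_on_subset[OF cont]) auto
qed

text \<open>Substitution of \<open>u = v x\<close>; the ends change places because \<open>v\<close>
  decreases.\<close>

lemma I_diff_eq:
  assumes a: "0 < a" "a \<le> b"
  shows "(LBINT u=ereal (v b)..ereal (v a). \<Phi> u / \<Psi> u) = I a - I b"
proof -
  have "(LBINT x=ereal a..ereal b. - \<Psi> (v x) *\<^sub>R (\<Phi> (v x) / \<Psi> (v x))) = (LBINT y=ereal (v a)..ereal (v b). \<Phi> y / \<Psi> y)"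
  proof (rule interval_integral_substitution_finite[OF a(2)])
    show "(v has_real_derivative - \<Psi> (v x)) (at x within {a..b})" if "a \<le> x" "x \<le> b" for x
      using v_deriv[of x] that a by (auto intro: has_field_derivative_at_within)
    show "continuous_on (v ` {a..b}) (\<lambda>u. \<Phi> u / \<Psi> u)"
      using ratio_continuous[OF a] by (simp add: v_image[OF a])
    show "continuous_on {a..b} (\<lambda>x. - \<Psi> (v x))"
      by (intro continuous_intros continuous_on_subset[OF \<Psi>_v_continuous]) (use a in auto)
  qed
  moreover have "(LBINT x=ereal a..ereal b. - \<Psi> (v x) *\<^sub>R (\<Phi> (v x) / \<Psi> (v x))) = I b - I a"
  proof -
    have "(LBINT x=ereal a..ereal b. - \<Phi> (v x)) = I b - I a"
    proof (rule interval_integral_FTC_finite)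
      show "continuous_on {min a b..max a b} (\<lambda>x. - \<Phi> (v x))"
        by (intro continuous_intros continuous_on_subset[OF \<Phi>_v_continuous]) (use a in auto)
      show "(I has_vector_derivative - \<Phi> (v x)) (at x within {min a b..max a b})" if "min a b \<le> x" "x \<le> max a b" for x
        using I_deriv[of x] that a
        by (simp add: has_real_derivative_iff_has_vector_derivative has_vector_derivative_at_within)
    qed
    moreover have "- \<Psi> (v x) *\<^sub>R (\<Phi> (v x) / \<Psi> (v x)) = - \<Phi> (v x)" if "x \<in> {a<..<b}" for x
      using \<Psi>_v_pos[of x] that a by simp
    then have "(LBINT x=ereal a..ereal b. - \<Psi> (v x) *\<^sub>R (\<Phi> (v x) / \<Psi> (v x))) = (LBINT x=ereal a..ereal b. - \<Phi> (v x))"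
      using a by (intro interval_integral_cong) (auto simp: min_def max_def einterval_def)
    ultimately show ?thesis by simp
  qed
  ultimately have "I b - I a = - (LBINT y=ereal (v b)..ereal (v a). \<Phi> y / \<Psi> y)"
    by (subst interval_integral_endpoints_reverse[symmetric]) simp
  then show ?thesis by simp
qed

lemma I_eq:
  assumes t: "0 < t"
  shows "I t = (LBINT u=ereal (v 1)..ereal (v t). \<Phi> u / \<Psi> u)"
proof (cases "t \<le> 1")
  case True
  then show ?thesis using I_diff_eq[OF t True] I_1 by simp
next
  case False
  then show ?thesis
    using I_diff_eq[of 1 t] I_1 by (subst interval_integral_endpoints_reverse) simp
qed

text \<open>As \<open>e\<close> decreases to 0, \<open>I e\<close> increases to the integral of
  \<open>\<Phi> / \<Psi>\<close> from \<open>v 1\<close> on. Moving the lower limit between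
  \<open>v 1\<close> and \<open>\<theta>\<close> changes it by a finite amount, because
  \<open>\<Psi>\<close> is positive and continuous in between.\<close>

lemma ratio_integral_finite_iff:
  assumes \<theta>: "0 < \<theta>" "\<And>z. \<theta> \<le> z \<Longrightarrow> 0 < \<Psi> z"
  shows "(\<integral>\<^sup>+s\<in>{\<theta>..}. ennreal (\<Phi> s / \<Psi> s) \<partial>lborel) < \<infinity> \<longleftrightarrow> (\<exists>K. \<forall>e>0. exp (I e) \<le> K)"
proof -
  define R where "R a b = (\<integral>\<^sup>+s\<in>{a..b}. ennreal (\<Phi> s / \<Psi> s) \<partial>lborel)" for a b
  \<comment> \<open>Points from \<open>v 1\<close> on are values of \<open>v\<close>, where
    \<open>\<Psi>\<close> is positive by \<open>\<Psi>_v_pos\<close>.\<close>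
  have pos: "0 < \<Psi> z" if z: "min \<theta> (v 1) \<le> z" for z
  proof (cases "\<theta> \<le> z")
    case False
    then have vz: "v 1 \<le> z" using z by simp
    have "eventually (\<lambda>s. z \<le> v s \<and> s \<in> {0<..<1}) (at_right 0)"
      using v_top unfolding filterlim_at_top by (intro eventually_conj eventually_at_right_real) auto
    then obtain s where s: "z \<le> v s" "0 < s" "s < 1"
      using eventually_happens'[OF trivial_limit_at_right_real] by fastforce
    then have "z \<in> v ` {s..1}" using vz by (simp add: v_image)
    then show ?thesis using \<Psi>_v_pos s by auto
  qed (use \<theta> in auto)
  have v1: "0 < v 1" by (rule v_positive) simp
  have rat: "continuous_on {a..b} (\<lambda>s. \<Phi> s / \<Psi> s)" if "min \<theta> (v 1) \<le> a" for a b
  proof -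
    have "\<Psi> s \<noteq> 0" if "s \<in> {a..b}" for s using pos[of s] that \<open>min \<theta> (v 1) \<le> a\<close> by auto
    moreover have "{a..b} \<subseteq> {0..}" using that v1 \<theta>(1) by auto
    ultimately show ?thesis
      by (intro continuous_on_divide continuous_on_subset[OF \<Phi>_continuous] continuous_on_subset[OF cont]) auto
  qed
  have R_eq: "R a b = ennreal (LBINT u=ereal a..ereal b. \<Phi> u / \<Psi> u)" if "min \<theta> (v 1) \<le> a" "a \<le> b" for a b
  proof -
    have int: "set_integrable lborel {a..b} (\<lambda>s. \<Phi> s / \<Psi> s)"
      by (rule borel_integrable_atLeastAtMost'[OF rat[OF that(1)]])
    have "R a b = (\<integral>\<^sup>+s. ennreal (indicator {a..b} s *\<^sub>R (\<Phi> s / \<Psi> s)) \<partial>lborel)"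
      unfolding R_def by (intro nn_integral_cong) (auto simp: indicator_def)
    also have "\<dots> = ennreal (\<integral>s. indicator {a..b} s *\<^sub>R (\<Phi> s / \<Psi> s) \<partial>lborel)"
    proof (intro nn_integral_eq_integral AE_I2)
      fix s
      show "0 \<le> indicator {a..b} s *\<^sub>R (\<Phi> s / \<Psi> s)"
        using pos[of s] \<Phi>_nonneg[of s] that v1 \<theta>(1) by (auto simp: indicator_def)
    qed (use int in \<open>simp add: set_integrable_def\<close>)
    also have "\<dots> = ennreal (LBINT u=ereal a..ereal b. \<Phi> u / \<Psi> u)"
      using that by (simp add: interval_integral_Icc set_lebesgue_integral_def)
    finally show ?thesis .
  qed
  have I_R: "ennreal (I e) = R (v 1) (v e)" if "0 < e" "e \<le> 1" for e
    using that by (subst R_eq) (auto simp: I_eq v_antimono)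
  have meas: "(\<lambda>s. ennreal (\<Phi> s / \<Psi> s) * indicator {a..b} s) \<in> borel_measurable lborel" if "min \<theta> (v 1) \<le> a" for a b
  proof -
    have "(\<lambda>s. indicator {a..b} s *\<^sub>R (\<Phi> s / \<Psi> s)) \<in> borel_measurable borel"
      by (rule borel_measurable_continuous_on_indicator[OF _ rat[OF that]]) simp
    then have "(\<lambda>s. ennreal (indicator {a..b} s *\<^sub>R (\<Phi> s / \<Psi> s))) \<in> borel_measurable lborel" by simp
    moreover have "(\<lambda>s. ennreal (indicator {a..b} s *\<^sub>R (\<Phi> s / \<Psi> s))) = (\<lambda>s. ennreal (\<Phi> s / \<Psi> s) * indicator {a..b} s)"
      by (auto simp: indicator_def)
    ultimately show ?thesis by simp
  qed
  have R_mono: "R a b \<le> R a' b'" if "a' \<le> a" "b \<le> b'" for a b a' b'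
    unfolding R_def using that by (intro nn_integral_mono) (auto simp: indicator_def)
  have R_add: "R a c \<le> R a b + R b c" if "min \<theta> (v 1) \<le> a" "a \<le> b" for a b c
  proof -
    have "R a c \<le> (\<integral>\<^sup>+s. ennreal (\<Phi> s / \<Psi> s) * indicator {a..b} s + ennreal (\<Phi> s / \<Psi> s) * indicator {b..c} s \<partial>lborel)"
      unfolding R_def by (intro nn_integral_mono) (auto simp: indicator_def)
    also have "\<dots> = R a b + R b c"
      unfolding R_def using that by (intro nn_integral_add meas) auto
    finally show ?thesis .
  qed
  show ?thesis
  proof
    assume fin: "(\<integral>\<^sup>+s\<in>{\<theta>..}. ennreal (\<Phi> s / \<Psi> s) \<partial>lborel) < \<infinity>"
    define b where "b = max \<theta> (v 1)"
    have B: "R \<theta> c \<le> (\<integral>\<^sup>+s\<in>{\<theta>..}. ennreal (\<Phi> s / \<Psi> s) \<partial>lborel)" for c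
      unfolding R_def by (intro nn_integral_mono) (auto simp: indicator_def)
    have "R (v 1) b + (\<integral>\<^sup>+s\<in>{\<theta>..}. ennreal (\<Phi> s / \<Psi> s) \<partial>lborel) < \<infinity>"
      using fin by (subst R_eq) (auto simp: b_def ennreal_add_eq_top less_top)
    then obtain C where C: "0 \<le> C" "R (v 1) b + (\<integral>\<^sup>+s\<in>{\<theta>..}. ennreal (\<Phi> s / \<Psi> s) \<partial>lborel) = ennreal C"
      by (metis less_top infinity_ennreal_def ennreal_cases order_less_irrefl)
    have "exp (I e) \<le> exp C" if e: "0 < e" for e
    proof (cases "e \<le> 1")
      case True
      have "ennreal (I e) \<le> R (v 1) b + R b (v e)"
        unfolding I_R[OF e True] by (rule R_add) (auto simp: b_def)
      also have "\<dots> \<le> ennreal C"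
        unfolding C(2)[symmetric]
        by (intro add_mono order_refl order_trans[OF R_mono B]) (auto simp: b_def)
      finally show ?thesis using C(1) by simp
    next
      case False
      then show ?thesis using I_antimono[of 1 e] I_1 C(1) by simp
    qed
    then show "\<exists>K. \<forall>e>0. exp (I e) \<le> K" by blast
  next
    assume "\<exists>K. \<forall>e>0. exp (I e) \<le> K"
    then obtain K where K: "\<And>e. 0 < e \<Longrightarrow> exp (I e) \<le> K" by blast
    have K1: "1 \<le> K" using K[of 1] I_1 by simp
    define b where "b = max \<theta> (v 1)"
    have bound: "R \<theta> (real n) \<le> R \<theta> b + ennreal (ln K)" for n
    proof -
      have "eventually (\<lambda>s. max b (real n) \<le> v s \<and> s \<in> {0<..<1}) (at_right 0)"
        using v_top unfolding filterlim_at_top by (intro eventually_conj eventually_at_right_real) (blast, simp)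
      then obtain s where s: "max b (real n) \<le> v s" "0 < s" "s < 1"
        using eventually_happens'[OF trivial_limit_at_right_real] by fastforce
      have "R \<theta> (real n) \<le> R \<theta> b + R b (real n)" by (rule R_add) (auto simp: b_def)
      also have "R b (real n) \<le> R (v 1) (v s)" using s by (intro R_mono) (auto simp: b_def)
      also have "\<dots> = ennreal (I s)" using s by (simp add: I_R)
      also have "\<dots> \<le> ennreal (ln K)" using K[OF s(2)] K1 by (intro ennreal_leI) (simp add: ln_ge_iff)
      finally show ?thesis by (simp add: add_left_mono)
    qed
    \<comment> \<open>The half-line is exhausted by bounded intervals, to which \<open>bound\<close>
      applies uniformly.\<close>
    have "(\<integral>\<^sup>+s\<in>{\<theta>..}. ennreal (\<Phi> s / \<Psi> s) \<partial>lborel)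
        = (\<integral>\<^sup>+s. (SUP n. ennreal (\<Phi> s / \<Psi> s) * indicator {\<theta>..real n} s) \<partial>lborel)"
    proof (rule nn_integral_cong)
      fix s
      show "ennreal (\<Phi> s / \<Psi> s) * indicator {\<theta>..} s = (SUP n. ennreal (\<Phi> s / \<Psi> s) * indicator {\<theta>..real n} s)"
      proof (rule antisym)
        obtain n where "s \<le> real n" using real_arch_simple by blast
        then show "ennreal (\<Phi> s / \<Psi> s) * indicator {\<theta>..} s \<le> (SUP n. ennreal (\<Phi> s / \<Psi> s) * indicator {\<theta>..real n} s)"
          by (intro SUP_upper2[of n]) (auto simp: indicator_def)
        show "(SUP n. ennreal (\<Phi> s / \<Psi> s) * indicator {\<theta>..real n} s) \<le> ennreal (\<Phi> s / \<Psi> s) * indicator {\<theta>..} s"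
          by (intro SUP_least) (auto simp: indicator_def)
      qed
    qed
    also have "\<dots> = (SUP n. R \<theta> (real n))"
      unfolding R_def
      by (intro nn_integral_monotone_convergence_SUP incseq_SucI le_funI meas) (auto simp: indicator_def)
    also have "\<dots> \<le> R \<theta> b + ennreal (ln K)" by (intro SUP_least bound)
    also have "\<dots> < \<infinity>" by (subst R_eq) (auto simp: b_def ennreal_add_eq_top less_top)
    finally show "(\<integral>\<^sup>+s\<in>{\<theta>..}. ennreal (\<Phi> s / \<Psi> s) \<partial>lborel) < \<infinity>" .
  qed
qed

end

section \<open>The process with immigration\<close>

text \<open>The Markov property is given for indicators, as real conditional expectations. On
  \<open>A\<close> it says that the law of \<open>Y (s + t)\<close> is a mixture of the kernels, an
  equality of measures that extends to all nonnegative functions.\<close>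

lemma markov_process_nn_integral:
  fixes f :: "ennreal \<Rightarrow> ennreal"
  assumes M: "prob_space M" and P: "markov_process M P Y" and st: "0 \<le> s" "0 \<le> t"
    and A: "A \<in> sets (natural_filtration M Y s)" and f: "f \<in> borel_measurable borel"
  shows "(\<integral>\<^sup>+\<omega>\<in>A. f (Y (s + t) \<omega>) \<partial>M) = (\<integral>\<^sup>+\<omega>\<in>A. (\<integral>\<^sup>+y. f y \<partial>P t (Y s \<omega>)) \<partial>M)"
proof -
  interpret prob_space M by fact
  have Y: "Y r \<in> borel_measurable M" if "0 \<le> r" for r using P that by (simp add: markov_process_def)
  have Pt: "P t \<in> borel \<rightarrow>\<^sub>M prob_algebra borel" using P st by (simp add: markov_process_def)
  have sub: "subalgebra M (natural_filtration M Y s)" by (rule natural_filtration_subalgebra) (rule Y)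
  interpret sigma_finite_subalgebra M "natural_filtration M Y s"
    by (intro finite_measure_subalgebra_is_sigma_finite finite_measure_subalgebra.intro
        finite_measure_subalgebra_axioms.intro sub) unfold_locales
  have AM [measurable]: "A \<in> sets M" using A sub by (auto simp: subalgebra_def)
  have [measurable]: "Y (s + t) \<in> borel_measurable M" "Y s \<in> borel_measurable M" using Y st by auto
  have K: "(\<lambda>\<omega>. P t (Y s \<omega>)) \<in> density M (indicator A) \<rightarrow>\<^sub>M subprob_algebra borel"
    using measurable_compose[OF \<open>Y s \<in> borel_measurable M\<close> measurable_prob_algebraD[OF Pt]] by simp
  have Pp: "prob_space (P t y)" "sets (P t y) = sets borel" for y
    using measurable_space[OF Pt, of y] by (auto simp: space_prob_algebra)
  have "distr (density M (indicator A)) borel (Y (s + t)) = density M (indicator A) \<bind> (\<lambda>\<omega>. P t (Y s \<omega>))"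
  proof (rule measure_eqI)
    have sb: "sets (density M (indicator A) \<bind> (\<lambda>\<omega>. P t (Y s \<omega>))) = sets borel"
      by (rule sets_bind) (use Pp not_empty in auto)
    then show "sets (distr (density M (indicator A)) borel (Y (s + t))) = sets (density M (indicator A) \<bind> (\<lambda>\<omega>. P t (Y s \<omega>)))"
      by simp
    fix B assume "B \<in> sets (distr (density M (indicator A)) borel (Y (s + t)))"
    then have B [measurable]: "B \<in> sets borel" by simp
    have mB [measurable]: "(\<lambda>\<omega>. measure (P t (Y s \<omega>)) B) \<in> borel_measurable M"
      unfolding measure_def
      using measurable_compose[OF K measurable_emeasure_subprob_algebra[OF B]] by simp
    have "(\<integral>\<omega>\<in>A. indicator B (Y (s + t) \<omega>) \<partial>M)
        = (\<integral>\<omega>\<in>A. real_cond_exp M (natural_filtration M Y s) (\<lambda>\<omega>. indicator B (Y (s + t) \<omega>)) \<omega> \<partial>M)"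
      by (rule real_cond_exp_intA[OF _ A])
        (rule integrable_const_bound[where B=1], auto simp: indicator_def)
    also have "\<dots> = (\<integral>\<omega>\<in>A. measure (P t (Y s \<omega>)) B \<partial>M)"
    proof (rule set_lebesgue_integral_cong_AE)
      have "AE \<omega> in M. real_cond_exp M (natural_filtration M Y s) (\<lambda>\<omega>. indicator B (Y (s + t) \<omega>)) \<omega> = measure (P t (Y s \<omega>)) B"
        using P st B by (simp add: markov_process_def)
      then show "AE \<omega>\<in>A in M. real_cond_exp M (natural_filtration M Y s) (\<lambda>\<omega>. indicator B (Y (s + t) \<omega>)) \<omega> = measure (P t (Y s \<omega>)) B"
        by eventually_elim simp
    qed (auto intro: borel_measurable_cond_exp2)
    finally have eq: "(\<integral>\<omega>\<in>A. indicator B (Y (s + t) \<omega>) \<partial>M) = (\<integral>\<omega>\<in>A. measure (P t (Y s \<omega>)) B \<partial>M)" .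
    have "emeasure (distr (density M (indicator A)) borel (Y (s + t))) B
        = (\<integral>\<^sup>+\<omega>. ennreal (indicator A \<omega> * indicator B (Y (s + t) \<omega>)) \<partial>M)"
      by (subst emeasure_distr)
        (auto simp: emeasure_density indicator_def intro!: nn_integral_cong)
    also have "\<dots> = ennreal (\<integral>\<omega>\<in>A. indicator B (Y (s + t) \<omega>) \<partial>M)"
      unfolding set_lebesgue_integral_def real_scaleR_def
      by (rule nn_integral_eq_integral) (rule integrable_const_bound[where B=1], auto simp: indicator_def)
    also have "\<dots> = (\<integral>\<^sup>+\<omega>. ennreal (indicator A \<omega> * measure (P t (Y s \<omega>)) B) \<partial>M)"
      unfolding eq unfolding set_lebesgue_integral_def real_scaleR_def
      by (rule nn_integral_eq_integral[symmetric])
        (rule integrable_const_bound[where B=1], auto simp: indicator_def intro!: prob_space.prob_le_1 Pp)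
    also have "\<dots> = (\<integral>\<^sup>+\<omega>. emeasure (P t (Y s \<omega>)) B \<partial>density M (indicator A))"
    proof (subst nn_integral_density)
      show "(\<lambda>\<omega>. emeasure (P t (Y s \<omega>)) B) \<in> borel_measurable M"
        using measurable_compose[OF K measurable_emeasure_subprob_algebra[OF B]] by simp
      show "(\<integral>\<^sup>+\<omega>. ennreal (indicator A \<omega> * measure (P t (Y s \<omega>)) B) \<partial>M) = (\<integral>\<^sup>+\<omega>. indicator A \<omega> * emeasure (P t (Y s \<omega>)) B \<partial>M)"
        using Pp(1) by (intro nn_integral_cong) (auto simp: indicator_def finite_measure.emeasure_eq_measure[OF prob_space.finite_measure])
    qed simp
    also have "\<dots> = emeasure (density M (indicator A) \<bind> (\<lambda>\<omega>. P t (Y s \<omega>))) B"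
      by (rule emeasure_bind[symmetric, OF _ K B]) (use not_empty in simp)
    finally show "emeasure (distr (density M (indicator A)) borel (Y (s + t))) B
      = emeasure (density M (indicator A) \<bind> (\<lambda>\<omega>. P t (Y s \<omega>))) B" .
  qed
  then have "(\<integral>\<^sup>+y. f y \<partial>distr (density M (indicator A)) borel (Y (s + t))) = (\<integral>\<^sup>+y. f y \<partial>(density M (indicator A) \<bind> (\<lambda>\<omega>. P t (Y s \<omega>))))"
    by simp
  then have "(\<integral>\<^sup>+\<omega>. f (Y (s + t) \<omega>) \<partial>density M (indicator A)) = (\<integral>\<^sup>+\<omega>. (\<integral>\<^sup>+y. f y \<partial>P t (Y s \<omega>)) \<partial>density M (indicator A))"
    using f by (subst (asm) nn_integral_distr) (simp_all add: nn_integral_bind[OF f K])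
  moreover have "(\<lambda>\<omega>. \<integral>\<^sup>+y. f y \<partial>P t (Y s \<omega>)) \<in> borel_measurable M"
    using measurable_compose[OF K nn_integral_measurable_subprob_algebra[OF f]] by simp
  ultimately show ?thesis
    using measurable_compose[OF \<open>Y (s + t) \<in> borel_measurable M\<close> f]
    by (simp add: nn_integral_density mult.commute)
qed

context immigration_flow
begin

text \<open>By the flow property the kernel maps \<open>exp_neg (v e)\<close> to
  \<open>exp_neg (v (e + t))\<close> times \<open>exp (I (e + t) - I e)\<close>, and the factor
  \<open>exp (I e)\<close> absorbs this constant. From \<infinity> both sides give 0.\<close>

lemma CBI_markov:
  assumes M: "prob_space M" and Y: "CBI M \<Psi> \<Phi> x Y" and A: "A \<in> sets (natural_filtration M Y s)"
    and st: "0 \<le> s" "0 \<le> t" and e: "0 < e"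
  shows "(\<integral>\<^sup>+\<omega>\<in>A. ennreal (exp (I e) * exp_neg (v e) (Y (s + t) \<omega>)) \<partial>M)
    = (\<integral>\<^sup>+\<omega>\<in>A. ennreal (exp (I (e + t)) * exp_neg (v (e + t)) (Y s \<omega>)) \<partial>M)"
proof -
  obtain P w where P: "markov_process M P Y" and w: "cumulant_flow \<Psi> w"
    and tr: "\<And>t q x. 0 \<le> t \<Longrightarrow> 0 < q \<Longrightarrow> 0 \<le> x \<Longrightarrow>
      (\<integral>y. exp_neg q y \<partial>P t (ennreal x)) = exp (- x * w t q - (LBINT s=0..ereal t. \<Phi> (w s q)))"
    and infty: "\<And>t. 0 \<le> t \<Longrightarrow> P t \<infinity> = return borel \<infinity>"
    using Y unfolding CBI_def CBI_transition_def by blast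
  have Pt: "P t \<in> borel \<rightarrow>\<^sub>M prob_algebra borel" using P st by (simp add: markov_process_def)
  have Pp: "prob_space (P t y)" "sets (P t y) = sets borel" for y
    using measurable_space[OF Pt, of y] by (auto simp: space_prob_algebra)
  have v: "0 < v e" by (rule v_positive[OF e])
  have [measurable]: "exp_neg q \<in> borel_measurable borel" for q
    unfolding exp_neg_def[abs_def] by measurable
  have step: "(\<integral>\<^sup>+\<omega>\<in>A. ennreal (exp (I e) * exp_neg (v e) (Y (s + t) \<omega>)) \<partial>M)
      = (\<integral>\<^sup>+\<omega>\<in>A. (\<integral>\<^sup>+y. ennreal (exp (I e) * exp_neg (v e) y) \<partial>P t (Y s \<omega>)) \<partial>M)"
    by (rule markov_process_nn_integral[OF M P st A]) measurable
  have inner: "(\<integral>\<^sup>+y. ennreal (exp (I e) * exp_neg (v e) y) \<partial>P t z) = ennreal (exp (I (e + t)) * exp_neg (v (e + t)) z)" for z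
  proof -
    interpret P: prob_space "P t z" by (rule Pp)
    have [measurable]: "exp_neg (v e) \<in> borel_measurable (P t z)"
      by (subst measurable_cong_sets[OF Pp(2) refl]) simp
    have "(\<integral>\<^sup>+y. ennreal (exp (I e) * exp_neg (v e) y) \<partial>P t z) = ennreal (\<integral>y. exp (I e) * exp_neg (v e) y \<partial>P t z)"
    proof (rule nn_integral_eq_integral)
      have "AE y in P t z. norm (exp_neg (v e) y) \<le> 1" using v by (auto simp: exp_neg_def)
      then show "integrable (P t z) (\<lambda>y. exp (I e) * exp_neg (v e) y)"
        by (intro integrable_mult_right P.integrable_const_bound) simp_all
    qed (auto simp: exp_neg_def)
    also have "(\<integral>y. exp (I e) * exp_neg (v e) y \<partial>P t z) = exp (I e) * (\<integral>y. exp_neg (v e) y \<partial>P t z)" by simp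
    also have "\<dots> = exp (I (e + t)) * exp_neg (v (e + t)) z"
    proof (cases z)
      case (real x)
      have "(LBINT s=0..ereal t. \<Phi> (w s (v e))) = (LBINT s=0..ereal t. \<Phi> (v (e + s)))"
        using st e by (intro interval_integral_cong) (auto simp: einterval_def zero_ereal_def min_def flow_eq[OF w] split: if_splits)
      then have "exp (I e) * (\<integral>y. exp_neg (v e) y \<partial>P t z) = exp (I e) * exp (- x * v (e + t) - (I e - I (e + t)))"
        using real tr[OF st(2) v, of x] by (simp add: flow_eq[OF w e st(2)] I_diff[OF e st(2)])
      then show ?thesis using real by (simp add: exp_neg_def exp_add[symmetric] algebra_simps)
    next
      case top
      have "(\<integral>y. exp_neg (v e) y \<partial>return borel (\<infinity>::ennreal)) = exp_neg (v e) \<infinity>"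
        by (rule integral_return) auto
      then show ?thesis using top infty[OF st(2)] by (simp add: exp_neg_def)
    qed
    finally show ?thesis .
  qed
  show ?thesis unfolding step inner ..
qed

text \<open>The flow \<open>v\<close> is constrained only at positive times; a constant elsewhere
  makes \<open>\<rho>\<close> and \<open>v'\<close> measurable on the real line.\<close>

definition \<rho> :: "real \<Rightarrow> real" where "\<rho> t = (if 0 < t then exp (I t) else 1)"

definition v' :: "real \<Rightarrow> real" where "v' t = (if 0 < t then v t else 1)"

lemma CBI_laplace_flow_process:
  assumes M: "prob_space M" and Y: "CBI M \<Psi> \<Phi> 0 Y"
  shows "laplace_flow_process M Y \<rho> v'"
proof -
  interpret prob_space M by fact
  have meas: "(\<lambda>t. if 0 < t then f t else 1) \<in> borel_measurable borel" if "continuous_on {0<..} f" for f :: "real \<Rightarrow> real"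
  proof -
    have "(\<lambda>t. indicator {0<..} t *\<^sub>R f t) \<in> borel_measurable borel"
      using that by (intro borel_measurable_continuous_on_indicator) auto
    then have "(\<lambda>t. if 0 < t then indicator {0<..} t *\<^sub>R f t else 1) \<in> borel_measurable borel" by measurable
    then show ?thesis by (rule measurable_cong[THEN iffD1, rotated]) auto
  qed
  show ?thesis
  proof
    show "Y t \<in> borel_measurable M" if "0 \<le> t" for t
      using Y that by (auto simp: CBI_def markov_process_def)
    show "continuous (at_right t) (\<lambda>t. Y t \<omega>)" if "\<omega> \<in> space M" "0 \<le> t" for \<omega> t
      using Y that by (auto simp: CBI_def cadlag_def)
    show "AE \<omega> in M. Y 0 \<omega> = 0" using Y by (simp add: CBI_def)
    show "\<rho> \<in> borel_measurable borel" "v' \<in> borel_measurable borel"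
      unfolding \<rho>_def[abs_def] v'_def[abs_def]
      by (intro meas continuous_intros I_continuous v_continuous)+
    show "0 < \<rho> t" "0 < v' t" if "0 < t" for t using that v_positive by (auto simp: \<rho>_def v'_def)
    show "\<rho> t \<le> \<rho> s" if "0 < s" "s \<le> t" for s t using that I_antimono by (auto simp: \<rho>_def)
    show "filterlim v' at_top (at_right 0)"
      using v_top by (rule filterlim_cong[THEN iffD1, rotated -1]) (auto simp: v'_def eventually_at_right_field intro!: exI[of _ 1])
    show "(\<integral>\<^sup>+\<omega>\<in>A. ennreal (\<rho> e * exp_neg (v' e) (Y (s + t) \<omega>)) \<partial>M)
        = (\<integral>\<^sup>+\<omega>\<in>A. ennreal (\<rho> (e + t) * exp_neg (v' (e + t)) (Y s \<omega>)) \<partial>M)"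
      if "A \<in> sets (natural_filtration M Y s)" "0 \<le> s" "0 \<le> t" "0 < e" for A s t e
      using CBI_markov[OF M Y that] that by (simp add: \<rho>_def v'_def)
  qed
qed

end

theorem theorem1:
  fixes M :: "'a measure" and Y :: "real \<Rightarrow> 'a \<Rightarrow> ennreal"
    and \<Psi> \<Phi> v :: "real \<Rightarrow> real" and d \<sigma> \<beta> \<theta> :: real and \<nu>\<^sub>1 \<nu>\<^sub>0 :: "real measure"
  assumes "prob_space M"
    and "branching_mechanism d \<sigma> \<nu>\<^sub>1 \<Psi>"
    and "grey_condition \<Psi>"
    and "immigration_mechanism \<beta> \<nu>\<^sub>0 \<Phi>"
    and "CBI M \<Psi> \<Phi> 0 Y"
    and "flow_from_infinity \<Psi> v"
    and "0 < \<theta>" and "\<forall>z\<ge>\<theta>. 0 < \<Psi> z"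
  shows
    "((AE \<omega> in M. zero_set Y \<omega> = {0}) \<longleftrightarrow>
        (\<integral>\<^sup>+u\<in>{0<..<1}. ennreal (exp (- (LBINT s=1..ereal u. \<Phi> (v s)))) \<partial>lborel) = \<infinity>)
     \<and>
     ((\<integral>\<^sup>+u\<in>{0<..<1}. ennreal (exp (- (LBINT s=1..ereal u. \<Phi> (v s)))) \<partial>lborel) < \<infinity> \<longrightarrow>
        (\<exists>S L. subordinator M S \<and> has_Laplace_exponent M S L \<and>
           (\<forall>q>0.
              L q = inverse (LINT t:{0<..}|lborel.
                      exp (- q * t) * exp (LBINT s=ereal t..1. \<Phi> (v s))) \<and>
              L q = inverse (LINT t:{0<..}|lborel.
                      exp (- q * t) * exp (LBINT u=ereal (v 1)..ereal (v t). \<Phi> u / \<Psi> u))) \<and>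
           (AE \<omega> in M. zero_set Y \<omega> = closed_range S \<omega>))
        \<and>
        ((AE \<omega> in M. 0 < emeasure lborel (zero_set Y \<omega>)) \<longleftrightarrow>
           (\<integral>\<^sup>+s\<in>{\<theta>..}. ennreal (\<Phi> s / \<Psi> s) \<partial>lborel) < \<infinity>)
        \<and>
        ((AE \<omega> in M. \<exists>\<I>. (\<forall>I\<in>\<I>. nondegenerate_closed_interval I) \<and> zero_set Y \<omega> = \<Union>\<I>) \<longleftrightarrow>
           \<beta> = 0 \<and> finite_measure \<nu>\<^sub>0))"
proof -
  interpret branching d \<sigma> \<nu>\<^sub>1 \<Psi> by unfold_locales fact
  interpret immigration_flow \<Psi> v \<beta> \<nu>\<^sub>0 \<Phi>
    by unfold_locales (use assms \<Psi>_0 \<Psi>_continuous \<Psi>_convex in \<open>auto simp: flow_from_infinity_def\<close>)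
  interpret laplace_flow_process M Y \<rho> v' by (rule CBI_laplace_flow_process) fact+
  \<comment> \<open>Exchanging the ends shows that the integral from 1 to \<open>u\<close> is
    \<open>- I u\<close>.\<close>
  have u_eq: "(\<integral>\<^sup>+u\<in>{0<..<1}. ennreal (exp (- (LBINT s=1..ereal u. \<Phi> (v s)))) \<partial>lborel) = (\<integral>\<^sup>+x\<in>{0<..<1}. ennreal (\<rho> x) \<partial>lborel)"
    by (intro nn_integral_cong, subst interval_integral_endpoints_reverse)
      (auto simp: indicator_def \<rho>_def I_def)
  show ?thesis
  \<comment> \<open>An infinite integral gives the trivial set. A finite one makes the local time
    available, and \<open>zero_set_nontrivial\<close> then settles the other direction of
    (i).\<close>
  proof (cases "(\<integral>\<^sup>+x\<in>{0<..<1}. ennreal (\<rho> x) \<partial>lborel) = \<infinity>")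
    case True
    then show ?thesis using zero_set_trivial[OF True] unfolding u_eq by simp
  next
    case False
    then have fin: "(\<integral>\<^sup>+x\<in>{0<..<1}. ennreal (\<rho> x) \<partial>lborel) < \<infinity>" by (simp add: less_top)
    interpret local_time_process M Y \<rho> v'
    proof
      show "((\<lambda>e. \<rho> e * exp (- \<kappa> * v' e)) \<longlongrightarrow> 0) (at_right 0)" if "0 < \<kappa>" for \<kappa>
        using exp_I_growth[OF that]
        by (rule tendsto_cong[THEN iffD1, rotated]) (auto simp: \<rho>_def v'_def eventually_at_right_field intro!: exI[of _ 1])
    qed fact
    have L1: "L q = inverse (LINT t:{0<..}|lborel. exp (- q * t) * exp (LBINT s=ereal t..1. \<Phi> (v s)))" if "0 < q" for q
      unfolding L_eq[OF that] by (intro arg_cong[where f=inverse] set_lebesgue_integral_cong) (auto simp: \<rho>_def I_def)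
    have L2: "L q = inverse (LINT t:{0<..}|lborel. exp (- q * t) * exp (LBINT u=ereal (v 1)..ereal (v t). \<Phi> u / \<Psi> u))" if "0 < q" for q
      unfolding L_eq[OF that] by (intro arg_cong[where f=inverse] set_lebesgue_integral_cong) (auto simp: \<rho>_def I_eq)
    have "AE \<omega> in M. zero_set Y \<omega> = closed_range S' \<omega>"
      using AE_G2 by eventually_elim (rule zero_set_eq_closed_range)
    then have a: "\<exists>S L. subordinator M S \<and> has_Laplace_exponent M S L \<and>
           (\<forall>q>0.
              L q = inverse (LINT t:{0<..}|lborel.
                      exp (- q * t) * exp (LBINT s=ereal t..1. \<Phi> (v s))) \<and>
              L q = inverse (LINT t:{0<..}|lborel.
                      exp (- q * t) * exp (LBINT u=ereal (v 1)..ereal (v t). \<Phi> u / \<Psi> u))) \<and>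
           (AE \<omega> in M. zero_set Y \<omega> = closed_range S \<omega>)"
      using L1 L2 subordinator_S' has_Laplace_exponent_S' by blast
    have b: "(AE \<omega> in M. 0 < emeasure lborel (zero_set Y \<omega>)) \<longleftrightarrow> (\<exists>K. \<forall>e>0. exp (I e) \<le> K)"
    proof
      assume pos: "AE \<omega> in M. 0 < emeasure lborel (zero_set Y \<omega>)"
      show "\<exists>K. \<forall>e>0. exp (I e) \<le> K"
      proof (rule ccontr)
        assume no: "\<not> ?thesis"
        have "\<exists>e>0. K \<le> \<rho> e" for K
        proof -
          obtain e where "0 < e" "\<not> exp (I e) \<le> K" using no by blast
          then show ?thesis by (intro exI[of _ e]) (simp add: \<rho>_def)
        qed
        then have "AE \<omega> in M. emeasure lborel (zero_set Y \<omega>) = 0" by (rule null_Lebesgue)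
        with pos have "AE \<omega> in M. False" by eventually_elim simp
        then show False by simp
      qed
    next
      assume "\<exists>K. \<forall>e>0. exp (I e) \<le> K"
      then obtain K where "\<And>e. 0 < e \<Longrightarrow> exp (I e) \<le> K" by blast
      then have "\<And>e. 0 < e \<Longrightarrow> \<rho> e \<le> K" by (simp add: \<rho>_def)
      then show "AE \<omega> in M. 0 < emeasure lborel (zero_set Y \<omega>)" by (rule positive_Lebesgue)
    qed
    have c: "(AE \<omega> in M. \<exists>\<I>. (\<forall>I\<in>\<I>. nondegenerate_closed_interval I) \<and> zero_set Y \<omega> = \<Union>\<I>) \<longleftrightarrow> (\<exists>c. \<forall>q\<ge>0. \<Phi> q \<le> c)"
    proof (cases "\<exists>c. \<forall>q\<ge>0. \<Phi> q \<le> c")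
      case True
      then obtain c where c: "\<And>q. 0 \<le> q \<Longrightarrow> \<Phi> q \<le> c" by blast
      have "\<rho> e \<le> \<rho> (e + t) * exp (c * t)" if "0 < e" "0 \<le> t" for e t
        using exp_I_bounded_decrease[OF c that] that by (simp add: \<rho>_def)
      from union_of_intervals[OF this] True show ?thesis by simp
    next
      case False
      have "\<exists>e0>0. \<forall>e t. 0 < e \<longrightarrow> 0 \<le> t \<longrightarrow> e + t \<le> e0 \<longrightarrow> \<rho> (e + t) \<le> exp (- C * t) * \<rho> e" for C
        using exp_I_fast_decrease[OF False, of C] by (auto simp: \<rho>_def)
      from not_union_of_intervals[OF this] False show ?thesis by blast
    qed
    show ?thesis
      unfolding u_eq compound_Poisson_iff
      using a b c zero_set_nontrivial False fin ratio_integral_finite_iff[of \<theta>] assms(7,8) by simp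
  qed
qed

end
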